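(* Let $f$ be a polynomial diffeomorphism of $\mathbb C^2$ of dynamical degree $d>1$. If $f$ is quasi-expanding, then $\mathcal J_1$ is an open, dense subset of $J^*$.
   Context: $f:\mathbb C^2\to\mathbb C^2$ is a polynomial diffeomorphism of dynamical degree $d>1$ (up to polynomial conjugacy, a finite composition of generalized Hénon maps, of degree $d$). $K^\pm$ is the set of points with bounded forward/backward orbit, $J^\pm=\partial K^\pm$, $G^+(x)=\lim_{n\to\infty}d^{-n}\log^+\|f^n(x)\|$. $J^*$ is the closure of the set of saddle (periodic) points. Fix a normalized invariant family $\psi_S=\{\psi_x:x\in S\}$: $S\subset J^*$ is a dense set with $f(S)=S$, and each $\psi_x:\mathbb C\to\mathbb C^2$ is an injective holomorphic immersion such that (i) $x\in\psi_x(\mathbb C)\subset J^-$; (ii) $f(\psi_x(\mathbb C))=\psi_{fx}(\mathbb C)$, and for $x_1,x_2\in S$ the sets $\psi_{x_1}(\mathbb C),\psi_{x_2}(\mathbb C)$ are disjoint or equal; (iii) $\psi_x(0)=x$ and $\max_{|\zeta|\le1}G^+(\psi_x(\zeta))=1$. (Example: $S$ the saddle points, $\psi_x$ normalized uniformizations of unstable manifolds.) $f$ is quasi-expanding if $\psi_S$ is a normal family; equivalently, there is $\kappa>1$ with $|\lambda_x|\ge\kappa$ for all $x\in S$, where $f(\psi_x(\zeta))=\psi_{fx}(\lambda_x\zeta)$. When $f$ is quasi-expanding, for $x\in J^*$ let $\Psi_x$ be the set of entire maps $\psi:\mathbb C\to\mathbb C^2$ that are locally uniform limits of $\psi_{y_j}$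 for sequences $S\ni y_j\to x$; all of these are non-constant. $\mathrm{Ord}(\psi)=\min\{n\ge1:\psi^{(n)}(0)\ne0\}$, $\tau(x)=\sup_{\psi\in\Psi_x}\mathrm{Ord}(\psi)$, and $\mathcal J_k=\{x\in J^*:\tau(x)=k\}$. *)

theory Defs
  imports "HOL-Complex_Analysis.Complex_Analysis" "HOL-Library.Extended_Nat"
begin

section \<open>Polynomial diffeomorphisms of the complex plane \<open>\<complex> \<times> \<complex>\<close>\<close>

text \<open>The norm on \<^typ>\<open>complex \<times> complex\<close> is the Euclidean one.\<close>

text \<open>Polynomial functions of two variables of total degree at most \<open>N\<close>.\<close>

definition poly2_le :: "nat \<Rightarrow> (complex \<times> complex \<Rightarrow> complex) \<Rightarrow> bool" where
  "poly2_le N g \<longleftrightarrow>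
     (\<exists>a :: nat \<Rightarrow> nat \<Rightarrow> complex. \<forall>x y. g (x, y) = (\<Sum>i\<le>N. \<Sum>j\<le>N - i. a i j * x ^ i * y ^ j))"

definition polymap_le :: "nat \<Rightarrow> (complex \<times> complex \<Rightarrow> complex \<times> complex) \<Rightarrow> bool" where
  "polymap_le N f \<longleftrightarrow> poly2_le N (\<lambda>p. fst (f p)) \<and> poly2_le N (\<lambda>p. snd (f p))"

definition polymap :: "(complex \<times> complex \<Rightarrow> complex \<times> complex) \<Rightarrow> bool" where
  "polymap f \<longleftrightarrow> (\<exists>N. polymap_le N f)"

definition polymap_degree :: "(complex \<times> complex \<Rightarrow> complex \<times> complex) \<Rightarrow> nat" where
  "polymap_degree f = (LEAST N. polymap_le N f)"

definition poly_diffeo :: "(complex \<times> complex \<Rightarrow> complex \<times> complex) \<Rightarrow> bool" where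
  "poly_diffeo f \<longleftrightarrow> polymap f \<and> bij f \<and> polymap (inv f)"

text \<open>The sequence \<open>deg (f\<^sup>n)\<close> is submultiplicative, so the limit exists (Fekete). For a
  composition of generalized Henon maps it is the algebraic degree.\<close>

definition dynamical_degree :: "(complex \<times> complex \<Rightarrow> complex \<times> complex) \<Rightarrow> real" where
  "dynamical_degree f = lim (\<lambda>n. root n (real (polymap_degree (f ^^ n))))"

section \<open>Invariant sets and the Green function\<close>

definition K_minus :: "(complex \<times> complex \<Rightarrow> complex \<times> complex) \<Rightarrow> (complex \<times> complex) set" where
  "K_minus f = {x. bounded (range (\<lambda>n. (inv f ^^ n) x))}"

definition J_minus :: "(complex \<times> complex \<Rightarrow> complex \<times> complex) \<Rightarrow> (complex \<times> complex) set" where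
  "J_minus f = frontier (K_minus f)"

definition log_plus :: "real \<Rightarrow> real" where
  "log_plus t = (if t \<le> 1 then 0 else ln t)"

definition G_plus :: "(complex \<times> complex \<Rightarrow> complex \<times> complex) \<Rightarrow> complex \<times> complex \<Rightarrow> real" where
  "G_plus f x = lim (\<lambda>n. log_plus (norm ((f ^^ n) x)) / dynamical_degree f ^ n)"

text \<open>The (real) Frechet derivative of a polynomial map is complex linear, so its complex
  eigenvalues make sense. In dimension two, a saddle has one eigenvalue inside and one
  outside the unit circle.\<close>

definition eigenvalue_of :: "(complex \<times> complex \<Rightarrow> complex \<times> complex) \<Rightarrow> complex \<Rightarrow> bool" where
  "eigenvalue_of D c \<longleftrightarrow> (\<exists>v. v \<noteq> 0 \<and> D v = (c * fst v, c * snd v))"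

definition saddle_point :: "(complex \<times> complex \<Rightarrow> complex \<times> complex) \<Rightarrow> complex \<times> complex \<Rightarrow> bool" where
  "saddle_point f p \<longleftrightarrow>
     (\<exists>n\<ge>1. (f ^^ n) p = p \<and>
        (\<exists>c. eigenvalue_of (frechet_derivative (f ^^ n) (at p)) c \<and> norm c < 1) \<and>
        (\<exists>c. eigenvalue_of (frechet_derivative (f ^^ n) (at p)) c \<and> norm c > 1))"

definition J_star :: "(complex \<times> complex \<Rightarrow> complex \<times> complex) \<Rightarrow> (complex \<times> complex) set" where
  "J_star f = closure {p. saddle_point f p}"

section \<open>Normalized invariant families and quasi-expansion\<close>

definition entire_curve :: "(complex \<Rightarrow> complex \<times> complex) \<Rightarrow> bool" where
  "entire_curve \<psi> \<longleftrightarrow>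
     (\<lambda>z. fst (\<psi> z)) holomorphic_on UNIV \<and> (\<lambda>z. snd (\<psi> z)) holomorphic_on UNIV"

definition curve_deriv :: "nat \<Rightarrow> (complex \<Rightarrow> complex \<times> complex) \<Rightarrow> complex \<Rightarrow> complex \<times> complex" where
  "curve_deriv n \<psi> z = ((deriv ^^ n) (\<lambda>w. fst (\<psi> w)) z, (deriv ^^ n) (\<lambda>w. snd (\<psi> w)) z)"

definition injective_immersion :: "(complex \<Rightarrow> complex \<times> complex) \<Rightarrow> bool" where
  "injective_immersion \<psi> \<longleftrightarrow> entire_curve \<psi> \<and> inj \<psi> \<and> (\<forall>z. curve_deriv 1 \<psi> z \<noteq> 0)"

definition normalized_invariant_family ::
  "(complex \<times> complex \<Rightarrow> complex \<times> complex) \<Rightarrow> (complex \<times> complex) set \<Rightarrow>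
   (complex \<times> complex \<Rightarrow> complex \<Rightarrow> complex \<times> complex) \<Rightarrow> bool" where
  "normalized_invariant_family f S \<psi> \<longleftrightarrow>
     S \<subseteq> J_star f \<and> J_star f \<subseteq> closure S \<and> f ` S = S \<and>
     (\<forall>x\<in>S. injective_immersion (\<psi> x) \<and>
        x \<in> range (\<psi> x) \<and> range (\<psi> x) \<subseteq> J_minus f \<and>
        f ` range (\<psi> x) = range (\<psi> (f x)) \<and>
        \<psi> x 0 = x \<and>
        (\<forall>\<zeta>\<in>cball 0 1. G_plus f (\<psi> x \<zeta>) \<le> 1) \<and> (\<exists>\<zeta>\<in>cball 0 1. G_plus f (\<psi> x \<zeta>) = 1)) \<and>
     (\<forall>x1\<in>S. \<forall>x2\<in>S. range (\<psi> x1) \<inter> range (\<psi> x2) = {} \<or> range (\<psi> x1) = range (\<psi> x2))"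

definition locally_uniform_limit ::
  "(nat \<Rightarrow> complex \<Rightarrow> complex \<times> complex) \<Rightarrow> (complex \<Rightarrow> complex \<times> complex) \<Rightarrow> bool" where
  "locally_uniform_limit h g \<longleftrightarrow> (\<forall>K. compact K \<longrightarrow> uniform_limit K h g sequentially)"

text \<open>Divergence to infinity is not admitted as a limit: for the families considered here the
  values at \<open>0\<close> lie in the bounded set \<open>J_star f\<close>, so this makes no difference.\<close>

definition normal_family :: "(complex \<Rightarrow> complex \<times> complex) set \<Rightarrow> bool" where
  "normal_family F \<longleftrightarrow>
     (\<forall>h. range h \<subseteq> F \<longrightarrow> (\<exists>g (r :: nat \<Rightarrow> nat). strict_mono r \<and> locally_uniform_limit (h \<circ> r) g))"

definition quasi_expanding ::
  "(complex \<times> complex) set \<Rightarrow> (complex \<times> complex \<Rightarrow> complex \<Rightarrow> complex \<times> complex) \<Rightarrow> bool" where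
  "quasi_expanding S \<psi> \<longleftrightarrow> normal_family (\<psi> ` S)"

definition limit_curves ::
  "(complex \<times> complex) set \<Rightarrow> (complex \<times> complex \<Rightarrow> complex \<Rightarrow> complex \<times> complex) \<Rightarrow>
   complex \<times> complex \<Rightarrow> (complex \<Rightarrow> complex \<times> complex) set" where
  "limit_curves S \<psi> x =
     {g. entire_curve g \<and>
         (\<exists>y. range y \<subseteq> S \<and> y \<longlonglongrightarrow> x \<and> locally_uniform_limit (\<lambda>j. \<psi> (y j)) g)}"

text \<open>Orders take values in \<^typ>\<open>enat\<close>: a constant curve would have order \<open>\<infinity>\<close>
  (infimum of the empty set), and the supremum below is a genuine supremum.\<close>

definition curve_order :: "(complex \<Rightarrow> complex \<times> complex) \<Rightarrow> enat" where
  "curve_order g = Inf {enat n | n. 1 \<le> n \<and> curve_deriv n g 0 \<noteq> 0}"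

definition tau ::
  "(complex \<times> complex) set \<Rightarrow> (complex \<times> complex \<Rightarrow> complex \<Rightarrow> complex \<times> complex) \<Rightarrow>
   complex \<times> complex \<Rightarrow> enat" where
  "tau S \<psi> x = (SUP g\<in>limit_curves S \<psi> x. curve_order g)"

definition J_stratum ::
  "(complex \<times> complex \<Rightarrow> complex \<times> complex) \<Rightarrow> (complex \<times> complex) set \<Rightarrow>
   (complex \<times> complex \<Rightarrow> complex \<Rightarrow> complex \<times> complex) \<Rightarrow> nat \<Rightarrow> (complex \<times> complex) set" where
  "J_stratum f S \<psi> k = {x \<in> J_star f. tau S \<psi> x = enat k}"

end

theory Submission
  imports Defs "HOL-Computational_Algebra.Fundamental_Theorem_Algebra"
begin

text \<open>
  The order of limit curves is upper semicontinuous: limits of limit curves are again limit curves,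
  by a diagonal choice, and derivatives at \<open>0\<close> depend continuously on the curve. So the points at
  which some limit curve has vanishing first derivative form a relatively closed set, and its
  complement \<open>\<J>\<^sub>1\<close> is open in \<open>J\<^sup>*\<close>.

  For the density, suppose that \<open>\<tau> \<ge> 2\<close> on a nonempty relatively open subset \<open>U\<close> of \<open>J\<^sup>*\<close>. Limit
  curves are not constant, so \<open>\<tau>\<close> is finite; let \<open>k\<close> be its least value on \<open>U\<close>, attained at \<open>x\<close>.
  Some curve in \<open>\<Psi>\<^sub>x\<close> of order \<open>k\<close> is the limit of curves \<open>\<psi>\<^sub>j\<close> of the family with centres \<open>y\<^sub>j\<close>
  in \<open>U\<close>. Each \<open>\<Psi>\<close> at \<open>y\<^sub>j\<close> contains a curve \<open>\<phi>\<^sub>j\<close> of order at least \<open>k\<close>, and after passing to a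
  subsequence \<open>\<phi>\<^sub>j\<close> tends to an element of \<open>\<Psi>\<^sub>x\<close>, which has order exactly \<open>k\<close> by the choice of \<open>k\<close>.
  The images of the family are pairwise disjoint or equal, so near \<open>0\<close> the curve \<open>\<phi>\<^sub>j\<close> runs inside
  the image of \<open>\<psi>\<^sub>j\<close> (\<open>limit_curve_in_plaque\<close>, by Hurwitz). For generic linear coordinates
  \<open>(\<pi>, \<kappa>)\<close> the function \<open>\<kappa> \<circ> \<phi>\<^sub>j\<close> is a power series in \<open>\<pi> \<circ> \<phi>\<^sub>j\<close> minus its value at \<open>0\<close>, with a
  radius of convergence bounded below independently of \<open>j\<close> (\<open>expansion_in_powers\<close>); by analytic
  continuation the same series expresses \<open>\<kappa> \<circ> \<psi>\<^sub>j\<close> through \<open>\<pi> \<circ> \<psi>\<^sub>j\<close> on a fixed disc. But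
  \<open>\<pi> \<circ> \<psi>\<^sub>j\<close> tends to a function of order \<open>k \<ge> 2\<close> at \<open>0\<close>, so on that disc it takes its value at \<open>0\<close>
  once more, and then so does \<open>\<psi>\<^sub>j\<close>, contrary to injectivity (\<open>no_branched_limits\<close>).

  It remains to see that limit curves are not constant. This uses the normalization
  \<open>max G\<^sup>+ = 1\<close> on the unit disc together with two facts about \<open>G\<^sup>+\<close>, stated in \<open>green_facts\<close>: the limit
  that defines it exists everywhere, and \<open>d\<^sup>-\<^sup>n log\<^sup>+ \<parallel>f\<^sup>n\<parallel>\<close> is bounded on bounded sets uniformly in
  \<open>n\<close>, with the dynamical degree \<open>d\<close> as the base. Both are obtained directly for every
  polynomial automorphism of dynamical degree \<open>d > 1\<close>. Such a map is conjugate to one that is regular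
  at infinity, namely to any one of least degree in its conjugacy class (\<open>regular_conjugate\<close>); the degree is lowered with a shear
  as in Jung's theorem (\<open>jung_core\<close>). The shear exists because, for suitable weights and linear
  coordinates, all combinations \<open>A - s B\<close> of the components have the same leading part, a multiple of
  a power of some \<open>y\<^sup>p - c x\<^sup>q\<close>. The Jacobian derivation \<open>h \<mapsto> A\<^sub>x h\<^sub>y - A\<^sub>y h\<^sub>x\<close> is locally nilpotent and
  hence so is the one formed with the leading part of \<open>A\<close>, which is impossible for \<open>p, q \<ge> 2\<close>.
\<close>

text \<open>Points of \<open>\<complex> \<times> \<complex>\<close> are kept as single variables instead of being split into coordinates.\<close>

declare split_paired_All [simp del] split_paired_Ex [simp del]

section \<open>Polynomial functions of two variables\<close>

text \<open>Polynomial functions of two variables, generated from constants and the two coordinates by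
  sums and products. They are the functions with some degree bound (\<open>bipoly_iff_poly2_le\<close>).\<close>

inductive bipoly :: "(complex \<times> complex \<Rightarrow> complex) \<Rightarrow> bool" where
  bipoly_const: "bipoly (\<lambda>z. c)"
| bipoly_fst: "bipoly (\<lambda>z. fst z)"
| bipoly_snd: "bipoly (\<lambda>z. snd z)"
| bipoly_add: "bipoly f \<Longrightarrow> bipoly g \<Longrightarrow> bipoly (\<lambda>z. f z + g z)"
| bipoly_mult: "bipoly f \<Longrightarrow> bipoly g \<Longrightarrow> bipoly (\<lambda>z. f z * g z)"

lemmas bipoly_intros = bipoly_const bipoly_fst bipoly_snd bipoly_add bipoly_mult

lemma bipoly_uminus: "bipoly f \<Longrightarrow> bipoly (\<lambda>z. - f z)"
  using bipoly_mult[OF bipoly_const[of "-1"], of f] by simp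

lemma bipoly_diff: "bipoly f \<Longrightarrow> bipoly g \<Longrightarrow> bipoly (\<lambda>z. f z - g z)"
  using bipoly_add[OF _ bipoly_uminus, of f g] by simp

lemma bipoly_power: "bipoly f \<Longrightarrow> bipoly (\<lambda>z. f z ^ n)"
  by (induction n) (auto intro: bipoly_intros)

lemma bipoly_sum: "(\<And>i. i \<in> A \<Longrightarrow> bipoly (f i)) \<Longrightarrow> bipoly (\<lambda>z. \<Sum>i\<in>A. f i z)"
  by (induction A rule: infinite_finite_induct) (auto intro: bipoly_intros)

lemma bipoly_compose:
  assumes "bipoly h" "bipoly f" "bipoly g"
  shows "bipoly (\<lambda>z. h (f z, g z))"
  using assms(1) by induction (auto intro: bipoly_intros assms)

lemma continuous_on_bipoly: "bipoly h \<Longrightarrow> continuous_on A h"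
  by (induction rule: bipoly.induct) (auto intro!: continuous_intros)

lemma isCont_bipoly: "bipoly h \<Longrightarrow> isCont h z"
  using continuous_on_bipoly[of h UNIV] by (simp add: continuous_on_eq_continuous_at)

lemma tendsto_bipoly: "bipoly h \<Longrightarrow> (f \<longlongrightarrow> z) F \<Longrightarrow> ((\<lambda>a. h (f a)) \<longlongrightarrow> h z) F"
  using isCont_bipoly isCont_tendsto_compose by blast

lemma holomorphic_bipoly:
  assumes "bipoly h" "f holomorphic_on A" "g holomorphic_on A"
  shows "(\<lambda>s. h (f s, g s)) holomorphic_on A"
  using assms(1) by induction (auto intro!: holomorphic_intros assms)

text \<open>The monomial \<open>x\<^sup>i y\<^sup>j\<close> with exponent pair \<open>(i, j)\<close>.\<close>

definition mono2 :: "nat \<times> nat \<Rightarrow> complex \<times> complex \<Rightarrow> complex" where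
  "mono2 t z = fst z ^ fst t * snd z ^ snd t"

lemma bipoly_mono2: "bipoly (\<lambda>z. c * mono2 t z)"
  unfolding mono2_def by (intro bipoly_intros bipoly_power)

lemma finite_exponents: "finite {t :: nat \<times> nat. fst t + snd t \<le> N}"
  by (rule finite_subset[of _ "{..N} \<times> {..N}"]) auto

lemma poly2_le_iff:
  "poly2_le N g \<longleftrightarrow> (\<exists>a. \<forall>z. g z = (\<Sum>t\<in>{t. fst t + snd t \<le> N}. a t * mono2 t z))"
proof -
  have eq: "{t. fst t + snd t \<le> N} = (SIGMA i:{..N}. {..N - i})" by auto
  have *: "(\<Sum>i\<le>N. \<Sum>j\<le>N - i. a i j * x ^ i * y ^ j) =
     (\<Sum>t\<in>{t. fst t + snd t \<le> N}. (\<lambda>t. a (fst t) (snd t)) t * mono2 t (x, y))" for a x y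
    unfolding eq by (subst sum.Sigma) (auto simp: mono2_def case_prod_unfold mult.assoc)
  show ?thesis
  proof
    assume "poly2_le N g"
    then obtain a where "\<forall>x y. g (x, y) = (\<Sum>i\<le>N. \<Sum>j\<le>N - i. a i j * x ^ i * y ^ j)"
      unfolding poly2_le_def by blast
    then show "\<exists>a. \<forall>z. g z = (\<Sum>t\<in>{t. fst t + snd t \<le> N}. a t * mono2 t z)"
      unfolding * by (intro exI[of _ "\<lambda>t. a (fst t) (snd t)"]) auto
  next
    assume "\<exists>a. \<forall>z. g z = (\<Sum>t\<in>{t. fst t + snd t \<le> N}. a t * mono2 t z)"
    then obtain a where a: "\<forall>z. g z = (\<Sum>t\<in>{t. fst t + snd t \<le> N}. a t * mono2 t z)" by blast
    show "poly2_le N g"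
      unfolding poly2_le_def * by (intro exI[of _ "\<lambda>i j. a (i, j)"]) (use a in auto)
  qed
qed

lemma poly2_le_mono2:
  assumes "fst t + snd t \<le> N" shows "poly2_le N (\<lambda>z. c * mono2 t z)"
  unfolding poly2_le_iff
proof (intro exI[of _ "\<lambda>s. if s = t then c else 0"] allI)
  fix z
  have "(\<Sum>s\<in>{t. fst t + snd t \<le> N}. (if s = t then c else 0) * mono2 s z) =
        (\<Sum>s\<in>{t. fst t + snd t \<le> N}. if s = t then c * mono2 t z else 0)"
    by (intro sum.cong) auto
  also have "\<dots> = c * mono2 t z" using assms finite_exponents by (subst sum.delta) auto
  finally show "c * mono2 t z = (\<Sum>s\<in>{t. fst t + snd t \<le> N}. (if s = t then c else 0) * mono2 s z)" ..
qed

lemma poly2_le_add: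
  assumes "poly2_le N f" "poly2_le N g" shows "poly2_le N (\<lambda>z. f z + g z)"
proof -
  from assms obtain a b where "\<forall>z. f z = (\<Sum>t\<in>{t. fst t + snd t \<le> N}. a t * mono2 t z)"
    "\<forall>z. g z = (\<Sum>t\<in>{t. fst t + snd t \<le> N}. b t * mono2 t z)" unfolding poly2_le_iff by blast
  then show ?thesis unfolding poly2_le_iff
    by (intro exI[of _ "\<lambda>t. a t + b t"]) (auto simp: sum.distrib distrib_right)
qed

lemma poly2_le_0: "poly2_le N (\<lambda>z. 0)"
  unfolding poly2_le_iff by (intro exI[of _ "\<lambda>_. 0"]) auto

lemma poly2_le_sum:
  "(\<And>i. i \<in> A \<Longrightarrow> poly2_le N (f i)) \<Longrightarrow> poly2_le N (\<lambda>z. \<Sum>i\<in>A. f i z)"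
  by (induction A rule: infinite_finite_induct) (auto intro: poly2_le_0 poly2_le_add)

lemma poly2_le_weaken:
  assumes "poly2_le M g" "M \<le> N" shows "poly2_le N g"
proof -
  obtain a where a: "\<forall>z. g z = (\<Sum>t\<in>{t. fst t + snd t \<le> M}. a t * mono2 t z)"
    using assms(1) unfolding poly2_le_iff by blast
  then have "g = (\<lambda>z. \<Sum>t\<in>{t. fst t + snd t \<le> M}. a t * mono2 t z)" by auto
  moreover have "poly2_le N (\<lambda>z. \<Sum>t\<in>{t. fst t + snd t \<le> M}. a t * mono2 t z)"
    using assms(2) by (intro poly2_le_sum poly2_le_mono2) auto
  ultimately show ?thesis by simp
qed

lemma poly2_le_mult:
  assumes "poly2_le N f" "poly2_le M g" shows "poly2_le (N + M) (\<lambda>z. f z * g z)"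
proof -
  from assms obtain a b where ab: "\<forall>z. f z = (\<Sum>t\<in>{t. fst t + snd t \<le> N}. a t * mono2 t z)"
    "\<forall>z. g z = (\<Sum>t\<in>{t. fst t + snd t \<le> M}. b t * mono2 t z)" unfolding poly2_le_iff by blast
  have "(\<lambda>z. f z * g z) = (\<lambda>z. \<Sum>s\<in>{t. fst t + snd t \<le> N}. \<Sum>t\<in>{t. fst t + snd t \<le> M}.
      (a s * b t) * mono2 (fst s + fst t, snd s + snd t) z)"
    by (auto simp: ab sum_product mono2_def power_add ac_simps intro!: sum.cong ext)
  moreover have "poly2_le (N + M) \<dots>"
    by (intro poly2_le_sum poly2_le_mono2) auto
  ultimately show ?thesis by simp
qed

lemma bipoly_iff_poly2_le: "bipoly h \<longleftrightarrow> (\<exists>N. poly2_le N h)"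
proof
  assume "bipoly h"
  then show "\<exists>N. poly2_le N h"
  proof induction
    case (bipoly_const c)
    then show ?case using poly2_le_mono2[of "(0,0)" 0 c] by (auto simp: mono2_def)
  next
    case bipoly_fst
    then show ?case using poly2_le_mono2[of "(1,0)" 1 1] by (auto simp: mono2_def)
  next
    case bipoly_snd
    then show ?case using poly2_le_mono2[of "(0,1)" 1 1] by (auto simp: mono2_def)
  next
    case (bipoly_add f g)
    then obtain N M where "poly2_le N f" "poly2_le M g" by blast
    then show ?case using poly2_le_add[of "max N M" f g] poly2_le_weaken
      by (meson max.cobounded1 max.cobounded2)
  next
    case (bipoly_mult f g)
    then show ?case using poly2_le_mult by blast
  qed
next
  assume "\<exists>N. poly2_le N h"
  then obtain N a where "\<forall>z. h z = (\<Sum>t\<in>{t. fst t + snd t \<le> N}. a t * mono2 t z)"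
    unfolding poly2_le_iff by blast
  then have "h = (\<lambda>z. \<Sum>t\<in>{t. fst t + snd t \<le> N}. a t * mono2 t z)" by auto
  moreover have "bipoly \<dots>" by (intro bipoly_sum bipoly_mono2)
  ultimately show "bipoly h" by simp
qed

subsection \<open>Quasi-homogeneous decompositions\<close>

text \<open>The dilation \<open>(x, y) \<mapsto> (r\<^sup>p x, r\<^sup>q y)\<close> for the weights \<open>(p, q)\<close>.\<close>

definition dil :: "nat \<Rightarrow> nat \<Rightarrow> complex \<Rightarrow> complex \<times> complex \<Rightarrow> complex \<times> complex" where
  "dil p q r z = (r ^ p * fst z, r ^ q * snd z)"

text \<open>Quasi-homogeneous polynomials of weight \<open>m\<close>; the zero polynomial has every weight. The relation
  for \<open>r = 0\<close> is implied by continuity.\<close>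

definition qhom :: "nat \<Rightarrow> nat \<Rightarrow> nat \<Rightarrow> (complex \<times> complex \<Rightarrow> complex) \<Rightarrow> bool" where
  "qhom p q m W \<longleftrightarrow> bipoly W \<and> (\<forall>r z. r \<noteq> 0 \<longrightarrow> W (dil p q r z) = r ^ m * W z)"

text \<open>The decomposition of \<open>h\<close> into parts \<open>W m\<close> of weight \<open>m\<close>. Here \<open>K\<close> is only an upper bound for the
  weighted degree: the leading part \<open>W K\<close> may vanish.\<close>

definition qdec :: "nat \<Rightarrow> nat \<Rightarrow> nat \<Rightarrow> (complex \<times> complex \<Rightarrow> complex) \<Rightarrow>
    (nat \<Rightarrow> complex \<times> complex \<Rightarrow> complex) \<Rightarrow> bool" where
  "qdec p q K h W \<longleftrightarrow> (\<forall>m. qhom p q m (W m)) \<and> (\<forall>m>K. W m = (\<lambda>_. 0)) \<and>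
     (\<forall>z. h z = (\<Sum>m\<le>K. W m z))"

lemma qhomD: "qhom p q m W \<Longrightarrow> r \<noteq> 0 \<Longrightarrow> W (dil p q r z) = r ^ m * W z"
  by (auto simp: qhom_def)

lemma qhom_bipoly: "qhom p q m W \<Longrightarrow> bipoly W"
  by (auto simp: qhom_def)

lemma qdec_qhom: "qdec p q K h W \<Longrightarrow> qhom p q m (W m)"
  by (auto simp: qdec_def)

lemma qdec_bipoly: "qdec p q K h W \<Longrightarrow> bipoly (W m)"
  by (auto simp: qdec_def qhom_def)

lemma qdec_bipoly': "qdec p q K h W \<Longrightarrow> bipoly h"
proof -
  assume *: "qdec p q K h W"
  then have "h = (\<lambda>z. \<Sum>m\<le>K. W m z)" by (auto simp: qdec_def)
  then show ?thesis using * bipoly_sum[of "{..K}" W] by (simp add: qdec_bipoly)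
qed

lemma qdec_eq: "qdec p q K h W \<Longrightarrow> h z = (\<Sum>m\<le>K. W m z)"
  by (auto simp: qdec_def)

text \<open>Every polynomial splits into quasi-homogeneous parts; the parts are the sums of its
  monomials of a given weight.\<close>

lemma bipoly_qdec_monomials:
  assumes "bipoly h"
  shows "\<exists>K A a. finite A \<and>
    qdec p q K h (\<lambda>m z. \<Sum>t\<in>{t\<in>A. p * fst t + q * snd t = m}. a t * mono2 t z)"
proof -
  obtain N a where h: "\<forall>z. h z = (\<Sum>t\<in>{t. fst t + snd t \<le> N}. a t * mono2 t z)"
    using assms unfolding bipoly_iff_poly2_le poly2_le_iff by blast
  define A where "A = {t::nat\<times>nat. fst t + snd t \<le> N}"
  have fin: "finite A" unfolding A_def by (rule finite_exponents)
  define w where "w = (\<lambda>t::nat\<times>nat. p * fst t + q * snd t)"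
  define K where "K = Max (insert 0 (w ` A))"
  have K: "w t \<le> K" if "t \<in> A" for t
    unfolding K_def using fin that by (intro Max_ge) auto
  have "qdec p q K h (\<lambda>m z. \<Sum>t\<in>{t\<in>A. w t = m}. a t * mono2 t z)"
    unfolding qdec_def
  proof (intro conjI allI impI)
    fix m
    have "mono2 t (dil p q r z) = r ^ w t * mono2 t z" for t r z
      by (simp add: mono2_def dil_def w_def power_mult_distrib power_mult power_add)
    then show "qhom p q m (\<lambda>z. \<Sum>t\<in>{t\<in>A. w t = m}. a t * mono2 t z)"
      unfolding qhom_def by (auto intro!: bipoly_sum bipoly_mono2 sum.cong simp: sum_distrib_left)
  next
    fix m assume "m > K"
    then have "{t\<in>A. w t = m} = {}" using K by fastforce
    then show "(\<lambda>z. \<Sum>t\<in>{t\<in>A. w t = m}. a t * mono2 t z) = (\<lambda>_. 0)"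
      by (metis sum.empty)
  next
    fix z
    have "h z = (\<Sum>t\<in>A. a t * mono2 t z)" using h by (simp add: A_def)
    also have "\<dots> = (\<Sum>m\<le>K. \<Sum>t\<in>{t\<in>A. w t = m}. a t * mono2 t z)"
      using fin K by (intro sum.group[symmetric]) auto
    finally show "h z = (\<Sum>m\<le>K. \<Sum>t\<in>{t\<in>A. w t = m}. a t * mono2 t z)" .
  qed
  then show ?thesis using fin unfolding w_def by blast
qed

lemma lead_tendsto:
  fixes r :: "'a \<Rightarrow> complex"
  assumes r: "filterlim r at_infinity F" and c: "\<And>j. j \<le> m \<Longrightarrow> ((\<lambda>a. c j a) \<longlongrightarrow> C j) F"
  shows "((\<lambda>a. (\<Sum>j\<le>m. c j a * r a ^ j) / r a ^ m) \<longlongrightarrow> C m) F"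
proof -
  have inv: "((\<lambda>a. inverse (r a)) \<longlongrightarrow> 0) F"
    by (rule filterlim_compose[OF tendsto_inverse_0 r])
  have nz: "eventually (\<lambda>a. r a \<noteq> 0) F"
    using r filterlim_at_infinity_imp_eventually_ne by blast
  have "((\<lambda>a. \<Sum>j\<le>m. c j a * inverse (r a) ^ (m - j)) \<longlongrightarrow> (\<Sum>j\<le>m. C j * 0 ^ (m - j))) F"
    by (intro tendsto_intros c inv) auto
  moreover have "(\<Sum>j\<le>m. C j * 0 ^ (m - j)) = C m"
  proof -
    have "(\<Sum>j\<le>m. C j * 0 ^ (m - j)) = (\<Sum>j\<le>m. if j = m then C m else 0)"
      by (intro sum.cong) auto
    then show ?thesis by simp
  qed
  moreover have "eventually (\<lambda>a. (\<Sum>j\<le>m. c j a * inverse (r a) ^ (m - j)) = (\<Sum>j\<le>m. c j a * r a ^ j) / r a ^ m) F"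
    using nz
  proof eventually_elim
    case (elim a)
    show ?case unfolding sum_divide_distrib
    proof (rule sum.cong[OF refl])
      fix j assume "j \<in> {..m}"
      then have "r a ^ m = r a ^ j * r a ^ (m - j)" by (simp flip: power_add)
      then show "c j a * inverse (r a) ^ (m - j) = c j a * r a ^ j / r a ^ m"
        using elim by (simp add: field_simps)
    qed
  qed
  ultimately show ?thesis by (simp add: tendsto_cong)
qed

lemma qdec_tendsto:
  assumes "qdec p q K h W" "filterlim r at_infinity F" "(\<zeta> \<longlongrightarrow> z) F"
  shows "((\<lambda>a. h (dil p q (r a) (\<zeta> a)) / r a ^ K) \<longlongrightarrow> W K z) F"
proof -
  have "((\<lambda>a. (\<Sum>j\<le>K. W j (\<zeta> a) * r a ^ j) / r a ^ K) \<longlongrightarrow> W K z) F"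
    by (rule lead_tendsto[OF assms(2)]) (intro tendsto_bipoly assms(3) qdec_bipoly[OF assms(1)])
  moreover have "eventually (\<lambda>a. (\<Sum>j\<le>K. W j (\<zeta> a) * r a ^ j) / r a ^ K = h (dil p q (r a) (\<zeta> a)) / r a ^ K) F"
    using filterlim_at_infinity_imp_eventually_ne[OF assms(2), of 0]
  proof eventually_elim
    case (elim a)
    then show ?case
      by (simp add: qdec_eq[OF assms(1)] qhomD[OF qdec_qhom[OF assms(1)]] mult.commute)
  qed
  ultimately show ?thesis by (simp add: tendsto_cong)
qed

lemma of_nat_at_infinity: "filterlim (\<lambda>n. of_nat n :: complex) at_infinity sequentially"
  by (rule tendsto_of_nat)

text \<open>The growth of a polynomial along the dilations bounds its weighted degree, and the limit of the
  normalized values is the leading part. In this way leading parts are computed below.\<close>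

lemma qdec_lower:
  assumes W: "qdec p q L h W"
    and lim: "\<And>z. (\<lambda>n. h (dil p q (of_nat n) z) / of_nat n ^ K) \<longlonglongrightarrow> T z"
  shows "qdec p q K h W" "W K = T"
proof -
  have zero: "W m z = 0" if "m > K" for m z
  proof (rule ccontr)
    assume nz: "W m z \<noteq> 0"
    define M where "M = {j. j > K \<and> W j z \<noteq> 0}"
    have sub: "M \<subseteq> {..L}" 
    proof
      fix j assume "j \<in> M"
      then show "j \<in> {..L}" using W unfolding qdec_def M_def by (cases "j \<le> L") auto
    qed
    then have fin: "finite M" using finite_subset by blast
    have "m \<in> M" using nz that by (simp add: M_def)
    define k where "k = Max M"
    have k: "k \<in> M" "\<And>j. j \<in> M \<Longrightarrow> j \<le> k"
      using fin \<open>m \<in> M\<close> by (auto simp: k_def intro: Max_in)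
    then have kK: "k > K" "W k z \<noteq> 0" "k \<le> L" using sub by (auto simp: M_def)
    have k0: "W j z = 0" if "j > k" for j
      using k(2)[of j] that kK(1) by (auto simp: M_def)
    have eq: "h (dil p q (of_nat n) z) = (\<Sum>j\<le>k. W j z * of_nat n ^ j)" if "n > 0" for n
    proof -
      have "h (dil p q (of_nat n) z) = (\<Sum>j\<le>L. W j z * of_nat n ^ j)"
        using that by (simp add: qdec_eq[OF W] qhomD[OF qdec_qhom[OF W]] mult.commute)
      also have "\<dots> = (\<Sum>j\<le>k. W j z * of_nat n ^ j)"
        using kK k0 by (intro sum.mono_neutral_right) auto
      finally show ?thesis .
    qed
    have "(\<lambda>n. (\<Sum>j\<le>k. W j z * of_nat n ^ j) / of_nat n ^ k) \<longlonglongrightarrow> W k z"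
      by (rule lead_tendsto[OF of_nat_at_infinity]) auto
    moreover have "(\<lambda>n. (\<Sum>j\<le>k. W j z * of_nat n ^ j) / of_nat n ^ k) \<longlonglongrightarrow> 0"
    proof -
      have "(\<lambda>n. inverse (of_nat n :: complex)) \<longlonglongrightarrow> 0" 
        by (rule filterlim_compose[OF tendsto_inverse_0 of_nat_at_infinity])
      then have "(\<lambda>n. h (dil p q (of_nat n) z) / of_nat n ^ K * inverse (of_nat n) ^ (k - K)) \<longlonglongrightarrow> T z * 0 ^ (k - K)"
        by (intro tendsto_intros lim)
      moreover have "T z * 0 ^ (k - K) = 0" using kK by simp
      moreover have "eventually (\<lambda>n. h (dil p q (of_nat n) z) / of_nat n ^ K * inverse (of_nat n) ^ (k - K) =
          (\<Sum>j\<le>k. W j z * of_nat n ^ j) / of_nat n ^ k) sequentially"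
        using eventually_gt_at_top[of 0]
      proof eventually_elim
        case (elim n)
        have "(of_nat n::complex) ^ k = of_nat n ^ K * of_nat n ^ (k - K)" 
          using kK by (simp flip: power_add)
        then show ?case using elim by (simp add: eq divide_inverse power_inverse mult.assoc)
      qed
      ultimately show ?thesis by (simp add: tendsto_cong)
    qed
    ultimately show False using LIMSEQ_unique kK by blast
  qed
  show *: "qdec p q K h W"
    unfolding qdec_def
  proof (intro conjI allI impI)
    show "qhom p q m (W m)" for m by (rule qdec_qhom[OF W])
    show "W m = (\<lambda>_. 0)" if "m > K" for m using zero[OF that] by auto
    fix z
    have WL: "W m = (\<lambda>_. 0)" if "m > L" for m using W that by (auto simp: qdec_def)
    have "h z = (\<Sum>m\<le>L. W m z)" by (rule qdec_eq[OF W])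
    also have "\<dots> = (\<Sum>m\<le>max K L. W m z)" by (intro sum.mono_neutral_left) (auto simp: WL)
    also have "\<dots> = (\<Sum>m\<le>K. W m z)" by (intro sum.mono_neutral_right) (auto simp: zero)
    finally show "h z = (\<Sum>m\<le>K. W m z)" .
  qed
  show "W K = T"
  proof
    fix z
    show "W K z = T z"
      using qdec_tendsto[OF * of_nat_at_infinity tendsto_const[of z]] lim LIMSEQ_unique by blast
  qed
qed

lemma qdec_exists: "bipoly h \<Longrightarrow> \<exists>K W. qdec p q K h W"
  using bipoly_qdec_monomials[of h p q] by blast

lemma growth_qdec:
  assumes "bipoly h" "\<And>z. (\<lambda>n. h (dil p q (of_nat n) z) / of_nat n ^ K) \<longlonglongrightarrow> T z"
  shows "\<exists>W. qdec p q K h W \<and> W K = T"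
  using qdec_exists[OF assms(1), of p q] qdec_lower[OF _ assms(2)] by blast

lemma qdec_top_0:
  assumes "qdec p q (Suc K) h W" "W (Suc K) = (\<lambda>_. 0)"
  shows "qdec p q K h W"
  unfolding qdec_def
proof (intro conjI allI impI)
  show "qhom p q m (W m)" for m by (rule qdec_qhom[OF assms(1)])
  show "W m = (\<lambda>_. 0)" if "m > K" for m
    using assms that by (cases "m = Suc K") (auto simp: qdec_def)
  show "h z = (\<Sum>m\<le>K. W m z)" for z using assms by (simp add: qdec_eq[OF assms(1)])
qed

lemma qdec_leading_exists:
  assumes "bipoly h" "h z0 \<noteq> 0"
  shows "\<exists>K W z. qdec p q K h W \<and> W K z \<noteq> 0"
proof -
  define P where "P = (\<lambda>K. \<exists>W. qdec p q K h W)"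
  have ex: "\<exists>K. P K" unfolding P_def using qdec_exists[OF assms(1)] by blast
  define K where "K = (LEAST K. P K)"
  obtain W where W: "qdec p q K h W" using LeastI_ex[OF ex] unfolding K_def P_def by blast
  have "W K \<noteq> (\<lambda>_. 0)"
  proof
    assume 0: "W K = (\<lambda>_. 0)"
    show False
    proof (cases K)
      case 0
      then show ?thesis using \<open>W K = _\<close> qdec_eq[OF W, of z0] assms(2) by simp
    next
      case (Suc k)
      then have "P k" unfolding P_def using qdec_top_0 W 0 by blast
      then show ?thesis using not_less_Least[of k P] Suc unfolding K_def by simp
    qed
  qed
  then show ?thesis using W by blast
qed

text \<open>Ordinary degree and homogeneous parts are the case of weights \<open>(1, 1)\<close>.\<close>

lemma poly2_le_iff_qdec: "poly2_le N h \<longleftrightarrow> (\<exists>W. qdec 1 1 N h W)"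
proof
  assume p: "poly2_le N h"
  then obtain a where a: "\<forall>z. h z = (\<Sum>t\<in>{t. fst t + snd t \<le> N}. a t * mono2 t z)"
    unfolding poly2_le_iff by blast
  define W where "W = (\<lambda>m z. if m \<le> N then \<Sum>t\<in>{t. fst t + snd t = m}. a t * mono2 t z else 0)"
  have hom: "mono2 t (dil 1 1 r z) = r ^ (fst t + snd t) * mono2 t z" for t r z
    by (simp add: mono2_def dil_def power_mult_distrib power_add)
  have "qdec 1 1 N h W" unfolding qdec_def
  proof (intro conjI allI impI)
    show "qhom 1 1 m (W m)" for m
      unfolding qhom_def
    proof (intro conjI allI impI)
      show "bipoly (W m)" unfolding W_def
        by (cases "m \<le> N") (auto intro!: bipoly_sum bipoly_mono2 bipoly_const)
      show "W m (dil 1 1 r z) = r ^ m * W m z" for r z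
        unfolding W_def by (auto simp: hom[unfolded One_nat_def] sum_distrib_left intro!: sum.cong)
    qed
    show "W m = (\<lambda>_. 0)" if "m > N" for m using that by (auto simp: W_def)
    fix z
    have "h z = (\<Sum>m\<le>N. \<Sum>t\<in>{t\<in>{t. fst t + snd t \<le> N}. fst t + snd t = m}. a t * mono2 t z)"
      using a finite_exponents by (subst sum.group) auto
    also have "\<dots> = (\<Sum>m\<le>N. W m z)"
      unfolding W_def by (intro sum.cong refl) (auto intro!: sum.cong)
    finally show "h z = (\<Sum>m\<le>N. W m z)" .
  qed
  then show "\<exists>W. qdec 1 1 N h W" by blast
next
  assume "\<exists>W. qdec 1 1 N h W"
  then obtain W where W: "qdec 1 1 N h W" by blast
  then obtain K A a where
    A: "finite A" and V: "qdec 1 1 K h (\<lambda>m z. \<Sum>t\<in>{t\<in>A. 1 * fst t + 1 * snd t = m}. a t * mono2 t z)"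
    using bipoly_qdec_monomials[OF qdec_bipoly'[OF W], of 1 1] by blast
  note V' = qdec_lower(1)[OF V qdec_tendsto[OF W of_nat_at_infinity tendsto_const]]
  have "h = (\<lambda>z. \<Sum>m\<le>N. \<Sum>t\<in>{t\<in>A. 1 * fst t + 1 * snd t = m}. a t * mono2 t z)"
    using qdec_eq[OF V'] by auto
  moreover have "poly2_le N \<dots>"
    by (intro poly2_le_sum poly2_le_mono2) auto
  ultimately show "poly2_le N h" by simp
qed

subsection \<open>Partial derivatives\<close>

text \<open>The partial derivatives, as derivatives of the restrictions to coordinate lines.\<close>

definition dx :: "(complex \<times> complex \<Rightarrow> complex) \<Rightarrow> complex \<times> complex \<Rightarrow> complex" where
  "dx h z = deriv (\<lambda>x. h (x, snd z)) (fst z)"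

definition dy :: "(complex \<times> complex \<Rightarrow> complex) \<Rightarrow> complex \<times> complex \<Rightarrow> complex" where
  "dy h z = deriv (\<lambda>y. h (fst z, y)) (snd z)"

lemma bipoly_has_partials:
  assumes "bipoly h"
  shows "\<exists>g g'. bipoly g \<and> bipoly g' \<and>
    (\<forall>x y. ((\<lambda>x. h (x, y)) has_field_derivative g (x, y)) (at x)) \<and>
    (\<forall>x y. ((\<lambda>y. h (x, y)) has_field_derivative g' (x, y)) (at y))"
  using assms
proof induction
  case (bipoly_const c)
  show ?case by (intro exI[of _ "\<lambda>_. 0"]) (auto intro: bipoly_intros)
next
  case bipoly_fst
  show ?case by (intro exI[of _ "\<lambda>_. 1"] exI[of _ "\<lambda>_. 0"]) (auto intro: bipoly_intros)
next
  case bipoly_snd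
  show ?case by (rule exI[of _ "\<lambda>_. 0"], rule exI[of _ "\<lambda>_. 1"]) (auto intro: bipoly_intros)
next
  case (bipoly_add f g)
  then obtain f1 f2 g1 g2 where
    "bipoly f1" "bipoly f2" "bipoly g1" "bipoly g2" and
    *: "\<And>x y. ((\<lambda>x. f (x, y)) has_field_derivative f1 (x, y)) (at x)"
    "\<And>x y. ((\<lambda>y. f (x, y)) has_field_derivative f2 (x, y)) (at y)"
    "\<And>x y. ((\<lambda>x. g (x, y)) has_field_derivative g1 (x, y)) (at x)"
    "\<And>x y. ((\<lambda>y. g (x, y)) has_field_derivative g2 (x, y)) (at y)" by metis
  then show ?case
    by (intro exI[of _ "\<lambda>z. f1 z + g1 z"] exI[of _ "\<lambda>z. f2 z + g2 z"])
       (auto intro!: bipoly_intros derivative_intros *)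
next
  case (bipoly_mult f g)
  then obtain f1 f2 g1 g2 where
    bp: "bipoly f1" "bipoly f2" "bipoly g1" "bipoly g2" and
    *: "\<And>x y. ((\<lambda>x. f (x, y)) has_field_derivative f1 (x, y)) (at x)"
    "\<And>x y. ((\<lambda>y. f (x, y)) has_field_derivative f2 (x, y)) (at y)"
    "\<And>x y. ((\<lambda>x. g (x, y)) has_field_derivative g1 (x, y)) (at x)"
    "\<And>x y. ((\<lambda>y. g (x, y)) has_field_derivative g2 (x, y)) (at y)" by metis
  show ?case
    by (intro exI[of _ "\<lambda>z. f1 z * g z + g1 z * f z"] exI[of _ "\<lambda>z. f2 z * g z + g2 z * f z"])
       (auto intro!: bipoly_intros DERIV_mult * bp bipoly_mult.hyps)
qed

lemma bipoly_dx: "bipoly h \<Longrightarrow> bipoly (dx h)"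
  and bipoly_dy: "bipoly h \<Longrightarrow> bipoly (dy h)"
  and has_dx: "bipoly h \<Longrightarrow> ((\<lambda>x. h (x, y)) has_field_derivative dx h (x, y)) (at x)"
  and has_dy: "bipoly h \<Longrightarrow> ((\<lambda>y. h (x, y)) has_field_derivative dy h (x, y)) (at y)"
proof -
  have *: "bipoly (dx h) \<and> bipoly (dy h) \<and>
    (\<forall>x y. ((\<lambda>x. h (x, y)) has_field_derivative dx h (x, y)) (at x)) \<and>
    (\<forall>x y. ((\<lambda>y. h (x, y)) has_field_derivative dy h (x, y)) (at y))" if bph: "bipoly h"
  proof -
    obtain g g' where g: "bipoly g" "bipoly g'" 
      "\<And>x y. ((\<lambda>x. h (x, y)) has_field_derivative g (x, y)) (at x)"
      "\<And>x y. ((\<lambda>y. h (x, y)) has_field_derivative g' (x, y)) (at y)"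
      using bipoly_has_partials[OF bph] by auto
    have "dx h = g" unfolding dx_def using DERIV_imp_deriv[OF g(3)] by force
    moreover have "dy h = g'" unfolding dy_def using DERIV_imp_deriv[OF g(4)] by force
    ultimately show ?thesis using g by blast
  qed
  show "bipoly h \<Longrightarrow> bipoly (dx h)" "bipoly h \<Longrightarrow> bipoly (dy h)"
    "bipoly h \<Longrightarrow> ((\<lambda>x. h (x, y)) has_field_derivative dx h (x, y)) (at x)"
    "bipoly h \<Longrightarrow> ((\<lambda>y. h (x, y)) has_field_derivative dy h (x, y)) (at y)"
    using * by blast+
qed

lemma dxI: "((\<lambda>x. h (x, snd z)) has_field_derivative D) (at (fst z)) \<Longrightarrow> dx h z = D"
  unfolding dx_def by (rule DERIV_imp_deriv)
lemma dyI: "((\<lambda>y. h (fst z, y)) has_field_derivative D) (at (snd z)) \<Longrightarrow> dy h z = D"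
  unfolding dy_def by (rule DERIV_imp_deriv)

lemma has_dx': "bipoly h \<Longrightarrow> ((\<lambda>x. h (x, snd z)) has_field_derivative dx h z) (at (fst z))"
  using has_dx[of h "snd z" "fst z"] by simp
lemma has_dy': "bipoly h \<Longrightarrow> ((\<lambda>y. h (fst z, y)) has_field_derivative dy h z) (at (snd z))"
  using has_dy[of h "fst z" "snd z"] by simp

lemma dx_const [simp]: "dx (\<lambda>z. c) z = 0" and dy_const [simp]: "dy (\<lambda>z. c) z = 0"
  and dx_fst [simp]: "dx fst z = 1" and dy_fst [simp]: "dy fst z = 0"
  and dx_snd [simp]: "dx snd z = 0" and dy_snd [simp]: "dy snd z = 1"
  by (simp_all add: dx_def dy_def)

lemma dx_add: "bipoly f \<Longrightarrow> bipoly g \<Longrightarrow> dx (\<lambda>z. f z + g z) z = dx f z + dx g z"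
  and dy_add: "bipoly f \<Longrightarrow> bipoly g \<Longrightarrow> dy (\<lambda>z. f z + g z) z = dy f z + dy g z"
  and dx_mult: "bipoly f \<Longrightarrow> bipoly g \<Longrightarrow> dx (\<lambda>z. f z * g z) z = dx f z * g z + f z * dx g z"
  and dy_mult: "bipoly f \<Longrightarrow> bipoly g \<Longrightarrow> dy (\<lambda>z. f z * g z) z = dy f z * g z + f z * dy g z"
  by (rule dxI, rule derivative_eq_intros, erule has_dx', erule has_dx', simp,
      rule dyI, rule derivative_eq_intros, erule has_dy', erule has_dy', simp,
      rule dxI, rule derivative_eq_intros, erule has_dx', erule has_dx', simp add: algebra_simps,
      rule dyI, rule derivative_eq_intros, erule has_dy', erule has_dy', simp add: algebra_simps)

lemma dx_sum: "(\<And>i. i \<in> A \<Longrightarrow> bipoly (f i)) \<Longrightarrow> dx (\<lambda>z. \<Sum>i\<in>A. f i z) z = (\<Sum>i\<in>A. dx (f i) z)"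
  by (rule dxI) (auto intro!: DERIV_sum has_dx')
lemma dy_sum: "(\<And>i. i \<in> A \<Longrightarrow> bipoly (f i)) \<Longrightarrow> dy (\<lambda>z. \<Sum>i\<in>A. f i z) z = (\<Sum>i\<in>A. dy (f i) z)"
  by (rule dyI) (auto intro!: DERIV_sum has_dy')

lemma qhom_dx:
  assumes "qhom p q m W" "r \<noteq> 0"
  shows "r ^ p * dx W (dil p q r z) = r ^ m * dx W z"
proof -
  note bp = qhom_bipoly[OF assms(1)]
  have "((\<lambda>x. W (r ^ p * x, r ^ q * snd z)) has_field_derivative
      dx W (r ^ p * fst z, r ^ q * snd z) * r ^ p) (at (fst z))"
    by (rule DERIV_chain2[OF has_dx[OF bp]]) (auto intro!: derivative_eq_intros)
  moreover have "(\<lambda>x. W (r ^ p * x, r ^ q * snd z)) = (\<lambda>x. r ^ m * W (x, snd z))"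
    using qhomD[OF assms, of "(_, snd z)"] by (auto simp: dil_def)
  moreover have "((\<lambda>x. r ^ m * W (x, snd z)) has_field_derivative r ^ m * dx W z) (at (fst z))"
    by (rule DERIV_cmult[OF has_dx'[OF bp]])
  ultimately show ?thesis by (metis DERIV_unique dil_def mult.commute)
qed

lemma qhom_dy:
  assumes "qhom p q m W" "r \<noteq> 0"
  shows "r ^ q * dy W (dil p q r z) = r ^ m * dy W z"
proof -
  note bp = qhom_bipoly[OF assms(1)]
  have "((\<lambda>y. W (r ^ p * fst z, r ^ q * y)) has_field_derivative
      dy W (r ^ p * fst z, r ^ q * snd z) * r ^ q) (at (snd z))"
    by (rule DERIV_chain2[OF has_dy[OF bp]]) (auto intro!: derivative_eq_intros)
  moreover have "(\<lambda>y. W (r ^ p * fst z, r ^ q * y)) = (\<lambda>y. r ^ m * W (fst z, y))"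
    using qhomD[OF assms, of "(fst z, _)"] by (auto simp: dil_def)
  moreover have "((\<lambda>y. r ^ m * W (fst z, y)) has_field_derivative r ^ m * dy W z) (at (snd z))"
    by (rule DERIV_cmult[OF has_dy'[OF bp]])
  ultimately show ?thesis by (metis DERIV_unique dil_def mult.commute)
qed

lemma qdec_dx_tendsto:
  assumes "qdec p q K h W"
  shows "(\<lambda>n. of_nat n ^ p * dx h (dil p q (of_nat n) z) / of_nat n ^ K) \<longlonglongrightarrow> dx (W K) z"
proof -
  have h: "h = (\<lambda>z. \<Sum>m\<le>K. W m z)" using qdec_eq[OF assms] by auto
  have "(\<lambda>n. (\<Sum>j\<le>K. dx (W j) z * of_nat n ^ j) / of_nat n ^ K) \<longlonglongrightarrow> dx (W K) z"
    by (rule lead_tendsto[OF of_nat_at_infinity]) auto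
  moreover have "eventually (\<lambda>n. (\<Sum>j\<le>K. dx (W j) z * of_nat n ^ j) / of_nat n ^ K =
      of_nat n ^ p * dx h (dil p q (of_nat n) z) / of_nat n ^ K) sequentially"
    using eventually_gt_at_top[of 0]
  proof eventually_elim
    case (elim n)
    have "dx h (dil p q (of_nat n) z) = (\<Sum>j\<le>K. dx (W j) (dil p q (of_nat n) z))"
      unfolding h by (rule dx_sum) (rule qdec_bipoly[OF assms])
    moreover have "of_nat n ^ p * dx (W j) (dil p q (of_nat n) z) = dx (W j) z * of_nat n ^ j" for j
      using qhom_dx[OF qdec_qhom[OF assms, of j], where r = "of_nat n" and z = z] elim by (simp add: mult.commute)
    ultimately show ?case by (simp add: sum_distrib_left)
  qed
  ultimately show ?thesis by (simp add: tendsto_cong)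
qed

lemma qdec_dy_tendsto:
  assumes "qdec p q K h W"
  shows "(\<lambda>n. of_nat n ^ q * dy h (dil p q (of_nat n) z) / of_nat n ^ K) \<longlonglongrightarrow> dy (W K) z"
proof -
  have h: "h = (\<lambda>z. \<Sum>m\<le>K. W m z)" using qdec_eq[OF assms] by auto
  have "(\<lambda>n. (\<Sum>j\<le>K. dy (W j) z * of_nat n ^ j) / of_nat n ^ K) \<longlonglongrightarrow> dy (W K) z"
    by (rule lead_tendsto[OF of_nat_at_infinity]) auto
  moreover have "eventually (\<lambda>n. (\<Sum>j\<le>K. dy (W j) z * of_nat n ^ j) / of_nat n ^ K =
      of_nat n ^ q * dy h (dil p q (of_nat n) z) / of_nat n ^ K) sequentially"
    using eventually_gt_at_top[of 0]
  proof eventually_elim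
    case (elim n)
    have "dy h (dil p q (of_nat n) z) = (\<Sum>j\<le>K. dy (W j) (dil p q (of_nat n) z))"
      unfolding h by (rule dy_sum) (rule qdec_bipoly[OF assms])
    moreover have "of_nat n ^ q * dy (W j) (dil p q (of_nat n) z) = dy (W j) z * of_nat n ^ j" for j
      using qhom_dy[OF qdec_qhom[OF assms, of j], where r = "of_nat n" and z = z] elim by (simp add: mult.commute)
    ultimately show ?case by (simp add: sum_distrib_left)
  qed
  ultimately show ?thesis by (simp add: tendsto_cong)
qed

subsection \<open>The Jacobian derivation\<close>

text \<open>The Jacobian determinant of \<open>(A, h)\<close>. For fixed \<open>A\<close> it is a derivation in \<open>h\<close>, whose iterates are
  written \<open>jac A ^^ n\<close>.\<close>

definition jac :: "(complex \<times> complex \<Rightarrow> complex) \<Rightarrow> (complex \<times> complex \<Rightarrow> complex) \<Rightarrow>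
    complex \<times> complex \<Rightarrow> complex" where
  "jac A h z = dx A z * dy h z - dy A z * dx h z"

lemma bipoly_jac: "bipoly A \<Longrightarrow> bipoly h \<Longrightarrow> bipoly (jac A h)"
  unfolding jac_def[abs_def] by (intro bipoly_diff bipoly_mult bipoly_dx bipoly_dy)

lemma jac_mult: "bipoly f \<Longrightarrow> bipoly g \<Longrightarrow> jac A (\<lambda>z. f z * g z) z = jac A f z * g z + f z * jac A g z"
  by (simp add: jac_def dx_mult dy_mult algebra_simps)

lemma jac_add: "bipoly f \<Longrightarrow> bipoly g \<Longrightarrow> jac A (\<lambda>z. f z + g z) z = jac A f z + jac A g z"
  by (simp add: jac_def dx_add dy_add algebra_simps)

lemma jac_const [simp]: "jac A (\<lambda>z. c) z = 0"
  by (simp add: jac_def)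

lemma jac_self [simp]: "jac A A z = 0"
  by (simp add: jac_def)

lemma jac_power_self: "bipoly A \<Longrightarrow> jac A (\<lambda>z. A z ^ k) z = 0"
  by (induction k) (simp_all add: jac_mult bipoly_power)

text \<open>The part of weight \<open>K + L - (p + q)\<close> of a Jacobian determinant is the Jacobian determinant of the
  leading parts; all higher parts vanish.\<close>

lemma jac_tendsto:
  assumes "qdec p q K A V" "qdec p q L h W"
  shows "(\<lambda>n. of_nat n ^ (p + q) * jac A h (dil p q (of_nat n) z) / of_nat n ^ (K + L))
     \<longlonglongrightarrow> jac (V K) (W L) z"
proof -
  let ?d = "\<lambda>n. dil p q (of_nat n) z"
  have "(\<lambda>n. (of_nat n ^ p * dx A (?d n) / of_nat n ^ K) * (of_nat n ^ q * dy h (?d n) / of_nat n ^ L)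
     - (of_nat n ^ q * dy A (?d n) / of_nat n ^ K) * (of_nat n ^ p * dx h (?d n) / of_nat n ^ L))
     \<longlonglongrightarrow> dx (V K) z * dy (W L) z - dy (V K) z * dx (W L) z"
    by (intro tendsto_intros qdec_dx_tendsto qdec_dy_tendsto assms)
  then show ?thesis
    unfolding jac_def by (simp add: power_add field_simps diff_divide_distrib)
qed

text \<open>In the coordinates \<open>(A, B)\<close> the derivation \<open>jac A\<close> is the multiple \<open>jac A B\<close> of \<open>\<partial>\<^sub>y\<close>.\<close>

lemma jac_compose:
  assumes "bipoly P" "bipoly A" "bipoly B"
  shows "jac A (\<lambda>z. P (A z, B z)) z = jac A B z * dy P (A z, B z)"
  using assms(1)
proof induction
  case bipoly_fst
  then show ?case by (simp flip: eta_contract_eq)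
next
  case bipoly_snd
  then show ?case by simp
next
  case (bipoly_add f g)
  have "bipoly (\<lambda>z. f (A z, B z))" "bipoly (\<lambda>z. g (A z, B z))"
    using bipoly_add assms by (auto intro: bipoly_compose)
  then show ?case using bipoly_add by (simp add: jac_add dy_add algebra_simps)
next
  case (bipoly_mult f g)
  have "bipoly (\<lambda>z. f (A z, B z))" "bipoly (\<lambda>z. g (A z, B z))"
    using bipoly_mult assms by (auto intro: bipoly_compose)
  then show ?case using bipoly_mult by (simp add: jac_mult dy_mult algebra_simps)
qed simp

lemma jac_iterate_bipoly: "bipoly A \<Longrightarrow> bipoly h \<Longrightarrow> bipoly ((jac A ^^ n) h)"
  by (induction n) (auto intro: bipoly_jac)

text \<open>Iterated \<open>y\<close>-derivatives of a polynomial vanish: each lowers the weight for \<open>(0, 1)\<close>.\<close>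

lemma qdec_dy_lower:
  assumes W: "qdec 0 1 K h W"
  shows "\<exists>W'. qdec 0 1 (K - 1) (dy h) W'" "K = 0 \<Longrightarrow> dy h z = 0"
proof -
  note bp = qdec_bipoly'[OF W]
  have lim: "(\<lambda>n. of_nat n * dy h (dil 0 1 (of_nat n) z) / of_nat n ^ K) \<longlonglongrightarrow> dy (W K) z" for z
    using qdec_dy_tendsto[OF W, of z] by simp
  show K0: "dy h z = 0" if "K = 0" for z
  proof -
    have h: "h = W 0" using qdec_eq[OF W] that by auto
    have c: "h (fst z, y) = h (fst z, 1)" if "y \<noteq> 0" for y
      using qhomD[OF qdec_qhom[OF W, of 0], where r = y and z = "(fst z, 1)"] that by (simp add: h dil_def)
    have d0: "dy h (fst z, y) = 0" if "y \<noteq> 0" for y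
    proof (rule dyI)
      have "((\<lambda>y. h (fst z, 1)) has_field_derivative 0) (at y)" by simp
      then have "((\<lambda>y. h (fst z, y)) has_field_derivative 0) (at y)"
        by (rule has_field_derivative_transform_within_open[of _ _ _ "- {0}"]) (use that in \<open>auto intro: c[symmetric]\<close>)
      then show "((\<lambda>y'. h (fst (fst z, y), y')) has_field_derivative 0) (at (snd (fst z, y)))"
        by simp
    qed
    have "filterlim (\<lambda>n. of_nat (Suc n) :: complex) at_infinity sequentially"
      using filterlim_compose[OF of_nat_at_infinity filterlim_Suc] .
    then have lim0: "(\<lambda>n. inverse (of_nat (Suc n)) :: complex) \<longlonglongrightarrow> 0"
      by (rule filterlim_compose[OF tendsto_inverse_0])
    have "(\<lambda>n. dy h (fst z, snd z + inverse (of_nat (Suc n)))) \<longlonglongrightarrow> dy h (fst z, snd z + 0)"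
      by (intro tendsto_bipoly[OF bipoly_dy[OF bp]] tendsto_intros lim0)
    moreover have "eventually (\<lambda>n. dy h (fst z, snd z + inverse (of_nat (Suc n))) = 0) sequentially"
    proof (cases "snd z = 0")
      case True
      then show ?thesis using d0 by (auto simp del: of_nat_Suc)
    next
      case False
      have "(\<lambda>n. snd z + inverse (of_nat (Suc n))) \<longlonglongrightarrow> snd z + 0"
        by (intro tendsto_intros lim0)
      then have "eventually (\<lambda>n. snd z + inverse (of_nat (Suc n)) \<noteq> 0) sequentially"
        using False by (intro tendsto_imp_eventually_ne) auto
      then show ?thesis by eventually_elim (use d0 in auto)
    qed
    ultimately have "dy h (fst z, snd z + 0) = 0"
      by (rule LIMSEQ_unique[OF _ tendsto_eventually])
    then show ?thesis by simp
  qed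
  show "\<exists>W'. qdec 0 1 (K - 1) (dy h) W'"
  proof (cases K)
    case 0
    then have "dy h = (\<lambda>_. 0)" using K0 by auto
    then show ?thesis by (intro exI[of _ "\<lambda>_ _. 0"]) (auto simp: qdec_def qhom_def intro: bipoly_const)
  next
    case (Suc k)
    have "(\<lambda>n. dy h (dil 0 1 (of_nat n) z) / of_nat n ^ (K - 1)) \<longlonglongrightarrow> dy (W K) z" for z
    proof -
      have "eventually (\<lambda>n. of_nat n * dy h (dil 0 1 (of_nat n) z) / of_nat n ^ K = 
          dy h (dil 0 1 (of_nat n) z) / of_nat n ^ (K - 1)) sequentially"
        using eventually_gt_at_top[of 0] by eventually_elim (simp add: Suc)
      then show ?thesis using lim[of z] by (simp add: tendsto_cong)
    qed
    then show ?thesis using growth_qdec[OF bipoly_dy[OF bp]] by blast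
  qed
qed

lemma dy_nilpotent:
  assumes "bipoly h" shows "\<exists>n. \<forall>z. (dy ^^ n) h z = 0"
proof -
  obtain K W where W: "qdec 0 1 K h W" using qdec_exists[OF assms] by blast
  have "\<exists>W'. qdec 0 1 (K - n) ((dy ^^ n) h) W'" for n
  proof (induction n)
    case 0 then show ?case using W by auto
  next
    case (Suc n)
    then obtain W' where "qdec 0 1 (K - n) ((dy ^^ n) h) W'" by blast
    from qdec_dy_lower(1)[OF this] show ?case by simp
  qed
  from this[of K] show ?thesis using qdec_dy_lower(2)
    by (intro exI[of _ "Suc K"]) auto
qed

section \<open>Polynomial automorphisms at infinity\<close>

lemma bipoly_line_poly:
  assumes "bipoly h"
  shows "\<exists>P. \<forall>s. h (a + s * b, c + s * d) = poly P s"
  using assms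
proof induction
  case (bipoly_const k)
  show ?case by (intro exI[of _ "[:k:]"]) auto
next
  case bipoly_fst
  show ?case by (intro exI[of _ "[:a, b:]"]) auto
next
  case bipoly_snd
  show ?case by (intro exI[of _ "[:c, d:]"]) auto
next
  case (bipoly_add f g)
  then obtain P Q where "\<forall>s. f (a + s * b, c + s * d) = poly P s" "\<forall>s. g (a + s * b, c + s * d) = poly Q s" by blast
  then show ?case by (intro exI[of _ "P + Q"]) auto
next
  case (bipoly_mult f g)
  then obtain P Q where "\<forall>s. f (a + s * b, c + s * d) = poly P s" "\<forall>s. g (a + s * b, c + s * d) = poly Q s" by blast
  then show ?case by (intro exI[of _ "P * Q"]) auto
qed

lemma poly_infinite_zeros:
  fixes P :: "complex poly"
  assumes "infinite S" "\<And>s. s \<in> S \<Longrightarrow> poly P s = 0"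
  shows "P = 0"
  using assms poly_roots_finite[of P] finite_subset[of S "{s. poly P s = 0}"] by auto

text \<open>A polynomial without zeros in the plane is constant.\<close>

lemma bipoly_no_zeros_const:
  assumes "bipoly h" "\<And>z. h z \<noteq> 0"
  shows "h z = h w"
proof -
  have "\<exists>P. \<forall>s. h (fst w + s * (fst z - fst w), snd w + s * (snd z - snd w)) = poly P s"
    by (rule bipoly_line_poly[OF assms(1)])
  then obtain P where P: "\<And>s. h (fst w + s * (fst z - fst w), snd w + s * (snd z - snd w)) = poly P s"
    by blast
  have "poly P s \<noteq> 0" for s unfolding P[symmetric] by (rule assms(2))
  then have "constant (poly P)" using Fundamental_Theorem_Algebra.fundamental_theorem_of_algebra[of P] by auto
  then have "poly P 1 = poly P 0" unfolding constant_def by blast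
  moreover have "poly P 1 = h z" using P[of 1, symmetric] by simp
  moreover have "poly P 0 = h w" using P[of 0, symmetric] by simp
  ultimately show ?thesis by simp
qed

text \<open>Complex scalar multiplication on \<open>\<complex> \<times> \<complex>\<close>.\<close>

definition cs :: "complex \<Rightarrow> complex \<times> complex \<Rightarrow> complex \<times> complex" where
  "cs r z = (r * fst z, r * snd z)"

lemma dil_1_1: "dil 1 1 = cs" by (auto simp: dil_def cs_def fun_eq_iff)

lemma fst_cs [simp]: "fst (cs r z) = r * fst z" and snd_cs [simp]: "snd (cs r z) = r * snd z"
  by (auto simp: cs_def)

lemma cs_cs [simp]: "cs a (cs b z) = cs (a * b) z" by (simp add: cs_def mult.assoc)
lemma cs_0 [simp]: "cs 0 z = 0" by (simp add: cs_def zero_prod_def)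
lemma cs_0' [simp]: "cs r 0 = 0" by (simp add: cs_def zero_prod_def)
lemma cs_eq_0 [simp]: "cs r z = 0 \<longleftrightarrow> r = 0 \<or> z = 0" by (auto simp: cs_def zero_prod_def prod_eq_iff)

text \<open>The determinant of two vectors; it vanishes when they are parallel.\<close>

definition dt :: "complex \<times> complex \<Rightarrow> complex \<times> complex \<Rightarrow> complex" where
  "dt v w = fst v * snd w - snd v * fst w"

lemma dt_cs [simp]: "dt (cs a v) w = a * dt v w" "dt v (cs a w) = a * dt v w"
  by (simp_all add: dt_def algebra_simps)

lemma dt_self [simp]: "dt v v = 0" by (simp add: dt_def)

lemma dt_0D:
  assumes "dt v w = 0" "v \<noteq> 0" shows "\<exists>c. w = cs c v"
proof (cases "fst v = 0")
  case True
  then have "snd v \<noteq> 0" using assms(2) by (auto simp: prod_eq_iff)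
  then show ?thesis using True assms(1)
    by (intro exI[of _ "snd w / snd v"]) (auto simp: prod_eq_iff dt_def)
next
  case False
  then show ?thesis using assms(1)
    by (intro exI[of _ "fst w / fst v"]) (auto simp: prod_eq_iff dt_def field_simps)
qed

lemma of_nat_power_at_infinity:
  "k \<ge> 1 \<Longrightarrow> filterlim (\<lambda>n. (of_nat n :: complex) ^ k) at_infinity sequentially"
  by (rule filterlim_compose[OF filterlim_power_at_infinity of_nat_at_infinity]) auto

subsection \<open>Top forms of polynomial maps\<close>

text \<open>\<open>T\<close> is the homogeneous part of degree \<open>N\<close> of the polynomial map \<open>F\<close>, which has degree at most
  \<open>N\<close>. If \<open>T\<close> is not zero, then \<open>N\<close> is the degree of \<open>F\<close> (\<open>mtop_degree\<close>) and \<open>T\<close> describes the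
  action of \<open>F\<close> on the line at infinity.\<close>

definition mtop :: "nat \<Rightarrow> (complex \<times> complex \<Rightarrow> complex \<times> complex) \<Rightarrow>
    (complex \<times> complex \<Rightarrow> complex \<times> complex) \<Rightarrow> bool" where
  "mtop N F T \<longleftrightarrow> (\<exists>W W'. qdec 1 1 N (\<lambda>z. fst (F z)) W \<and> qdec 1 1 N (\<lambda>z. snd (F z)) W' \<and>
     T = (\<lambda>z. (W N z, W' N z)))"

lemma polymap_le_iff_mtop: "polymap_le N F \<longleftrightarrow> (\<exists>T. mtop N F T)"
  unfolding polymap_le_def poly2_le_iff_qdec mtop_def by blast

lemma polymap_iff_bipoly: "polymap F \<longleftrightarrow> bipoly (\<lambda>z. fst (F z)) \<and> bipoly (\<lambda>z. snd (F z))"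
proof
  assume "polymap F"
  then show "bipoly (\<lambda>z. fst (F z)) \<and> bipoly (\<lambda>z. snd (F z))"
    unfolding polymap_def polymap_le_def bipoly_iff_poly2_le by blast
next
  assume "bipoly (\<lambda>z. fst (F z)) \<and> bipoly (\<lambda>z. snd (F z))"
  then obtain N M where "poly2_le N (\<lambda>z. fst (F z))" "poly2_le M (\<lambda>z. snd (F z))"
    unfolding bipoly_iff_poly2_le by blast
  then have "polymap_le (max N M) F" unfolding polymap_le_def
    using poly2_le_weaken by (meson max.cobounded1 max.cobounded2)
  then show "polymap F" unfolding polymap_def by blast
qed

lemma mtop_polymap: "mtop N F T \<Longrightarrow> polymap F"
  using polymap_le_iff_mtop polymap_def by blast

lemma mtop_qhom: "mtop N F T \<Longrightarrow> qhom 1 1 N (\<lambda>z. fst (T z))" "mtop N F T \<Longrightarrow> qhom 1 1 N (\<lambda>z. snd (T z))"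
  unfolding mtop_def using qdec_qhom by force+

lemma mtop_cs:
  assumes "mtop N F T" "r \<noteq> 0" shows "T (cs r z) = cs (r ^ N) (T z)"
  using qhomD[OF mtop_qhom(1)[OF assms(1)] assms(2)] qhomD[OF mtop_qhom(2)[OF assms(1)] assms(2)]
  by (auto simp: dil_1_1[unfolded One_nat_def] prod_eq_iff)

lemma qhom_0: "qhom p q m W \<Longrightarrow> m \<ge> 1 \<Longrightarrow> W 0 = 0"
proof -
  assume *: "qhom p q m W" "m \<ge> 1"
  have "W (dil p q 2 0) = 2 ^ m * W 0" using qhomD[OF *(1), of 2] by simp
  then have "W 0 = 2 ^ m * W 0" by (simp add: dil_def zero_prod_def)
  then have "(2 ^ m - 1) * W 0 = 0" by (simp add: algebra_simps)
  moreover have "(2::complex) ^ m \<noteq> 1"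
  proof
    assume "(2::complex) ^ m = 1"
    then have "norm ((2::complex) ^ m) = 1" by simp
    then have "(2::real) ^ m = 1" by (simp add: norm_power)
    then show False using *(2) one_less_power[of "2::real" m] by simp
  qed
  ultimately show "W 0 = 0" by simp
qed

lemma qhom_cs: "qhom 1 1 m W \<Longrightarrow> m \<ge> 1 \<Longrightarrow> W (cs r z) = r ^ m * W z"
  using qhomD[of 1 1 m W r z] qhom_0[of 1 1 m W] by (cases "r = 0") (auto simp: dil_1_1[unfolded One_nat_def])

lemma mtop_tendsto:
  assumes "mtop N F T" "filterlim r at_infinity G" "(\<zeta> \<longlongrightarrow> z) G"
  shows "((\<lambda>a. fst (F (cs (r a) (\<zeta> a))) / r a ^ N) \<longlongrightarrow> fst (T z)) G"
        "((\<lambda>a. snd (F (cs (r a) (\<zeta> a))) / r a ^ N) \<longlongrightarrow> snd (T z)) G"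
proof -
  from assms(1) obtain W W' where W: "qdec 1 1 N (\<lambda>z. fst (F z)) W" "qdec 1 1 N (\<lambda>z. snd (F z)) W'"
     "T = (\<lambda>z. (W N z, W' N z))" unfolding mtop_def by blast
  show "((\<lambda>a. fst (F (cs (r a) (\<zeta> a))) / r a ^ N) \<longlongrightarrow> fst (T z)) G"
        "((\<lambda>a. snd (F (cs (r a) (\<zeta> a))) / r a ^ N) \<longlongrightarrow> snd (T z)) G"
    using qdec_tendsto[OF W(1) assms(2,3)] qdec_tendsto[OF W(2) assms(2,3)]
    by (simp_all add: W(3) dil_1_1[unfolded One_nat_def])
qed

lemma mtop_growth:
  assumes "polymap F"
    "\<And>z. (\<lambda>n. fst (F (cs (of_nat n) z)) / of_nat n ^ N) \<longlonglongrightarrow> fst (T z)"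
    "\<And>z. (\<lambda>n. snd (F (cs (of_nat n) z)) / of_nat n ^ N) \<longlonglongrightarrow> snd (T z)"
  shows "mtop N F T"
proof -
  have b: "bipoly (\<lambda>z. fst (F z))" "bipoly (\<lambda>z. snd (F z))" using assms(1) polymap_iff_bipoly by auto
  obtain W where "qdec 1 1 N (\<lambda>z. fst (F z)) W \<and> W N = (\<lambda>z. fst (T z))"
    using growth_qdec[OF b(1), of 1 1 N "\<lambda>z. fst (T z)"] assms(2) by (auto simp: dil_1_1[unfolded One_nat_def])
  moreover obtain W' where "qdec 1 1 N (\<lambda>z. snd (F z)) W' \<and> W' N = (\<lambda>z. snd (T z))"
    using growth_qdec[OF b(2), of 1 1 N "\<lambda>z. snd (T z)"] assms(3) by (auto simp: dil_1_1[unfolded One_nat_def])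
  ultimately show ?thesis unfolding mtop_def by (intro exI[of _ W] exI[of _ W']) auto
qed

lemma mtop_unique:
  assumes "mtop N F T" "mtop N F T'" shows "T z = T' z"
  using LIMSEQ_unique[OF mtop_tendsto(1)[OF assms(1) of_nat_at_infinity tendsto_const[of z]]
      mtop_tendsto(1)[OF assms(2) of_nat_at_infinity tendsto_const[of z]]]
    LIMSEQ_unique[OF mtop_tendsto(2)[OF assms(1) of_nat_at_infinity tendsto_const[of z]]
      mtop_tendsto(2)[OF assms(2) of_nat_at_infinity tendsto_const[of z]]]
  by (rule prod_eqI)

lemma polymap_comp: "polymap F \<Longrightarrow> polymap G \<Longrightarrow> polymap (F \<circ> G)"
  unfolding polymap_iff_bipoly o_def
  using bipoly_compose[of "\<lambda>z. fst (F z)" "\<lambda>z. fst (G z)" "\<lambda>z. snd (G z)"]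
    bipoly_compose[of "\<lambda>z. snd (F z)" "\<lambda>z. fst (G z)" "\<lambda>z. snd (G z)"] by simp

lemma isCont_polymap: "polymap F \<Longrightarrow> isCont F z"
  using isCont_Pair[OF isCont_bipoly isCont_bipoly, of "\<lambda>z. fst (F z)" "\<lambda>z. snd (F z)" z]
  by (simp add: polymap_iff_bipoly)

lemma continuous_on_polymap: "polymap F \<Longrightarrow> continuous_on A F"
  using isCont_polymap continuous_at_imp_continuous_on by blast

lemma mtop_compose:
  assumes F: "mtop N F T" and G: "mtop M G U" and M: "M \<ge> 1"
  shows "mtop (N * M) (F \<circ> G) (T \<circ> U)"
proof (rule mtop_growth)
  show "polymap (F \<circ> G)" using F G mtop_polymap polymap_comp by blast
  fix z
  define r where "r = (\<lambda>n. (of_nat n :: complex) ^ M)"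
  define \<zeta> where "\<zeta> = (\<lambda>n. (fst (G (cs (of_nat n) z)) / r n, snd (G (cs (of_nat n) z)) / r n))"
  have r: "filterlim r at_infinity sequentially"
    unfolding r_def by (rule of_nat_power_at_infinity[OF M])
  have \<zeta>: "\<zeta> \<longlonglongrightarrow> (fst (U z), snd (U z))"
    unfolding \<zeta>_def r_def by (intro tendsto_Pair mtop_tendsto[OF G of_nat_at_infinity] tendsto_const)
  have eq: "eventually (\<lambda>n. cs (r n) (\<zeta> n) = G (cs (of_nat n) z)) sequentially"
    using eventually_gt_at_top[of 0]
    by eventually_elim (simp add: \<zeta>_def r_def cs_def)
  have rN: "r n ^ N = of_nat n ^ (N * M)" for n by (simp add: r_def power_mult mult.commute flip: power_mult)
  have "eventually (\<lambda>n. fst (F (cs (r n) (\<zeta> n))) / r n ^ N = fst ((F \<circ> G) (cs (of_nat n) z)) / of_nat n ^ (N * M)) sequentially"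
    using eq by eventually_elim (simp add: rN)
  then show "(\<lambda>n. fst ((F \<circ> G) (cs (of_nat n) z)) / of_nat n ^ (N * M)) \<longlonglongrightarrow> fst ((T \<circ> U) z)"
    using Lim_transform_eventually[OF mtop_tendsto(1)[OF F r \<zeta>]] by simp
  have "eventually (\<lambda>n. snd (F (cs (r n) (\<zeta> n))) / r n ^ N = snd ((F \<circ> G) (cs (of_nat n) z)) / of_nat n ^ (N * M)) sequentially"
    using eq by eventually_elim (simp add: rN)
  then show "(\<lambda>n. snd ((F \<circ> G) (cs (of_nat n) z)) / of_nat n ^ (N * M)) \<longlonglongrightarrow> snd ((T \<circ> U) z)"
    using Lim_transform_eventually[OF mtop_tendsto(2)[OF F r \<zeta>]] by simp
qed

lemma mtop_zero_lower:
  assumes "mtop (Suc N) F T" "\<And>z. T z = 0" shows "polymap_le N F"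
proof -
  from assms(1) obtain W W' where W: "qdec 1 1 (Suc N) (\<lambda>z. fst (F z)) W" "qdec 1 1 (Suc N) (\<lambda>z. snd (F z)) W'"
     "T = (\<lambda>z. (W (Suc N) z, W' (Suc N) z))" unfolding mtop_def by blast
  have "W (Suc N) = (\<lambda>_. 0)" "W' (Suc N) = (\<lambda>_. 0)"
    using assms(2) unfolding W(3) by (auto simp: prod_eq_iff)
  then have "qdec 1 1 N (\<lambda>z. fst (F z)) W" "qdec 1 1 N (\<lambda>z. snd (F z)) W'"
    using W qdec_top_0 by blast+
  then show ?thesis unfolding polymap_le_def poly2_le_iff_qdec by blast
qed

lemma polymap_id: "polymap id"
  by (simp add: polymap_iff_bipoly bipoly_fst bipoly_snd)

lemma tendsto_inverse_power_nat:
  assumes "k \<ge> 1" shows "(\<lambda>n. c / (of_nat n :: complex) ^ k) \<longlonglongrightarrow> 0"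
proof -
  have "filterlim (\<lambda>n. (of_nat n :: complex) ^ k) at_infinity sequentially"
    by (rule of_nat_power_at_infinity[OF assms])
  then show ?thesis by (rule tendsto_divide_0[OF tendsto_const])
qed

lemma mtop_id_high:
  assumes "N \<ge> 2" shows "mtop N id (\<lambda>z. 0)"
proof (rule mtop_growth[OF polymap_id])
  obtain k where k: "N = Suc k" "k \<ge> 1" using assms by (cases N) auto
  have *: "(\<lambda>n. of_nat n * c / (of_nat n :: complex) ^ N) \<longlonglongrightarrow> 0" for c
    by (rule Lim_transform_eventually[OF tendsto_inverse_power_nat[OF k(2), of c]])
       (use eventually_gt_at_top[of 0] in eventually_elim, simp add: k)
  show "(\<lambda>n. fst (id (cs (of_nat n) z)) / of_nat n ^ N) \<longlonglongrightarrow> fst 0" for z using * by simp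
  show "(\<lambda>n. snd (id (cs (of_nat n) z)) / of_nat n ^ N) \<longlonglongrightarrow> snd 0" for z using * by simp
qed

subsection \<open>Polynomial automorphisms\<close>

text \<open>A polynomial automorphism \<open>f\<close> together with its inverse \<open>g\<close>.\<close>

definition autpair :: "(complex \<times> complex \<Rightarrow> complex \<times> complex) \<Rightarrow>
    (complex \<times> complex \<Rightarrow> complex \<times> complex) \<Rightarrow> bool" where
  "autpair f g \<longleftrightarrow> polymap f \<and> polymap g \<and> (\<forall>z. f (g z) = z) \<and> (\<forall>z. g (f z) = z)"

lemma autpair_sym: "autpair f g \<Longrightarrow> autpair g f" by (auto simp: autpair_def)

lemma autpair_comp: "autpair f f' \<Longrightarrow> autpair g g' \<Longrightarrow> autpair (f \<circ> g) (g' \<circ> f')"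
  unfolding autpair_def using polymap_comp by (auto simp: o_def)

lemma autpair_id: "autpair id id" by (simp add: autpair_def polymap_id)

lemma poly_diffeo_autpair: "poly_diffeo f \<Longrightarrow> autpair f (inv f)"
  unfolding poly_diffeo_def autpair_def using bij_is_inj bij_is_surj inv_f_f surj_f_inv_f by metis

lemma autpairD: "autpair f g \<Longrightarrow> f (g z) = z" "autpair f g \<Longrightarrow> g (f z) = z" "autpair f g \<Longrightarrow> polymap f" "autpair f g \<Longrightarrow> polymap g"
  by (auto simp: autpair_def)

lemma autpair_inj: "autpair f g \<Longrightarrow> f z = f w \<longleftrightarrow> z = w"
  by (metis autpairD(2))

lemma polymap_le_degree: "polymap F \<Longrightarrow> polymap_le (polymap_degree F) F"
  unfolding polymap_def polymap_degree_def by (rule LeastI_ex)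

lemma polymap_degree_le: "polymap_le N F \<Longrightarrow> polymap_degree F \<le> N"
  unfolding polymap_degree_def by (rule Least_le)

lemma mtop_degree:
  assumes "mtop N F T" "T z \<noteq> 0" shows "polymap_degree F = N"
proof (rule antisym)
  show "polymap_degree F \<le> N" using assms polymap_le_iff_mtop polymap_degree_le by blast
  show "N \<le> polymap_degree F"
  proof (rule ccontr)
    assume "\<not> ?thesis"
    then have lt: "polymap_degree F < N" by simp
    define M where "M = polymap_degree F"
    obtain U where U: "mtop M F U"
      using polymap_le_degree[OF mtop_polymap[OF assms(1)]] polymap_le_iff_mtop unfolding M_def by blast
    have *: "(\<lambda>n. a n / of_nat n ^ M * (1 / of_nat n ^ (N - M))) = (\<lambda>n. a n / of_nat n ^ N)" for a :: "nat \<Rightarrow> complex"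
      using lt by (auto simp: M_def simp flip: power_add)
    have "(\<lambda>n. fst (F (cs (of_nat n) z)) / of_nat n ^ N) \<longlonglongrightarrow> fst (U z) * 0"
      unfolding *[symmetric]
      by (intro tendsto_mult mtop_tendsto[OF U of_nat_at_infinity] tendsto_const tendsto_inverse_power_nat)
         (use lt in \<open>auto simp: M_def\<close>)
    then have 1: "fst (T z) = 0"
      using mtop_tendsto(1)[OF assms(1) of_nat_at_infinity tendsto_const[of z]] LIMSEQ_unique by fastforce
    have "(\<lambda>n. snd (F (cs (of_nat n) z)) / of_nat n ^ N) \<longlonglongrightarrow> snd (U z) * 0"
      unfolding *[symmetric]
      by (intro tendsto_mult mtop_tendsto[OF U of_nat_at_infinity] tendsto_const tendsto_inverse_power_nat)
         (use lt in \<open>auto simp: M_def\<close>)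
    then have "snd (T z) = 0"
      using mtop_tendsto(2)[OF assms(1) of_nat_at_infinity tendsto_const[of z]] LIMSEQ_unique by fastforce
    with 1 show False using assms(2) by (simp add: prod_eq_iff)
  qed
qed

lemma poly2_le_0_const: "poly2_le 0 h \<Longrightarrow> h z = h w"
  by (cases z; cases w) (auto simp: poly2_le_def)

lemma aut_top_exists:
  assumes "autpair f g"
  shows "polymap_degree f \<ge> 1" "\<exists>T z. mtop (polymap_degree f) f T \<and> T z \<noteq> 0"
proof -
  define N where "N = polymap_degree f"
  have le: "polymap_le N f" unfolding N_def using assms autpairD(3) polymap_le_degree by blast
  show "polymap_degree f \<ge> 1"
  proof (rule ccontr)
    assume "\<not> ?thesis"
    then have "polymap_degree f = 0" by simp
    then have "polymap_le 0 f" using le by (simp add: N_def)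
    then have "f z = f w" for z w unfolding polymap_le_def using poly2_le_0_const by (metis prod_eq_iff)
    then have "(0, 0) = (1::complex, 1::complex)" using autpair_inj[OF assms] by blast
    then show False by (simp add: prod_eq_iff)
  qed
  then obtain k where k: "N = Suc k" unfolding N_def by (cases "polymap_degree f") auto
  obtain T where T: "mtop N f T" using le polymap_le_iff_mtop by blast
  moreover have "\<exists>z. T z \<noteq> 0"
  proof (rule ccontr)
    assume "\<not> ?thesis"
    then have "polymap_le k f" using T k mtop_zero_lower by blast
    then show False using polymap_degree_le[of k f] k by (simp add: N_def)
  qed
  ultimately show "\<exists>T z. mtop (polymap_degree f) f T \<and> T z \<noteq> 0" unfolding N_def by blast
qed

text \<open>The top form of \<open>\<phi>\<^sup>-\<^sup>1\<close> kills the image of the top form of \<open>\<phi>\<close>, for the identity has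
  degree one.\<close>

lemma top_annihilates:
  assumes ap: "autpair \<phi> \<phi>i" and "mtop N \<phi> T" "mtop M \<phi>i U" "N \<ge> 1" "N * M \<ge> 2"
  shows "U (T z) = 0"
proof -
  have "\<phi>i \<circ> \<phi> = id" using autpairD[OF ap] by auto
  then have "mtop (M * N) id (U \<circ> T)" using mtop_compose[OF assms(3,2,4)] by simp
  then show ?thesis using mtop_unique[OF _ mtop_id_high, of "M * N" "U \<circ> T" z] assms(5) by (simp add: mult.commute)
qed

lemma mtop_affine_kernel:
  assumes U: "mtop 1 F U" "U v = 0" shows "F (cs 2 v) = F v"
proof -
  from U(1) obtain W W' where W: "qdec 1 1 1 (\<lambda>z. fst (F z)) W" "qdec 1 1 1 (\<lambda>z. snd (F z)) W'"
     "U = (\<lambda>z. (W 1 z, W' 1 z))" unfolding mtop_def by blast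
  have 1: "W j (cs 2 v) = 2 ^ j * W j v" "W' j (cs 2 v) = 2 ^ j * W' j v" for j
    using qhomD[OF qdec_qhom[OF W(1), of j], where r = 2 and z = v]
      qhomD[OF qdec_qhom[OF W(2), of j], where r = 2 and z = v] by (simp_all add: dil_1_1[unfolded One_nat_def])
  have "W 1 v = 0" "W' 1 v = 0" using U(2) by (auto simp: W(3) prod_eq_iff)
  then have "fst (F (cs 2 v)) = fst (F v)" "snd (F (cs 2 v)) = snd (F v)"
    unfolding qdec_eq[OF W(1)] qdec_eq[OF W(2)] by (simp_all add: 1)
  then show ?thesis by (simp add: prod_eq_iff)
qed

text \<open>If the top form of an automorphism has a zero outside the origin, then the automorphism is not
  affine, for it is injective.\<close>

lemma aut_top_kernel_degree:
  assumes ap: "autpair F Fi" and T: "mtop N F T" "T v = 0" "v \<noteq> 0" "N \<ge> 1"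
  shows "N \<ge> 2"
proof (rule ccontr)
  assume "\<not> ?thesis"
  then have "N = 1" using T by simp
  then have "F (cs 2 v) = F v" using mtop_affine_kernel T by blast
  then have "cs 2 v = v" using autpair_inj[OF ap] by blast
  then show False using T(3) by (auto simp: cs_def prod_eq_iff)
qed

lemma inverse_degree_ge2:
  assumes ap: "autpair \<phi> \<phi>i" and T: "mtop N \<phi> T" "T z1 \<noteq> 0" "N \<ge> 2" and U: "mtop M \<phi>i U" "M \<ge> 1"
  shows "M \<ge> 2"
proof -
  have "1 \<le> N" "2 \<le> N * M" using T(3) U(2) mult_le_mono[of 2 N 1 M] by auto
  then show ?thesis using aut_top_kernel_degree[OF autpair_sym[OF ap] U(1) top_annihilates[OF ap T(1) U(1)] T(2) U(2)] by blast
qed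

lemma qhom_line_zero:
  assumes U: "qhom 1 1 M h" and vw: "dt v w \<noteq> 0" and z: "\<And>s. h (v + cs s w) = 0"
  shows "h z = 0"
proof -
  \<comment> \<open>Cramer: \<open>z\<close> is a combination of \<open>v\<close> and \<open>w\<close>.\<close>
  define a b where "a = dt z w / dt v w" and "b = dt v z / dt v w"
  have eq: "z = cs a v + cs b w"
  proof -
    have "dt v w * fst z = dt z w * fst v + dt v z * fst w" "dt v w * snd z = dt z w * snd v + dt v z * snd w"
      by (simp_all add: dt_def algebra_simps)
    then show ?thesis using vw by (auto simp: prod_eq_iff a_def b_def add_divide_distrib[symmetric] eq_divide_eq mult.commute)
  qed
  have nz: "h (cs e v + cs b w) = 0" if "e \<noteq> 0" for e
  proof -
    have "cs e v + cs b w = cs e (v + cs (b / e) w)" using that by (auto simp: prod_eq_iff algebra_simps)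
    then show ?thesis using qhomD[OF U that, of "v + cs (b / e) w"] z by (simp add: dil_1_1[unfolded One_nat_def])
  qed
  have "\<exists>P. \<forall>s. h (b * fst w + s * fst v, b * snd w + s * snd v) = poly P s"
    by (rule bipoly_line_poly[OF qhom_bipoly[OF U]])
  then obtain P where P: "\<And>s. h (b * fst w + s * fst v, b * snd w + s * snd v) = poly P s" by blast
  have e: "(b * fst w + s * fst v, b * snd w + s * snd v) = cs s v + cs b w" for s
    by (simp add: prod_eq_iff)
  have "P = 0"
    by (rule poly_infinite_zeros[of "- {0}"]) (auto simp: nz e P[symmetric] finite_compl infinite_UNIV_char_0)
  then show ?thesis using P[of a] by (simp add: e eq)
qed

text \<open>The top form of an automorphism of degree at least two takes its values in a line: the line
  at infinity is contracted to one point. Indeed its image lies in the zero set of the top form of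
  the inverse, a finite union of lines, and is irreducible.\<close>

lemma top_form_line:
  assumes ap: "autpair \<phi> \<phi>i" and T: "mtop N \<phi> T" "T z1 \<noteq> 0" "N \<ge> 1"
    and U: "mtop M \<phi>i U" "U z2 \<noteq> 0" "N * M \<ge> 2"
  obtains H v where "v \<noteq> 0" "\<And>z. T z = cs (H z) v" "qhom 1 1 N H" "H z1 \<noteq> 0"
proof -
  define v where "v = T z1"
  have v0: "v \<noteq> 0" using T(2) by (simp add: v_def)
  define w where "w = (if fst v \<noteq> 0 then (0, 1 / fst v) else (- 1 / snd v, 0))"
  have vw: "dt v w = 1" using v0 by (auto simp: w_def dt_def prod_eq_iff)
  define H where "H = (\<lambda>z. if fst v \<noteq> 0 then fst (T z) / fst v else snd (T z) / snd v)"
  have Hq: "qhom 1 1 N H"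
  proof (cases "fst v = 0")
    case True
    then have eq: "H = (\<lambda>z. (1 / snd v) * snd (T z))" by (auto simp: H_def)
    show ?thesis using mtop_qhom(2)[OF T(1)] bipoly_mult[OF bipoly_const[of "1 / snd v"], of "\<lambda>z. snd (T z)"]
      unfolding qhom_def eq by auto
  next
    case False
    then have eq: "H = (\<lambda>z. (1 / fst v) * fst (T z))" by (auto simp: H_def)
    show ?thesis using mtop_qhom(1)[OF T(1)] bipoly_mult[OF bipoly_const[of "1 / fst v"], of "\<lambda>z. fst (T z)"]
      unfolding qhom_def eq by auto
  qed
  have Tz: "T z = cs (H z) v + cs (dt v (T z)) w" for z
    using v0 by (auto simp: H_def w_def prod_eq_iff dt_def field_simps)
  have H1: "H z1 = 1" using v0 by (auto simp: H_def prod_eq_iff simp flip: v_def)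
  have "dt v (T z) = 0" for z
  proof -
    \<comment> \<open>A component \<open>u\<close> of the top form of the inverse that is not zero; it vanishes on the image of \<open>T\<close>.\<close>
    define u where "u = (\<lambda>z. if fst (U z2) \<noteq> 0 then fst (U z) else snd (U z))"
    have uq: "qhom 1 1 M u" and u2: "u z2 \<noteq> 0"
      using mtop_qhom[OF U(1)] U(2) by (cases "fst (U z2) = 0"; auto simp: u_def prod_eq_iff)+
    have uT: "u (T z) = 0" for z
      using top_annihilates[OF ap T(1) U(1) T(3) U(3)] by (simp add: u_def)
    have "\<exists>P. \<forall>s. u (fst v + s * fst w, snd v + s * snd w) = poly P s"
      by (rule bipoly_line_poly[OF qhom_bipoly[OF uq]])
    then obtain P where P: "\<And>s. u (fst v + s * fst w, snd v + s * snd w) = poly P s" by blast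
    have P': "u (v + cs s w) = poly P s" for s unfolding P[symmetric] by (simp add: plus_prod_def)
    have P0: "P \<noteq> 0"
    proof
      assume "P = 0"
      then have z: "u (v + cs s w) = 0" for s unfolding P' by simp
      have "dt v w \<noteq> 0" using vw by simp
      from qhom_line_zero[OF uq this z] have "u z2 = 0" .
      then show False using u2 by simp
    qed
    have "\<exists>A. \<forall>s. H (fst z1 + s * (fst z - fst z1), snd z1 + s * (snd z - snd z1)) = poly A s"
      by (rule bipoly_line_poly[OF qhom_bipoly[OF Hq]])
    then obtain A where A: "\<And>s. H (fst z1 + s * (fst z - fst z1), snd z1 + s * (snd z - snd z1)) = poly A s" by blast
    have bb: "bipoly (\<lambda>z. dt v (T z))"
      unfolding dt_def by (intro bipoly_diff bipoly_mult bipoly_const qhom_bipoly[OF mtop_qhom(1)[OF T(1)]] qhom_bipoly[OF mtop_qhom(2)[OF T(1)]])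
    have "\<exists>B. \<forall>s. dt v (T (fst z1 + s * (fst z - fst z1), snd z1 + s * (snd z - snd z1))) = poly B s"
      by (rule bipoly_line_poly[OF bb])
    then obtain B where B: "\<And>s. dt v (T (fst z1 + s * (fst z - fst z1), snd z1 + s * (snd z - snd z1))) = poly B s" by blast
    \<comment> \<open>On the line from \<open>z1\<close> to \<open>z\<close> one has \<open>T = A v + B w\<close>, and \<open>B / A\<close> takes values in the finite
      set of roots of \<open>P\<close>; so it is constant, with value zero at \<open>z1\<close>.\<close>
    have A0: "poly A 0 = 1" using A[of 0] H1 by simp
    have B0: "poly B 0 = 0" using B[of 0] by (simp flip: v_def)
    have root: "poly P (poly B s / poly A s) = 0" if "poly A s \<noteq> 0" for s
    proof -
      define zs where "zs = (fst z1 + s * (fst z - fst z1), snd z1 + s * (snd z - snd z1))"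
      have "T zs = cs (poly A s) v + cs (poly B s) w" using Tz[of zs] A[of s] B[of s] by (simp add: zs_def)
      also have "\<dots> = cs (poly A s) (v + cs (poly B s / poly A s) w)" using that by (auto simp: prod_eq_iff algebra_simps)
      finally have "0 = u (cs (poly A s) (v + cs (poly B s / poly A s) w))" using uT[of zs] by simp
      also have "\<dots> = poly A s ^ M * poly P (poly B s / poly A s)"
        using qhomD[OF uq that] by (simp add: dil_1_1[unfolded One_nat_def] P')
      finally show ?thesis using that by simp
    qed
    have "A \<noteq> 0" using A0 by auto
    then have inf: "infinite {s. poly A s \<noteq> 0}"
      using poly_roots_finite[of A] by (simp add: Collect_neg_eq finite_compl infinite_UNIV_char_0)
    have sub: "{s. poly A s \<noteq> 0} \<subseteq> (\<Union>\<sigma>\<in>{\<sigma>. poly P \<sigma> = 0}. {s. poly (B - smult \<sigma> A) s = 0})"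
    proof
      fix s assume s: "s \<in> {s. poly A s \<noteq> 0}"
      then show "s \<in> (\<Union>\<sigma>\<in>{\<sigma>. poly P \<sigma> = 0}. {s. poly (B - smult \<sigma> A) s = 0})"
        using root[of s] by (intro UN_I[of "poly B s / poly A s"]) auto
    qed
    have "\<exists>\<sigma>. B = smult \<sigma> A"
    proof (rule ccontr)
      assume no: "\<not> ?thesis"
      have "finite (\<Union>\<sigma>\<in>{\<sigma>. poly P \<sigma> = 0}. {s. poly (B - smult \<sigma> A) s = 0})"
        using no by (intro finite_UN_I poly_roots_finite P0) auto
      then show False using inf sub finite_subset by blast
    qed
    then obtain \<sigma> where \<sigma>: "B = smult \<sigma> A" by blast
    then have "\<sigma> = 0" using A0 B0 by simp
    then have "poly B 1 = 0" using \<sigma> by simp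
    then show ?thesis using B[of 1] by simp
  qed
  then have "T z = cs (H z) v" for z using Tz[of z] by simp
  then show ?thesis using that v0 Hq H1 by auto
qed

subsection \<open>Zeros of a polynomial near infinity\<close>

text \<open>Every zero of the leading part is a limit of rescaled zeros of the polynomial itself, by Hurwitz'
  theorem on a line through the zero on which the leading part does not vanish identically.\<close>

lemma asymptotic_zeros:
  assumes V: "qdec p q K A V" and z1: "V K z1 \<noteq> 0" and z0: "V K z0 = 0"
  shows "\<exists>n \<zeta>. filterlim n at_top sequentially \<and> \<zeta> \<longlonglongrightarrow> z0 \<and> (\<forall>k. A (dil p q (of_nat (n k)) (\<zeta> k)) = 0)"
proof -
  define line where "line = (\<lambda>s. (fst z0 + s * (fst z1 - fst z0), snd z0 + s * (snd z1 - snd z0)))"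
  have line: "line 0 = z0" "line 1 = z1" by (auto simp: line_def)
  have lc: "continuous_on X line" for X unfolding line_def by (intro continuous_intros)
  have holl: "bipoly h \<Longrightarrow> (\<lambda>s. h (line s)) holomorphic_on X" for h X
    unfolding line_def by (intro holomorphic_bipoly holomorphic_intros)
  have key: "\<exists>n\<ge>m. \<exists>\<zeta>. dist \<zeta> z0 < e \<and> A (dil p q (of_nat n) \<zeta>) = 0" if e: "e > 0" for m e
  proof (rule ccontr)
    assume no: "\<not> ?thesis"
    have "isCont line 0" using lc[of UNIV] by (simp add: continuous_on_eq_continuous_at)
    then obtain d where d: "d > 0" "\<And>s. dist s 0 < d \<Longrightarrow> dist (line s) z0 < e"
      using e unfolding continuous_at_eps_delta line(1) by (metis dist_commute)
    define r where "r = (\<lambda>n. (of_nat (n + Suc m) :: complex))"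
    have r0: "r n \<noteq> 0" for n unfolding r_def by (simp flip: of_nat_Suc)
    have r: "filterlim r at_infinity sequentially"
      unfolding r_def by (rule filterlim_compose[OF of_nat_at_infinity filterlim_add_const_nat_at_top])
    have ul: "uniform_limit C (\<lambda>n s. A (dil p q (r n) (line s)) / r n ^ K) (\<lambda>s. V K (line s)) sequentially"
      if C: "compact C" for C
    proof (rule uniform_limitI)
      fix e :: real assume e: "e > 0"
      have "\<exists>B. \<forall>j\<le>K. \<forall>s\<in>C. norm (V j (line s)) \<le> B"
      proof -
        have "\<exists>B. \<forall>s\<in>C. norm (V j (line s)) \<le> B" for j
        proof -
          have "compact ((\<lambda>s. V j (line s)) ` C)"
            by (intro compact_continuous_image C continuous_on_compose2[OF continuous_on_bipoly[OF qdec_bipoly[OF V], of UNIV] lc]) auto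
          then show ?thesis by (meson bounded_iff compact_imp_bounded imageI)
        qed
        then obtain B where B: "\<And>j s. s \<in> C \<Longrightarrow> norm (V j (line s)) \<le> B j" by metis
        have "norm (V j (line s)) \<le> Max (B ` {..K})" if "j \<le> K" "s \<in> C" for j s
          using B[OF that(2), of j] Max_ge[of "B ` {..K}" "B j"] that(1) by (auto intro: order_trans)
        then show ?thesis by blast
      qed
      then obtain B where B: "\<And>j s. j \<le> K \<Longrightarrow> s \<in> C \<Longrightarrow> norm (V j (line s)) \<le> B" by blast
      have inv0: "(\<lambda>n. inverse (r n)) \<longlonglongrightarrow> 0" by (rule filterlim_compose[OF tendsto_inverse_0 r])
      have "(\<lambda>n. \<Sum>j<K. \<bar>B\<bar> * norm (inverse (r n) ^ (K - j))) \<longlonglongrightarrow> (\<Sum>j<K. \<bar>B\<bar> * norm (0 ^ (K - j) :: complex))"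
        by (intro tendsto_intros inv0)
      moreover have "(\<Sum>j<K. \<bar>B\<bar> * norm (0 ^ (K - j) :: complex)) = 0" by (intro sum.neutral) auto
      ultimately have "(\<lambda>n. \<Sum>j<K. \<bar>B\<bar> * norm (inverse (r n) ^ (K - j))) \<longlonglongrightarrow> 0" by simp
      then have "eventually (\<lambda>n. (\<Sum>j<K. \<bar>B\<bar> * norm (inverse (r n) ^ (K - j))) < e) sequentially"
        using e order_tendstoD(2) by blast
      then show "\<forall>\<^sub>F n in sequentially. \<forall>s\<in>C. dist (A (dil p q (r n) (line s)) / r n ^ K) (V K (line s)) < e"
      proof eventually_elim
        case (elim n)
        show ?case
        proof
          fix s assume s: "s \<in> C"
          have "A (dil p q (r n) (line s)) / r n ^ K = (\<Sum>j\<le>K. V j (line s) * inverse (r n) ^ (K - j))"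
            unfolding qdec_eq[OF V] sum_divide_distrib
          proof (rule sum.cong[OF refl])
            fix j assume "j \<in> {..K}"
            then have "r n ^ K = r n ^ j * r n ^ (K - j)" by (simp flip: power_add)
            then show "V j (dil p q (r n) (line s)) / r n ^ K = V j (line s) * inverse (r n) ^ (K - j)"
              using r0[of n] by (simp add: qhomD[OF qdec_qhom[OF V]] field_simps)
          qed
          also have "\<dots> = (\<Sum>j<K. V j (line s) * inverse (r n) ^ (K - j)) + V K (line s)"
            by (simp add: lessThan_Suc_atMost[symmetric])
          finally have "dist (A (dil p q (r n) (line s)) / r n ^ K) (V K (line s)) =
             norm (\<Sum>j<K. V j (line s) * inverse (r n) ^ (K - j))" by (simp add: dist_norm)
          also have "\<dots> \<le> (\<Sum>j<K. \<bar>B\<bar> * norm (inverse (r n) ^ (K - j)))"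
          proof (rule sum_norm_le)
            fix j assume "j \<in> {..<K}"
            then have "norm (V j (line s)) \<le> \<bar>B\<bar>" using B[of j s] s by simp
            then show "norm (V j (line s) * inverse (r n) ^ (K - j)) \<le> \<bar>B\<bar> * norm (inverse (r n) ^ (K - j))"
              by (simp add: norm_mult mult_right_mono)
          qed
          also have "\<dots> < e" by (rule elim)
          finally show "dist (A (dil p q (r n) (line s)) / r n ^ K) (V K (line s)) < e" .
        qed
      qed
    qed
    have "V K (line 0) \<noteq> 0"
    proof (rule Hurwitz_no_zeros[of "ball 0 d" "\<lambda>n s. A (dil p q (r n) (line s)) / r n ^ K" "\<lambda>s. V K (line s)" 0])
      show "(\<lambda>s. A (dil p q (r n) (line s)) / r n ^ K) holomorphic_on ball 0 d" for n
      proof -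
        have "bipoly (\<lambda>z. A (r n ^ p * fst z, r n ^ q * snd z))"
          by (rule bipoly_compose[OF qdec_bipoly'[OF V] bipoly_mult[OF bipoly_const bipoly_fst] bipoly_mult[OF bipoly_const bipoly_snd]])
        from holl[OF this] show ?thesis unfolding dil_def using r0[of n] by (intro holomorphic_on_divide holomorphic_on_const) auto
      qed
      show "(\<lambda>s. V K (line s)) holomorphic_on ball 0 d" by (rule holl[OF qdec_bipoly[OF V]])
      show "\<not> (\<lambda>s. V K (line s)) constant_on ball 0 d"
      proof
        assume "(\<lambda>s. V K (line s)) constant_on ball 0 d"
        then have zero: "V K (line s) = 0" if "s \<in> ball 0 d" for s
          using that d(1) z0 line(1) unfolding constant_on_def by (metis centre_in_ball)
        have "\<exists>P. \<forall>s. V K (line s) = poly P s"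
          unfolding line_def by (rule bipoly_line_poly[OF qdec_bipoly[OF V]])
        then obtain P where P: "\<And>s. V K (line s) = poly P s" by blast
        have "P = 0" by (rule poly_infinite_zeros[of "ball 0 d"]) (use zero P d(1) in \<open>auto simp: uncountable_infinite uncountable_ball\<close>)
        then show False using P[of 1] z1 line(2) by simp
      qed
      show "A (dil p q (r n) (line s)) / r n ^ K \<noteq> 0" if "s \<in> ball 0 d" for n s
      proof -
        have "dist (line s) z0 < e" using d(2)[of s] that by (simp add: dist_commute)
        moreover have "m \<le> n + Suc m" by simp
        ultimately have "A (dil p q (of_nat (n + Suc m)) (line s)) \<noteq> 0" using no by blast
        then show ?thesis using r0 by (simp add: r_def)
      qed
    qed (use d ul in auto)
    then show False using z0 line by simp
  qed
  have "\<exists>n \<zeta>. n \<ge> k \<and> dist \<zeta> z0 < inverse (real (Suc k)) \<and> A (dil p q (of_nat n) \<zeta>) = 0" for k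
    using key[of "inverse (real (Suc k))" k] by auto
  then obtain n \<zeta> where n: "\<And>k. n k \<ge> k" and \<zeta>: "\<And>k. dist (\<zeta> k) z0 < inverse (real (Suc k))"
    and A: "\<And>k. A (dil p q (of_nat (n k)) (\<zeta> k)) = 0" by metis
  have "filterlim n at_top sequentially" by (rule filterlim_at_top_mono[OF filterlim_ident]) (use n in auto)
  moreover have "\<zeta> \<longlonglongrightarrow> z0"
    by (rule metric_tendsto_imp_tendsto[OF LIMSEQ_inverse_real_of_nat])
       (use \<zeta> in \<open>auto simp: less_imp_le dist_real_def\<close>)
  ultimately show ?thesis using A by blast
qed

subsection \<open>Asymptotics of the level curves of an automorphism\<close>

text \<open>The zero set of \<open>det (d, \<phi>)\<close> is the curve \<open>t \<mapsto> \<phi>\<^sup>-\<^sup>1 (t d)\<close>. So every zero of a leading part of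
  \<open>det (d, \<phi>)\<close> is approached by rescaled points of this curve, with parameters tending to infinity.\<close>

lemma curve_points:
  assumes ap: "autpair \<phi> \<phi>i" and d: "d \<noteq> 0"
    and V: "qdec p q K (\<lambda>z. dt d (\<phi> z)) V" "V K z1 \<noteq> 0" "V K z0 = 0" "z0 \<noteq> 0" and pq: "p \<ge> 1" "q \<ge> 1"
  obtains n \<zeta> t where "filterlim n at_top sequentially" "\<zeta> \<longlonglongrightarrow> z0"
    "filterlim t at_infinity sequentially" "\<And>k. dil p q (of_nat (n k)) (\<zeta> k) = \<phi>i (cs (t k) d)"
proof -
  obtain n \<zeta> where n: "filterlim n at_top sequentially" and \<zeta>: "\<zeta> \<longlonglongrightarrow> z0"
    and z: "\<And>k. dt d (\<phi> (dil p q (of_nat (n k)) (\<zeta> k))) = 0"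
    using asymptotic_zeros[OF V(1-3)] by blast
  define D where "D = (\<lambda>k. dil p q (of_nat (n k)) (\<zeta> k))"
  have "\<exists>t. \<phi> (D k) = cs t d" for k using dt_0D[OF z d] unfolding D_def .
  then obtain t where t: "\<And>k. \<phi> (D k) = cs (t k) d" by metis
  have D: "D k = \<phi>i (cs (t k) d)" for k by (metis t autpairD(2)[OF ap])
  have Dinf: "filterlim (\<lambda>k. norm (D k)) at_top sequentially"
  proof -
    have rn: "filterlim (\<lambda>k. real (n k) ^ j) at_top sequentially" if "j \<ge> 1" for j
      by (rule filterlim_pow_at_top[OF _ filterlim_compose[OF filterlim_real_sequentially n]]) (use that in auto)
    consider "fst z0 \<noteq> 0" | "snd z0 \<noteq> 0" using V(4) by (auto simp: prod_eq_iff)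
    then show ?thesis
    proof cases
      case 1
      have "filterlim (\<lambda>k. norm (fst (\<zeta> k)) * real (n k) ^ p) at_top sequentially"
        by (rule filterlim_tendsto_pos_mult_at_top[OF tendsto_norm[OF tendsto_fst[OF \<zeta>]]]) (use 1 pq in \<open>auto intro: rn\<close>)
      moreover have "norm (fst (\<zeta> k)) * real (n k) ^ p \<le> norm (D k)" for k
        using norm_fst_le[of "fst (D k)" "snd (D k)"] by (simp add: D_def dil_def norm_mult norm_power mult.commute)
      ultimately show ?thesis using filterlim_at_top_mono by fastforce
    next
      case 2
      have "filterlim (\<lambda>k. norm (snd (\<zeta> k)) * real (n k) ^ q) at_top sequentially"
        by (rule filterlim_tendsto_pos_mult_at_top[OF tendsto_norm[OF tendsto_snd[OF \<zeta>]]]) (use 2 pq in \<open>auto intro: rn\<close>)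
      moreover have "norm (snd (\<zeta> k)) * real (n k) ^ q \<le> norm (D k)" for k
        using norm_snd_le[of "snd (D k)" "fst (D k)"] by (simp add: D_def dil_def norm_mult norm_power mult.commute)
      ultimately show ?thesis using filterlim_at_top_mono by fastforce
    qed
  qed
  have "filterlim t at_infinity sequentially"
    unfolding filterlim_at_infinity[OF order_refl]
  proof (intro allI impI)
    fix R :: real
    have "continuous_on (cball 0 R) (\<lambda>t. \<phi>i (cs t d))"
      by (rule continuous_on_compose2[OF continuous_on_polymap[OF autpairD(4)[OF ap], of UNIV]])
         (auto simp: cs_def intro!: continuous_intros)
    then have "compact ((\<lambda>t. \<phi>i (cs t d)) ` cball 0 R)" by (rule compact_continuous_image) auto
    then obtain C where C: "\<And>s. norm s \<le> R \<Longrightarrow> norm (\<phi>i (cs s d)) \<le> C"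
      by (meson bounded_iff compact_imp_bounded imageI mem_cball_0)
    have "eventually (\<lambda>k. norm (D k) > C) sequentially" using Dinf unfolding filterlim_at_top_dense by blast
    then show "eventually (\<lambda>k. R \<le> norm (t k)) sequentially"
    proof eventually_elim
      case (elim k)
      then show ?case using C[of "t k"] D[of k] by (cases "norm (t k) \<le> R") auto
    qed
  qed
  then show ?thesis using that n \<zeta> D unfolding D_def by blast
qed

text \<open>The zeros of the top form of \<open>\<phi>\<close> lie on the single line to which \<open>\<phi>\<^sup>-\<^sup>1\<close> contracts the line
  at infinity: the zero set of \<open>det (d, \<phi>)\<close>, for a vector \<open>d\<close> at which the top form of \<open>\<phi>\<^sup>-\<^sup>1\<close> does not
  vanish, is a line parametrized by polynomials and has only one point at infinity.\<close>

lemma top_form_zeros: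
  assumes ap: "autpair \<phi> \<phi>i"
    and T: "mtop N \<phi> T" "\<And>z. T z = cs (H z) v" "H z1 \<noteq> 0" "v \<noteq> 0" "N \<ge> 1"
    and U: "mtop M \<phi>i U" "\<And>z. U z = cs (H' z) v'" "H' d \<noteq> 0" "qhom 1 1 M H'" "v' \<noteq> 0" "N * M \<ge> 2" "M \<ge> 1"
    and z: "H z = 0" "z \<noteq> 0"
  shows "dt v' z = 0"
proof -
  have H'v: "H' v = 0"
  proof -
    have "U (T z1) = 0" by (rule top_annihilates[OF ap T(1) U(1) T(5) U(6)])
    then have "H' (cs (H z1) v) = 0" using U(5) by (simp add: U(2) T(2))
    then show ?thesis using T(3) by (simp add: qhom_cs[OF U(4) U(7), simplified])
  qed
  have H'0: "H' 0 = 0" by (rule qhom_0[OF U(4) U(7)])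
  have d0: "d \<noteq> 0" using U(3) H'0 by auto
  have dv: "dt d v \<noteq> 0"
  proof
    assume "dt d v = 0"
    then obtain c where "v = cs c d" using dt_0D d0 by blast
    then have "H' v = c ^ M * H' d" by (simp add: qhom_cs[OF U(4) U(7), simplified])
    then show False using H'v U(3) T(4) \<open>v = cs c d\<close> by auto
  qed
  have bip: "bipoly (\<lambda>z. dt d (\<phi> z))" unfolding dt_def
    using autpairD(3)[OF ap] by (intro bipoly_diff bipoly_mult bipoly_const) (auto simp: polymap_iff_bipoly)
  have lim: "(\<lambda>n. dt d (\<phi> (dil 1 1 (of_nat n) z)) / of_nat n ^ N) \<longlonglongrightarrow> dt d (T z)" for z
    using tendsto_diff[OF tendsto_mult[OF tendsto_const[of "fst d"] mtop_tendsto(2)[OF T(1) of_nat_at_infinity tendsto_const[of z]]]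
       tendsto_mult[OF tendsto_const[of "snd d"] mtop_tendsto(1)[OF T(1) of_nat_at_infinity tendsto_const[of z]]]]
    by (simp add: dt_def diff_divide_distrib dil_1_1[unfolded One_nat_def])
  obtain V where V: "qdec 1 1 N (\<lambda>z. dt d (\<phi> z)) V" "V N = (\<lambda>z. dt d (T z))"
    using growth_qdec[OF bip lim] by blast
  have V1: "V N z1 \<noteq> 0" "V N z = 0" using T(2,3) dv z by (auto simp: V(2))
  obtain n \<zeta> t where n: "filterlim n at_top sequentially" "\<zeta> \<longlonglongrightarrow> z"
    "filterlim t at_infinity sequentially" "\<And>k. dil 1 1 (of_nat (n k)) (\<zeta> k) = \<phi>i (cs (t k) d)"
    using curve_points[OF ap d0 V(1) V1 z(2) order_refl order_refl] by blast
  have "(\<lambda>k. fst (\<phi>i (cs (t k) d)) / t k ^ M * snd (\<zeta> k) - snd (\<phi>i (cs (t k) d)) / t k ^ M * fst (\<zeta> k))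
     \<longlonglongrightarrow> fst (U d) * snd z - snd (U d) * fst z"
    by (intro tendsto_intros mtop_tendsto[OF U(1) n(3)] n(2))
  moreover have "(\<lambda>k. fst (\<phi>i (cs (t k) d)) / t k ^ M * snd (\<zeta> k) - snd (\<phi>i (cs (t k) d)) / t k ^ M * fst (\<zeta> k)) = (\<lambda>k. 0)"
    unfolding n(4)[symmetric] by (simp add: dil_def fun_eq_iff)
  ultimately have "dt (U d) z = 0" by (simp add: dt_def LIMSEQ_const_iff)
  then show ?thesis using U(3) by (simp add: U(2))
qed

lemma hom_one_zero:
  assumes H: "qhom 1 1 N H" "N \<ge> 1" and z: "\<And>z. H z = 0 \<Longrightarrow> z \<noteq> 0 \<Longrightarrow> snd z = 0"
  shows "H z = H (0, 1) * snd z ^ N"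
proof -
  have c: "H (x, 1) = H (0, 1)" for x
  proof -
    have "\<exists>P. \<forall>s. H (0 + s * 1, 1 + s * 0) = poly P s" by (rule bipoly_line_poly[OF qhom_bipoly[OF H(1)]])
    then obtain P where P: "\<And>s. H (s, 1) = poly P s" by auto
    have "poly P s \<noteq> 0" for s unfolding P[symmetric] using z[of "(s, 1)"] by (auto simp: prod_eq_iff)
    then have "constant (poly P)" using Fundamental_Theorem_Algebra.fundamental_theorem_of_algebra[of P] by auto
    then have "poly P x = poly P 0" unfolding constant_def by blast
    then show ?thesis by (simp only: P)
  qed
  have nz: "H (x, y) = H (0, 1) * y ^ N" if "y \<noteq> 0" for x y
  proof -
    have "(x, y) = cs y (x / y, 1)" using that by (simp add: cs_def)
    then have "H (x, y) = y ^ N * H (x / y, 1)" using qhom_cs[OF H(1,2)] by (metis One_nat_def)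
    then show ?thesis using c[of "x / y"] by simp
  qed
  have "\<exists>P. \<forall>s. H (fst z + s * 0, 0 + s * 1) = poly P s" by (rule bipoly_line_poly[OF qhom_bipoly[OF H(1)]])
  then obtain P where P: "\<And>s. H (fst z, s) = poly P s" by auto
  have "P - monom (H (0, 1)) N = 0"
  proof (rule poly_infinite_zeros)
    show "infinite (- {0 :: complex})" by (simp add: finite_compl infinite_UNIV_char_0)
    fix s :: complex assume "s \<in> - {0}"
    then have "poly P s = H (0, 1) * s ^ N" using nz[of s "fst z"] unfolding P[symmetric] by blast
    then show "poly (P - monom (H (0, 1)) N) s = 0" by (simp only: poly_diff poly_monom) simp
  qed
  then have "poly P s - H (0, 1) * s ^ N = 0" for s by (metis poly_0 poly_diff poly_monom)
  then have "poly P (snd z) = H (0, 1) * snd z ^ N" by (simp only: right_minus_eq)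
  then show ?thesis unfolding P[symmetric] by simp
qed

lemma poly_one_root:
  fixes R :: "complex poly"
  assumes "R \<noteq> 0" "\<And>y. poly R y = 0 \<Longrightarrow> y = c"
  shows "R = smult (lead_coeff R) ([:-c, 1:] ^ degree R)"
proof -
  have *: "R = smult (lead_coeff R) ([:-c, 1:] ^ order c R)"
  proof (cases "poly R c = 0")
    case True
    then have eq: "{z. poly R z = 0} = {c}" using assms(2) by blast
    have "smult (lead_coeff R) (\<Prod>z\<in>{c}. [:-z, 1:] ^ order z R) = R"
      using complex_poly_decompose[of R] unfolding eq .
    then have "R = smult (lead_coeff R) (\<Prod>z\<in>{c}. [:-z, 1:] ^ order z R)" by (rule sym)
    also have "(\<Prod>z\<in>{c}. [:-z, 1:] ^ order z R) = [:-c, 1:] ^ order c R" by simp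
    finally show ?thesis .
  next
    case False
    then have eq: "{z. poly R z = 0} = {}" using assms(2) by blast
    have "smult (lead_coeff R) (\<Prod>z\<in>{}. [:-z, 1:] ^ order z R) = R"
      using complex_poly_decompose[of R] unfolding eq .
    then have "R = smult (lead_coeff R) (\<Prod>z\<in>{}. [:-z, 1:] ^ order z R)" by (rule sym)
    also have "(\<Prod>z\<in>{}. [:-z, 1:] ^ order z R) = [:-c, 1:] ^ order c R" using False by (simp add: order_0I)
    finally show ?thesis .
  qed
  then have "degree R = degree ([:-c, 1:] ^ order c R)"
    using assms(1) by (metis degree_smult_eq leading_coeff_0_iff)
  then have "degree R = order c R" by (simp add: degree_linear_power)
  then show ?thesis using * by simp
qed

lemma complex_root_exists: "n \<ge> 1 \<Longrightarrow> \<exists>r::complex. r ^ n = z"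
proof -
  assume n: "n \<ge> 1"
  have "\<not> constant (poly (monom 1 n - [:z:]))"
  proof
    assume "constant (poly (monom 1 n - [:z:]))"
    then have "poly (monom 1 n - [:z:]) 1 = poly (monom 1 n - [:z:]) 0" unfolding constant_def by blast
    then show False using n by (simp add: poly_monom power_0_left)
  qed
  then obtain r where "poly (monom 1 n - [:z:]) r = 0"
    using Fundamental_Theorem_Algebra.fundamental_theorem_of_algebra by blast
  then show ?thesis by (auto simp: poly_monom)
qed

text \<open>Let \<open>A\<close> have the ordinary top form \<open>\<eta> y\<^sup>N\<close>. If its leading part for the weights \<open>(p, q)\<close> vanishes,
  outside the origin, only on the curve \<open>y\<^sup>p = c x\<^sup>q\<close>, then this part is \<open>\<eta>\<close> times a power of
  \<open>y\<^sup>p - c x\<^sup>q\<close> and has weight \<open>q N\<close>.\<close>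

lemma weighted_form:
  assumes W: "qdec 1 1 N A W" "\<And>z. W N z = \<eta> * snd z ^ N" "\<eta> \<noteq> 0" "N \<ge> 1"
    and pq: "p \<ge> 1" "q \<ge> 1" "coprime p q" and c: "c \<noteq> 0"
    and zeros: "\<And>K V z0 z1. qdec p q K A V \<Longrightarrow> V K z1 \<noteq> 0 \<Longrightarrow> V K z0 = 0 \<Longrightarrow> z0 \<noteq> 0 \<Longrightarrow> snd z0 ^ p = c * fst z0 ^ q"
  shows "\<exists>V k. qdec p q (q * N) A V \<and> N = p * k \<and> (\<forall>z. V (q * N) z = \<eta> * (snd z ^ p - c * fst z ^ q) ^ k)"
proof -
  have bA: "bipoly A" by (rule qdec_bipoly'[OF W(1)])
  have "\<exists>z0. A z0 \<noteq> 0"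
  proof (rule ccontr)
    assume "\<not> ?thesis"
    then have "(\<lambda>n. A (dil 1 1 (of_nat n) (0, 1)) / of_nat n ^ N) = (\<lambda>_. 0)" by auto
    then show False using qdec_tendsto[OF W(1) of_nat_at_infinity tendsto_const[of "(0, 1)"]] W(3)
      by (simp add: W(2) LIMSEQ_const_iff)
  qed
  then obtain z0 where "A z0 \<noteq> 0" by blast
  then obtain K W' z1 where W': "qdec p q K A W'" "W' K z1 \<noteq> 0" using qdec_leading_exists[OF bA] by blast
  obtain K0 S a where S: "finite S"
    and V0: "qdec p q K0 A (\<lambda>m z. \<Sum>t\<in>{t\<in>S. p * fst t + q * snd t = m}. a t * mono2 t z)"
    using bipoly_qdec_monomials[OF bA] by blast
  define V where "V = (\<lambda>m z. \<Sum>t\<in>{t\<in>S. p * fst t + q * snd t = m}. a t * mono2 t z)"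
  note lim = qdec_tendsto[OF W'(1) of_nat_at_infinity tendsto_const]
  have VW: "V K = W' K" using qdec_lower(2)[OF V0 lim] unfolding V_def .
  have V: "qdec p q K A V" using qdec_lower(1)[OF V0 lim] unfolding V_def .
  have V1: "V K z1 \<noteq> 0" using W'(2) unfolding VW .
  have Vz: "snd z ^ p = c * fst z ^ q" if "V K z = 0" "z \<noteq> 0" for z
    using zeros[OF V V1 that] .
  have V01: "V K (0, 1) \<noteq> 0" using Vz[of "(0, 1)"] pq by (auto simp: prod_eq_iff power_0_left)
  have V10: "V K (1, 0) \<noteq> 0" using Vz[of "(1, 0)"] pq c by (auto simp: prod_eq_iff power_0_left)
  have l1: "(\<lambda>n. A (0, of_nat n ^ q) / of_nat n ^ K) \<longlonglongrightarrow> V K (0, 1)"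
    using qdec_tendsto[OF V(1) of_nat_at_infinity tendsto_const[of "(0, 1)"]] by (simp add: dil_def)
  have l2: "(\<lambda>n. A (0, of_nat n ^ q) / of_nat n ^ (q * N)) \<longlonglongrightarrow> \<eta>"
    using qdec_tendsto[OF W(1) of_nat_power_at_infinity[OF pq(2)] tendsto_const[of "(0, 1)"]]
    by (simp add: dil_def W(2) power_mult)
  have split: "(\<lambda>n. x n / of_nat n ^ m * (1 / of_nat n ^ (l - m))) = (\<lambda>n. x n / of_nat n ^ l)" if "m \<le> l" for x :: "nat \<Rightarrow> complex" and m l
    using that by (auto simp flip: power_add)
  have K: "K = q * N"
  proof (rule ccontr)
    assume "K \<noteq> q * N"
    then consider "K < q * N" | "q * N < K" by linarith
    then show False
    proof cases
      case 1
      have "(\<lambda>n. A (0, of_nat n ^ q) / of_nat n ^ (q * N)) \<longlonglongrightarrow> V K (0, 1) * 0"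
        unfolding split[OF less_imp_le[OF 1], symmetric]
        by (rule tendsto_mult[OF l1 tendsto_inverse_power_nat]) (use 1 in auto)
      then show False using LIMSEQ_unique[OF l2] W(3) by fastforce
    next
      case 2
      have "(\<lambda>n. A (0, of_nat n ^ q) / of_nat n ^ K) \<longlonglongrightarrow> \<eta> * 0"
        unfolding split[OF less_imp_le[OF 2], symmetric]
        by (rule tendsto_mult[OF l2 tendsto_inverse_power_nat]) (use 2 in auto)
      then show False using LIMSEQ_unique[OF l1] V01 by fastforce
    qed
  qed
  have \<eta>: "V K (0, 1) = \<eta>" using LIMSEQ_unique[OF l1] l2 K by auto
  define B where "B = {t\<in>S. p * fst t + q * snd t = K}"
  have B: "finite B" using S by (simp add: B_def)
  have VB: "V K z = (\<Sum>t\<in>B. a t * mono2 t z)" for z by (simp add: V_def B_def)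
  have Bt: "snd t \<le> N" "p dvd N - snd t" "snd t = N \<longleftrightarrow> fst t = 0" if "t \<in> B" for t
  proof -
    have e: "p * fst t + q * snd t = q * N" using that K by (simp add: B_def)
    then have "q * snd t \<le> q * N" by linarith
    then show le: "snd t \<le> N" using pq by simp
    have e': "p * fst t = q * (N - snd t)" using e le by (simp add: diff_mult_distrib2)
    then have "p dvd q * (N - snd t)" by (metis dvd_triv_left)
    then show "p dvd N - snd t" using pq(3) coprime_dvd_mult_right_iff by blast
    show "snd t = N \<longleftrightarrow> fst t = 0" using e' le pq by auto
  qed
  have pN: "p dvd N"
  proof -
    have "\<exists>t\<in>B. snd t = 0"
    proof (rule ccontr)
      assume "\<not> ?thesis"
      then have "V K (1, 0) = 0" unfolding VB by (intro sum.neutral) (auto simp: mono2_def)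
      then show False using V10 by simp
    qed
    then show ?thesis using Bt(2) by fastforce
  qed
  then obtain k where k: "N = p * k" by blast
  have pt: "p dvd snd t" if "t \<in> B" for t
    using Bt(1,2)[OF that] pN by (metis dvd_diffD1)
  \<comment> \<open>On \<open>x = 1\<close> the leading part is a polynomial \<open>R\<close> in \<open>y\<^sup>p\<close>, and \<open>c\<close> is the only root of \<open>R\<close>.\<close>
  define R where "R = (\<Sum>t\<in>B. monom (a t) (snd t div p))"
  have R: "poly R (y ^ p) = V K (1, y)" for y
    unfolding R_def VB poly_sum
  proof (rule sum.cong[OF refl])
    fix t assume "t \<in> B"
    then have "(y ^ p) ^ (snd t div p) = y ^ snd t" using pt by (simp flip: power_mult)
    then show "poly (monom (a t) (snd t div p)) (y ^ p) = a t * mono2 t (1, y)"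
      by (simp add: poly_monom mono2_def)
  qed
  have "poly R (0 ^ p) \<noteq> 0" unfolding R using V10 by simp
  then have R0: "R \<noteq> 0" by auto
  have Rroot: "y = c" if "poly R y = 0" for y
  proof -
    obtain r where "r ^ p = y" using complex_root_exists pq(1) by blast
    then show ?thesis using Vz[of "(1, r)"] R[of r] that by (auto simp: prod_eq_iff)
  qed
  have "coeff R k = (\<Sum>t\<in>B. if snd t div p = k then a t else 0)"
    unfolding R_def coeff_sum by (auto intro!: sum.cong)
  also have "\<dots> = (\<Sum>t\<in>B. a t * mono2 t (0, 1))"
  proof (rule sum.cong[OF refl])
    fix t assume t: "t \<in> B"
    have "snd t div p = k \<longleftrightarrow> snd t = N" using pt[OF t] k pq by auto
    then show "(if snd t div p = k then a t else 0) = a t * mono2 t (0, 1)"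
      using Bt(3)[OF t] by (simp add: mono2_def)
  qed
  finally have ck: "coeff R k = \<eta>" using \<eta> VB by simp
  have "coeff R j = 0" if "j > k" for j
  proof -
    have "snd t div p \<noteq> j" if "t \<in> B" for t
      using Bt(1)[OF that] k \<open>j > k\<close> pq by (metis div_le_mono nonzero_mult_div_cancel_left not_less not_one_le_zero)
    then show ?thesis unfolding R_def coeff_sum by (auto intro!: sum.neutral)
  qed
  then have "degree R \<le> k" by (intro degree_le) auto
  then have dk: "degree R = k" using ck W(3) by (metis le_antisym le_degree)
  have Ry: "poly R y = \<eta> * (y - c) ^ k" for y
    using arg_cong[OF poly_one_root[OF R0 Rroot], of "\<lambda>P. poly P y"] by (simp add: dk ck)
  have k1: "k \<ge> 1" using k W(4) by (cases k) auto
  have form: "V K z = \<eta> * (snd z ^ p - c * fst z ^ q) ^ k" for z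
  proof (cases "fst z = 0")
    case True
    show ?thesis
    proof (cases "snd z = 0")
      case s0: True
      then have "z = 0" using True by (simp add: prod_eq_iff)
      moreover have "V K 0 = 0" by (rule qhom_0[OF qdec_qhom[OF V(1)]]) (use K pq W(4) in auto)
      ultimately show ?thesis using k1 pq by (simp add: power_0_left)
    next
      case False
      obtain r where r: "r ^ q = snd z" using complex_root_exists pq(2) by blast
      then have "r \<noteq> 0" using False pq by (auto simp: power_0_left)
      moreover have "z = dil p q r (0, 1)" using True r by (simp add: dil_def prod_eq_iff)
      ultimately have "V K z = r ^ (q * N) * \<eta>" using qhomD[OF qdec_qhom[OF V(1)]] \<eta> K by metis
      also have "r ^ (q * N) = (snd z ^ p) ^ k" by (simp add: power_mult r k)
      finally show ?thesis using True pq by (simp add: power_0_left)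
    qed
  next
    case False
    obtain r where r: "r ^ p = fst z" using complex_root_exists pq(1) by blast
    then have r0: "r \<noteq> 0" using False pq by (auto simp: power_0_left)
    moreover have "z = dil p q r (1, snd z / r ^ q)" using r0 r by (simp add: dil_def prod_eq_iff)
    ultimately have "V K z = r ^ K * V K (1, snd z / r ^ q)" using qhomD[OF qdec_qhom[OF V(1)]] by metis
    also have "V K (1, snd z / r ^ q) = \<eta> * ((snd z / r ^ q) ^ p - c) ^ k" by (simp add: R[symmetric] Ry)
    also have "r ^ K = ((r ^ q) ^ p) ^ k" by (simp add: K k power_mult)
    also have "((r ^ q) ^ p) ^ k * (\<eta> * ((snd z / r ^ q) ^ p - c) ^ k) = \<eta> * ((r ^ q) ^ p * ((snd z / r ^ q) ^ p - c)) ^ k"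
      by (simp add: power_mult_distrib)
    also have "(r ^ q) ^ p * ((snd z / r ^ q) ^ p - c) = snd z ^ p - c * (r ^ q) ^ p"
      using r0 by (simp add: power_divide right_diff_distrib)
    also have "(r ^ q) ^ p = fst z ^ q" by (simp add: r[symmetric] mult.commute flip: power_mult)
    finally show ?thesis .
  qed
  show ?thesis using V k form unfolding K by blast
qed

subsection \<open>Local nilpotency\<close>

lemma dx_compose:
  assumes "bipoly P" "bipoly A" "bipoly B"
  shows "dx (\<lambda>z. P (A z, B z)) z = dx P (A z, B z) * dx A z + dy P (A z, B z) * dx B z"
  using assms(1)
proof induction
  case (bipoly_add f g)
  have "bipoly (\<lambda>z. f (A z, B z))" "bipoly (\<lambda>z. g (A z, B z))"
    using bipoly_add assms by (auto intro: bipoly_compose)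
  then show ?case using bipoly_add by (simp add: dx_add dy_add algebra_simps)
next
  case (bipoly_mult f g)
  have "bipoly (\<lambda>z. f (A z, B z))" "bipoly (\<lambda>z. g (A z, B z))"
    using bipoly_mult assms by (auto intro: bipoly_compose)
  then show ?case using bipoly_mult by (simp add: dx_mult dy_mult algebra_simps)
qed simp_all

text \<open>The Jacobian determinant of an automorphism has no zeros, hence is constant.\<close>

lemma jacobian_const:
  assumes ap: "autpair \<phi> \<phi>i"
  shows "jac (\<lambda>z. fst (\<phi> z)) (\<lambda>z. snd (\<phi> z)) z = jac (\<lambda>z. fst (\<phi> z)) (\<lambda>z. snd (\<phi> z)) w"
proof (rule bipoly_no_zeros_const)
  let ?A = "\<lambda>z. fst (\<phi> z)" and ?B = "\<lambda>z. snd (\<phi> z)"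
  have b: "bipoly ?A" "bipoly ?B" "bipoly (\<lambda>z. fst (\<phi>i z))" "bipoly (\<lambda>z. snd (\<phi>i z))"
    using autpairD(3,4)[OF ap] by (auto simp: polymap_iff_bipoly)
  show "bipoly (jac ?A ?B)" by (rule bipoly_jac[OF b(1,2)])
  fix z
  show "jac ?A ?B z \<noteq> 0"
  proof
    assume 0: "jac ?A ?B z = 0"
    have "jac ?A (\<lambda>z. fst (\<phi>i (?A z, ?B z))) z = 0" "jac ?A (\<lambda>z. snd (\<phi>i (?A z, ?B z))) z = 0"
      by (simp_all only: jac_compose[OF b(3) b(1,2)] jac_compose[OF b(4) b(1,2)] 0 mult_zero_left)
    then have "dx ?A z = 0" "dy ?A z = 0" by (simp_all add: autpairD[OF ap] jac_def)
    moreover have "dx (\<lambda>w. ?A (fst (\<phi>i w), snd (\<phi>i w))) (\<phi> z) = dx ?A z * dx (\<lambda>z. fst (\<phi>i z)) (\<phi> z) + dy ?A z * dx (\<lambda>z. snd (\<phi>i z)) (\<phi> z)"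
      using dx_compose[OF b(1) b(3,4), of "\<phi> z"] by (simp add: autpairD[OF ap])
    moreover have "(\<lambda>w. ?A (fst (\<phi>i w), snd (\<phi>i w))) = fst" by (auto simp: autpairD[OF ap])
    ultimately show False by simp
  qed
qed

text \<open>In the coordinates given by the automorphism, the derivation \<open>jac A\<close> of its first component is a
  constant multiple of \<open>\<partial>\<^sub>y\<close>.\<close>

lemma jac_iterate_compose:
  assumes ap: "autpair \<phi> \<phi>i" and P: "bipoly P"
  defines "A \<equiv> \<lambda>z. fst (\<phi> z)" and "B \<equiv> \<lambda>z. snd (\<phi> z)"
  shows "(jac A ^^ n) (\<lambda>z. P (\<phi> z)) = (\<lambda>z. jac A B 0 ^ n * (dy ^^ n) P (\<phi> z))"
proof (induction n)
  case (Suc n)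
  have b: "bipoly A" "bipoly B"
    using autpairD(3)[OF ap] by (auto simp: polymap_iff_bipoly A_def B_def)
  have bn: "bipoly ((dy ^^ n) P)" by (induction n) (auto intro: bipoly_dy P)
  have bc: "bipoly (\<lambda>z. (dy ^^ n) P (A z, B z))" by (rule bipoly_compose[OF bn b])
  have AB: "(A z, B z) = \<phi> z" for z by (simp add: A_def B_def)
  have J: "jac A B z = jac A B 0" for z unfolding A_def B_def by (rule jacobian_const[OF ap])
  have "jac A (\<lambda>z. jac A B 0 ^ n * (dy ^^ n) P (A z, B z)) z = jac A B 0 ^ Suc n * (dy ^^ Suc n) P (\<phi> z)" for z
    using jac_mult[OF bipoly_const bc, of A "jac A B 0 ^ n" z] jac_compose[OF bn b, of z] J[of z] by (simp add: AB)
  then show ?case by (simp add: Suc AB fun_eq_iff)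
qed simp

lemma jac_nilpotent:
  assumes ap: "autpair \<phi> \<phi>i"
  shows "\<exists>n. \<forall>z. (jac (\<lambda>z. fst (\<phi> z)) ^^ n) fst z = 0"
proof -
  have b: "bipoly (\<lambda>z. fst (\<phi>i z))" using autpairD(4)[OF ap] by (auto simp: polymap_iff_bipoly)
  obtain n where n: "\<And>z. (dy ^^ n) (\<lambda>z. fst (\<phi>i z)) z = 0" using dy_nilpotent[OF b] by blast
  have "(\<lambda>z. fst (\<phi>i (\<phi> z))) = fst" by (auto simp: autpairD[OF ap])
  then show ?thesis using jac_iterate_compose[OF ap b, of n] n by (intro exI[of _ n]) simp
qed

text \<open>The leading part of a locally nilpotent derivation is locally nilpotent.\<close>

lemma jac_leading_iterate:
  assumes V: "qdec p q K A V" "K \<ge> p + q"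
  shows "\<exists>L W. qdec p q L ((jac A ^^ n) fst) W \<and> W L = (jac (V K) ^^ n) fst"
proof (induction n)
  case 0
  have b: "bipoly fst" using bipoly_fst by simp
  have lim: "(\<lambda>n. fst (dil p q (of_nat n) z) / of_nat n ^ p) \<longlonglongrightarrow> fst z" for z
    by (rule Lim_transform_eventually[OF tendsto_const])
       (use eventually_gt_at_top[of 0] in eventually_elim, simp add: dil_def)
  show ?case using growth_qdec[OF b lim] by auto
next
  case (Suc n)
  then obtain L W where W: "qdec p q L ((jac A ^^ n) fst) W" "W L = (jac (V K) ^^ n) fst" by blast
  have b: "bipoly (jac A ((jac A ^^ n) fst))"
    by (rule bipoly_jac[OF qdec_bipoly'[OF V(1)] qdec_bipoly'[OF W(1)]])
  have lim: "(\<lambda>m. jac A ((jac A ^^ n) fst) (dil p q (of_nat m) z) / of_nat m ^ (K + L - (p + q))) \<longlonglongrightarrow> jac (V K) (W L) z" for z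
  proof (rule Lim_transform_eventually[OF jac_tendsto[OF V(1) W(1), of z]])
    show "\<forall>\<^sub>F m in sequentially. of_nat m ^ (p + q) * jac A ((jac A ^^ n) fst) (dil p q (of_nat m) z) / of_nat m ^ (K + L) =
        jac A ((jac A ^^ n) fst) (dil p q (of_nat m) z) / of_nat m ^ (K + L - (p + q))"
      using eventually_gt_at_top[of 0]
    proof eventually_elim
      case (elim m)
      have "(of_nat m :: complex) ^ (K + L) = of_nat m ^ (p + q) * of_nat m ^ (K + L - (p + q))"
        using V(2) by (simp flip: power_add)
      then show ?case using elim by simp
    qed
  qed
  show ?case using growth_qdec[OF b lim] W(2) by auto
qed

lemma jac_nilpotent_leading:
  assumes "qdec p q K A V" "K \<ge> p + q" "\<And>z. (jac A ^^ n) fst z = 0"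
  shows "(jac (V K) ^^ n) fst z = 0"
proof -
  obtain L W where W: "qdec p q L ((jac A ^^ n) fst) W" "W L = (jac (V K) ^^ n) fst"
    using jac_leading_iterate[OF assms(1,2)] by blast
  have "(\<lambda>m. 0) \<longlonglongrightarrow> W L z"
    using qdec_tendsto[OF W(1) of_nat_at_infinity tendsto_const[of z]] by (simp add: assms(3))
  then show ?thesis using W(2) by (simp add: LIMSEQ_const_iff)
qed

lemma jac_left_mult:
  assumes "bipoly f" "bipoly g"
  shows "jac (\<lambda>z. f z * g z) h z = jac f h z * g z + f z * jac g h z"
  using assms by (simp add: jac_def dx_mult dy_mult algebra_simps)

lemma jac_left_power:
  assumes u: "bipoly u"
  shows "jac (\<lambda>z. c * u z ^ k) h z = (c * of_nat k * u z ^ (k - 1)) * jac u h z"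
proof -
  have "jac (\<lambda>z. u z ^ k) h z = of_nat k * u z ^ (k - 1) * jac u h z"
  proof (induction k)
    case 0
    then show ?case by (simp add: jac_def)
  next
    case (Suc k)
    have "jac (\<lambda>z. u z * u z ^ k) h z = jac u h z * u z ^ k + u z * jac (\<lambda>z. u z ^ k) h z"
      by (rule jac_left_mult[OF u bipoly_power[OF u]])
    also have "\<dots> = of_nat (Suc k) * u z ^ k * jac u h z"
      unfolding Suc by (cases k) (simp_all add: algebra_simps)
    finally show ?case by simp
  qed
  then show ?thesis using jac_left_mult[OF bipoly_const[of c] bipoly_power[OF u], where h = h and z = z]
    by (simp add: jac_def)
qed

lemma jac_iterate_power:
  assumes u: "bipoly u" and h: "bipoly h"
  shows "(jac (\<lambda>z. c * u z ^ k) ^^ n) h = (\<lambda>z. (c * of_nat k * u z ^ (k - 1)) ^ n * (jac u ^^ n) h z)"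
proof (induction n)
  case (Suc n)
  have b1: "bipoly (\<lambda>z. (c * of_nat k) ^ n * u z ^ ((k - 1) * n))"
    by (intro bipoly_mult bipoly_const bipoly_power u)
  have eq: "(c * of_nat k * u z ^ (k - 1)) ^ n = (c * of_nat k) ^ n * u z ^ ((k - 1) * n)" for z
    by (simp add: power_mult_distrib power_mult)
  have 0: "jac u (\<lambda>z. (c * of_nat k) ^ n * u z ^ ((k - 1) * n)) z = 0" for z
    by (simp add: jac_mult bipoly_const bipoly_power u jac_power_self)
  have "(jac (\<lambda>z. c * u z ^ k) ^^ Suc n) h z = (c * of_nat k * u z ^ (k - 1)) ^ Suc n * (jac u ^^ Suc n) h z" for z
  proof -
    have "(jac (\<lambda>z. c * u z ^ k) ^^ Suc n) h z =
        jac (\<lambda>z. c * u z ^ k) (\<lambda>z. (c * of_nat k) ^ n * u z ^ ((k - 1) * n) * (jac u ^^ n) h z) z"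
      by (simp only: funpow.simps(2) o_apply Suc eq)
    also have "\<dots> = (c * of_nat k * u z ^ (k - 1)) * ((c * of_nat k) ^ n * u z ^ ((k - 1) * n) * jac u ((jac u ^^ n) h) z)"
      by (simp only: jac_left_power[OF u] jac_mult[OF b1 jac_iterate_bipoly[OF u h]] 0 mult_zero_left add_0_left)
    also have "\<dots> = (c * of_nat k * u z ^ (k - 1)) ^ Suc n * (jac u ^^ Suc n) h z"
      unfolding eq[symmetric] by simp
    finally show ?thesis .
  qed
  then show ?case by blast
qed simp

text \<open>Polynomials with positive coefficients and no constant term; the derivation
  \<open>q x\<^sup>q\<^sup>-\<^sup>1 \<partial>\<^sub>y + p y\<^sup>p\<^sup>-\<^sup>1 \<partial>\<^sub>x\<close> preserves them when \<open>p, q \<ge> 2\<close>.\<close>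

inductive pospoly :: "(complex \<times> complex \<Rightarrow> complex) \<Rightarrow> bool" where
  pos_mono: "c > 0 \<Longrightarrow> fst t + snd t > 0 \<Longrightarrow> pospoly (\<lambda>z. of_real c * mono2 t z)"
| pos_add: "pospoly f \<Longrightarrow> pospoly g \<Longrightarrow> pospoly (\<lambda>z. f z + g z)"

lemma pospoly_bipoly: "pospoly f \<Longrightarrow> bipoly f"
  by (induction rule: pospoly.induct) (auto intro: bipoly_mono2 bipoly_add)

lemma pospoly_pos: "pospoly f \<Longrightarrow> \<exists>r::real. r > 0 \<and> f (1, 2) = of_real r"
proof (induction rule: pospoly.induct)
  case (pos_mono c t)
  then show ?case by (intro exI[of _ "c * 2 ^ snd t"]) (simp add: mono2_def)
next
  case (pos_add f g)
  then obtain r s :: real where "r > 0" "f (1, 2) = of_real r" "s > 0" "g (1, 2) = of_real s" by blast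
  then show ?case by (intro exI[of _ "r + s"]) simp
qed

lemma dx_mono2: "dx (\<lambda>z. c * mono2 t z) z = c * of_nat (fst t) * (fst z ^ (fst t - 1) * snd z ^ snd t)"
  by (rule dxI) (auto simp: mono2_def intro!: derivative_eq_intros)
lemma dy_mono2: "dy (\<lambda>z. c * mono2 t z) z = c * of_nat (snd t) * (fst z ^ fst t * snd z ^ (snd t - 1))"
  by (rule dyI) (auto simp: mono2_def intro!: derivative_eq_intros)

lemma pospoly_derivation:
  assumes "pospoly f" and pq: "p \<ge> 2" "q \<ge> 2"
  shows "pospoly (\<lambda>z. of_nat q * fst z ^ (q - 1) * dy f z + of_nat p * snd z ^ (p - 1) * dx f z)"
  using assms(1)
proof induction
  case (pos_mono c t)
  define X where "X = (\<lambda>z. of_real (c * p * fst t) * mono2 (fst t - 1, snd t + (p - 1)) z)"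
  define Y where "Y = (\<lambda>z. of_real (c * q * snd t) * mono2 (fst t + (q - 1), snd t - 1) z)"
  have eqX: "of_nat p * snd z ^ (p - 1) * dx (\<lambda>z. of_real c * mono2 t z) z = X z" for z
    unfolding dx_mono2 by (simp add: X_def mono2_def power_add)
  have eqY: "of_nat q * fst z ^ (q - 1) * dy (\<lambda>z. of_real c * mono2 t z) z = Y z" for z
    unfolding dy_mono2 by (simp add: Y_def mono2_def power_add)
  have X: "pospoly X" if "fst t > 0" unfolding X_def by (rule pospoly.pos_mono) (use pos_mono pq that in auto)
  have Y: "pospoly Y" if "snd t > 0" unfolding Y_def by (rule pospoly.pos_mono) (use pos_mono pq that in auto)
  have X0: "X = (\<lambda>_. 0)" if "fst t = 0" using that by (simp add: X_def)
  have Y0: "Y = (\<lambda>_. 0)" if "snd t = 0" using that by (simp add: Y_def)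
  have "pospoly (\<lambda>z. Y z + X z)"
  proof (cases "fst t = 0")
    case True
    then show ?thesis using Y pos_mono X0 by auto
  next
    case f: False
    show ?thesis
    proof (cases "snd t = 0")
      case True
      then show ?thesis using X f Y0 by auto
    next
      case False
      then show ?thesis using X Y f by (auto intro: pospoly.pos_add)
    qed
  qed
  then show ?case by (simp only: eqX eqY)
next
  case (pos_add f g)
  have b: "bipoly f" "bipoly g" using pos_add pospoly_bipoly by auto
  have eq: "(\<lambda>z. of_nat q * fst z ^ (q - 1) * dy (\<lambda>z. f z + g z) z + of_nat p * snd z ^ (p - 1) * dx (\<lambda>z. f z + g z) z) =
     (\<lambda>z. (of_nat q * fst z ^ (q - 1) * dy f z + of_nat p * snd z ^ (p - 1) * dx f z) +
       (of_nat q * fst z ^ (q - 1) * dy g z + of_nat p * snd z ^ (p - 1) * dx g z))"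
    by (simp add: dx_add[OF b] dy_add[OF b] algebra_simps)
  show ?case unfolding eq by (rule pospoly.pos_add[OF pos_add.IH])
qed

text \<open>For \<open>u = y\<^sup>p - c x\<^sup>q\<close> with \<open>p, q \<ge> 2\<close> no iterate of \<open>jac u\<close> annihilates \<open>x\<close>: after rescaling \<open>x\<close> by a
  root \<open>\<kappa>\<close> of \<open>\<kappa>\<^sup>q = 1 / c\<close>, the iterates have positive coefficients up to a constant factor.\<close>

lemma jac_curve_not_nilpotent:
  fixes c :: complex
  assumes pq: "p \<ge> 2" "q \<ge> 2" and c: "c \<noteq> 0"
  defines "u \<equiv> \<lambda>z. snd z ^ p - c * fst z ^ q"
  shows "\<exists>z. u z \<noteq> 0 \<and> (jac u ^^ n) fst z \<noteq> 0"
proof -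
  obtain \<kappa> where \<kappa>: "\<kappa> ^ q = 1 / c" using complex_root_exists[of q "1 / c"] pq by auto
  then have \<kappa>0: "\<kappa> \<noteq> 0" using c pq by (auto simp: power_0_left)
  have ck: "c * \<kappa> ^ (q - 1) = 1 / \<kappa>"
    using \<kappa> \<kappa>0 c pq power_eq_if[of \<kappa> q] by (simp add: field_simps)
  have bu: "bipoly u" unfolding u_def by (intro bipoly_diff bipoly_power bipoly_mult bipoly_const bipoly_fst bipoly_snd)
  have ux: "dx u z = - c * of_nat q * fst z ^ (q - 1)" for z
    unfolding u_def by (rule dxI) (auto intro!: derivative_eq_intros)
  have uy: "dy u z = of_nat p * snd z ^ (p - 1)" for z
    unfolding u_def by (rule dyI) (auto intro!: derivative_eq_intros)
  have "\<exists>P. pospoly P \<and> (\<forall>x y. (jac u ^^ n) fst (\<kappa> * x, y) = (- 1 / \<kappa>) ^ n * \<kappa> * P (x, y))" for n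
  proof (induction n)
    case 0
    have "pospoly (\<lambda>z. of_real 1 * mono2 (1, 0) z)" by (rule pos_mono) auto
    then show ?case by (intro exI[of _ "\<lambda>z. of_real 1 * mono2 (1, 0) z"]) (auto simp: mono2_def)
  next
    case (Suc n)
    define g where "g = (jac u ^^ n) fst"
    have bg: "bipoly g" unfolding g_def using jac_iterate_bipoly[OF bu, of fst n] bipoly_fst by simp
    from Suc obtain P where P: "pospoly P" "\<And>x y. g (\<kappa> * x, y) = (- 1 / \<kappa>) ^ n * \<kappa> * P (x, y)"
      unfolding g_def by blast
    note bP = pospoly_bipoly[OF P(1)]
    define C where "C = (- 1 / \<kappa>) ^ n * \<kappa>"
    have gx: "dx g (\<kappa> * x, y) * \<kappa> = C * dx P (x, y)" for x y
    proof -
      have "((\<lambda>x. g (\<kappa> * x, y)) has_field_derivative dx g (\<kappa> * x, y) * \<kappa>) (at x)"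
        by (rule DERIV_chain2[OF has_dx[OF bg]]) (auto intro!: derivative_eq_intros)
      moreover have "((\<lambda>x. g (\<kappa> * x, y)) has_field_derivative C * dx P (x, y)) (at x)"
        unfolding P(2) C_def by (rule DERIV_cmult[OF has_dx[OF bP]])
      ultimately show ?thesis by (rule DERIV_unique)
    qed
    have gy: "dy g (\<kappa> * x, y) = C * dy P (x, y)" for x y
    proof -
      have "((\<lambda>y. g (\<kappa> * x, y)) has_field_derivative C * dy P (x, y)) (at y)"
        unfolding P(2) C_def by (rule DERIV_cmult[OF has_dy[OF bP]])
      then show ?thesis using DERIV_unique[OF has_dy[OF bg, of "\<kappa> * x" y]] by simp
    qed
    define P' where "P' = (\<lambda>z. of_nat q * fst z ^ (q - 1) * dy P z + of_nat p * snd z ^ (p - 1) * dx P z)"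
    have "jac u g (\<kappa> * x, y) = (- 1 / \<kappa>) ^ Suc n * \<kappa> * P' (x, y)" for x y
    proof -
      have gx': "dx g (\<kappa> * x, y) = C * dx P (x, y) / \<kappa>" using gx[of x y] \<kappa>0 by (simp add: field_simps)
      have "jac u g (\<kappa> * x, y) = - (c * \<kappa> ^ (q - 1)) * (of_nat q * x ^ (q - 1) * (C * dy P (x, y))) - of_nat p * y ^ (p - 1) * (C * dx P (x, y) / \<kappa>)"
        unfolding jac_def ux uy gx' gy by (simp add: power_mult_distrib algebra_simps)
      also have "\<dots> = (- 1 / \<kappa>) * C * P' (x, y)"
        unfolding ck P'_def using \<kappa>0 by (simp add: field_simps)
      finally show ?thesis by (simp add: C_def)
    qed
    moreover have "pospoly P'" unfolding P'_def by (rule pospoly_derivation[OF P(1) pq])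
    ultimately show ?case by (intro exI[of _ P']) (auto simp flip: g_def)
  qed
  \<comment> \<open>At \<open>(\<kappa>, 2)\<close> the value of \<open>u\<close> is \<open>2\<^sup>p - 1\<close>.\<close>
  then obtain P where P: "pospoly P" "(jac u ^^ n) fst (\<kappa> * 1, 2) = (- 1 / \<kappa>) ^ n * \<kappa> * P (1, 2)" by blast
  obtain r :: real where "r > 0" "P (1, 2) = of_real r" using pospoly_pos[OF P(1)] by blast
  then have "(jac u ^^ n) fst (\<kappa>, 2) \<noteq> 0" using P(2) \<kappa>0 by simp
  moreover have "u (\<kappa>, 2) \<noteq> 0"
  proof -
    have "u (\<kappa>, 2) = 2 ^ p - 1" using \<kappa> c by (simp add: u_def)
    moreover have "(2::complex) ^ p \<noteq> 1"
    proof
      assume "(2::complex) ^ p = 1"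
      then have "norm ((2::complex) ^ p) = 1" by simp
      then show False using pq one_less_power[of "2::real" p] by (simp add: norm_power)
    qed
    ultimately show ?thesis by simp
  qed
  ultimately show ?thesis by blast
qed

subsection \<open>Lowering the degree by a shear\<close>

text \<open>The elementary automorphism \<open>(x, y) \<mapsto> (x + P(y), y)\<close>.\<close>

definition shear :: "complex poly \<Rightarrow> complex \<times> complex \<Rightarrow> complex \<times> complex" where
  "shear P z = (fst z + poly P (snd z), snd z)"

lemma bipoly_poly_snd: "bipoly (\<lambda>z. poly P (snd z))"
  by (induction P) (auto intro!: bipoly_intros)

lemma polymap_shear: "polymap (shear P)"
  by (auto simp: polymap_iff_bipoly shear_def intro!: bipoly_intros bipoly_poly_snd)

lemma autpair_shear: "autpair (shear P) (shear (- P))"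
  by (auto simp: autpair_def polymap_shear shear_def)

lemma shear_comp: "shear P \<circ> shear Q = shear (P + Q)"
  by (auto simp: shear_def fun_eq_iff)

text \<open>The reduction step in Jung's theorem. Let \<open>\<phi>\<close> and its inverse have degree at least two and top
  forms with values in the \<open>x\<close>-axis; these forms are \<open>h y\<^sup>N\<close> and \<open>b y\<^sup>M\<close> times \<open>(1, 0)\<close>. On a
  generic line with parameter \<open>t\<close> the components of the inverse grow like \<open>t\<^sup>M\<close> and \<open>t\<^sup>Q\<close>, and the
  ratio \<open>p : q\<close> of \<open>M\<close> and \<open>Q\<close> gives the weights. The level curves of all the combinations \<open>A - s B\<close>
  of the components of \<open>\<phi>\<close> are asymptotic to one curve \<open>y\<^sup>p = c x\<^sup>q\<close>, whence all \<open>A - s B\<close> have the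
  leading part \<open>h (y\<^sup>p - c x\<^sup>q)\<^sup>k\<close>. Local nilpotency of \<open>jac A\<close> excludes \<open>q \<ge> 2\<close>, and for \<open>q = 1\<close> the
  shear \<open>x \<mapsto> x + y\<^sup>p / c\<close> annihilates the parts of degree \<open>N\<close> of both components.\<close>

lemma jung_core:
  assumes ap: "autpair \<phi> \<phi>i"
    and T: "mtop N \<phi> T" "\<And>z. T z = cs (H z) (1, 0)" "H z1 \<noteq> 0" "N \<ge> 2" "qhom 1 1 N H"
    and U: "mtop M \<phi>i U" "\<And>z. U z = cs (H' z) (1, 0)" "H' z2 \<noteq> 0" "M \<ge> 2" "qhom 1 1 M H'"
  shows "\<exists>P. polymap_le (N - 1) (\<phi> \<circ> shear P)"
proof -
  have v0: "(1, 0) \<noteq> (0 :: complex \<times> complex)" by (simp add: prod_eq_iff)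
  have MN: "N \<ge> 1" "M \<ge> 1" using T(4) U(4) by auto
  have NM2: "N * M \<ge> 2" "M * N \<ge> 2" using T(4) U(4) mult_le_mono[of 2 N 1 M] by (auto simp: mult.commute)
  define h where "h = H (0, 1)"
  define b where "b = H' (0, 1)"
  have H: "H z = h * snd z ^ N" for z
    unfolding h_def
  proof (rule hom_one_zero[OF T(5) MN(1)])
    fix z assume "H z = 0" "z \<noteq> 0"
    then show "snd z = 0"
      using top_form_zeros[OF ap T(1,2,3) v0 MN(1) U(1,2,3,5) v0 NM2(1) MN(2)] by (simp add: dt_def)
  qed
  have H': "H' z = b * snd z ^ M" for z
    unfolding b_def
  proof (rule hom_one_zero[OF U(5) MN(2)])
    fix z assume "H' z = 0" "z \<noteq> 0"
    then show "snd z = 0"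
      using top_form_zeros[OF autpair_sym[OF ap] U(1,2,3) v0 MN(2) T(1,2,3,5) v0 NM2(2) MN(1)] by (simp add: dt_def)
  qed
  have h0: "h \<noteq> 0" and b0: "b \<noteq> 0" using T(3) U(3) H H' by auto
  define X Y where "X = (\<lambda>z. fst (\<phi>i z))" and "Y = (\<lambda>z. snd (\<phi>i z))"
  define A B where "A = (\<lambda>z. fst (\<phi> z))" and "B = (\<lambda>z. snd (\<phi> z))"
  have bXY: "bipoly X" "bipoly Y" "bipoly A" "bipoly B"
    using autpairD(3,4)[OF ap] by (auto simp: polymap_iff_bipoly X_def Y_def A_def B_def)
  have limX: "(\<lambda>n. X (dil 1 1 (of_nat n) z) / of_nat n ^ M) \<longlonglongrightarrow> b * snd z ^ M" for z
    using mtop_tendsto(1)[OF U(1) of_nat_at_infinity tendsto_const[of z]]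
    by (simp add: dil_1_1[unfolded One_nat_def] X_def U(2) H')
  have limY: "(\<lambda>n. Y (dil 1 1 (of_nat n) z) / of_nat n ^ M) \<longlonglongrightarrow> 0" for z
    using mtop_tendsto(2)[OF U(1) of_nat_at_infinity tendsto_const[of z]]
    by (simp add: dil_1_1[unfolded One_nat_def] Y_def U(2))
  obtain WX where WX: "qdec 1 1 M X WX" "WX M = (\<lambda>z. b * snd z ^ M)"
    using growth_qdec[OF bXY(1) limX] by blast
  have "Y (\<phi> (0, 1)) = 1" by (simp add: Y_def autpairD[OF ap])
  then have Ynz: "Y (\<phi> (0, 1)) \<noteq> 0" by simp
  obtain Q WY y1 where WY: "qdec 1 1 Q Y WY" "WY Q y1 \<noteq> 0"
    using qdec_leading_exists[OF bXY(2) Ynz] by blast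
  have limYQ: "(\<lambda>n. Y (dil 1 1 (of_nat n) z) / of_nat n ^ Q) \<longlonglongrightarrow> WY Q z" for z
    by (rule qdec_tendsto[OF WY(1) of_nat_at_infinity tendsto_const])
  have Q1: "Q \<ge> 1"
  proof (rule ccontr)
    assume "\<not> ?thesis"
    then have "Q = 0" by simp
    then have "poly2_le 0 Y" using WY(1) unfolding poly2_le_iff_qdec by blast
    then have "Y (\<phi> (0, 1)) = Y (\<phi> (0, 0))" by (rule poly2_le_0_const)
    then show False by (simp add: Y_def autpairD[OF ap])
  qed
  have QM: "Q < M"
  proof (rule ccontr)
    assume "\<not> ?thesis"
    then have le: "M \<le> Q" by simp
    have "(\<lambda>n. Y (dil 1 1 (of_nat n) y1) / of_nat n ^ M * (1 / of_nat n ^ (Q - M))) = (\<lambda>n. Y (dil 1 1 (of_nat n) y1) / of_nat n ^ Q)"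
      using le by (auto simp flip: power_add)
    moreover have "(\<lambda>n. Y (dil 1 1 (of_nat n) y1) / of_nat n ^ M * (1 / of_nat n ^ (Q - M))) \<longlonglongrightarrow> 0"
    proof (cases "M = Q")
      case True
      then show ?thesis using limY by simp
    next
      case False
      then have "(\<lambda>n. Y (dil 1 1 (of_nat n) y1) / of_nat n ^ M * (1 / of_nat n ^ (Q - M))) \<longlonglongrightarrow> 0 * 0"
        by (intro tendsto_mult limY tendsto_inverse_power_nat) (use le in auto)
      then show ?thesis by simp
    qed
    ultimately show False using LIMSEQ_unique[OF limYQ[of y1]] WY(2) by fastforce
  qed
  \<comment> \<open>The Jacobian determinant of \<open>\<phi>\<^sup>-\<^sup>1\<close> is constant, so its part of degree \<open>M + Q - 2\<close> vanishes:
    the leading part of \<open>Y\<close> is a multiple of \<open>y\<^sup>Q\<close>.\<close>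
  have jac0: "jac (WX M) (WY Q) z = 0" for z
  proof -
    define j0 where "j0 = jac X Y 0"
    have j: "jac X Y z = j0" for z
      unfolding j0_def X_def Y_def by (rule jacobian_const[OF autpair_sym[OF ap]])
    have "(\<lambda>n. of_nat n ^ (1 + 1) * j0 / of_nat n ^ (M + Q)) \<longlonglongrightarrow> jac (WX M) (WY Q) z"
      using jac_tendsto[OF WX(1) WY(1), of z] unfolding j .
    moreover have "(\<lambda>n. of_nat n ^ (1 + 1) * j0 / of_nat n ^ (M + Q)) \<longlonglongrightarrow> 0"
    proof (rule Lim_transform_eventually[OF tendsto_inverse_power_nat[of "M + Q - 2" j0]])
      show "1 \<le> M + Q - 2" using U(4) Q1 by simp
      show "\<forall>\<^sub>F n in sequentially. j0 / of_nat n ^ (M + Q - 2) = of_nat n ^ (1 + 1) * j0 / of_nat n ^ (M + Q)"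
        using eventually_gt_at_top[of 0]
      proof eventually_elim
        case (elim n)
        have "M + Q = (1 + 1) + (M + Q - 2)" using U(4) Q1 by simp
        then have "(of_nat n :: complex) ^ (M + Q) = of_nat n ^ (1 + 1) * of_nat n ^ (M + Q - 2)"
          by (metis power_add)
        then show ?case using elim by simp
      qed
    qed
    ultimately show ?thesis using LIMSEQ_unique by blast
  qed
  define a where "a = WY Q (0, 1)"
  have WYc: "WY Q (s, 1) = a" for s
  proof -
    have bW: "bipoly (WY Q)" by (rule qdec_bipoly[OF WY(1)])
    have d1: "dx (WX M) z = 0" for z unfolding WX(2) by (rule dxI) auto
    have d2: "dy (WX M) z = b * of_nat M * snd z ^ (M - 1)" for z
      unfolding WX(2) by (rule dyI) (auto intro!: derivative_eq_intros)
    have "dx (WY Q) (x, 1) = 0" for x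
      using jac0[of "(x, 1)"] b0 U(4) by (simp add: jac_def d1 d2)
    then have "((\<lambda>x. WY Q (x, 1)) has_field_derivative 0) (at x within UNIV)" for x
      using has_dx[OF bW, of 1 x] by simp
    then have "\<exists>c. \<forall>x\<in>UNIV. WY Q (x, 1) = c"
      by (intro has_field_derivative_zero_constant) auto
    then show ?thesis unfolding a_def by fastforce
  qed
  have a0: "a \<noteq> 0"
  proof
    assume "a = 0"
    have "WY Q ((0, 1) + cs s (1, 0)) = 0" for s
      using WYc[of s] \<open>a = 0\<close> by (simp add: cs_def)
    moreover have "dt (0, 1) (1, 0) \<noteq> 0" by (simp add: dt_def)
    ultimately have "WY Q y1 = 0" using qhom_line_zero[OF qdec_qhom[OF WY(1)]] by blast
    then show False using WY(2) by simp
  qed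
  define g where "g = gcd M Q"
  obtain p q where pq: "M = g * p" "Q = g * q" "coprime p q"
    using gcd_coprime_exists[of M Q] Q1 unfolding g_def by (auto simp: mult.commute)
  have pq1: "q \<ge> 1" "p \<ge> 1" "q < p"
    using pq(1,2) Q1 QM by (auto simp: Suc_le_eq intro!: gr0I)
  define c where "c = a ^ p / b ^ q"
  have c0: "c \<noteq> 0" using a0 b0 by (simp add: c_def)
  \<comment> \<open>The zero set of \<open>A - s B\<close> is the image under \<open>\<phi>\<^sup>-\<^sup>1\<close> of the line in direction \<open>(s, 1)\<close>, along
    which the ratio \<open>y\<^sup>p / x\<^sup>q\<close> tends to \<open>c\<close>, independently of \<open>s\<close>.\<close>
  define As where "As = (\<lambda>s z. A z - s * B z)"
  have key: "\<exists>V k. qdec p q (q * N) (As s) V \<and> N = p * k \<and> (\<forall>z. V (q * N) z = h * (snd z ^ p - c * fst z ^ q) ^ k)" for s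
  proof -
    define d :: "complex \<times> complex" where "d = (- s, - 1)"
    have d0: "d \<noteq> 0" by (simp add: d_def prod_eq_iff)
    have dA: "dt d (\<phi> z) = As s z" for z by (simp add: dt_def d_def As_def A_def B_def)
    have bA: "bipoly (As s)" unfolding As_def by (intro bipoly_diff bipoly_mult bipoly_const bXY)
    have lim: "(\<lambda>n. As s (dil 1 1 (of_nat n) z) / of_nat n ^ N) \<longlonglongrightarrow> h * snd z ^ N" for z
      using tendsto_diff[OF mtop_tendsto(1)[OF T(1) of_nat_at_infinity tendsto_const[of z]]
         tendsto_mult[OF tendsto_const[of s] mtop_tendsto(2)[OF T(1) of_nat_at_infinity tendsto_const[of z]]]]
      by (simp add: As_def A_def B_def T(2) H dil_1_1[unfolded One_nat_def] diff_divide_distrib)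
    obtain W where W: "qdec 1 1 N (As s) W" "W N = (\<lambda>z. h * snd z ^ N)"
      using growth_qdec[OF bA lim] by blast
    have zeros: "snd z0 ^ p = c * fst z0 ^ q"
      if V: "qdec p q K (As s) V" "V K z1 \<noteq> 0" "V K z0 = 0" "z0 \<noteq> 0" for K V z0 z1
    proof -
      have V': "qdec p q K (\<lambda>z. dt d (\<phi> z)) V" using V(1) by (simp only: dA)
      obtain n \<zeta> t where n0: "filterlim n at_top sequentially" and n: "\<zeta> \<longlonglongrightarrow> z0"
        "filterlim t at_infinity sequentially" "\<And>k. dil p q (of_nat (n k)) (\<zeta> k) = \<phi>i (cs (t k) d)"
        by (rule curve_points[OF ap d0 V' V(2-4) pq1(2,1)]) (rule that)
      have x: "(\<lambda>k. X (cs (t k) d) / t k ^ M) \<longlonglongrightarrow> b * (- 1) ^ M"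
        using mtop_tendsto(1)[OF U(1) n(2) tendsto_const[of d]] by (simp add: X_def U(2) H' d_def)
      have y: "(\<lambda>k. Y (cs (t k) d) / t k ^ Q) \<longlonglongrightarrow> WY Q d"
        using qdec_tendsto[OF WY(1) n(2) tendsto_const[of d]] by (simp add: dil_1_1[unfolded One_nat_def])
      have Wd: "WY Q d = (- 1) ^ Q * a"
      proof -
        have "WY Q (cs (- 1) (s, 1)) = (- 1) ^ Q * WY Q (s, 1)"
          using qhomD[OF qdec_qhom[OF WY(1), of Q], where r = "- 1" and z = "(s, 1)"] by (simp add: dil_1_1[unfolded One_nat_def])
        then show ?thesis by (simp add: WYc d_def cs_def)
      qed
      have Mq: "M * q = Q * p" by (simp add: pq)
      have lhs: "(\<lambda>k. (Y (cs (t k) d) / t k ^ Q) ^ p * fst (\<zeta> k) ^ q - (X (cs (t k) d) / t k ^ M) ^ q * snd (\<zeta> k) ^ p)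
          \<longlonglongrightarrow> (WY Q d) ^ p * fst z0 ^ q - (b * (- 1) ^ M) ^ q * snd z0 ^ p"
        by (intro tendsto_intros x y n(1))
      have "(Y (cs (t k) d) / t k ^ Q) ^ p * fst (\<zeta> k) ^ q - (X (cs (t k) d) / t k ^ M) ^ q * snd (\<zeta> k) ^ p = 0" for k
      proof -
        have XY: "X (cs (t k) d) = of_nat (n k) ^ p * fst (\<zeta> k)" "Y (cs (t k) d) = of_nat (n k) ^ q * snd (\<zeta> k)"
          unfolding X_def Y_def n(3)[symmetric] by (simp_all add: dil_def)
        have e: "(t k ^ Q) ^ p = (t k ^ M) ^ q" "((of_nat (n k) :: complex) ^ q) ^ p = (of_nat (n k) ^ p) ^ q"
          by (simp_all add: Mq mult.commute flip: power_mult)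
        show ?thesis unfolding XY power_divide power_mult_distrib e by simp
      qed
      then have "(\<lambda>k::nat. 0) \<longlonglongrightarrow> (WY Q d) ^ p * fst z0 ^ q - (b * (- 1) ^ M) ^ q * snd z0 ^ p"
        using lhs by simp
      then have "(WY Q d) ^ p * fst z0 ^ q = (b * (- 1) ^ M) ^ q * snd z0 ^ p" by (simp add: LIMSEQ_const_iff)
      moreover have "((- 1 :: complex) ^ Q) ^ p = ((- 1) ^ M) ^ q" by (simp add: Mq flip: power_mult)
      ultimately have "((- 1) ^ M) ^ q * (a ^ p * fst z0 ^ q) = ((- 1) ^ M) ^ q * (b ^ q * snd z0 ^ p)"
        by (simp add: Wd power_mult_distrib mult.assoc mult.left_commute)
      then have "a ^ p * fst z0 ^ q = b ^ q * snd z0 ^ p" by simp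
      then show ?thesis using b0 by (simp add: c_def field_simps)
    qed
    have Wz: "W N z = h * snd z ^ N" for z by (simp add: W(2))
    show ?thesis by (rule weighted_form[OF W(1) Wz h0 MN(1) pq1(2,1) pq(3) c0]) (rule zeros)
  qed
  have q: "q = 1"
  proof (rule ccontr)
    assume "q \<noteq> 1"
    then have q2: "q \<ge> 2" and p2: "p \<ge> 2" using pq1 by auto
    obtain V k where V: "qdec p q (q * N) A V" "N = p * k" "\<And>z. V (q * N) z = h * (snd z ^ p - c * fst z ^ q) ^ k"
      using key[of 0] by (auto simp: As_def)
    have k1: "k \<ge> 1" using V(2) MN by (cases k) auto
    define u where "u = (\<lambda>z :: complex \<times> complex. snd z ^ p - c * fst z ^ q)"
    have bu: "bipoly u" unfolding u_def by (intro bipoly_diff bipoly_power bipoly_mult bipoly_const bipoly_fst bipoly_snd)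
    have "p + q \<le> p * q" using p2 q2
    proof -
      obtain p' q' where "p = p' + 2" "q = q' + 2" using p2 q2 by (metis le_add_diff_inverse2)
      then show ?thesis by (simp add: algebra_simps)
    qed
    also have "\<dots> \<le> q * N" using V(2) k1 by simp
    finally have le: "p + q \<le> q * N" .
    obtain n where n: "\<And>z. (jac A ^^ n) fst z = 0" using jac_nilpotent[OF ap] unfolding A_def by blast
    obtain z where z: "u z \<noteq> 0" "(jac u ^^ n) fst z \<noteq> 0"
      using jac_curve_not_nilpotent[OF p2 q2 c0, of n] unfolding u_def by blast
    have Vu: "V (q * N) = (\<lambda>z. h * u z ^ k)" using V(3) by (auto simp: u_def)
    have "(jac (V (q * N)) ^^ n) fst z = 0" by (rule jac_nilpotent_leading[OF V(1) le n])
    moreover have "(jac (V (q * N)) ^^ n) fst z = (h * of_nat k * u z ^ (k - 1)) ^ n * (jac u ^^ n) fst z"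
      unfolding Vu using jac_iterate_power[OF bu, where h = fst and c = h and k = k and n = n] bipoly_fst by simp
    ultimately show False using z h0 k1 by simp
  qed
  define P where "P = monom (1 / c) p"
  have lim0: "(\<lambda>n. As s (shear P (cs (of_nat n) z)) / of_nat n ^ N) \<longlonglongrightarrow> 0" for s z
  proof -
    obtain V k where V: "qdec p q (q * N) (As s) V" "N = p * k" "\<And>z. V (q * N) z = h * (snd z ^ p - c * fst z ^ q) ^ k"
      using key[of s] by blast
    have k1: "k \<ge> 1" using V(2) MN by (cases k) auto
    define \<zeta> where "\<zeta> = (\<lambda>n. (fst z / of_nat n ^ (p - 1) + snd z ^ p / c, snd z))"
    have \<zeta>: "\<zeta> \<longlonglongrightarrow> (0 + snd z ^ p / c, snd z)"
      unfolding \<zeta>_def by (intro tendsto_Pair tendsto_add tendsto_const tendsto_inverse_power_nat) (use pq1 q in auto)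
    have "(\<lambda>n. As s (dil p q (of_nat n) (\<zeta> n)) / of_nat n ^ (q * N)) \<longlonglongrightarrow> V (q * N) (0 + snd z ^ p / c, snd z)"
      by (rule qdec_tendsto[OF V(1) of_nat_at_infinity \<zeta>])
    also have "V (q * N) (0 + snd z ^ p / c, snd z) = 0" unfolding V(3) using c0 k1 q by simp
    finally have l: "(\<lambda>n. As s (dil p q (of_nat n) (\<zeta> n)) / of_nat n ^ (q * N)) \<longlonglongrightarrow> 0" .
    have "eventually (\<lambda>n. As s (dil p q (of_nat n) (\<zeta> n)) / of_nat n ^ (q * N) = As s (shear P (cs (of_nat n) z)) / of_nat n ^ N) sequentially"
      using eventually_gt_at_top[of 0]
    proof eventually_elim
      case (elim n)
      have "(of_nat n :: complex) ^ p = of_nat n * of_nat n ^ (p - 1)"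
        using pq1 by (simp flip: power_Suc)
      then have "dil p q (of_nat n) (\<zeta> n) = shear P (cs (of_nat n) z)"
        using elim by (simp add: dil_def \<zeta>_def shear_def P_def poly_monom q prod_eq_iff distrib_left power_mult_distrib)
      then show ?case using q by simp
    qed
    then show ?thesis using Lim_transform_eventually[OF l] by simp
  qed
  have "mtop N (\<phi> \<circ> shear P) (\<lambda>z. 0)"
  proof (rule mtop_growth)
    show "polymap (\<phi> \<circ> shear P)" by (intro polymap_comp autpairD(3)[OF ap] polymap_shear)
    fix z
    show "(\<lambda>n. fst ((\<phi> \<circ> shear P) (cs (of_nat n) z)) / of_nat n ^ N) \<longlonglongrightarrow> fst 0"
      using lim0[of 0 z] by (simp add: As_def A_def)
    show "(\<lambda>n. snd ((\<phi> \<circ> shear P) (cs (of_nat n) z)) / of_nat n ^ N) \<longlonglongrightarrow> snd 0"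
      using tendsto_diff[OF lim0[of 0 z] lim0[of 1 z]] by (simp add: As_def A_def B_def flip: diff_divide_distrib)
  qed
  then have "mtop (Suc (N - 1)) (\<phi> \<circ> shear P) (\<lambda>z. 0)" using MN by simp
  then have "polymap_le (N - 1) (\<phi> \<circ> shear P)" by (rule mtop_zero_lower) auto
  then show ?thesis by blast
qed

lemma polymap_le_comp:
  assumes "polymap_le N F" "polymap_le M G" "M \<ge> 1" shows "polymap_le (N * M) (F \<circ> G)"
  using assms mtop_compose unfolding polymap_le_iff_mtop by blast

lemma polymap_le_weaken: "polymap_le N F \<Longrightarrow> N \<le> M \<Longrightarrow> polymap_le M F"
  unfolding polymap_le_def using poly2_le_weaken by blast

lemma autpair_funpow: "autpair f fi \<Longrightarrow> autpair (f ^^ n) (fi ^^ n)"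
proof (induction n)
  case (Suc n)
  have "autpair (f ^^ n \<circ> f) (fi \<circ> fi ^^ n)"
    by (rule autpair_comp[OF Suc.IH[OF Suc.prems] Suc.prems])
  then show ?case by (simp add: funpow_Suc_right[of n f] del: funpow.simps(2)) (simp add: o_def)
qed (simp add: autpair_id)

lemma conj_funpow:
  assumes "autpair \<phi> \<phi>i" shows "(\<phi> \<circ> g \<circ> \<phi>i) ^^ n = \<phi> \<circ> g ^^ n \<circ> \<phi>i"
proof (induction n)
  case (Suc n)
  then show ?case using autpairD(2)[OF assms] by (auto simp: fun_eq_iff)
qed (use autpairD(1)[OF assms] in auto)

subsection \<open>Linear coordinate changes\<close>

text \<open>Mutually inverse linear maps: a polynomial map that is equal to its own form of degree one is
  linear.\<close>

definition isolin :: "(complex \<times> complex \<Rightarrow> complex \<times> complex) \<Rightarrow> (complex \<times> complex \<Rightarrow> complex \<times> complex) \<Rightarrow> bool" where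
  "isolin L L' \<longleftrightarrow> autpair L L' \<and> mtop 1 L L \<and> mtop 1 L' L'"

lemma mtop_linear:
  assumes "polymap L" "\<And>r z. L (cs r z) = cs r (L z)" shows "mtop 1 L L"
proof (rule mtop_growth[OF assms(1)])
  show "(\<lambda>n. fst (L (cs (of_nat n) z)) / of_nat n ^ 1) \<longlonglongrightarrow> fst (L z)" for z
    by (rule Lim_transform_eventually[OF tendsto_const])
       (use eventually_gt_at_top[of 0] in eventually_elim, simp add: assms(2))
  show "(\<lambda>n. snd (L (cs (of_nat n) z)) / of_nat n ^ 1) \<longlonglongrightarrow> snd (L z)" for z
    by (rule Lim_transform_eventually[OF tendsto_const])
       (use eventually_gt_at_top[of 0] in eventually_elim, simp add: assms(2))
qed

lemma isolin_exists:
  assumes D: "dt v w \<noteq> 0"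
  shows "\<exists>L L'. isolin L L' \<and> L v = (1, 0) \<and> L w = (0, 1)"
proof -
  define L where "L = (\<lambda>z. (dt z w / dt v w, dt v z / dt v w))"
  define L' where "L' = (\<lambda>z. (fst z * fst v + snd z * fst w, fst z * snd v + snd z * snd w))"
  have L: "L z = ((snd w / dt v w) * fst z + (- fst w / dt v w) * snd z, (- snd v / dt v w) * fst z + (fst v / dt v w) * snd z)" for z
    by (simp add: L_def dt_def[of z w] dt_def[of v z] diff_divide_distrib mult.commute)
  have "polymap L" unfolding polymap_iff_bipoly L
    by (simp only: fst_conv snd_conv) (intro conjI bipoly_add bipoly_mult bipoly_const bipoly_fst bipoly_snd)
  moreover have "polymap L'" unfolding polymap_iff_bipoly L'_def
    by (simp only: fst_conv snd_conv) (intro conjI bipoly_add bipoly_mult bipoly_const bipoly_fst bipoly_snd)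
  moreover have "L (L' z) = z" for z
  proof -
    have "dt (L' z) w = fst z * dt v w" "dt v (L' z) = snd z * dt v w"
      by (simp_all add: L'_def dt_def algebra_simps)
    then show ?thesis using D by (simp add: L_def)
  qed
  moreover have "L' (L z) = z" for z
  proof -
    have e: "dt v w * fst z = dt z w * fst v + dt v z * fst w" "dt v w * snd z = dt z w * snd v + dt v z * snd w"
      by (simp_all add: dt_def algebra_simps)
    show ?thesis unfolding L_def L'_def prod_eq_iff fst_conv snd_conv times_divide_eq_left add_divide_distrib[symmetric] e[symmetric]
      using D by simp
  qed
  moreover have "L (cs r z) = cs r (L z)" for r z by (simp add: L_def cs_def[of r "(_, _)"] )
  moreover have "L' (cs r z) = cs r (L' z)" for r z by (simp add: L'_def prod_eq_iff algebra_simps)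
  ultimately have "isolin L L'" unfolding isolin_def autpair_def using mtop_linear by blast
  moreover have "dt w w = 0" "dt v v = 0" by simp_all
  then have "L v = (1, 0)" "L w = (0, 1)" using D by (simp_all add: L_def)
  ultimately show ?thesis by blast
qed

lemma dt_partner: "v \<noteq> 0 \<Longrightarrow> \<exists>w. dt v w \<noteq> 0"
  by (rule ccontr) (auto simp: dt_def prod_eq_iff dest: spec[of _ "(1, 0)"] spec[of _ "(0, 1)"])

lemma isolin_cs:
  assumes "isolin L L'" shows "L (cs r z) = cs r (L z)" "L' (cs r z) = cs r (L' z)"
proof -
  have t: "mtop 1 L L" "mtop 1 L' L'" using assms by (auto simp: isolin_def)
  have 0: "L 0 = 0" "L' 0 = 0"
    using qhom_0[OF mtop_qhom(1)[OF t(1)]] qhom_0[OF mtop_qhom(2)[OF t(1)]]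
      qhom_0[OF mtop_qhom(1)[OF t(2)]] qhom_0[OF mtop_qhom(2)[OF t(2)]] by (simp_all add: prod_eq_iff)
  show "L (cs r z) = cs r (L z)" using mtop_cs[OF t(1), of r z] 0 by (cases "r = 0") auto
  show "L' (cs r z) = cs r (L' z)" using mtop_cs[OF t(2), of r z] 0 by (cases "r = 0") auto
qed

lemma isolin_autpair: "isolin L L' \<Longrightarrow> autpair L L'" by (simp add: isolin_def)

lemma qhom_isolin:
  assumes "isolin L L'" "qhom 1 1 N H" shows "qhom 1 1 N (\<lambda>z. c * H (L z))" "qhom 1 1 N (\<lambda>z. c * H (L' z))"
proof -
  have p: "bipoly (\<lambda>z. fst (L z))" "bipoly (\<lambda>z. snd (L z))" "bipoly (\<lambda>z. fst (L' z))" "bipoly (\<lambda>z. snd (L' z))"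
    using assms(1) by (auto simp: isolin_def autpair_def polymap_iff_bipoly)
  have "bipoly (\<lambda>z. H (L z))" "bipoly (\<lambda>z. H (L' z))"
    using bipoly_compose[OF qhom_bipoly[OF assms(2)] p(1,2)] bipoly_compose[OF qhom_bipoly[OF assms(2)] p(3,4)] by simp_all
  then show "qhom 1 1 N (\<lambda>z. c * H (L z))" "qhom 1 1 N (\<lambda>z. c * H (L' z))"
    using qhomD[OF assms(2)] unfolding qhom_def
    by (auto simp: dil_1_1[unfolded One_nat_def] isolin_cs[OF assms(1)] intro: bipoly_mult bipoly_const)
qed

text \<open>The shape of the top forms \<open>T = H v\<close> and \<open>U = H' v'\<close> of an automorphism of degree at least two and
  of its inverse: both take values in a line, and each scalar factor vanishes exactly on the line of
  values of the other.\<close>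

lemma aut_tops:
  assumes ap: "autpair \<phi> \<phi>i" and T: "mtop N \<phi> T" "T z1 \<noteq> 0" "N \<ge> 2"
  obtains M U H v H' v' z2 where "mtop M \<phi>i U" "M \<ge> 2" "M = polymap_degree \<phi>i" "v \<noteq> 0" "v' \<noteq> 0"
    "\<And>z. T z = cs (H z) v" "qhom 1 1 N H" "H z1 \<noteq> 0"
    "\<And>z. U z = cs (H' z) v'" "qhom 1 1 M H'" "H' z2 \<noteq> 0"
    "\<And>z. H z = 0 \<Longrightarrow> z \<noteq> 0 \<Longrightarrow> dt v' z = 0" "\<And>z. H' z = 0 \<Longrightarrow> z \<noteq> 0 \<Longrightarrow> dt v z = 0" "H v' = 0" "H' v = 0"
proof -
  define M where "M = polymap_degree \<phi>i"
  note sym = autpair_sym[OF ap]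
  obtain U z2 where U: "mtop M \<phi>i U" "U z2 \<noteq> 0" and M1: "M \<ge> 1"
    using aut_top_exists[OF sym] unfolding M_def by blast
  have M2: "M \<ge> 2" by (rule inverse_degree_ge2[OF ap T U(1) M1])
  have N1: "N \<ge> 1" using T by simp
  have NM: "N * M \<ge> 2" "M * N \<ge> 2" using T(3) M1 mult_le_mono[of 2 N 1 M] by (auto simp: mult.commute)
  obtain H v where H: "v \<noteq> 0" "\<And>z. T z = cs (H z) v" "qhom 1 1 N H" "H z1 \<noteq> 0"
    by (rule top_form_line[OF ap T(1,2) N1 U NM(1)]) (rule that)
  obtain H' v' where H': "v' \<noteq> 0" "\<And>z. U z = cs (H' z) v'" "qhom 1 1 M H'" "H' z2 \<noteq> 0"
    by (rule top_form_line[OF sym U M1 T(1,2) NM(2)]) (rule that)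
  have "U (T z1) = 0" by (rule top_annihilates[OF ap T(1) U(1) N1 NM(1)])
  then have H'v: "H' v = 0" using H'(1) H(4) by (simp add: H'(2) H(2) qhom_cs[OF H'(3) M1, simplified])
  have "T (U z2) = 0" by (rule top_annihilates[OF sym U(1) T(1) M1 NM(2)])
  then have Hv': "H v' = 0" using H(1) H'(4) by (simp add: H'(2) H(2) qhom_cs[OF H(3) N1, simplified])
  have zH: "dt v' z = 0" if "H z = 0" "z \<noteq> 0" for z
    by (rule top_form_zeros[OF ap T(1) H(2,4,1) N1 U(1) H'(2,4,3,1) NM(1) M1 that])
  have zH': "dt v z = 0" if "H' z = 0" "z \<noteq> 0" for z
    by (rule top_form_zeros[OF sym U(1) H'(2,4,1) M1 T(1) H(2,4,3,1) NM(2) N1 that])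
  show ?thesis
    by (rule that[OF U(1) M2 M_def H(1) H'(1) H(2,3,4) H'(2,3,4) zH zH' Hv' H'v])
qed

text \<open>The reduction step without the normalization of the line of values. The condition
  \<open>T (1, 0) = 0\<close> says that the inverse contracts the line at infinity to the point of the \<open>x\<close>-axis.\<close>

lemma jung_step:
  assumes ap: "autpair \<phi> \<phi>i" and T: "mtop N \<phi> T" "T z1 \<noteq> 0" "N \<ge> 2" and bad: "T (1, 0) = 0"
  shows "\<exists>P. polymap_le (N - 1) (\<phi> \<circ> shear P)"
proof -
  obtain M U H v H' v' z2 where *: "mtop M \<phi>i U" "M \<ge> 2" "v \<noteq> 0" "v' \<noteq> 0"
    "\<And>z. T z = cs (H z) v" "qhom 1 1 N H" "H z1 \<noteq> 0"
    "\<And>z. U z = cs (H' z) v'" "qhom 1 1 M H'" "H' z2 \<noteq> 0"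
    "\<And>z. H z = 0 \<Longrightarrow> z \<noteq> 0 \<Longrightarrow> dt v' z = 0"
  proof (rule aut_tops[OF ap T], goal_cases)
    case (1 M U H v H' v' z2)
    show ?case by (rule 1(1)[OF 1(2,3,5-13)])
  qed
  have "H (1, 0) = 0" using bad *(3) by (simp add: *(5))
  then have "dt v' (1, 0) = 0" by (rule *(11)) (simp add: prod_eq_iff)
  then have s0: "snd v' = 0" by (simp add: dt_def)
  define k where "k = fst v'"
  have v': "v' = cs k (1, 0)" and k0: "k \<noteq> 0" using s0 *(4) by (auto simp: k_def cs_def prod_eq_iff)
  obtain w where "dt v w \<noteq> 0" using dt_partner[OF *(3)] by blast
  then obtain L L' where L: "isolin L L'" "L v = (1, 0)" using isolin_exists by blast
  note Lap = isolin_autpair[OF L(1)]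
  have tL: "mtop 1 L L" "mtop 1 L' L'" using L(1) by (auto simp: isolin_def)
  have N1: "N \<ge> 1" and M1: "M \<ge> 1" using T(3) *(2) by auto
  have t1: "mtop N (L \<circ> \<phi>) (L \<circ> T)" using mtop_compose[OF tL(1) T(1) N1] by simp
  have t2: "mtop M (\<phi>i \<circ> L') (U \<circ> L')" using mtop_compose[OF *(1) tL(2)] by simp
  have "\<exists>P. polymap_le (N - 1) ((L \<circ> \<phi>) \<circ> shear P)"
  proof (rule jung_core[OF autpair_comp[OF Lap ap] t1 _ *(7) T(3) *(6) t2 _ _ *(2) qhom_isolin(2)[OF L(1) *(9)]])
    show "(L \<circ> T) z = cs (H z) (1, 0)" for z by (simp add: *(5) isolin_cs[OF L(1)] L(2))
    show "(U \<circ> L') z = cs (k * H' (L' z)) (1, 0)" for z by (simp add: *(8) v' mult.commute)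
    show "k * H' (L' (L z2)) \<noteq> 0" using k0 *(10) by (simp add: autpairD(2)[OF Lap])
  qed
  then obtain P where P: "polymap_le (N - 1) ((L \<circ> \<phi>) \<circ> shear P)" by blast
  have "polymap_le (1 * (N - 1)) (L' \<circ> ((L \<circ> \<phi>) \<circ> shear P))"
    using polymap_le_comp[OF _ P] tL(2) polymap_le_iff_mtop T(3) by fastforce
  moreover have "L' \<circ> ((L \<circ> \<phi>) \<circ> shear P) = \<phi> \<circ> shear P" by (auto simp: autpairD(2)[OF Lap])
  ultimately show ?thesis by auto
qed

subsection \<open>Conjugation to a map that is regular at infinity\<close>

lemma mtop_shear_high:
  assumes "degree P \<ge> 2"
  shows "mtop (degree P) (shear P) (\<lambda>z. (lead_coeff P * snd z ^ degree P, 0))"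
proof (rule mtop_growth[OF polymap_shear])
  fix z :: "complex \<times> complex"
  define s where "s = degree P"
  have lin: "(\<lambda>n. of_nat n * c / (of_nat n :: complex) ^ s) \<longlonglongrightarrow> 0" for c :: complex
    by (rule Lim_transform_eventually[OF tendsto_inverse_power_nat[of "s - 1" c]])
       (use assms in \<open>simp add: s_def\<close>, use eventually_gt_at_top[of 0] in eventually_elim,
        use assms in \<open>simp add: s_def power_eq_if[of _ "degree P"] numeral_2_eq_2\<close>)
  have "(\<lambda>n. (\<Sum>j\<le>s. coeff P j * snd z ^ j * of_nat n ^ j) / of_nat n ^ s) \<longlonglongrightarrow> coeff P s * snd z ^ s"
    by (rule lead_tendsto[OF of_nat_at_infinity]) auto
  then have "(\<lambda>n. of_nat n * fst z / of_nat n ^ s + (\<Sum>j\<le>s. coeff P j * snd z ^ j * of_nat n ^ j) / of_nat n ^ s) \<longlonglongrightarrow> 0 + coeff P s * snd z ^ s"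
    by (intro tendsto_add lin)
  moreover have "poly P (of_nat n * snd z) = (\<Sum>j\<le>s. coeff P j * snd z ^ j * of_nat n ^ j)" for n
    by (simp add: poly_altdef s_def power_mult_distrib mult_ac)
  ultimately show "(\<lambda>n. fst (shear P (cs (of_nat n) z)) / of_nat n ^ degree P) \<longlonglongrightarrow> fst (lead_coeff P * snd z ^ degree P, 0)"
    by (simp add: shear_def s_def add_divide_distrib)
  show "(\<lambda>n. snd (shear P (cs (of_nat n) z)) / of_nat n ^ degree P) \<longlonglongrightarrow> snd (lead_coeff P * snd z ^ degree P, 0 :: complex)"
    using lin[of "snd z"] by (simp add: shear_def s_def)
qed

lemma mtop_shear_low:
  assumes "degree P \<le> 1"
  shows "mtop 1 (shear P) (\<lambda>z. (fst z + coeff P 1 * snd z, snd z))"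
proof (rule mtop_growth[OF polymap_shear])
  fix z :: "complex \<times> complex"
  have P: "poly P y = coeff P 0 + coeff P 1 * y" for y
    using assms by (cases "degree P") (auto simp: poly_altdef coeff_eq_0)
  have c: "(\<lambda>n. fst z + coeff P 1 * snd z + coeff P 0 / of_nat n ^ 1) \<longlonglongrightarrow> fst z + coeff P 1 * snd z + 0"
    by (intro tendsto_add tendsto_const tendsto_inverse_power_nat) auto
  have "eventually (\<lambda>n. fst z + coeff P 1 * snd z + coeff P 0 / of_nat n ^ 1 = fst (shear P (cs (of_nat n) z)) / of_nat n ^ 1) sequentially"
    using eventually_gt_at_top[of 0] by eventually_elim (simp add: shear_def P add_divide_distrib)
  then show "(\<lambda>n. fst (shear P (cs (of_nat n) z)) / of_nat n ^ 1) \<longlonglongrightarrow> fst (fst z + coeff P 1 * snd z, snd z)"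
    using Lim_transform_eventually[OF c] by simp
  show "(\<lambda>n. snd (shear P (cs (of_nat n) z)) / of_nat n ^ 1) \<longlonglongrightarrow> snd (fst z + coeff P 1 * snd z, snd z)"
    by (rule Lim_transform_eventually[OF tendsto_const])
       (use eventually_gt_at_top[of 0] in eventually_elim, simp add: shear_def)
qed

text \<open>The degrees of the iterates are bounded.\<close>

definition bounded_degrees :: "(complex \<times> complex \<Rightarrow> complex \<times> complex) \<Rightarrow> bool" where
  "bounded_degrees g \<longleftrightarrow> (\<exists>C. \<forall>n. polymap_le C (g ^^ n))"

lemma bounded_degrees_conj:
  assumes "bounded_degrees g" "autpair \<phi> \<phi>i" shows "bounded_degrees (\<phi> \<circ> g \<circ> \<phi>i)"
proof -
  obtain C where C: "\<And>n. polymap_le C (g ^^ n)" using assms(1) unfolding bounded_degrees_def by blast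
  obtain K where K: "polymap_le K \<phi>" using polymap_le_degree autpairD(3)[OF assms(2)] by blast
  obtain K' where K': "polymap_le K' \<phi>i" "K' \<ge> 1"
    using polymap_le_degree[OF autpairD(4)[OF assms(2)]] aut_top_exists(1)[OF autpair_sym[OF assms(2)]] by blast
  have "polymap_le (K * (Suc C * K')) (\<phi> \<circ> (g ^^ n \<circ> \<phi>i))" for n
    by (intro polymap_le_comp K K' polymap_le_weaken[OF C]) (use K' in auto)
  then show ?thesis unfolding bounded_degrees_def conj_funpow[OF assms(2)] o_assoc by blast
qed

lemma poly2_le_1_affine: "poly2_le 1 h \<Longrightarrow> \<exists>\<alpha> \<beta> \<gamma>. \<forall>z. h z = \<alpha> * fst z + \<beta> * snd z + \<gamma>"
proof -
  assume "poly2_le 1 h"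
  then obtain a where a: "\<And>x y. h (x, y) = (\<Sum>i\<le>1. \<Sum>j\<le>1 - i. a i j * x ^ i * y ^ j)"
    unfolding poly2_le_def by blast
  have "h z = a 1 0 * fst z + a 0 1 * snd z + a 0 0" for z
    using a[of "fst z" "snd z"] by (simp add: algebra_simps)
  then show ?thesis by blast
qed

lemma triangular_bounded_degrees:
  assumes "\<And>z. g z = (k * fst z + poly R (snd z), \<beta> * snd z + \<gamma>)"
  shows "bounded_degrees g"
proof -
  define s where "s = max 1 (degree R)"
  have tri: "\<exists>k' R' \<beta>' \<gamma>'. degree R' \<le> s \<and> (\<forall>z. (g ^^ n) z = (k' * fst z + poly R' (snd z), \<beta>' * snd z + \<gamma>'))" for n
  proof (induction n)
    case 0
    show ?case by (rule exI[of _ 1], rule exI[of _ 0], rule exI[of _ 1], rule exI[of _ 0]) (auto simp: s_def)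
  next
    case (Suc n)
    then obtain k' R' \<beta>' \<gamma>' where *: "degree R' \<le> s" "\<And>z. (g ^^ n) z = (k' * fst z + poly R' (snd z), \<beta>' * snd z + \<gamma>')" by blast
    define R'' where "R'' = smult k R' + pcompose R [:\<gamma>', \<beta>':]"
    have "degree (pcompose R [:\<gamma>', \<beta>':]) \<le> degree R * degree [:\<gamma>', \<beta>':]" by (rule degree_pcompose_le)
    also have "\<dots> \<le> degree R" by simp
    finally have "degree R'' \<le> s" unfolding R''_def s_def
      using *(1) degree_smult_le[of k R'] by (intro degree_add_le) (auto simp: s_def)
    moreover have "(g ^^ Suc n) z = (k * k' * fst z + poly R'' (snd z), \<beta> * \<beta>' * snd z + (\<beta> * \<gamma>' + \<gamma>))" for z
      by (simp add: assms *(2) R''_def poly_pcompose algebra_simps)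
    ultimately show ?case by blast
  qed
  have "polymap_le s (g ^^ n)" for n
  proof -
    obtain k' R' \<beta>' \<gamma>' where *: "degree R' \<le> s" "\<And>z. (g ^^ n) z = (k' * fst z + poly R' (snd z), \<beta>' * snd z + \<gamma>')"
      using tri by blast
    have s1: "s \<ge> 1" by (simp add: s_def)
    have "(\<lambda>z. fst ((g ^^ n) z)) = (\<lambda>z. k' * mono2 (1, 0) z + (\<Sum>i\<le>degree R'. coeff R' i * mono2 (0, i) z))"
      by (simp add: *(2) mono2_def poly_altdef)
    moreover have "poly2_le s \<dots>"
      by (intro poly2_le_add poly2_le_sum poly2_le_mono2) (use s1 *(1) in auto)
    ultimately have 1: "poly2_le s (\<lambda>z. fst ((g ^^ n) z))" by simp
    have "(\<lambda>z. snd ((g ^^ n) z)) = (\<lambda>z. \<beta>' * mono2 (0, 1) z + \<gamma>' * mono2 (0, 0) z)"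
      by (simp add: *(2) mono2_def)
    moreover have "poly2_le s \<dots>"
      by (intro poly2_le_add poly2_le_mono2) (use s1 in auto)
    ultimately have "poly2_le s (\<lambda>z. snd ((g ^^ n) z))" by simp
    with 1 show ?thesis unfolding polymap_le_def by blast
  qed
  then show ?thesis unfolding bounded_degrees_def by blast
qed

text \<open>If the degrees of the iterates are unbounded, then the map is conjugate to a map \<open>g\<close> of degree at
  least two whose top form \<open>T\<close> satisfies \<open>T \<circ> T \<noteq> 0\<close>: the point to which \<open>g\<close> contracts the line at
  infinity is not a point of indeterminacy. Any \<open>g\<close> of least degree in the conjugacy class will do.\<close>

lemma regular_conjugate:
  assumes ap: "autpair f fi" and nb: "\<not> bounded_degrees f"
  obtains g gi \<phi> \<phi>i N T where "autpair g gi" "autpair \<phi> \<phi>i" "f = \<phi> \<circ> g \<circ> \<phi>i" "mtop N g T" "N \<ge> 2" "\<exists>z. T (T z) \<noteq> 0"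
proof -
  define C where "C = (\<lambda>g. \<exists>gi \<phi> \<phi>i. autpair g gi \<and> autpair \<phi> \<phi>i \<and> f = \<phi> \<circ> g \<circ> \<phi>i)"
  have Cf: "C f" unfolding C_def using ap autpair_id by (metis comp_id id_comp)
  have Cconj: "C (\<theta>i \<circ> g \<circ> \<theta>)" if "C g" "autpair \<theta> \<theta>i" for g \<theta> \<theta>i
  proof -
    obtain gi \<phi> \<phi>i where *: "autpair g gi" "autpair \<phi> \<phi>i" "f = \<phi> \<circ> g \<circ> \<phi>i" using \<open>C g\<close> unfolding C_def by blast
    have "autpair (\<theta>i \<circ> g \<circ> \<theta>) (\<theta>i \<circ> (gi \<circ> \<theta>))"
      by (rule autpair_comp[OF autpair_comp[OF autpair_sym[OF that(2)] *(1)] that(2)])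
    moreover have "autpair (\<phi> \<circ> \<theta>) (\<theta>i \<circ> \<phi>i)" by (rule autpair_comp[OF *(2) that(2)])
    moreover have "f = (\<phi> \<circ> \<theta>) \<circ> (\<theta>i \<circ> g \<circ> \<theta>) \<circ> (\<theta>i \<circ> \<phi>i)"
      by (auto simp: *(3) autpairD[OF that(2)])
    ultimately show ?thesis unfolding C_def by blast
  qed
  obtain g where g: "C g" "\<And>g'. C g' \<Longrightarrow> polymap_degree g \<le> polymap_degree g'"
    using ex_has_least_nat[of C f polymap_degree] Cf by blast
  obtain gi \<phi> \<phi>i where g': "autpair g gi" "autpair \<phi> \<phi>i" "f = \<phi> \<circ> g \<circ> \<phi>i" using g(1) unfolding C_def by blast
  define N where "N = polymap_degree g"
  obtain T z1 where T: "mtop N g T" "T z1 \<noteq> 0" "N \<ge> 1" using aut_top_exists[OF g'(1)] unfolding N_def by blast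
  have nbg: "\<not> bounded_degrees g'" if "C g'" for g'
    using that nb bounded_degrees_conj unfolding C_def by blast
  have N2: "N \<ge> 2"
  proof (rule ccontr)
    assume "\<not> ?thesis"
    then have "N = 1" using T by simp
    have "polymap_le 1 (g ^^ n)" for n
    proof (induction n)
      case 0
      have "mtop 1 id id" by (rule mtop_linear[OF polymap_id]) simp
      then show ?case unfolding funpow.simps(1) polymap_le_iff_mtop by blast
    next
      case (Suc n)
      have "polymap_le 1 g" using T(1) \<open>N = 1\<close> polymap_le_iff_mtop by blast
      then have "polymap_le (1 * 1) (g \<circ> g ^^ n)" by (rule polymap_le_comp[OF _ Suc]) simp
      then show ?case unfolding funpow.simps(2) mult_1_left .
    qed
    then show False using nbg[OF g(1)] unfolding bounded_degrees_def by blast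
  qed
  have "\<exists>z. T (T z) \<noteq> 0"
  proof (rule ccontr)
    assume bad: "\<not> ?thesis"
    obtain H v where *: "v \<noteq> 0" "\<And>z. T z = cs (H z) v" "qhom 1 1 N H" "H z1 \<noteq> 0"
    proof (rule aut_tops[OF g'(1) T(1,2) N2], goal_cases)
      case (1 M U H v H' v' z2)
      show ?case by (rule 1(1)[OF 1(5,7-9)])
    qed
    have "T (cs (H z1) v) = 0" using bad *(2) by metis
    then have Tv: "T v = 0" using mtop_cs[OF T(1) *(4), of v] *(4) by simp
    obtain w where "dt v w \<noteq> 0" using dt_partner[OF *(1)] by blast
    then obtain L L' where L: "isolin L L'" "L v = (1, 0)" using isolin_exists by blast
    note Lap = isolin_autpair[OF L(1)]
    have tL: "mtop 1 L L" "mtop 1 L' L'" using L(1) by (auto simp: isolin_def)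
    define g1 where "g1 = L \<circ> g \<circ> L'"
    define T1 where "T1 = L \<circ> T \<circ> L'"
    have Cg1: "C g1" unfolding g1_def by (rule Cconj[OF g(1) autpair_sym[OF Lap]])
    have t1: "mtop N g1 T1"
      using mtop_compose[OF mtop_compose[OF tL(1) T(1,3)] tL(2)] by (simp add: g1_def T1_def)
    have ap1: "\<exists>g1i. autpair g1 g1i" using Cg1 unfolding C_def by blast
    then obtain g1i where ap1: "autpair g1 g1i" by blast
    have T1z: "T1 z = cs (H (L' z)) (1, 0)" for z
      by (simp add: T1_def *(2) isolin_cs[OF L(1)] L(2))
    have "L' (1, 0) = v" using autpairD(2)[OF Lap, of v] L(2) by simp
    then have T10: "T1 (1, 0) = 0" using Tv isolin_cs(1)[OF L(1), of 0 0] by (simp add: T1_def)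
    have T1nz: "T1 (L z1) \<noteq> 0" using *(4) by (simp add: T1z autpairD(2)[OF Lap] prod_eq_iff)
    have dg1: "polymap_degree g1 = N" by (rule mtop_degree[OF t1 T1nz])
    obtain P where P: "\<And>Q. polymap_degree (g1 \<circ> shear P) \<le> polymap_degree (g1 \<circ> shear Q)"
      using ex_has_least_nat[of "\<lambda>_. True" 0 "\<lambda>P. polymap_degree (g1 \<circ> shear P)"] by blast
    define g2 where "g2 = g1 \<circ> shear P"
    have ap2: "autpair g2 (shear (- P) \<circ> g1i)" unfolding g2_def by (rule autpair_comp[OF ap1 autpair_shear])
    define N' where "N' = polymap_degree g2"
    obtain T' z' where T': "mtop N' g2 T'" "T' z' \<noteq> 0" "N' \<ge> 1"
      using aut_top_exists[OF ap2] unfolding N'_def by blast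
    have e10: "(1, 0) \<noteq> (0 :: complex \<times> complex)" by (simp add: prod_eq_iff)
    \<comment> \<open>Now \<open>g1 = g2 \<circ> shear (- P)\<close> with \<open>g2\<close> of least degree. If the top form \<open>T'\<close> of \<open>g2\<close> vanished at
      \<open>(1, 0)\<close>, then a further shear would lower this degree.\<close>
    have T'10: "T' (1, 0) \<noteq> 0"
    proof
      assume z: "T' (1, 0) = 0"
      have N'2: "N' \<ge> 2" by (rule aut_top_kernel_degree[OF ap2 T'(1) z e10 T'(3)])
      obtain Q where "polymap_le (N' - 1) (g2 \<circ> shear Q)" using jung_step[OF ap2 T'(1,2) N'2 z] by blast
      then have "polymap_degree (g1 \<circ> shear (P + Q)) \<le> N' - 1"
        using polymap_degree_le unfolding g2_def o_assoc[symmetric] shear_comp by blast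
      moreover have "N' \<le> polymap_degree (g1 \<circ> shear (P + Q))" unfolding N'_def g2_def by (rule P)
      ultimately show False using N'2 by simp
    qed
    have g1eq: "g1 = g2 \<circ> shear (- P)" by (auto simp: g2_def autpairD(1)[OF autpair_shear])
    define s where "s = degree P"
    define l where "l = lead_coeff (- P)"
    \<comment> \<open>A shear of degree at most one is affine and its linear part fixes \<open>(1, 0)\<close>, where \<open>T1\<close> vanishes
      but \<open>T'\<close> does not.\<close>
    have s2: "s \<ge> 2"
    proof (rule ccontr)
      assume "\<not> ?thesis"
      then have "degree (- P) \<le> 1" by (simp add: s_def)
      note low = mtop_compose[OF T'(1) mtop_shear_low[OF this] order_refl, folded g1eq, simplified mult_1_right]
      have nz: "(T' \<circ> (\<lambda>z. (fst z + coeff (- P) 1 * snd z, snd z))) (1, 0) \<noteq> 0" using T'10 by simp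
      have "N' = N" using mtop_degree[OF low nz] dg1 by simp
      then show False using mtop_unique[OF t1, of _ "(1, 0)"] low nz T10 by metis
    qed
    then have ms: "mtop s (shear (- P)) (\<lambda>z. (l * snd z ^ s, 0))"
      using mtop_shear_high[of "- P"] by (simp add: s_def l_def)
    have l0: "l \<noteq> 0" using s2 by (auto simp: l_def s_def)
    have s1: "s \<ge> 1" using s2 by simp
    note t2 = mtop_compose[OF T'(1) ms s1, folded g1eq]
    have T'l: "T' (c, 0) = cs (c ^ N') (T' (1, 0))" if "c \<noteq> 0" for c
      using mtop_cs[OF T'(1) that, of "(1, 0)"] by (simp add: cs_def)
    have nz: "(T' \<circ> (\<lambda>z. (l * snd z ^ s, 0))) (0 :: complex, 1) \<noteq> 0"
      using T'l[OF l0] l0 T'10 by simp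
    \<comment> \<open>Comparison of the top forms of \<open>g1\<close> and \<open>g2 \<circ> shear (- P)\<close>.\<close>
    have NN: "N = N' * s" using mtop_degree[OF t2 nz] dg1 by simp
    have "T1 (0, 1) = (T' \<circ> (\<lambda>z. (l * snd z ^ s, 0))) (0 :: complex, 1)"
      by (rule mtop_unique[OF t1 t2[folded NN], of "(0, 1)"])
    then have "cs (H (L' (0, 1))) (1, 0) = cs (l ^ N') (T' (1, 0))" using T'l[OF l0] by (simp add: T1z)
    then have "snd (cs (l ^ N') (T' (1, 0))) = 0" by (metis snd_conv snd_cs mult_zero_right)
    then have "snd (T' (1, 0)) = 0" using l0 by simp
    then have T'line: "\<exists>k. k \<noteq> 0 \<and> T' (1, 0) = cs k (1, 0)"
      using T'10 by (intro exI[of _ "fst (T' (1, 0))"]) (auto simp: prod_eq_iff)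
    then obtain k where k: "k \<noteq> 0" "T' (1, 0) = cs k (1, 0)" by blast
    show False
    proof (cases "N' = 1")
      case True
      \<comment> \<open>Then \<open>g1\<close> is triangular.\<close>
      have "poly2_le 1 (\<lambda>z. fst (g2 z))" "poly2_le 1 (\<lambda>z. snd (g2 z))"
        using T'(1) True polymap_le_iff_mtop unfolding polymap_le_def by blast+
      then obtain \<alpha> \<beta> \<gamma> \<alpha>' \<beta>' \<gamma>' where a: "\<And>z. fst (g2 z) = \<alpha> * fst z + \<beta> * snd z + \<gamma>" "\<And>z. snd (g2 z) = \<alpha>' * fst z + \<beta>' * snd z + \<gamma>'"
        using poly2_le_1_affine by metis
      have "(\<lambda>n. snd (g2 (cs (of_nat n) (1, 0))) / of_nat n ^ 1) \<longlonglongrightarrow> snd (T' (1, 0))"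
        using mtop_tendsto(2)[OF T'(1) of_nat_at_infinity tendsto_const[of "(1, 0)"]] True by simp
      moreover have "(\<lambda>n. snd (g2 (cs (of_nat n) (1, 0))) / of_nat n ^ 1) \<longlonglongrightarrow> \<alpha>' + 0"
      proof (rule Lim_transform_eventually[OF tendsto_add[OF tendsto_const tendsto_inverse_power_nat[of 1 \<gamma>']]])
        show "\<forall>\<^sub>F n in sequentially. \<alpha>' + \<gamma>' / of_nat n ^ 1 = snd (g2 (cs (of_nat n) (1, 0))) / of_nat n ^ 1"
          using eventually_gt_at_top[of 0] by eventually_elim (simp add: a field_simps)
      qed simp
      ultimately have "snd (T' (1, 0)) = \<alpha>'" using LIMSEQ_unique by fastforce
      then have \<alpha>': "\<alpha>' = 0" by (simp add: k(2))
      have "g1 z = (\<alpha> * fst z + poly (smult \<alpha> (- P) + [:\<gamma>, \<beta>:]) (snd z), \<beta>' * snd z + \<gamma>')" for z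
        by (simp add: g1eq prod_eq_iff a shear_def \<alpha>' algebra_simps)
      then show False using triangular_bounded_degrees nbg[OF Cg1] by blast
    next
      case False
      \<comment> \<open>The conjugate \<open>shear (- P) \<circ> g2\<close> of \<open>g1\<close> has degree less than \<open>s N' = N\<close>, since \<open>T'\<close> takes its values
        in the \<open>x\<close>-axis, where the top form of the shear vanishes.\<close>
      then have N'2: "N' \<ge> 2" using T'(3) by simp
      obtain H2 v2 where H2: "v2 \<noteq> 0" "\<And>z. T' z = cs (H2 z) v2"
      proof (rule aut_tops[OF ap2 T'(1,2) N'2], goal_cases)
        case (1 M U H v H' v' z2)
        show ?case by (rule 1(1)[OF 1(5,7)])
      qed
      have "snd v2 = 0" using k H2(2)[of "(1, 0)"] by (auto simp: prod_eq_iff cs_def)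
      then have sT': "snd (T' z) = 0" for z by (simp add: H2)
      have "Suc (N - 1) = N" using N2 by simp
      then have "Suc (N - 1) = s * N'" unfolding NN by (simp only: mult.commute)
      then have "mtop (Suc (N - 1)) (shear (- P) \<circ> g2) ((\<lambda>z. (l * snd z ^ s, 0)) \<circ> T')"
        using mtop_compose[OF ms T'(1) T'(3)] by (simp only:)
      moreover have "((\<lambda>z. (l * snd z ^ s, 0)) \<circ> T') z = 0" for z using s1 by (simp add: sT' prod_eq_iff power_0_left)
      ultimately have "polymap_le (N - 1) (shear (- P) \<circ> g2)"
        by (rule mtop_zero_lower)
      then have "polymap_degree (shear (- P) \<circ> g2) \<le> N - 1" by (rule polymap_degree_le)
      moreover have "C (shear (- P) \<circ> g1 \<circ> shear P)" by (rule Cconj[OF Cg1 autpair_shear])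
      then have "N \<le> polymap_degree (shear (- P) \<circ> g2)" unfolding N_def g2_def o_assoc by (rule g(2))
      ultimately show False using N2 by simp
    qed
  qed
  then show ?thesis using that g' T(1) N2 by blast
qed

lemma hom_one_zero_fst:
  assumes H: "qhom 1 1 N H" "N \<ge> 1" and z: "\<And>z. H z = 0 \<Longrightarrow> z \<noteq> 0 \<Longrightarrow> fst z = 0"
  shows "H z = H (1, 0) * fst z ^ N"
proof -
  have b: "bipoly (\<lambda>z. H (snd z, fst z))"
    by (rule bipoly_compose[OF qhom_bipoly[OF H(1)] bipoly_snd bipoly_fst])
  have q: "qhom 1 1 N (\<lambda>z. H (snd z, fst z))"
    unfolding qhom_def
  proof (intro conjI allI impI b)
    fix r z assume "(r::complex) \<noteq> 0"
    from qhomD[OF H(1) this, of "(snd z, fst z)"]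
    show "H (snd (dil 1 1 r z), fst (dil 1 1 r z)) = r ^ N * H (snd z, fst z)" by (simp add: dil_def)
  qed
  have z': "snd w = 0" if "H (snd w, fst w) = 0" "w \<noteq> 0" for w
    using z[of "(snd w, fst w)"] that by (auto simp: prod_eq_iff)
  show ?thesis using hom_one_zero[OF q H(2) z', of "(snd z, fst z)"] by simp
qed

text \<open>Among the conjugacies \<open>\<phi> g\<^sup>m\<close> from \<open>g\<close> to \<open>f\<close> one has a top form that does not vanish at the
  point to which \<open>g\<close> contracts the line at infinity; in suitable linear coordinates this point is
  \<open>(0, 1)\<close> and the corresponding point for \<open>g\<^sup>-\<^sup>1\<close> is \<open>(1, 0)\<close>.\<close>

lemma adapted_conjugate:
  assumes ap: "autpair f fi" and nb: "\<not> bounded_degrees f"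
  shows "\<exists>g gi \<phi> \<phi>i N M K h b t. autpair g gi \<and> autpair \<phi> \<phi>i \<and> f = \<phi> \<circ> g \<circ> \<phi>i \<and> N \<ge> 2 \<and> M \<ge> 2 \<and> K \<ge> 1 \<and>
     mtop N g (\<lambda>z. (0, h * snd z ^ N)) \<and> h \<noteq> 0 \<and> mtop M gi (\<lambda>z. (b * fst z ^ M, 0)) \<and> b \<noteq> 0 \<and>
     mtop K \<phi> t \<and> t (0, 1) \<noteq> 0"
proof -
  obtain g gi \<phi>0 \<phi>0i N T where g: "autpair g gi" "autpair \<phi>0 \<phi>0i" "f = \<phi>0 \<circ> g \<circ> \<phi>0i" "mtop N g T" "N \<ge> 2" "\<exists>z. T (T z) \<noteq> 0"
    by (rule regular_conjugate[OF ap nb]) (rule that)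
  obtain z1 where z1: "T (T z1) \<noteq> 0" using g(6) by blast
  have N1: "N \<ge> 1" using g(5) by simp
  obtain M U H v H' v' z2 where A: "mtop M gi U" "M \<ge> 2" "v \<noteq> 0" "v' \<noteq> 0"
    "\<And>z. T z = cs (H z) v" "qhom 1 1 N H" "\<And>z. U z = cs (H' z) v'" "qhom 1 1 M H'" "H' z2 \<noteq> 0"
    "\<And>z. H z = 0 \<Longrightarrow> z \<noteq> 0 \<Longrightarrow> dt v' z = 0" "\<And>z. H' z = 0 \<Longrightarrow> z \<noteq> 0 \<Longrightarrow> dt v z = 0" "H v' = 0"
  proof (rule aut_tops[OF g(1,4) z1 g(5)], goal_cases)
    case (1 M U H v H' v' z2)
    show ?case by (rule 1(1)[OF 1(2,3,5-8,10-15)])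
  qed
  have M1: "M \<ge> 1" using A(2) by simp
  have "T z1 = cs (H z1) v" by (rule A(5))
  then have "H (cs (H z1) v) \<noteq> 0" using z1 A(5)[of "T z1"] by auto
  then have Hv: "H v \<noteq> 0" using qhom_cs[OF A(6) N1, of "H z1" v] by auto
  then have Tv: "T v \<noteq> 0" using A(3) by (simp add: A(5))
  \<comment> \<open>Let \<open>m\<close> make the degree of \<open>\<phi>\<^sup>-\<^sup>1 = g\<^sup>-\<^sup>m \<phi>\<^sub>0\<^sup>-\<^sup>1\<close> minimal; the conjugacy to use is the one for \<open>m + 1\<close>.
    If its top form vanished at \<open>v\<close>, then its inverse would contract the line at infinity to the point of
    \<open>v\<close>, and since \<open>T v \<noteq> 0\<close> one step back to \<open>m\<close> would multiply the degree by \<open>N\<close>.\<close>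
  define D where "D = (\<lambda>k. polymap_degree (gi ^^ k \<circ> \<phi>0i))"
  obtain m where m: "\<And>k. D m \<le> D k" using ex_has_least_nat[of "\<lambda>_. True" 0 D] by blast
  define \<phi> \<phi>i where "\<phi> = \<phi>0 \<circ> g ^^ Suc m" and "\<phi>i = gi ^^ Suc m \<circ> \<phi>0i"
  have ap\<phi>: "autpair \<phi> \<phi>i" unfolding \<phi>_def \<phi>i_def by (rule autpair_comp[OF g(2) autpair_funpow[OF g(1)]])
  have f: "f = \<phi> \<circ> g \<circ> \<phi>i"
  proof
    fix z
    have "(g ^^ Suc m) (g ((gi ^^ Suc m) w)) = g ((g ^^ Suc m) ((gi ^^ Suc m) w))" for w
      by (metis comp_apply funpow_swap1)
    then show "f z = (\<phi> \<circ> g \<circ> \<phi>i) z"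
      using autpairD(1)[OF autpair_funpow[OF g(1)], of "Suc m"] by (simp only: g(3) \<phi>_def \<phi>i_def o_apply)
  qed
  define K where "K = polymap_degree \<phi>"
  obtain t z3 where t: "mtop K \<phi> t" "t z3 \<noteq> 0" and K1: "K \<ge> 1" using aut_top_exists[OF ap\<phi>] unfolding K_def by blast
  have tv: "t v \<noteq> 0"
  proof
    assume bad: "t v = 0"
    have K2: "K \<ge> 2" by (rule aut_top_kernel_degree[OF ap\<phi> t(1) bad A(3) K1])
    obtain M2 U2 H2 v2 H2' v2' y2 where B: "mtop M2 \<phi>i U2" "M2 \<ge> 2" "M2 = polymap_degree \<phi>i" "v2 \<noteq> 0" "v2' \<noteq> 0"
      "\<And>z. t z = cs (H2 z) v2" "\<And>z. U2 z = cs (H2' z) v2'" "H2' y2 \<noteq> 0" "\<And>z. H2 z = 0 \<Longrightarrow> z \<noteq> 0 \<Longrightarrow> dt v2' z = 0"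
    proof (rule aut_tops[OF ap\<phi> t K2], goal_cases)
      case (1 M U H v H' v' z2)
      show ?case by (rule 1(1)[OF 1(2-7,10,12,13)])
    qed
    have "H2 v = 0" using bad B(4) by (simp add: B(6))
    then obtain c where c: "v = cs c v2'" using B(9) A(3) dt_0D B(5) by blast
    then have c0: "c \<noteq> 0" using A(3) by auto
    have "T v2' \<noteq> 0" using Tv mtop_cs[OF g(4) c0, of v2'] by (simp add: c)
    then have nz: "(T \<circ> U2) y2 \<noteq> 0" using mtop_cs[OF g(4) B(8), of v2'] B(8) by (simp add: B(7))
    have "mtop (N * M2) (g \<circ> \<phi>i) (T \<circ> U2)" by (rule mtop_compose[OF g(4) B(1)]) (use B(2) in simp)
    then have "polymap_degree (g \<circ> \<phi>i) = N * M2" using nz by (rule mtop_degree)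
    moreover have "g \<circ> \<phi>i = gi ^^ m \<circ> \<phi>0i" by (rule ext) (simp add: \<phi>i_def autpairD(1)[OF g(1)])
    ultimately have "D m = N * D (Suc m)" using B(3) by (simp add: D_def \<phi>i_def)
    moreover have "D (Suc m) \<ge> 2" using B(2,3) by (simp add: D_def \<phi>i_def)
    moreover have "2 * D (Suc m) \<le> N * D (Suc m)" using g(5) by simp
    ultimately show False using m[of "Suc m"] by linarith
  qed
  have ne: "dt v' v \<noteq> 0"
  proof
    assume "dt v' v = 0"
    then obtain c where "v = cs c v'" using dt_0D A(4) by blast
    then show False using Hv qhom_cs[OF A(6) N1, of c v'] A(12) by simp
  qed
  obtain L L' where L: "isolin L L'" "L v' = (1, 0)" "L v = (0, 1)" using isolin_exists[OF ne] by blast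
  note Lap = isolin_autpair[OF L(1)]
  have tL: "mtop 1 L L" "mtop 1 L' L'" using L(1) by (auto simp: isolin_def)
  have L'v: "L' (1, 0) = v'" "L' (0, 1) = v" using autpairD(2)[OF Lap] L(2,3) by metis+
  have L'0: "L' z \<noteq> 0" if "z \<noteq> 0" for z
    using autpairD(1)[OF Lap, of z] isolin_cs(1)[OF L(1), of 0 0] that by auto
  define h where "h = H (L' (0, 1))"
  define b where "b = H' (L' (1, 0))"
  have HL0: "1 * H (L' z) = (1 * H (L' (0, 1))) * snd z ^ N" for z
  proof (rule hom_one_zero[OF qhom_isolin(2)[OF L(1) A(6), of 1] N1])
    fix z assume "1 * H (L' z) = 0" "z \<noteq> 0"
    then have "dt v' (L' z) = 0" using A(10) L'0 by simp
    then obtain c where "L' z = cs c v'" using dt_0D A(4) by blast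
    then have "z = cs c (1, 0)" using autpairD(1)[OF Lap, of z] isolin_cs(1)[OF L(1)] L(2) by metis
    then show "snd z = 0" by simp
  qed
  have HL: "H (L' z) = h * snd z ^ N" for z using HL0[of z] unfolding h_def mult_1_left .
  have HL0': "1 * H' (L' z) = (1 * H' (L' (1, 0))) * fst z ^ M" for z
  proof (rule hom_one_zero_fst[OF qhom_isolin(2)[OF L(1) A(8), of 1] M1])
    fix z assume "1 * H' (L' z) = 0" "z \<noteq> 0"
    then have "dt v (L' z) = 0" using A(11) L'0 by simp
    then obtain c where "L' z = cs c v" using dt_0D A(3) by blast
    then have "z = cs c (0, 1)" using autpairD(1)[OF Lap, of z] isolin_cs(1)[OF L(1)] L(3) by metis
    then show "fst z = 0" by simp
  qed
  have HL': "H' (L' z) = b * fst z ^ M" for z using HL0'[of z] unfolding b_def mult_1_left .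
  have h0: "h \<noteq> 0" using Hv by (simp add: h_def L'v)
  have b0: "b \<noteq> 0" using HL'[of "L z2"] A(9) autpairD(2)[OF Lap] by auto
  have 1: "mtop N (L \<circ> g \<circ> L') (\<lambda>z. (0, h * snd z ^ N))"
  proof -
    have "L \<circ> T \<circ> L' = (\<lambda>z. (0, h * snd z ^ N))"
      by (rule ext) (simp add: A(5) isolin_cs[OF L(1)] L(3) HL, simp add: cs_def)
    then show ?thesis using mtop_compose[OF mtop_compose[OF tL(1) g(4) N1] tL(2)] by simp
  qed
  have 2: "mtop M (L \<circ> gi \<circ> L') (\<lambda>z. (b * fst z ^ M, 0))"
  proof -
    have "L \<circ> U \<circ> L' = (\<lambda>z. (b * fst z ^ M, 0))"
      by (rule ext) (simp add: A(7) isolin_cs[OF L(1)] L(2) HL', simp add: cs_def)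
    then show ?thesis using mtop_compose[OF mtop_compose[OF tL(1) A(1) M1] tL(2)] by simp
  qed
  have 3: "mtop K (\<phi> \<circ> L') (t \<circ> L')" using mtop_compose[OF t(1) tL(2)] by simp
  have 4: "(t \<circ> L') (0, 1) \<noteq> 0" using tv by (simp add: L'v)
  have 5: "autpair (L \<circ> g \<circ> L') (L \<circ> gi \<circ> L')"
    unfolding o_assoc[of L gi L', symmetric]
    by (rule autpair_comp[OF autpair_comp[OF Lap g(1)] autpair_sym[OF Lap]])
  have 6: "autpair (\<phi> \<circ> L') (L \<circ> \<phi>i)" by (rule autpair_comp[OF ap\<phi> autpair_sym[OF Lap]])
  have 7: "f = (\<phi> \<circ> L') \<circ> (L \<circ> g \<circ> L') \<circ> (L \<circ> \<phi>i)"
    by (auto simp: f autpairD[OF Lap])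
  show ?thesis
    by (intro exI[of _ "L \<circ> g \<circ> L'"] exI[of _ "L \<circ> gi \<circ> L'"] exI[of _ "\<phi> \<circ> L'"] exI[of _ "L \<circ> \<phi>i"]
        exI[of _ N] exI[of _ M] exI[of _ K] exI[of _ h] exI[of _ b] exI[of _ "t \<circ> L'"]
        conjI 1 2 3 4 5 6 7 h0 b0 g(5) A(2) K1)
qed

section \<open>The Green function of a polynomial automorphism\<close>

subsection \<open>Growth estimates\<close>

lemma poly2_le_growth:
  assumes "poly2_le N h" shows "\<exists>C\<ge>0. \<forall>z. norm (h z) \<le> C * max 1 (norm z) ^ N"
proof -
  obtain a where a: "\<And>z. h z = (\<Sum>t\<in>{t. fst t + snd t \<le> N}. a t * mono2 t z)"
    using assms unfolding poly2_le_iff by blast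
  define C where "C = (\<Sum>t\<in>{t. fst t + snd t \<le> N}. norm (a t))"
  have "norm (h z) \<le> C * max 1 (norm z) ^ N" for z
  proof -
    have "norm (h z) \<le> (\<Sum>t\<in>{t. fst t + snd t \<le> N}. norm (a t) * max 1 (norm z) ^ N)"
      unfolding a
    proof (rule sum_norm_le)
      fix t :: "nat \<times> nat" assume t: "t \<in> {t. fst t + snd t \<le> N}"
      have "norm (mono2 t z) \<le> max 1 (norm z) ^ fst t * max 1 (norm z) ^ snd t"
        unfolding mono2_def norm_mult norm_power
        using norm_fst_le[of "fst z" "snd z"] norm_snd_le[of "snd z" "fst z"]
        by (intro mult_mono power_mono) auto
      also have "\<dots> \<le> max 1 (norm z) ^ N"
        using t by (auto simp flip: power_add intro!: power_increasing)
      finally show "norm (a t * mono2 t z) \<le> norm (a t) * max 1 (norm z) ^ N"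
        by (simp add: norm_mult mult_left_mono)
    qed
    then show ?thesis by (simp add: C_def sum_distrib_right)
  qed
  moreover have "C \<ge> 0" unfolding C_def by (intro sum_nonneg) auto
  ultimately show ?thesis by blast
qed

lemma polymap_le_growth:
  assumes "polymap_le N F" shows "\<exists>C\<ge>1. \<forall>z. norm (F z) \<le> C * max 1 (norm z) ^ N"
proof -
  obtain C C' where C: "C \<ge> 0" "\<And>z. norm (fst (F z)) \<le> C * max 1 (norm z) ^ N"
    "C' \<ge> 0" "\<And>z. norm (snd (F z)) \<le> C' * max 1 (norm z) ^ N"
    using assms poly2_le_growth unfolding polymap_le_def by meson
  have "norm (F z) \<le> (1 + C + C') * max 1 (norm z) ^ N" for z
  proof -
    have "norm (F z) \<le> norm (fst (F z)) + norm (snd (F z))"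
      using norm_Pair_le[of "fst (F z)" "snd (F z)"] by simp
    also have "\<dots> \<le> 1 * max 1 (norm z) ^ N + C * max 1 (norm z) ^ N + C' * max 1 (norm z) ^ N"
      using C(2,4)[of z] by (smt (verit) zero_le_power)
    finally show ?thesis by (simp add: algebra_simps)
  qed
  then show ?thesis using C(1,3) by (intro exI[of _ "1 + C + C'"]) auto
qed

lemma qdec_remainder:
  assumes "qdec 1 1 (Suc n) h W" shows "poly2_le n (\<lambda>z. h z - W (Suc n) z)"
proof -
  have "poly2_le n (W m)" if "m \<le> n" for m
  proof -
    have q: "qhom 1 1 j (\<lambda>z. 0)" for j by (simp add: qhom_def bipoly_const)
    have "qdec 1 1 m (W m) (\<lambda>j z. if j = m then W m z else 0)"
      unfolding qdec_def
    proof (intro conjI allI impI)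
      show "qhom 1 1 j (\<lambda>z. if j = m then W m z else 0)" for j
        using qdec_qhom[OF assms, of m] q[of j] by (cases "j = m") simp_all
    qed auto
    then show ?thesis using that poly2_le_iff_qdec poly2_le_weaken by blast
  qed
  then have "poly2_le n (\<lambda>z. \<Sum>m\<le>n. W m z)" by (intro poly2_le_sum) auto
  then show ?thesis by (simp add: qdec_eq[OF assms])
qed

lemma mtop_remainder:
  assumes "mtop (Suc n) F T"
  shows "\<exists>C\<ge>0. \<forall>z. norm (fst (F z) - fst (T z)) \<le> C * max 1 (norm z) ^ n \<and> norm (snd (F z) - snd (T z)) \<le> C * max 1 (norm z) ^ n"
proof -
  obtain W W' where W: "qdec 1 1 (Suc n) (\<lambda>z. fst (F z)) W" "qdec 1 1 (Suc n) (\<lambda>z. snd (F z)) W'"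
     "T = (\<lambda>z. (W (Suc n) z, W' (Suc n) z))" using assms unfolding mtop_def by blast
  obtain C C' where C: "C \<ge> 0" "\<And>z. norm (fst (F z) - W (Suc n) z) \<le> C * max 1 (norm z) ^ n"
    "C' \<ge> 0" "\<And>z. norm (snd (F z) - W' (Suc n) z) \<le> C' * max 1 (norm z) ^ n"
    using poly2_le_growth[OF qdec_remainder[OF W(1)]] poly2_le_growth[OF qdec_remainder[OF W(2)]] by blast
  have "norm (fst (F z) - fst (T z)) \<le> (C + C') * max 1 (norm z) ^ n \<and> norm (snd (F z) - snd (T z)) \<le> (C + C') * max 1 (norm z) ^ n" for z
  proof -
    have "0 \<le> C * max 1 (norm z) ^ n" "0 \<le> C' * max 1 (norm z) ^ n" using C(1,3) by auto
    then show ?thesis using C(2)[of z] C(4)[of z] by (simp add: W(3) distrib_right)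
  qed
  then show ?thesis using C(1,3) by (intro exI[of _ "C + C'"]) auto
qed

text \<open>With \<open>s = \<bar>y\<bar>\<close>, \<open>m\<close> the norm of the point \<open>(x, y)\<close>, and \<open>U\<close>, \<open>W\<close> the absolute values of the coordinates
  of its image: where \<open>\<bar>y\<bar>\<close> is large and dominates, the second coordinate at least doubles, dominates
  again, and the ratio of the new coordinates is at most a constant times \<open>1 / \<bar>y\<bar>\<close>.\<close>

lemma escape_bounds:
  fixes c C :: real
  assumes c: "c > 0" and C: "C \<ge> 0" and n: "n \<ge> 1"
  shows "\<exists>R\<ge>1. \<forall>s m U W. s \<ge> R \<longrightarrow> m \<le> 2 * s \<longrightarrow> U \<le> C * max 1 m ^ n \<longrightarrow> W \<ge> c * s ^ Suc n - C * max 1 m ^ n \<longrightarrow>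
     U \<le> W \<and> 2 * s \<le> W \<and> U * s \<le> R * W"
proof -
  define D where "D = C * 2 ^ n"
  define R where "R = max 1 (4 * D / c + 4 / c)"
  have D0: "D \<ge> 0" using C by (simp add: D_def)
  have "U \<le> W \<and> 2 * s \<le> W \<and> U * s \<le> R * W"
    if a: "s \<ge> R" "m \<le> 2 * s" "U \<le> C * max 1 m ^ n" "W \<ge> c * s ^ Suc n - C * max 1 m ^ n" for s m U W
  proof -
    have s1: "s \<ge> 1" using a(1) by (simp add: R_def)
    have "max 1 m ^ n \<le> (2 * s) ^ n" using a(2) s1 by (intro power_mono) auto
    then have E: "C * max 1 m ^ n \<le> D * s ^ n"
      using mult_left_mono[OF _ C, of "max 1 m ^ n" "(2 * s) ^ n"] by (simp add: D_def power_mult_distrib mult.assoc)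
    have "4 * D / c + 4 / c \<le> s" using a(1) by (simp add: R_def)
    then have cs: "4 * D + 4 \<le> c * s" using c by (simp add: field_simps)
    have sn: "s ^ n \<ge> s" using s1 n self_le_power by fastforce
    have sn0: "s ^ n \<ge> 0" using s1 by simp
    have q: "(4 * D + 4) * s ^ n \<le> c * s ^ Suc n"
      using mult_right_mono[OF cs sn0] by (simp add: mult.assoc)
    then have q': "4 * (D * s ^ n) + 4 * s ^ n \<le> c * s ^ Suc n" by (simp add: algebra_simps)
    have Ds0: "D * s ^ n \<ge> 0" using D0 sn0 by simp
    have W1: "W \<ge> c * s ^ Suc n - D * s ^ n" using a(4) E by linarith
    have U1: "U \<le> D * s ^ n" using a(3) E by linarith
    have "U * s \<le> D * s ^ n * s" using U1 s1 by (intro mult_right_mono) auto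
    also have "\<dots> = (D / c) * (c * s ^ Suc n)" using c by (simp add: mult_ac)
    also have "\<dots> \<le> (D / c) * (4 * W)"
    proof (rule mult_left_mono)
      show "c * s ^ Suc n \<le> 4 * W" using W1 q' Ds0 sn0 by linarith
    qed (use D0 c in simp)
    also have "\<dots> = (4 * D / c) * W" by simp
    also have "\<dots> \<le> R * W"
    proof (rule mult_right_mono)
      have "4 * D / c \<le> 4 * D / c + 4 / c" using c by simp
      also have "\<dots> \<le> R" unfolding R_def by (rule max.cobounded2)
      finally show "4 * D / c \<le> R" .
      show "0 \<le> W" using W1 q' Ds0 sn0 by linarith
    qed
    finally have "U * s \<le> R * W" .
    moreover have "U \<le> W" "2 * s \<le> W" using U1 W1 q' Ds0 sn sn0 s1 by linarith+
    ultimately show ?thesis by blast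
  qed
  then have "\<forall>s m U W. s \<ge> R \<longrightarrow> m \<le> 2 * s \<longrightarrow> U \<le> C * max 1 m ^ n \<longrightarrow> W \<ge> c * s ^ Suc n - C * max 1 m ^ n \<longrightarrow>
     U \<le> W \<and> 2 * s \<le> W \<and> U * s \<le> R * W" by blast
  moreover have "R \<ge> 1" unfolding R_def by (rule max.cobounded1)
  ultimately show ?thesis by blast
qed

lemma almost_geometric_convergent:
  fixes a :: "nat \<Rightarrow> real"
  assumes N: "N \<ge> 2" and B: "\<And>n. \<bar>a (Suc n) - real N * a n\<bar> \<le> B"
  shows "convergent (\<lambda>n. a n / real N ^ n)"
proof -
  define d where "d = (\<lambda>n. a (Suc n) / real N ^ Suc n - a n / real N ^ n)"
  have d: "norm (d n) \<le> B * (1 / real N) ^ n" for n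
  proof -
    have "d n = (a (Suc n) - real N * a n) / real N ^ Suc n" using N by (simp add: d_def field_simps)
    then have "norm (d n) = \<bar>a (Suc n) - real N * a n\<bar> / real N ^ Suc n" by (simp add: abs_divide)
    also have "\<dots> \<le> B / real N ^ Suc n" using B by (intro divide_right_mono) auto
    also have "\<dots> \<le> B / real N ^ n"
      using B[of 0] N by (intro divide_left_mono) (auto simp: mult_le_cancel_right1)
    finally show ?thesis by (simp add: power_one_over)
  qed
  have "summable (\<lambda>n. B * (1 / real N) ^ n)" using N by (intro summable_mult summable_geometric) auto
  then have "summable d" by (rule summable_comparison_test'[of _ 0]) (use d in auto)
  then have "convergent (\<lambda>n. \<Sum>i<n. d i)" by (simp add: summable_iff_convergent)
  moreover have "(\<Sum>i<n. d i) = a n / real N ^ n - a 0" for n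
    unfolding d_def by (subst sum_lessThan_telescope) simp
  ultimately have "convergent (\<lambda>n. a n / real N ^ n - a 0)" by simp
  then have "convergent (\<lambda>n. (a n / real N ^ n - a 0) + a 0)" by (intro convergent_add convergent_const)
  then show ?thesis by simp
qed

lemma log_plus_eq: "log_plus t = ln (max 1 t)"
  by (auto simp: log_plus_def max_def)

lemma log_plus_nonneg: "log_plus t \<ge> 0"
  by (simp add: log_plus_eq)

lemma log_plus_polymap:
  assumes "polymap_le N F"
  shows "\<exists>C\<ge>0. \<forall>z. log_plus (norm (F z)) \<le> C + real N * log_plus (norm z)"
proof -
  obtain C where C: "C \<ge> 1" "\<And>z. norm (F z) \<le> C * max 1 (norm z) ^ N" using polymap_le_growth[OF assms] by blast
  have "log_plus (norm (F z)) \<le> ln C + real N * log_plus (norm z)" for z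
  proof -
    have 1: "1 \<le> max 1 (norm z) ^ N" by simp
    have "1 * 1 \<le> C * max 1 (norm z) ^ N" using C(1) 1 by (intro mult_mono) auto
    then have "max 1 (norm (F z)) \<le> C * max 1 (norm z) ^ N" using C(2) by simp
    then have "ln (max 1 (norm (F z))) \<le> ln (C * max 1 (norm z) ^ N)" by (intro ln_mono) auto
    also have "\<dots> = ln C + real N * ln (max 1 (norm z))" using C(1) by (simp add: ln_mult ln_realpow)
    finally show ?thesis by (simp add: log_plus_eq)
  qed
  then show ?thesis using C(1) by (intro exI[of _ "ln C"]) auto
qed

lemma log_plus_iterate_bound:
  assumes g: "polymap_le N g" and N: "N \<ge> 2"
  shows "\<exists>C\<ge>0. \<forall>z n. log_plus (norm ((g ^^ n) z)) \<le> real N ^ n * (log_plus (norm z) + C)"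
proof -
  obtain C where C: "C \<ge> 0" "\<And>z. log_plus (norm (g z)) \<le> C + real N * log_plus (norm z)"
    using log_plus_polymap[OF g] by blast
  have "log_plus (norm ((g ^^ n) z)) + C \<le> real N ^ n * (log_plus (norm z) + C)" for z n
  proof (induction n)
    case (Suc n)
    have "log_plus (norm ((g ^^ Suc n) z)) + C \<le> 2 * C + real N * log_plus (norm ((g ^^ n) z))"
      using C(2)[of "(g ^^ n) z"] by simp
    also have "\<dots> \<le> real N * C + real N * log_plus (norm ((g ^^ n) z))"
      using N C(1) by (intro add_right_mono mult_right_mono) auto
    also have "\<dots> = real N * (log_plus (norm ((g ^^ n) z)) + C)" by (simp add: algebra_simps)
    also have "\<dots> \<le> real N * (real N ^ n * (log_plus (norm z) + C))"
      by (intro mult_left_mono Suc) auto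
    finally show ?case by simp
  qed simp
  then have "log_plus (norm ((g ^^ n) z)) \<le> real N ^ n * (log_plus (norm z) + C)" for z n
    using C(1) by (smt (verit))
  then show ?thesis using C(1) by blast
qed

lemma degree_power_lower:
  assumes g: "mtop N g (\<lambda>z. (0, h * snd z ^ N))" "h \<noteq> 0" "N \<ge> 2"
  shows "polymap_degree (g ^^ n) = N ^ n"
proof -
  have "\<exists>T c. mtop (N ^ n) (g ^^ n) T \<and> T (0, 1) = (0, c) \<and> c \<noteq> 0" for n
  proof (induction n)
    case 0
    have "mtop 1 id id" by (rule mtop_linear[OF polymap_id]) simp
    moreover have "id (0, 1) = (0, 1 :: complex)" "(1 :: complex) \<noteq> 0" by auto
    ultimately show ?case unfolding funpow.simps(1) power_0 by blast
  next
    case (Suc n)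
    then obtain T c where T: "mtop (N ^ n) (g ^^ n) T" "T (0, 1) = (0, c)" "c \<noteq> 0" by blast
    have "mtop (N * N ^ n) (g \<circ> g ^^ n) ((\<lambda>z. (0, h * snd z ^ N)) \<circ> T)"
      by (rule mtop_compose[OF g(1) T(1)]) (use g(3) in simp)
    moreover have "((\<lambda>z. (0, h * snd z ^ N)) \<circ> T) (0, 1) = (0, h * c ^ N)" using T(2) by simp
    moreover have "h * c ^ N \<noteq> 0" using T(3) g(2) by simp
    ultimately show ?case unfolding funpow.simps(2) power_Suc by blast
  qed
  then obtain T c where T: "mtop (N ^ n) (g ^^ n) T" "T (0, 1) = (0, c)" "c \<noteq> 0" by blast
  then have "T (0, 1) \<noteq> 0" by (simp add: prod_eq_iff)
  then show ?thesis by (rule mtop_degree[OF T(1)])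
qed

lemma polymap_degree_comp:
  assumes "polymap F" "autpair G Gi"
  shows "polymap_degree (F \<circ> G) \<le> polymap_degree F * polymap_degree G"
  using polymap_degree_le[OF polymap_le_comp[OF polymap_le_degree[OF assms(1)] polymap_le_degree[OF autpairD(3)[OF assms(2)]] aut_top_exists(1)[OF assms(2)]]] .

lemma dynamical_degree_unbounded:
  assumes ap: "autpair f fi" and d: "dynamical_degree f > 1"
  shows "\<not> bounded_degrees f"
proof
  assume "bounded_degrees f"
  then obtain C where C: "\<And>n. polymap_degree (f ^^ n) \<le> C" unfolding bounded_degrees_def using polymap_degree_le by blast
  have D1: "polymap_degree (f ^^ n) \<ge> 1" for n by (rule aut_top_exists(1)[OF autpair_funpow[OF ap]])
  have C1: "C \<ge> 1" using C[of 0] D1[of 0] by linarith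
  have "(\<lambda>n. root n (real (polymap_degree (f ^^ n)))) \<longlonglongrightarrow> 1"
  proof (rule tendsto_sandwich[OF _ _ tendsto_const LIMSEQ_root_const])
    show "\<forall>\<^sub>F n in sequentially. 1 \<le> root n (real (polymap_degree (f ^^ n)))"
      using eventually_gt_at_top[of 0] by eventually_elim (use D1 in simp)
    show "\<forall>\<^sub>F n in sequentially. root n (real (polymap_degree (f ^^ n))) \<le> root n (real C)"
      using eventually_gt_at_top[of 0] by eventually_elim (use C in \<open>simp add: real_root_le_mono\<close>)
    show "0 < real C" using C1 by simp
  qed
  then have "dynamical_degree f = 1" unfolding dynamical_degree_def by (rule limI)
  then show False using d by simp
qed

text \<open>The limit that defines \<open>G\<^sup>+\<close> exists, and its terms are uniformly bounded on bounded sets. For the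
  adapted conjugate \<open>g\<close>, an orbit that enters \<open>{\<bar>y\<bar> \<ge> R, \<bar>x\<bar> \<le> \<bar>y\<bar>}\<close> stays there and
  escapes in the direction \<open>(0, 1)\<close>, with second coordinates growing as under \<open>y \<mapsto> h y\<^sup>N\<close>; any other orbit
  is bounded, because \<open>g\<^sup>-\<^sup>1\<close> at least doubles the first coordinate where it is large and dominates. Since
  the top form of the conjugacy \<open>\<phi>\<close> does not vanish at \<open>(0, 1)\<close>, the growth is transferred to \<open>f\<close>.\<close>

lemma green_facts:
  assumes f: "poly_diffeo f" and d: "dynamical_degree f > 1"
  shows "\<exists>N\<ge>2. dynamical_degree f = real N \<and>
    (\<forall>z. convergent (\<lambda>n. log_plus (norm ((f ^^ n) z)) / real N ^ n)) \<and>
    (\<forall>B. \<exists>C. \<forall>z n. norm z \<le> B \<longrightarrow> log_plus (norm ((f ^^ n) z)) \<le> C * real N ^ n)"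
proof -
  note apf = poly_diffeo_autpair[OF f]
  obtain g gi \<phi> \<phi>i N M K h b t where g: "autpair g gi" "autpair \<phi> \<phi>i" "f = \<phi> \<circ> g \<circ> \<phi>i" "N \<ge> 2" "M \<ge> 2" "K \<ge> 1"
     "mtop N g (\<lambda>z. (0, h * snd z ^ N))" "h \<noteq> 0" "mtop M gi (\<lambda>z. (b * fst z ^ M, 0))" "b \<noteq> 0"
     "mtop K \<phi> t" "t (0, 1) \<noteq> 0"
    using adapted_conjugate[OF apf dynamical_degree_unbounded[OF apf d]] by blast
  have fn: "(f ^^ n) z = \<phi> ((g ^^ n) (\<phi>i z))" for n z
    unfolding g(3) conj_funpow[OF g(2)] by simp
  have N0: "real N > 0" using g(4) by simp
  \<comment> \<open>Up to a factor bounded above and below, the degree of \<open>f\<^sup>n\<close> is that of \<open>g\<^sup>n\<close>, which is \<open>N\<^sup>n\<close>.\<close>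
  have dN: "dynamical_degree f = real N"
  proof -
    define D where "D = (\<lambda>n. polymap_degree (f ^^ n))"
    define E where "E = polymap_degree \<phi> * polymap_degree \<phi>i"
    have E1: "E \<ge> 1" unfolding E_def using aut_top_exists(1)[OF g(2)] aut_top_exists(1)[OF autpair_sym[OF g(2)]] by (simp add: Suc_le_eq)
    have up: "D n \<le> E * N ^ n" for n
    proof -
      have "D n \<le> polymap_degree (\<phi> \<circ> g ^^ n) * polymap_degree \<phi>i"
        unfolding D_def g(3) conj_funpow[OF g(2)]
        by (rule polymap_degree_comp[OF polymap_comp autpair_sym[OF g(2)]]) (use g(1,2) autpair_funpow[OF g(1), of n] autpairD(3) in blast)+
      also have "\<dots> \<le> (polymap_degree \<phi> * polymap_degree (g ^^ n)) * polymap_degree \<phi>i"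
        by (intro mult_right_mono polymap_degree_comp[OF _ autpair_funpow[OF g(1)]] autpairD(3)[OF g(2)]) simp
      finally show ?thesis by (simp add: degree_power_lower[OF g(7,8,4)] E_def mult_ac)
    qed
    have low: "N ^ n \<le> E * D n" for n
    proof -
      have "g ^^ n = \<phi>i \<circ> f ^^ n \<circ> \<phi>" by (rule ext) (simp add: fn autpairD[OF g(2)])
      then have "N ^ n = polymap_degree (\<phi>i \<circ> f ^^ n \<circ> \<phi>)" using degree_power_lower[OF g(7,8,4), of n] by simp
      also have "\<dots> \<le> polymap_degree (\<phi>i \<circ> f ^^ n) * polymap_degree \<phi>"
        by (rule polymap_degree_comp[OF polymap_comp g(2)]) (use g(2) autpair_funpow[OF apf, of n] autpairD(3,4) in blast)+
      also have "\<dots> \<le> (polymap_degree \<phi>i * D n) * polymap_degree \<phi>" unfolding D_def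
        by (intro mult_right_mono polymap_degree_comp[OF _ autpair_funpow[OF apf]] autpairD(4)[OF g(2)]) simp
      finally show ?thesis by (simp add: E_def mult_ac)
    qed
    have pos: "real E > 0" using E1 by simp
    have rt: "root n (c * real N ^ n) = root n c * real N" if "n > 0" for n c
      using that N0 by (simp add: real_root_mult real_root_power_cancel)
    have lim: "(\<lambda>n. root n c * real N) \<longlonglongrightarrow> 1 * real N" if "c > 0" for c
      by (intro tendsto_mult tendsto_const LIMSEQ_root_const that)
    have "(\<lambda>n. root n (real (D n))) \<longlonglongrightarrow> 1 * real N"
    proof (rule tendsto_sandwich[OF _ _ lim lim])
      show "\<forall>\<^sub>F n in sequentially. root n (1 / real E) * real N \<le> root n (real (D n))"
        using eventually_gt_at_top[of 0]
      proof eventually_elim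
        case (elim n)
        have "real (N ^ n) \<le> real (E * D n)" using low by (simp only: of_nat_le_iff)
        then have "(1 / real E) * real N ^ n \<le> real (D n)" using pos by (simp add: field_simps)
        then show ?case unfolding rt[OF elim, symmetric] using elim by (rule real_root_le_mono[rotated])
      qed
      show "\<forall>\<^sub>F n in sequentially. root n (real (D n)) \<le> root n (real E) * real N"
        using eventually_gt_at_top[of 0]
      proof eventually_elim
        case (elim n)
        have "real (D n) \<le> real (E * N ^ n)" using up by (simp only: of_nat_le_iff)
        then have "real (D n) \<le> real E * real N ^ n" by simp
        then show ?case unfolding rt[OF elim, symmetric] using elim by (rule real_root_le_mono[rotated])
      qed
    qed (use pos in auto)
    then show ?thesis unfolding dynamical_degree_def D_def by (simp add: limI)
  qed
  \<comment> \<open>The uniform upper bound.\<close>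
  have bound: "\<exists>C. \<forall>z n. norm z \<le> B \<longrightarrow> log_plus (norm ((f ^^ n) z)) \<le> C * real N ^ n" for B
  proof -
    have "polymap_le K \<phi>" "polymap_le N g" using g(7,11) polymap_le_iff_mtop by blast+
    then obtain C1 C2 where C: "C1 \<ge> 0" "\<And>z. log_plus (norm (\<phi> z)) \<le> C1 + real K * log_plus (norm z)"
      "C2 \<ge> 0" "\<And>z n. log_plus (norm ((g ^^ n) z)) \<le> real N ^ n * (log_plus (norm z) + C2)"
      using log_plus_polymap log_plus_iterate_bound g(4) by metis
    obtain K' where "polymap_le K' \<phi>i" using polymap_le_degree autpairD(4)[OF g(2)] by blast
    then obtain C3 where C3: "C3 \<ge> 0" "\<And>z. log_plus (norm (\<phi>i z)) \<le> C3 + real K' * log_plus (norm z)"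
      using log_plus_polymap by blast
    define C where "C = C1 + real K * (C3 + real K' * log_plus B + C2)"
    have "log_plus (norm ((f ^^ n) z)) \<le> C * real N ^ n" if z: "norm z \<le> B" for z n
    proof -
      have "log_plus (norm z) \<le> log_plus B" unfolding log_plus_eq using z by (intro ln_mono) auto
      then have "real K' * log_plus (norm z) \<le> real K' * log_plus B" by (intro mult_left_mono) auto
      then have "log_plus (norm (\<phi>i z)) + C2 \<le> C3 + real K' * log_plus B + C2" using C3(2)[of z] by linarith
      then have "real N ^ n * (log_plus (norm (\<phi>i z)) + C2) \<le> real N ^ n * (C3 + real K' * log_plus B + C2)"
        by (intro mult_left_mono) auto
      then have "log_plus (norm ((g ^^ n) (\<phi>i z))) \<le> real N ^ n * (C3 + real K' * log_plus B + C2)"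
        using C(4)[of n "\<phi>i z"] by linarith
      then have "real K * log_plus (norm ((g ^^ n) (\<phi>i z))) \<le> real K * (real N ^ n * (C3 + real K' * log_plus B + C2))"
        by (intro mult_left_mono) auto
      moreover have "C1 * 1 \<le> C1 * real N ^ n" using C(1) g(4) by (intro mult_left_mono) auto
      ultimately show ?thesis using C(2)[of "(g ^^ n) (\<phi>i z)"] by (simp add: fn C_def algebra_simps)
    qed
    then show ?thesis by blast
  qed
  \<comment> \<open>Convergence along each orbit.\<close>
  have conv: "convergent (\<lambda>n. log_plus (norm ((f ^^ n) z)) / real N ^ n)" for z
  proof -
    obtain n where n: "N = Suc n" "n \<ge> 1" using g(4) by (cases N) auto
    obtain m where m: "M = Suc m" "m \<ge> 1" using g(5) by (cases M) auto
    obtain C1 where C1: "C1 \<ge> 0" "\<And>z. norm (fst (g z)) \<le> C1 * max 1 (norm z) ^ n"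
      "\<And>z. norm (snd (g z) - h * snd z ^ N) \<le> C1 * max 1 (norm z) ^ n"
      using mtop_remainder[OF g(7)[unfolded n(1)]] by (auto simp: n(1))
    obtain C2 where C2: "C2 \<ge> 0" "\<And>z. norm (snd (gi z)) \<le> C2 * max 1 (norm z) ^ m"
      "\<And>z. norm (fst (gi z) - b * fst z ^ M) \<le> C2 * max 1 (norm z) ^ m"
      using mtop_remainder[OF g(9)[unfolded m(1)]] by (auto simp: m(1))
    have hb: "norm h > 0" "norm b > 0" using g(8,10) by auto
    obtain R1 where R1: "R1 \<ge> 1" and R1': "\<forall>s m U W. s \<ge> R1 \<longrightarrow> m \<le> 2 * s \<longrightarrow> U \<le> C1 * max 1 m ^ n \<longrightarrow>
        W \<ge> norm h * s ^ Suc n - C1 * max 1 m ^ n \<longrightarrow> U \<le> W \<and> 2 * s \<le> W \<and> U * s \<le> R1 * W"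
      using escape_bounds[OF hb(1) C1(1) n(2)] by blast
    obtain R2 where R2: "R2 \<ge> 1" and R2': "\<forall>s m' U W. s \<ge> R2 \<longrightarrow> m' \<le> 2 * s \<longrightarrow> U \<le> C2 * max 1 m' ^ m \<longrightarrow>
        W \<ge> norm b * s ^ Suc m - C2 * max 1 m' ^ m \<longrightarrow> U \<le> W \<and> 2 * s \<le> W \<and> U * s \<le> R2 * W"
      using escape_bounds[OF hb(2) C2(1) m(2)] by blast
    define R where "R = max R1 R2"
    have nrm: "norm w \<le> norm (fst w) + norm (snd w)" for w :: "complex \<times> complex"
      using norm_Pair_le[of "fst w" "snd w"] by simp
    have fwd: "norm (fst (g w)) \<le> norm (snd (g w))" "2 * norm (snd w) \<le> norm (snd (g w))"
      "norm (fst (g w)) * norm (snd w) \<le> R1 * norm (snd (g w))"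
      if w: "norm (snd w) \<ge> R" "norm (fst w) \<le> norm (snd w)" for w
    proof -
      have "norm (snd (g w)) \<ge> norm h * norm (snd w) ^ Suc n - C1 * max 1 (norm w) ^ n"
        using C1(3)[of w] norm_triangle_ineq3[of "snd (g w)" "h * snd w ^ N"] by (simp add: n(1) norm_mult norm_power)
      then have "norm (fst (g w)) \<le> norm (snd (g w)) \<and> 2 * norm (snd w) \<le> norm (snd (g w)) \<and>
          norm (fst (g w)) * norm (snd w) \<le> R1 * norm (snd (g w))"
        using R1'[rule_format, of "norm (snd w)" "norm w" "norm (fst (g w))" "norm (snd (g w))"] w nrm[of w] C1(2)[of w] by (simp add: R_def)
      then show "norm (fst (g w)) \<le> norm (snd (g w))" "2 * norm (snd w) \<le> norm (snd (g w))"
        "norm (fst (g w)) * norm (snd w) \<le> R1 * norm (snd (g w))" by blast+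
    qed
    have bwd: "2 * norm (fst w) \<le> norm (fst (gi w))" if w: "norm (fst w) \<ge> R" "norm (snd w) \<le> norm (fst w)" for w
    proof -
      have "norm (fst (gi w)) \<ge> norm b * norm (fst w) ^ Suc m - C2 * max 1 (norm w) ^ m"
        using C2(3)[of w] norm_triangle_ineq3[of "fst (gi w)" "b * fst w ^ M"] by (simp add: m(1) norm_mult norm_power)
      then show ?thesis
        using R2'[rule_format, of "norm (fst w)" "norm w" "norm (snd (gi w))" "norm (fst (gi w))"] w nrm[of w] C2(2)[of w] by (simp add: R_def)
    qed
    have R0: "R \<ge> 1" using R1 by (simp add: R_def)
    define w where "w = (\<lambda>n. (g ^^ n) (\<phi>i z))"
    have wS: "w (Suc k) = g (w k)" for k by (simp add: w_def)
    have wgi: "w k = gi (w (Suc k))" for k by (simp add: wS autpairD[OF g(1)])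
    show ?thesis
    proof (cases "\<exists>k. norm (snd (w k)) \<ge> R \<and> norm (fst (w k)) \<le> norm (snd (w k))")
      case False
      define B where "B = max R (norm (fst (w 0)))"
      have x: "norm (fst (w k)) \<le> B" for k
      proof (induction k)
        case (Suc k)
        show ?case
        proof (rule ccontr)
          assume a: "\<not> norm (fst (w (Suc k))) \<le> B"
          then have a': "norm (fst (w (Suc k))) > R" by (simp add: B_def)
          then have "norm (snd (w (Suc k))) \<le> norm (fst (w (Suc k)))" using False by (metis less_le_trans linear less_imp_le)
          then have "2 * norm (fst (w (Suc k))) \<le> norm (fst (w k))" using bwd a' wgi[of k] by simp
          then show False using Suc a by (smt (verit) norm_ge_zero)
        qed
      qed (simp add: B_def)
      have y: "norm (snd (w k)) \<le> B" for k
      proof (rule ccontr)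
        assume a: "\<not> ?thesis"
        then have "norm (snd (w k)) \<ge> R" by (simp add: B_def)
        then show False using False a x[of k] by force
      qed
      have wB: "norm (w k) \<le> 2 * B" for k using nrm[of "w k"] x[of k] y[of k] by linarith
      have "polymap_le K \<phi>" using g(11) polymap_le_iff_mtop by blast
      then obtain C where C: "C \<ge> 0" "\<And>z. log_plus (norm (\<phi> z)) \<le> C + real K * log_plus (norm z)" using log_plus_polymap by blast
      define E where "E = C + real K * log_plus (2 * B)"
      have E: "log_plus (norm ((f ^^ k) z)) \<le> E" for k
      proof -
        have "log_plus (norm (w k)) \<le> log_plus (2 * B)" unfolding log_plus_eq using wB[of k] by (intro ln_mono) auto
        then have "real K * log_plus (norm (w k)) \<le> real K * log_plus (2 * B)" by (intro mult_left_mono) auto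
        then show ?thesis using C(2)[of "w k"] by (simp add: fn E_def w_def)
      qed
      have "(\<lambda>k. log_plus (norm ((f ^^ k) z)) / real N ^ k) \<longlonglongrightarrow> 0"
      proof (rule tendsto_sandwich[OF _ _ tendsto_const])
        show "\<forall>\<^sub>F k in sequentially. 0 \<le> log_plus (norm ((f ^^ k) z)) / real N ^ k"
          by (intro always_eventually allI divide_nonneg_nonneg log_plus_nonneg) auto
        show "\<forall>\<^sub>F k in sequentially. log_plus (norm ((f ^^ k) z)) / real N ^ k \<le> E / real N ^ k"
          by (intro always_eventually allI divide_right_mono E) auto
        have "(\<lambda>k. E * (1 / real N) ^ k) \<longlonglongrightarrow> E * 0"
          using g(4) by (intro tendsto_mult tendsto_const LIMSEQ_power_zero) auto
        then show "(\<lambda>k. E / real N ^ k) \<longlonglongrightarrow> 0" by (simp add: power_one_over)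
      qed
      then show ?thesis unfolding convergent_def by blast
    next
      case True
      then obtain k0 where k0: "norm (snd (w k0)) \<ge> R" "norm (fst (w k0)) \<le> norm (snd (w k0))" by blast
      define u where "u = (\<lambda>k. w (k + k0))"
      have uS: "u (Suc k) = g (u k)" for k by (simp add: u_def wS)
      have inv: "norm (snd (u k)) \<ge> R * 2 ^ k \<and> norm (fst (u k)) \<le> norm (snd (u k))" for k
      proof (induction k)
        case 0
        then show ?case using k0 by (simp add: u_def)
      next
        case (Suc k)
        have "R * 1 \<le> R * 2 ^ k" using R0 by (intro mult_left_mono) auto
        then have "norm (snd (u k)) \<ge> R" using Suc by linarith
        then show ?case using fwd[of "u k"] Suc by (auto simp: uS)
      qed
      have uR: "norm (snd (u k)) \<ge> R" for k
      proof -
        have "R * 1 \<le> R * 2 ^ k" using R0 by (intro mult_left_mono) auto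
        then show ?thesis using inv[of k] by linarith
      qed
      define y where "y = (\<lambda>k. snd (u k))"
      define \<zeta> where "\<zeta> = (\<lambda>k. (fst (u k) / snd (u k), 1 :: complex))"
      have y0: "y k \<noteq> 0" for k using uR[of k] R0 by (auto simp: y_def)
      have yinf: "filterlim y at_infinity sequentially"
      proof (rule filterlim_norm_at_top_imp_at_infinity, rule filterlim_at_top_mono)
        show "filterlim (\<lambda>k. 2 ^ k :: real) at_top sequentially" 
          by (rule filterlim_at_top_mono[OF filterlim_real_sequentially])
             (auto intro!: always_eventually less_imp_le of_nat_less_two_power)
        have "1 * 2 ^ k \<le> norm (y k)" for k
          using inv[of k] mult_right_mono[OF R0, of "2 ^ k"] unfolding y_def by (meson order_trans zero_le_numeral zero_le_power)
        then show "\<forall>\<^sub>F k in sequentially. 2 ^ k \<le> norm (y k)" by simp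
      qed
      have \<zeta>: "\<zeta> \<longlonglongrightarrow> (0, 1)"
        unfolding \<zeta>_def
      proof (rule tendsto_Pair[OF _ tendsto_const])
        have "(\<lambda>k. R1 * norm (inverse (y k))) \<longlonglongrightarrow> R1 * norm (0 :: complex)"
          by (intro tendsto_mult tendsto_const tendsto_norm filterlim_compose[OF tendsto_inverse_0 yinf])
        then have l: "(\<lambda>k. R1 * norm (inverse (y k))) \<longlonglongrightarrow> 0" by simp
        have "norm (fst (u (Suc k)) / snd (u (Suc k))) \<le> R1 * norm (inverse (y k))" for k
        proof -
          have "norm (fst (u (Suc k))) * norm (y k) \<le> R1 * norm (y (Suc k))"
            using fwd(3)[OF uR[of k]] inv[of k] by (simp add: uS y_def)
          then show ?thesis using y0[of k] y0[of "Suc k"] by (simp add: norm_divide norm_inverse y_def field_simps)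
        qed
        then have "(\<lambda>k. fst (u (Suc k)) / snd (u (Suc k))) \<longlonglongrightarrow> 0"
          by (intro Lim_null_comparison[OF _ l]) (auto intro: always_eventually)
        then show "(\<lambda>k. fst (u k) / snd (u k)) \<longlonglongrightarrow> 0" by (rule LIMSEQ_imp_Suc)
      qed
      have ucs: "u k = cs (y k) (\<zeta> k)" for k using y0[of k] by (simp add: cs_def \<zeta>_def y_def prod_eq_iff)
      \<comment> \<open>The logarithms \<open>a k\<close> of the second coordinates satisfy \<open>a (k + 1) = N a k + O(1)\<close>.\<close>
      define a where "a = (\<lambda>k. ln (norm (y k)))"
      have gy: "snd (g (cs (y k) (\<zeta> k))) = y (Suc k)" for k
        unfolding ucs[symmetric] by (simp add: y_def uS)
      have "(\<lambda>k. y (Suc k) / y k ^ N) \<longlonglongrightarrow> h"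
        using mtop_tendsto(2)[OF g(7) yinf \<zeta>] unfolding gy by simp
      then have "(\<lambda>k. ln (norm (y (Suc k) / y k ^ N))) \<longlonglongrightarrow> ln (norm h)"
        using g(8) by (intro tendsto_ln tendsto_norm) auto
      moreover have "ln (norm (y (Suc k) / y k ^ N)) = a (Suc k) - real N * a k" for k
        using y0 by (simp add: norm_divide norm_power ln_div ln_realpow a_def)
      ultimately have "(\<lambda>k. a (Suc k) - real N * a k) \<longlonglongrightarrow> ln (norm h)" by simp
      then have "Bseq (\<lambda>k. a (Suc k) - real N * a k)" by (intro convergent_imp_Bseq) (auto simp: convergent_def)
      then obtain B where "\<And>k. \<bar>a (Suc k) - real N * a k\<bar> \<le> B" unfolding Bseq_def by auto
      then have ca: "convergent (\<lambda>k. a k / real N ^ k)" by (rule almost_geometric_convergent[OF g(4)])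
      then obtain l where l: "(\<lambda>k. a k / real N ^ k) \<longlonglongrightarrow> l" unfolding convergent_def by blast
      \<comment> \<open>In the direction \<open>(0, 1)\<close> the norm of \<open>\<phi>\<close> grows like the \<open>K\<close>-th power.\<close>
      define F where "F = (\<lambda>k. norm (\<phi> (u k)))"
      have "(\<lambda>k. (fst (\<phi> (u k)) / y k ^ K, snd (\<phi> (u k)) / y k ^ K)) \<longlonglongrightarrow> (fst (t (0, 1)), snd (t (0, 1)))"
        unfolding ucs by (intro tendsto_Pair mtop_tendsto[OF g(11) yinf \<zeta>])
      then have "(\<lambda>k. norm (fst (\<phi> (u k)) / y k ^ K, snd (\<phi> (u k)) / y k ^ K)) \<longlonglongrightarrow> norm (t (0, 1))"
        using tendsto_norm by fastforce
      moreover have "norm (fst (\<phi> (u k)) / y k ^ K, snd (\<phi> (u k)) / y k ^ K) = F k / norm (y k) ^ K" for k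
      proof -
        have "(fst (\<phi> (u k)) / y k ^ K, snd (\<phi> (u k)) / y k ^ K) = cs (1 / y k ^ K) (\<phi> (u k))" by (simp add: cs_def)
        moreover have "norm (cs r v) = norm r * norm v" for r v
          by (simp add: cs_def norm_prod_def norm_mult power_mult_distrib real_sqrt_mult flip: distrib_left)
        ultimately show ?thesis by (simp add: F_def norm_divide norm_power)
      qed
      ultimately have q: "(\<lambda>k. F k / norm (y k) ^ K) \<longlonglongrightarrow> norm (t (0, 1))" by simp
      have t0: "norm (t (0, 1)) > 0" using g(12) by simp
      have ev: "\<forall>\<^sub>F k in sequentially. F k / norm (y k) ^ K > norm (t (0, 1)) / 2"
        using order_tendstoD(1)[OF q, of "norm (t (0, 1)) / 2"] t0 by simp
      have yK: "filterlim (\<lambda>k. norm (y k)) at_top sequentially" using yinf filterlim_at_infinity_imp_norm_at_top by blast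
      have big: "\<forall>\<^sub>F k in sequentially. F k > 1"
      proof -
        have "\<forall>\<^sub>F k in sequentially. norm (y k) \<ge> max 1 (2 / norm (t (0, 1)))"
          using yK unfolding filterlim_at_top by blast
        then show ?thesis using ev
        proof eventually_elim
          case (elim k)
          have y1: "norm (y k) \<ge> 1" "norm (y k) \<ge> 2 / norm (t (0, 1))" using elim(1) by auto
          have "norm (y k) \<le> norm (y k) ^ K" using y1(1) g(6) self_le_power by fastforce
          then have "2 / norm (t (0, 1)) \<le> norm (y k) ^ K" using y1(2) by linarith
          then have "2 \<le> norm (y k) ^ K * norm (t (0, 1))" using t0 by (simp add: field_simps)
          moreover have "norm (t (0, 1)) / 2 * norm (y k) ^ K < F k" using elim(2) y0[of k] by (simp add: field_simps)
          ultimately show ?case by (simp add: mult.commute)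
        qed
      qed
      have lnq: "(\<lambda>k. ln (F k / norm (y k) ^ K)) \<longlonglongrightarrow> ln (norm (t (0, 1)))" using t0 by (intro tendsto_ln q) auto
      have "(\<lambda>k. ln (F k / norm (y k) ^ K) * (1 / real N) ^ k + real K * (a k / real N ^ k)) \<longlonglongrightarrow> ln (norm (t (0, 1))) * 0 + real K * l"
        by (rule tendsto_add[OF tendsto_mult[OF lnq LIMSEQ_power_zero] tendsto_mult[OF tendsto_const l]]) (use g(4) in auto)
      moreover have "\<forall>\<^sub>F k in sequentially. ln (F k / norm (y k) ^ K) * (1 / real N) ^ k + real K * (a k / real N ^ k) = log_plus (F k) / real N ^ k"
        using big
      proof eventually_elim
        case (elim k)
        have "log_plus (F k) = ln (F k)" using elim by (simp add: log_plus_def)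
        moreover have "ln (F k / norm (y k) ^ K) = ln (F k) - real K * a k"
          using elim y0[of k] by (simp add: ln_div ln_realpow a_def)
        ultimately show ?case by (simp add: power_one_over diff_divide_distrib)
      qed
      ultimately have "(\<lambda>k. log_plus (F k) / real N ^ k) \<longlonglongrightarrow> ln (norm (t (0, 1))) * 0 + real K * l"
        by (rule Lim_transform_eventually)
      then have "(\<lambda>k. log_plus (F k) / real N ^ k * (1 / real N ^ k0)) \<longlonglongrightarrow> (ln (norm (t (0, 1))) * 0 + real K * l) * (1 / real N ^ k0)"
        by (rule tendsto_mult[OF _ tendsto_const])
      moreover have "log_plus (F k) / real N ^ k * (1 / real N ^ k0) = log_plus (norm ((f ^^ (k + k0)) z)) / real N ^ (k + k0)" for k
        by (simp add: F_def u_def w_def fn power_add)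
      ultimately have "(\<lambda>k. log_plus (norm ((f ^^ (k + k0)) z)) / real N ^ (k + k0)) \<longlonglongrightarrow> (ln (norm (t (0, 1))) * 0 + real K * l) * (1 / real N ^ k0)"
        by simp
      then show ?thesis unfolding convergent_def using LIMSEQ_offset[of "\<lambda>k. log_plus (norm ((f ^^ k) z)) / real N ^ k" k0] by blast
    qed
  qed
  show ?thesis using g(4) dN conv bound by blast
qed

section \<open>Entire curves and their limits\<close>

subsection \<open>Linear coordinates\<close>

text \<open>Complex linear functions on \<open>\<complex> \<times> \<complex>\<close>.\<close>

definition lfun :: "(complex \<times> complex \<Rightarrow> complex) \<Rightarrow> bool" where
  "lfun \<pi> \<longleftrightarrow> (\<exists>\<alpha> \<beta>. \<forall>z. \<pi> z = \<alpha> * fst z + \<beta> * snd z)"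

text \<open>Linear coordinates: two linear functions that separate points.\<close>

definition coordpair :: "(complex \<times> complex \<Rightarrow> complex) \<Rightarrow> (complex \<times> complex \<Rightarrow> complex) \<Rightarrow> bool" where
  "coordpair \<pi> \<kappa> \<longleftrightarrow> lfun \<pi> \<and> lfun \<kappa> \<and> (\<forall>z w. \<pi> z = \<pi> w \<longrightarrow> \<kappa> z = \<kappa> w \<longrightarrow> z = w)"

lemma lfun_holomorphic: "lfun \<pi> \<Longrightarrow> entire_curve g \<Longrightarrow> (\<lambda>z. \<pi> (g z)) holomorphic_on A"
proof -
  assume a: "lfun \<pi>" "entire_curve g"
  then obtain \<alpha> \<beta> where "\<And>z. \<pi> z = \<alpha> * fst z + \<beta> * snd z" unfolding lfun_def by blast
  moreover have "(\<lambda>z. \<alpha> * fst (g z) + \<beta> * snd (g z)) holomorphic_on A"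
    using a(2) unfolding entire_curve_def by (intro holomorphic_intros) (auto intro: holomorphic_on_subset)
  ultimately show ?thesis by simp
qed

lemma lfun_higher_deriv:
  assumes "lfun \<pi>" "entire_curve g"
  shows "(deriv ^^ n) (\<lambda>z. \<pi> (g z)) z = \<pi> (curve_deriv n g z)"
proof -
  obtain \<alpha> \<beta> where p: "\<And>z. \<pi> z = \<alpha> * fst z + \<beta> * snd z" using assms(1) unfolding lfun_def by blast
  have h: "(\<lambda>z. fst (g z)) holomorphic_on UNIV" "(\<lambda>z. snd (g z)) holomorphic_on UNIV"
    using assms(2) by (auto simp: entire_curve_def)
  have "(deriv ^^ n) (\<lambda>z. \<alpha> * fst (g z) + \<beta> * snd (g z)) z =
      (deriv ^^ n) (\<lambda>z. \<alpha> * fst (g z)) z + (deriv ^^ n) (\<lambda>z. \<beta> * snd (g z)) z"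
    by (rule higher_deriv_add[of _ UNIV]) (use h in \<open>auto intro!: holomorphic_intros\<close>)
  also have "\<dots> = \<alpha> * (deriv ^^ n) (\<lambda>z. fst (g z)) z + \<beta> * (deriv ^^ n) (\<lambda>z. snd (g z)) z"
    using higher_deriv_cmult[OF h(1), of z n \<alpha>] higher_deriv_cmult[OF h(2), of z n \<beta>] by simp
  finally show ?thesis by (simp add: p curve_deriv_def)
qed

lemma lfun_fst: "lfun fst" and lfun_snd: "lfun snd"
  unfolding lfun_def by (rule exI[of _ 1], rule exI[of _ 0], simp) (rule exI[of _ 0], rule exI[of _ 1], simp)

lemma coordpair_fst: "coordpair fst snd" and coordpair_snd: "coordpair snd fst"
  by (auto simp: coordpair_def lfun_fst lfun_snd prod_eq_iff)

lemma coordpair_generic: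
  assumes "v \<noteq> 0" "w \<noteq> 0"
  shows "\<exists>\<pi> \<kappa>. coordpair \<pi> \<kappa> \<and> \<pi> v \<noteq> 0 \<and> \<pi> w \<noteq> 0"
proof -
  obtain t where t: "t \<notin> {- fst v / snd v, - fst w / snd w}"
    using ex_new_if_finite[OF infinite_UNIV_char_0, of "{- fst v / snd v, - fst w / snd w}"] by auto
  have nz: "fst u + t * snd u \<noteq> 0" if "u \<noteq> 0" "t \<noteq> - fst u / snd u" for u
  proof
    assume 0: "fst u + t * snd u = 0"
    show False
    proof (cases "snd u = 0")
      case True
      then show ?thesis using 0 that(1) by (simp add: prod_eq_iff)
    next
      case False
      then have "t = - fst u / snd u" using 0 by (simp add: field_simps eq_neg_iff_add_eq_0 add.commute)
      then show ?thesis using that(2) by simp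
    qed
  qed
  have "lfun (\<lambda>z. fst z + t * snd z)" unfolding lfun_def by (rule exI[of _ 1], rule exI[of _ t]) simp
  then have "coordpair (\<lambda>z. fst z + t * snd z) snd"
    using lfun_snd by (auto simp: coordpair_def prod_eq_iff)
  then show ?thesis using nz[OF assms(1)] nz[OF assms(2)] t
    by (intro exI[of _ "\<lambda>z. fst z + t * snd z"] exI[of _ snd]) auto
qed

subsection \<open>Locally uniform limits\<close>

text \<open>Locally uniform convergence of maps from the plane to a metric space; for curves it is
  \<open>locally_uniform_limit\<close>, and it is also needed for functions.\<close>

definition lul :: "(nat \<Rightarrow> complex \<Rightarrow> 'a::metric_space) \<Rightarrow> (complex \<Rightarrow> 'a) \<Rightarrow> bool" where
  "lul h g \<longleftrightarrow> (\<forall>K. compact K \<longrightarrow> uniform_limit K h g sequentially)"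

lemma locally_uniform_limit_iff_lul: "locally_uniform_limit h g \<longleftrightarrow> lul h g"
  by (simp add: locally_uniform_limit_def lul_def)

lemma lul_subseq: "lul h g \<Longrightarrow> strict_mono r \<Longrightarrow> lul (\<lambda>n. h (r n)) g"
  unfolding lul_def uniform_limit_iff
  by (auto dest: eventually_compose_filterlim[OF _ filterlim_subseq])

lemma lul_tendsto: "lul h g \<Longrightarrow> (\<lambda>n. h n z) \<longlonglongrightarrow> g z"
proof -
  assume "lul h g"
  then have "compact {z} \<longrightarrow> uniform_limit {z} h g sequentially" unfolding lul_def by blast
  then show ?thesis by simp
qed

lemma lul_lipschitz:
  assumes h: "lul h g" and L: "\<And>z w. dist (p z) (p w) \<le> L * dist z w"
  shows "lul (\<lambda>n z. p (h n z)) (\<lambda>z. p (g z))"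
  unfolding lul_def
proof (intro allI impI uniform_limitI)
  fix K :: "complex set" and e :: real assume K: "compact K" and e: "e > 0"
  define L' where "L' = \<bar>L\<bar> + 1"
  have L': "L' > 0" "L \<le> L'" by (auto simp: L'_def)
  have "\<forall>\<^sub>F n in sequentially. \<forall>x\<in>K. dist (h n x) (g x) < e / L'"
    using h K e L' unfolding lul_def uniform_limit_iff by (meson divide_pos_pos)
  then show "\<forall>\<^sub>F n in sequentially. \<forall>x\<in>K. dist (p (h n x)) (p (g x)) < e"
  proof eventually_elim
    case (elim n)
    show ?case
    proof
      fix x assume "x \<in> K"
      then have "dist (h n x) (g x) < e / L'" using elim by blast
      then have "L' * dist (h n x) (g x) < e" using L' by (simp add: field_simps)
      moreover have "dist (p (h n x)) (p (g x)) \<le> L' * dist (h n x) (g x)"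
        using L[of "h n x" "g x"] mult_right_mono[OF L'(2), of "dist (h n x) (g x)"] by simp
      ultimately show "dist (p (h n x)) (p (g x)) < e" by simp
    qed
  qed
qed

lemma lfun_lipschitz:
  assumes "lfun \<pi>" shows "\<exists>L. \<forall>z w. dist (\<pi> z) (\<pi> w) \<le> L * dist z w"
proof -
  obtain \<alpha> \<beta> where p: "\<And>z. \<pi> z = \<alpha> * fst z + \<beta> * snd z" using assms unfolding lfun_def by blast
  have "dist (\<pi> z) (\<pi> w) \<le> (norm \<alpha> + norm \<beta>) * dist z w" for z w
  proof -
    have "dist (\<pi> z) (\<pi> w) = norm (\<alpha> * (fst z - fst w) + \<beta> * (snd z - snd w))"
      by (simp add: p dist_norm algebra_simps)
    also have "\<dots> \<le> norm \<alpha> * dist (fst z) (fst w) + norm \<beta> * dist (snd z) (snd w)"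
      by (metis dist_norm norm_mult norm_triangle_ineq)
    also have "\<dots> \<le> norm \<alpha> * dist z w + norm \<beta> * dist z w"
      by (intro add_mono mult_left_mono dist_fst_le dist_snd_le) auto
    finally show ?thesis by (simp add: distrib_right)
  qed
  then show ?thesis by blast
qed

lemma lul_lfun: "lul h g \<Longrightarrow> lfun \<pi> \<Longrightarrow> lul (\<lambda>n z. \<pi> (h n z)) (\<lambda>z. \<pi> (g z))"
  using lul_lipschitz lfun_lipschitz by metis

lemma lul_holomorphic:
  assumes "lul h g" "\<And>n. h n holomorphic_on UNIV" shows "g holomorphic_on UNIV"
proof (rule holomorphic_uniform_sequence[OF open_UNIV assms(2)])
  fix x :: complex
  show "\<exists>d>0. cball x d \<subseteq> UNIV \<and> uniform_limit (cball x d) h g sequentially"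
    using assms(1) unfolding lul_def by (intro exI[of _ 1]) auto
qed

lemma lul_entire_curve:
  assumes "lul h g" "\<And>n. entire_curve (h n)" shows "entire_curve g"
  using lul_holomorphic[OF lul_lfun[OF assms(1) lfun_fst]] lul_holomorphic[OF lul_lfun[OF assms(1) lfun_snd]] assms(2)
  by (auto simp: entire_curve_def)

lemma lul_higher_deriv:
  assumes "lul h g" "\<And>n. h n holomorphic_on UNIV"
  shows "(\<lambda>n. (deriv ^^ m) (h n) z) \<longlonglongrightarrow> (deriv ^^ m) g z"
proof (rule higher_deriv_complex_uniform_limit[where A = "ball z 1"])
  show "uniform_limit (ball z 1) h g sequentially"
  proof (rule uniform_limit_on_subset)
    show "uniform_limit (cball z 1) h g sequentially" using assms(1) unfolding lul_def by simp
  qed auto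
  show "\<forall>\<^sub>F n in sequentially. h n holomorphic_on ball z 1"
    using assms(2) holomorphic_on_subset by (intro always_eventually) blast
qed auto

lemma lul_curve_deriv:
  assumes "lul h g" "\<And>n. entire_curve (h n)"
  shows "(\<lambda>n. curve_deriv m (h n) z) \<longlonglongrightarrow> curve_deriv m g z"
  unfolding curve_deriv_def using assms(2)
  by (intro tendsto_Pair lul_higher_deriv lul_lfun[OF assms(1) lfun_fst] lul_lfun[OF assms(1) lfun_snd])
     (auto simp: entire_curve_def)

subsection \<open>Dividing by the variable\<close>

text \<open>The difference quotient at \<open>0\<close>, extended by the derivative. Its \<open>k\<close>-th iterate at \<open>0\<close> is the \<open>k\<close>-th
  Taylor coefficient.\<close>

definition dq :: "(complex \<Rightarrow> complex) \<Rightarrow> complex \<Rightarrow> complex" where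
  "dq f z = (if z = 0 then deriv f 0 else (f z - f 0) / z)"

lemma dq_holomorphic: "f holomorphic_on UNIV \<Longrightarrow> dq f holomorphic_on UNIV"
  using pole_lemma[of f UNIV 0] by (simp add: dq_def[abs_def] cong: if_cong)

lemma dq_eq: "f z = f 0 + z * dq f z"
  by (simp add: dq_def)

lemma dq_higher_deriv:
  assumes f: "f holomorphic_on UNIV"
  shows "(deriv ^^ Suc n) f 0 = of_nat (Suc n) * (deriv ^^ n) (dq f) 0"
proof -
  note q = dq_holomorphic[OF f]
  have hd: "(deriv ^^ m) (dq f) holomorphic_on UNIV" for m by (rule holomorphic_higher_deriv[OF q]) auto
  have "(deriv ^^ Suc m) f = (\<lambda>z. z * (deriv ^^ Suc m) (dq f) z + of_nat (Suc m) * (deriv ^^ m) (dq f) z)" for m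
  proof (induction m)
    case 0
    have "deriv f z = z * deriv (dq f) z + dq f z" for z
    proof -
      have "(dq f has_field_derivative deriv (dq f) z) (at z)" using q holomorphic_derivI by blast
      then have "((\<lambda>z. f 0 + z * dq f z) has_field_derivative (z * deriv (dq f) z + dq f z)) (at z)"
        by (auto intro!: derivative_eq_intros)
      moreover have "(\<lambda>z. f 0 + z * dq f z) = f" by (rule ext) (rule dq_eq[symmetric])
      ultimately have "(f has_field_derivative (z * deriv (dq f) z + dq f z)) (at z)" by (simp only:)
      then show ?thesis by (rule DERIV_imp_deriv)
    qed
    then show ?case by auto
  next
    case (Suc m)
    have "deriv ((deriv ^^ Suc m) f) z = z * (deriv ^^ Suc (Suc m)) (dq f) z + of_nat (Suc (Suc m)) * (deriv ^^ Suc m) (dq f) z" for z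
    proof -
      have d1: "((deriv ^^ Suc m) (dq f) has_field_derivative (deriv ^^ Suc (Suc m)) (dq f) z) (at z)"
        using holomorphic_derivI[OF hd[of "Suc m"] open_UNIV, of z] by simp
      have d2: "((deriv ^^ m) (dq f) has_field_derivative (deriv ^^ Suc m) (dq f) z) (at z)"
        using holomorphic_derivI[OF hd[of m] open_UNIV, of z] by simp
      have "((\<lambda>z. z * (deriv ^^ Suc m) (dq f) z + of_nat (Suc m) * (deriv ^^ m) (dq f) z) has_field_derivative
         (1 * (deriv ^^ Suc m) (dq f) z + (deriv ^^ Suc (Suc m)) (dq f) z * z + of_nat (Suc m) * (deriv ^^ Suc m) (dq f) z)) (at z)"
        by (rule DERIV_add[OF DERIV_mult[OF DERIV_ident d1] DERIV_cmult[OF d2]])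
      then show ?thesis unfolding Suc by (subst DERIV_imp_deriv) (auto simp: algebra_simps)
    qed
    then show ?case by auto
  qed
  from fun_cong[OF this[of n], of 0] show ?thesis by simp
qed

lemma lul_dq:
  assumes h: "lul h g" and hol: "\<And>n. h n holomorphic_on UNIV"
  shows "lul (\<lambda>n. dq (h n)) (dq g)"
  unfolding lul_def
proof (intro allI impI uniform_limitI)
  fix K :: "complex set" and e :: real assume K: "compact K" and e: "e > 0"
  note holg = lul_holomorphic[OF h hol]
  obtain R0 where R0: "\<And>z. z \<in> K \<Longrightarrow> norm z \<le> R0" using K compact_imp_bounded bounded_iff by metis
  define R where "R = max 1 R0"
  have R: "R \<ge> 1" "K \<subseteq> cball 0 R" using R0 by (auto simp: R_def) (meson le_max_iff_disj)
  have "\<forall>\<^sub>F n in sequentially. \<forall>x\<in>cball 0 R. dist (h n x) (g x) < e / 4"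
    using h e unfolding lul_def uniform_limit_iff by (meson compact_cball divide_pos_pos zero_less_numeral)
  then show "\<forall>\<^sub>F n in sequentially. \<forall>x\<in>K. dist (dq (h n) x) (dq g x) < e"
  proof eventually_elim
    case (elim n)
    show ?case
    proof
      fix x assume x: "x \<in> K"
      have hq: "(\<lambda>z. dq (h n) z - dq g z) holomorphic_on A" for A
        using dq_holomorphic[OF hol[of n]] dq_holomorphic[OF holg] by (intro holomorphic_intros) (auto intro: holomorphic_on_subset)
      have "norm (dq (h n) x - dq g x) \<le> e / 2"
      proof (rule maximum_modulus_frontier[of "\<lambda>z. dq (h n) z - dq g z" "cball 0 R"])
        fix z assume "z \<in> frontier (cball (0::complex) R)"
        then have z: "norm z = R" by (simp add: frontier_cball dist_norm)
        then have z0: "z \<noteq> 0" using R by auto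
        have "dq (h n) z - dq g z = ((h n z - g z) - (h n 0 - g 0)) / z"
          using z0 by (simp add: dq_def diff_divide_distrib)
        then have "norm (dq (h n) z - dq g z) = norm ((h n z - g z) - (h n 0 - g 0)) / R"
          using z by (simp add: norm_divide)
        also have "\<dots> \<le> norm ((h n z - g z) - (h n 0 - g 0)) / 1" using R by (intro divide_left_mono) auto
        also have "\<dots> \<le> norm (h n z - g z) + norm (h n 0 - g 0)" by (simp add: norm_triangle_ineq4)
        also have "\<dots> \<le> e / 4 + e / 4"
          using elim z R by (intro add_mono) (auto simp: dist_norm intro!: less_imp_le)
        finally show "norm (dq (h n) z - dq g z) \<le> e / 2" by simp
      qed (use x R hq in \<open>auto intro: holomorphic_on_imp_continuous_on\<close>)
      then show "dist (dq (h n) x) (dq g x) < e" using e by (simp add: dist_norm)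
    qed
  qed
qed

lemma dq_iterate_holomorphic: "f holomorphic_on UNIV \<Longrightarrow> (dq ^^ k) f holomorphic_on UNIV"
  by (induction k) (auto intro: dq_holomorphic)

lemma lul_dq_iterate:
  "lul h g \<Longrightarrow> (\<And>n. h n holomorphic_on UNIV) \<Longrightarrow> lul (\<lambda>n. (dq ^^ k) (h n)) ((dq ^^ k) g)"
  by (induction k) (auto intro!: lul_dq dq_iterate_holomorphic)

lemma dq_iterate_0:
  assumes "f holomorphic_on UNIV" shows "(deriv ^^ k) f 0 = fact k * (dq ^^ k) f 0"
proof -
  have "(deriv ^^ (k + m)) f 0 = fact (k + m) / fact m * (deriv ^^ m) ((dq ^^ k) f) 0" for m
  proof (induction k arbitrary: m)
    case (Suc k)
    have "(deriv ^^ (Suc k + m)) f 0 = (deriv ^^ (k + Suc m)) f 0" by simp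
    also have "\<dots> = fact (k + Suc m) / fact (Suc m) * (deriv ^^ Suc m) ((dq ^^ k) f) 0" using Suc[of "Suc m"] by simp
    also have "(deriv ^^ Suc m) ((dq ^^ k) f) 0 = of_nat (Suc m) * (deriv ^^ m) ((dq ^^ Suc k) f) 0"
      using dq_higher_deriv[OF dq_iterate_holomorphic[OF assms], of m k] by simp
    also have "fact (k + Suc m) / fact (Suc m) * (of_nat (Suc m) * (deriv ^^ m) ((dq ^^ Suc k) f) 0) =
        fact (Suc k + m) / fact m * (deriv ^^ m) ((dq ^^ Suc k) f) 0"
      using of_nat_neq_0[of m] by (simp add: fact_Suc[of m] del: of_nat_Suc fact_Suc)
    finally show ?case .
  qed simp
  from this[of 0] show ?thesis by simp
qed

lemma dq_iterate_factor:
  assumes "\<And>i. i < k \<Longrightarrow> (dq ^^ i) f 0 = 0" shows "f z = z ^ k * (dq ^^ k) f z"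
  using assms
proof (induction k)
  case (Suc k)
  have "f z = z ^ k * (dq ^^ k) f z" using Suc by simp
  also have "(dq ^^ k) f z = z * (dq ^^ Suc k) f z" using dq_eq[of "(dq ^^ k) f" z] Suc.prems[of k] by simp
  finally show ?case by simp
qed simp

subsection \<open>Local charts along an immersed curve\<close>

text \<open>Near a point where \<open>\<psi>\<close> is immersed, a suitable linear coordinate of \<open>\<psi>\<close> has an open image and a
  holomorphic inverse \<open>\<theta>\<close>.\<close>

lemma immersion_chart:
  assumes ec: "entire_curve \<psi>" and nz: "curve_deriv 1 \<psi> s0 \<noteq> 0"
  shows "\<exists>\<pi> \<kappa> r \<theta>. coordpair \<pi> \<kappa> \<and> r > 0 \<and> open ((\<lambda>s. \<pi> (\<psi> s)) ` ball s0 r) \<and> \<theta> holomorphic_on (\<lambda>s. \<pi> (\<psi> s)) ` ball s0 r \<and>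
    (\<forall>s\<in>ball s0 r. \<theta> (\<pi> (\<psi> s)) = s) \<and> deriv (\<lambda>s. \<pi> (\<psi> s)) s0 \<noteq> 0"
proof -
  have "\<exists>\<pi> \<kappa>. coordpair \<pi> \<kappa> \<and> \<pi> (curve_deriv 1 \<psi> s0) \<noteq> 0"
    using nz coordpair_fst coordpair_snd by (auto simp: prod_eq_iff)
  then obtain \<pi> \<kappa> where c: "coordpair \<pi> \<kappa>" "\<pi> (curve_deriv 1 \<psi> s0) \<noteq> 0" by blast
  then have l: "lfun \<pi>" by (simp add: coordpair_def)
  have d: "deriv (\<lambda>s. \<pi> (\<psi> s)) s0 \<noteq> 0" using lfun_higher_deriv[OF l ec, of 1 s0] c(2) by simp
  obtain r where r: "r > 0" "inj_on (\<lambda>s. \<pi> (\<psi> s)) (ball s0 r)"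
    using has_complex_derivative_locally_injective[OF lfun_holomorphic[OF l ec] _ open_UNIV d] by blast
  have hol: "(\<lambda>s. \<pi> (\<psi> s)) holomorphic_on ball s0 r" by (rule lfun_holomorphic[OF l ec])
  obtain \<theta> where "\<theta> holomorphic_on (\<lambda>s. \<pi> (\<psi> s)) ` ball s0 r" "\<And>s. s \<in> ball s0 r \<Longrightarrow> \<theta> (\<pi> (\<psi> s)) = s"
    using holomorphic_has_inverse[OF hol open_ball r(2)] by metis
  moreover have "open ((\<lambda>s. \<pi> (\<psi> s)) ` ball s0 r)" by (rule open_mapping_thm3[OF hol open_ball r(2)])
  ultimately show ?thesis using c(1) r(1) d by blast
qed

lemma entire_curve_continuous: "entire_curve g \<Longrightarrow> continuous_on A g"
proof -
  assume "entire_curve g"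
  then have "continuous_on A (\<lambda>z. (fst (g z), snd (g z)))" unfolding entire_curve_def
    by (intro continuous_on_Pair holomorphic_on_imp_continuous_on) (auto intro: holomorphic_on_subset)
  then show ?thesis by simp
qed

section \<open>Limit curves and leaves\<close>

lemma injective_immersionD:
  "injective_immersion \<psi> \<Longrightarrow> entire_curve \<psi>" "injective_immersion \<psi> \<Longrightarrow> inj \<psi>" "injective_immersion \<psi> \<Longrightarrow> curve_deriv 1 \<psi> z \<noteq> 0"
  by (auto simp: injective_immersion_def)

subsection \<open>Curves with the same image\<close>

text \<open>The change of parameter \<open>\<sigma>\<close> between two curves is holomorphic near \<open>z0\<close> as soon as it is continuous
  at \<open>z0\<close> along some set accumulating there: on that set it agrees with the holomorphic function read
  off in a chart of \<open>\<psi>1\<close>, and the identity principle does the rest.\<close>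

lemma leaf_local:
  assumes i1: "injective_immersion \<psi>1" and e2: "entire_curve \<psi>2" and \<sigma>: "\<And>z. \<psi>1 (\<sigma> z) = \<psi>2 z"
    and lim: "(\<sigma> \<longlongrightarrow> \<sigma> z0) (at z0 within A)" and lp: "z0 islimpt A"
  shows "\<exists>e>0. \<sigma> holomorphic_on ball z0 e"
proof -
  note e1 = injective_immersionD(1)[OF i1]
  obtain \<pi> \<kappa> r \<theta> where c: "coordpair \<pi> \<kappa>" "r > 0" "open ((\<lambda>s. \<pi> (\<psi>1 s)) ` ball (\<sigma> z0) r)"
    "\<theta> holomorphic_on (\<lambda>s. \<pi> (\<psi>1 s)) ` ball (\<sigma> z0) r" "\<forall>s\<in>ball (\<sigma> z0) r. \<theta> (\<pi> (\<psi>1 s)) = s"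
    using immersion_chart[OF e1 injective_immersionD(3)[OF i1], of "\<sigma> z0"] by blast
  define V where "V = (\<lambda>s. \<pi> (\<psi>1 s)) ` ball (\<sigma> z0) r"
  have l: "lfun \<pi>" "lfun \<kappa>" using c(1) by (auto simp: coordpair_def)
  have hol2: "(\<lambda>z. \<pi> (\<psi>2 z)) holomorphic_on X" "(\<lambda>z. \<kappa> (\<psi>2 z)) holomorphic_on X" for X
    by (rule lfun_holomorphic[OF _ e2], fact l)+
  have "\<pi> (\<psi>2 z0) \<in> V" unfolding V_def using c(2) by (intro image_eqI[of _ _ "\<sigma> z0"]) (auto simp: \<sigma>)
  moreover have "open ((\<lambda>z. \<pi> (\<psi>2 z)) -` V)"
    using c(3) holomorphic_on_imp_continuous_on[OF hol2(1)[of UNIV]] unfolding V_def by (simp add: open_vimage)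
  ultimately obtain e where e: "e > 0" "ball z0 e \<subseteq> (\<lambda>z. \<pi> (\<psi>2 z)) -` V"
    unfolding open_contains_ball by blast
  define \<tau> where "\<tau> = (\<lambda>z. \<theta> (\<pi> (\<psi>2 z)))"
  have \<tau>hol: "\<tau> holomorphic_on ball z0 e"
    using holomorphic_on_compose_gen[OF hol2(1) c(4)[folded V_def], of "ball z0 e"] e(2)
    unfolding \<tau>_def o_def by blast
  have \<tau>: "\<pi> (\<psi>1 (\<tau> z)) = \<pi> (\<psi>2 z)" if zb: "z \<in> ball z0 e" for z
  proof -
    obtain s where "s \<in> ball (\<sigma> z0) r" "\<pi> (\<psi>2 z) = \<pi> (\<psi>1 s)" using e(2) zb unfolding V_def by blast
    then show ?thesis using c(5) by (simp add: \<tau>_def)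
  qed
  have "\<forall>\<^sub>F z in at z0 within A. dist (\<sigma> z) (\<sigma> z0) < r" using tendstoD[OF lim c(2)] .
  then obtain d where d: "d > 0" "\<And>z. z \<in> A \<Longrightarrow> z \<noteq> z0 \<Longrightarrow> dist z z0 < d \<Longrightarrow> dist (\<sigma> z) (\<sigma> z0) < r"
    unfolding eventually_at by blast
  define F where "F = (\<lambda>z. \<kappa> (\<psi>1 (\<tau> z)) - \<kappa> (\<psi>2 z))"
  have Fhol: "F holomorphic_on ball z0 e"
    unfolding F_def
    using holomorphic_on_compose[OF \<tau>hol lfun_holomorphic[OF l(2) e1]] hol2(2) by (auto simp: o_def intro!: holomorphic_intros)
  define A' where "A' = A \<inter> ball z0 (min d e) - {z0}"
  have lp': "z0 islimpt A'"
    unfolding islimpt_approachable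
  proof (intro allI impI)
    fix \<epsilon> :: real assume "\<epsilon> > 0"
    then have "min \<epsilon> (min d e) > 0" using d e by simp
    then obtain x where "x \<in> A" "x \<noteq> z0" "dist x z0 < min \<epsilon> (min d e)" using lp unfolding islimpt_approachable by blast
    then show "\<exists>x'\<in>A'. x' \<noteq> z0 \<and> dist x' z0 < \<epsilon>" unfolding A'_def by (intro bexI[of _ x]) (auto simp: dist_commute)
  qed
  have FA: "F z = 0" if "z \<in> A'" for z
  proof -
    have z: "z \<in> A" "z \<noteq> z0" "dist z z0 < d" "z \<in> ball z0 e" using that by (auto simp: A'_def dist_commute)
    then have "\<sigma> z \<in> ball (\<sigma> z0) r" using d(2)[of z] by (simp add: dist_commute)
    then have "\<tau> z = \<sigma> z" using c(5) \<sigma>[of z] by (metis \<tau>_def)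
    then show ?thesis by (simp add: F_def \<sigma>)
  qed
  have F0: "F z = 0" if "z \<in> ball z0 e" for z
    by (rule analytic_continuation[OF Fhol open_ball connected_ball _ _ lp' FA that]) (use e in \<open>auto simp: A'_def\<close>)
  have "\<sigma> z = \<tau> z" if "z \<in> ball z0 e" for z
  proof -
    have "\<psi>1 (\<tau> z) = \<psi>2 z" using \<tau>[OF that] F0[OF that] c(1) unfolding coordpair_def F_def by simp
    then show ?thesis using \<sigma>[of z] injective_immersionD(2)[OF i1] by (metis injD)
  qed
  then have "\<sigma> holomorphic_on ball z0 e" using \<tau>hol by (metis (no_types, lifting) holomorphic_cong)
  then show ?thesis using e(1) by blast
qed

text \<open>An injectively immersed curve contained in another one is a holomorphic reparametrization of it.
  Continuity of the change of parameter \<open>\<sigma>\<close> is not clear beforehand, because \<open>\<psi>1\<close> need not be a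
  homeomorphism onto its image. On each closed set \<open>{\<bar>\<sigma>\<bar> \<le> n}\<close>, however, \<open>\<sigma>\<close> is continuous by
  compactness. If the closed set \<open>Z\<close> where \<open>\<sigma>\<close> is not locally holomorphic were nonempty, then by
  Baire's theorem a relatively open piece of it would lie in one of these sets and, by
  \<open>leaf_local\<close>, would consist of isolated points. At an isolated point the injective function \<open>\<sigma>\<close> has
  a removable singularity or a pole; the first is excluded by \<open>leaf_local\<close>, and a pole would make
  the image of \<open>\<psi>1\<close> bounded.\<close>

lemma leaf_reparametrization:
  assumes i1: "injective_immersion \<psi>1" and i2: "injective_immersion \<psi>2" and sub: "range \<psi>2 \<subseteq> range \<psi>1"
  shows "\<exists>\<sigma>. \<sigma> holomorphic_on UNIV \<and> (\<forall>z. \<psi>1 (\<sigma> z) = \<psi>2 z)"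
proof -
  note e1 = injective_immersionD(1)[OF i1] and e2 = injective_immersionD(1)[OF i2]
  note inj1 = injective_immersionD(2)[OF i1] and inj2 = injective_immersionD(2)[OF i2]
  have "\<exists>s. \<psi>1 s = \<psi>2 z" for z
  proof -
    have "\<psi>2 z \<in> range \<psi>1" using sub by blast
    then show ?thesis by auto
  qed
  then obtain \<sigma> where \<sigma>: "\<And>z. \<psi>1 (\<sigma> z) = \<psi>2 z" by metis
  have \<sigma>u: "\<sigma> z = s" if "\<psi>1 s = \<psi>2 z" for s z using that \<sigma>[of z] inj1 by (metis injD)
  have \<sigma>inj: "inj \<sigma>" using \<sigma> inj2 by (metis injD injI)
  define \<Omega> where "\<Omega> = {z. \<exists>e>0. \<sigma> holomorphic_on ball z e}"
  have diff: "\<sigma> field_differentiable at z" if zO: "z \<in> \<Omega>" for z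
  proof -
    obtain e where "e > 0" "\<sigma> holomorphic_on ball z e" using zO unfolding \<Omega>_def by blast
    then show ?thesis using holomorphic_on_imp_differentiable_at[OF _ open_ball, of \<sigma> z e z] by simp
  qed
  have "open \<Omega>"
    unfolding open_contains_ball
  proof
    fix z assume "z \<in> \<Omega>"
    then obtain e where e: "e > 0" "\<sigma> holomorphic_on ball z e" unfolding \<Omega>_def by blast
    have "ball z e \<subseteq> \<Omega>"
    proof
      fix w assume "w \<in> ball z e"
      then obtain d where "d > 0" "ball w d \<subseteq> ball z e" using open_contains_ball open_ball by blast
      then show "w \<in> \<Omega>" unfolding \<Omega>_def using e(2) holomorphic_on_subset by blast
    qed
    then show "\<exists>e>0. ball z e \<subseteq> \<Omega>" using e(1) by blast
  qed
  define Z where "Z = - \<Omega>"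
  have clZ: "closed Z" using \<open>open \<Omega>\<close> by (simp add: Z_def closed_def)
  have "Z = {}"
  proof (rule ccontr)
    assume Zne: "Z \<noteq> {}"
    define E where "E = (\<lambda>n::nat. {z. norm (\<sigma> z) \<le> real n})"
    have E: "E n = \<psi>2 -` (\<psi>1 ` cball 0 (real n))" for n
      unfolding E_def using \<sigma> \<sigma>u by (auto simp: image_iff) (metis mem_cball_0)
    have clE: "closed (E n)" for n
      unfolding E by (intro closed_vimage compact_imp_closed compact_continuous_image entire_curve_continuous e1 e2) auto
    have cE: "continuous_on (E n) \<sigma>" for n
    proof -
      have "continuous_on (\<psi>1 ` cball 0 (real n)) (inv \<psi>1)"
        by (rule continuous_on_inv[OF entire_curve_continuous[OF e1] compact_cball]) (simp add: inj1)
      then have "continuous_on (E n) (\<lambda>z. inv \<psi>1 (\<psi>2 z))"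
        by (rule continuous_on_compose2[OF _ entire_curve_continuous[OF e2]]) (auto simp: E)
      moreover have "inv \<psi>1 (\<psi>2 z) = \<sigma> z" for z using \<sigma>[of z] inj1 by (metis inv_f_f)
      ultimately show ?thesis by simp
    qed
    have "\<exists>n. \<not> Z \<subseteq> closure (Z - E n)"
    proof (rule ccontr)
      assume all: "\<not> ?thesis"
      have "Z \<subseteq> closure (\<Inter> (range (\<lambda>n. Z - E n)))"
      proof (rule Baire[OF clZ])
        fix T assume "T \<in> range (\<lambda>n. Z - E n)"
        then obtain n where T: "T = Z - E n" by blast
        have "openin (top_of_set Z) (Z - E n)"
          using clE[of n] by (simp add: Diff_eq openin_open_Int open_Compl)
        then show "openin (top_of_set Z) T \<and> Z \<subseteq> closure T" using all T by blast
      qed auto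
      moreover have "\<Inter> (range (\<lambda>n. Z - E n)) = {}"
      proof -
        have "\<exists>n. z \<in> E n" for z unfolding E_def using real_arch_simple[of "norm (\<sigma> z)"] by simp
        then show ?thesis by blast
      qed
      ultimately have "Z \<subseteq> {}" by (metis closure_empty)
      then show False using Zne by blast
    qed
    then obtain n z1 where z1: "z1 \<in> Z" "z1 \<notin> closure (Z - E n)" by blast
    then obtain e where e: "e > 0" "ball z1 e \<inter> (Z - E n) = {}"
      unfolding closure_approachable by (auto simp: dist_commute) (metis DiffI disjoint_iff dist_commute mem_ball)
    define A where "A = Z \<inter> ball z1 e"
    have AE: "A \<subseteq> E n" and z1A: "z1 \<in> A" using e z1(1) by (auto simp: A_def)
    have limA: "(\<sigma> \<longlongrightarrow> \<sigma> z1) (at z1 within A)"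
      using continuous_on_subset[OF cE AE] z1A unfolding continuous_on_def by blast
    have nlp: "\<not> z1 islimpt A"
    proof
      assume "z1 islimpt A"
      from leaf_local[OF i1 e2 \<sigma> limA this] show False using z1(1) unfolding Z_def \<Omega>_def by blast
    qed
    then obtain e' where e': "e' > 0" "\<And>z. z \<in> A \<Longrightarrow> z \<noteq> z1 \<Longrightarrow> \<not> dist z z1 < e'" unfolding islimpt_approachable by blast
    define d where "d = min e e'"
    have d0: "d > 0" using e e' by (simp add: d_def)
    have dO: "z \<in> \<Omega>" if "z \<in> ball z1 d" "z \<noteq> z1" for z
      using e'(2)[of z] that by (auto simp: A_def d_def Z_def dist_commute)
    have holP: "\<sigma> holomorphic_on ball z1 d - {z1}"
      unfolding holomorphic_on_def using diff dO field_differentiable_at_within by blast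
    define z' where "z' = z1 + of_real (d / 2)"
    have B': "ball z' (d / 4) \<subseteq> ball z1 d - {z1}"
    proof
      fix z assume z: "z \<in> ball z' (d / 4)"
      have dz: "dist z1 z' = d / 2" using d0 by (simp add: z'_def dist_norm)
      then have "dist z1 z < d" "z \<noteq> z1"
        using z d0 dist_triangle[of z1 z z'] by (auto simp: dist_commute)
      then show "z \<in> ball z1 d - {z1}" by simp
    qed
    have "open (\<sigma> ` ball z' (d / 4))"
      by (rule open_mapping_thm3[OF holomorphic_on_subset[OF holP B'] open_ball]) (rule inj_on_subset[OF \<sigma>inj subset_UNIV])
    moreover have "\<sigma> z' \<in> \<sigma> ` ball z' (d / 4)" using d0 by simp
    ultimately obtain \<epsilon> where \<epsilon>: "\<epsilon> > 0" "ball (\<sigma> z') \<epsilon> \<subseteq> \<sigma> ` ball z' (d / 4)" unfolding open_contains_ball by blast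
    \<comment> \<open>Near \<open>z1\<close> the function \<open>\<sigma>\<close> omits a disc around \<open>\<sigma> z'\<close>, so \<open>1 / (\<sigma> - \<sigma> z')\<close> is bounded there.\<close>
    have far: "dist (\<sigma> z') (\<sigma> z) \<ge> \<epsilon>" if "z \<in> ball z1 (d / 4)" for z
    proof (rule ccontr)
      assume "\<not> ?thesis"
      then have "\<sigma> z \<in> \<sigma> ` ball z' (d / 4)" using \<epsilon>(2) by auto
      then have "z \<in> ball z' (d / 4)" using \<sigma>inj by (metis image_iff injD)
      then have "dist z1 z' < d / 4 + d / 4" using that dist_triangle[of z1 z' z] by (simp add: dist_commute)
      then show False using d0 by (simp add: z'_def dist_norm)
    qed
    define S where "S = ball z1 (d / 4)"
    have S: "z1 \<in> interior S" "open S" "z1 \<in> S" "connected S" using d0 by (auto simp: S_def)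
    have nzS: "\<sigma> z - \<sigma> z' \<noteq> 0" if "z \<in> S" for z using far[of z] that \<epsilon>(1) by (auto simp: S_def)
    have "(\<lambda>z. 1 / (\<sigma> z - \<sigma> z')) holomorphic_on S - {z1}"
      by (intro holomorphic_intros holomorphic_on_subset[OF holP]) (use nzS d0 in \<open>auto simp: S_def\<close>)
    moreover have "\<exists>B. \<forall>\<^sub>F z in at z1. norm (1 / (\<sigma> z - \<sigma> z')) \<le> B"
    proof (intro exI)
      have "\<forall>\<^sub>F z in at z1. z \<in> S" using S by (simp add: eventually_at_in_open')
      then show "\<forall>\<^sub>F z in at z1. norm (1 / (\<sigma> z - \<sigma> z')) \<le> 1 / \<epsilon>"
      proof eventually_elim
        case (elim z)
        have "\<epsilon> \<le> norm (\<sigma> z - \<sigma> z')" using far[of z] elim by (simp add: S_def dist_norm norm_minus_commute)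
        then show ?case using \<epsilon>(1) by (simp add: norm_divide frac_le)
      qed
    qed
    ultimately obtain g where g: "g holomorphic_on S" "\<And>z. z \<in> S - {z1} \<Longrightarrow> g z = 1 / (\<sigma> z - \<sigma> z')"
      using holomorphic_on_extend_bounded[OF _ S(1)] by blast
    have glim: "(g \<longlongrightarrow> g z1) (at z1)"
      using holomorphic_on_imp_continuous_on[OF g(1)] S(2,3) by (simp add: continuous_on_eq_continuous_at isCont_def)
    show False
    proof (cases "g z1 = 0")
      case False
      have ev: "\<forall>\<^sub>F z in at z1. \<sigma> z' + 1 / g z = \<sigma> z"
      proof -
        have "\<forall>\<^sub>F z in at z1. z \<in> S - {z1}" using S by (auto simp: eventually_at_filter eventually_nhds)
        then show ?thesis by eventually_elim (use g(2) nzS in auto)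
      qed
      have "((\<lambda>z. \<sigma> z' + 1 / g z) \<longlongrightarrow> \<sigma> z' + 1 / g z1) (at z1)" by (intro tendsto_intros glim False)
      then have l: "(\<sigma> \<longlongrightarrow> \<sigma> z' + 1 / g z1) (at z1)" using ev by (rule Lim_transform_eventually)
      have c1: "isCont \<psi>1 s" "isCont \<psi>2 s" for s
        using entire_curve_continuous[OF e1, of UNIV] entire_curve_continuous[OF e2, of UNIV] by (auto simp: continuous_on_eq_continuous_at)
      have "((\<lambda>z. \<psi>1 (\<sigma> z)) \<longlongrightarrow> \<psi>1 (\<sigma> z' + 1 / g z1)) (at z1)" using isCont_tendsto_compose[OF c1(1) l] .
      moreover have "((\<lambda>z. \<psi>1 (\<sigma> z)) \<longlongrightarrow> \<psi>2 z1) (at z1)" unfolding \<sigma> using c1(2)[of z1] by (simp add: isCont_def)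
      ultimately have "\<psi>1 (\<sigma> z' + 1 / g z1) = \<psi>2 z1" using tendsto_unique[OF trivial_limit_at] by blast
      then have "\<sigma> z1 = \<sigma> z' + 1 / g z1" by (rule \<sigma>u)
      then have "(\<sigma> \<longlongrightarrow> \<sigma> z1) (at z1 within UNIV)" using l by simp
      from leaf_local[OF i1 e2 \<sigma> this islimpt_UNIV] show False using z1(1) unfolding Z_def \<Omega>_def by blast
    next
      case True
      have ncg: "\<not> g constant_on S"
      proof
        assume "g constant_on S"
        then obtain c where c: "\<And>z. z \<in> S \<Longrightarrow> g z = c" unfolding constant_on_def by blast
        define z2 where "z2 = z1 + of_real (d / 8)"
        have z2: "z2 \<in> S - {z1}" using d0 by (auto simp: S_def z2_def dist_norm)
        have "g z2 = 0" using c[of z1] c[of z2] S(3) z2 True by simp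
        then show False using g(2)[OF z2] nzS[of z2] z2 by simp
      qed
      \<comment> \<open>A pole: \<open>\<sigma>\<close> takes all large values near \<open>z1\<close>, so all but a compact part of the image of \<open>\<psi>1\<close> is
        covered by \<open>\<psi>2\<close> on a disc.\<close>
      have "open (g ` S)" by (rule open_mapping_thm[OF g(1) S(2,4) S(2) subset_refl ncg])
      moreover have "0 \<in> g ` S" using True S(3) by force
      ultimately obtain \<rho> where \<rho>: "\<rho> > 0" "ball 0 \<rho> \<subseteq> g ` S" unfolding open_contains_ball by blast
      have "bounded (\<psi>2 ` cball z1 d)" "bounded (\<psi>1 ` cball (\<sigma> z') (1 / \<rho>))"
        by (intro compact_imp_bounded compact_continuous_image entire_curve_continuous e1 e2 compact_cball)+
      moreover have "range \<psi>1 \<subseteq> \<psi>2 ` cball z1 d \<union> \<psi>1 ` cball (\<sigma> z') (1 / \<rho>)"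
      proof
        fix x assume "x \<in> range \<psi>1"
        then obtain s where s: "x = \<psi>1 s" by blast
        show "x \<in> \<psi>2 ` cball z1 d \<union> \<psi>1 ` cball (\<sigma> z') (1 / \<rho>)"
        proof (cases "s \<in> cball (\<sigma> z') (1 / \<rho>)")
          case False
          then have "norm (s - \<sigma> z') > 1 / \<rho>" by (simp add: dist_norm norm_minus_commute)
          moreover have p: "norm (s - \<sigma> z') > 0" using calculation \<rho>(1) by (meson divide_pos_pos less_trans zero_less_one)
          ultimately have "norm (1 / (s - \<sigma> z')) < \<rho>"
            using \<rho>(1) by (simp add: norm_divide divide_less_eq mult.commute)
          moreover have ne: "s - \<sigma> z' \<noteq> 0" using p by simp
          ultimately obtain z where z: "z \<in> S" "g z = 1 / (s - \<sigma> z')" using \<rho>(2) by (metis imageE mem_ball_0 subsetD)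
          then have "z \<noteq> z1" using True ne by auto
          then have "1 / (\<sigma> z - \<sigma> z') = 1 / (s - \<sigma> z')" using g(2) z by auto
          then have "\<sigma> z = s" using ne nzS[OF z(1)] by (simp add: field_simps)
          then have "x = \<psi>2 z" using s \<sigma>[of z] by simp
          moreover have "z \<in> cball z1 d" using z(1) d0 by (simp add: S_def)
          ultimately show ?thesis by blast
        qed (use s in auto)
      qed
      ultimately have bd: "bounded (range \<psi>1)" using bounded_Un bounded_subset by blast
      have const: "\<pi> (\<psi>1 0) = \<pi> (\<psi>1 1)" if l: "lfun \<pi>" for \<pi>
      proof -
        obtain L where L: "\<And>z w. dist (\<pi> z) (\<pi> w) \<le> L * dist z w" using lfun_lipschitz[OF l] by blast
        obtain B where B: "\<And>s. dist (\<psi>1 s) (\<psi>1 0) \<le> B" using bd unfolding bounded_any_center[of _ "\<psi>1 0"] by (auto simp: dist_commute)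
        have "dist (\<pi> (\<psi>1 0)) (\<pi> (\<psi>1 s)) \<le> \<bar>L\<bar> * B" for s
        proof -
          have "dist (\<pi> (\<psi>1 0)) (\<pi> (\<psi>1 s)) \<le> L * dist (\<psi>1 0) (\<psi>1 s)" by (rule L)
          also have "\<dots> \<le> \<bar>L\<bar> * dist (\<psi>1 0) (\<psi>1 s)" by (intro mult_right_mono) auto
          also have "\<dots> \<le> \<bar>L\<bar> * B" using B[of s] by (intro mult_left_mono) (auto simp: dist_commute)
          finally show ?thesis .
        qed
        then have "bounded (range (\<lambda>s. \<pi> (\<psi>1 s)))" unfolding bounded_def by blast
        then have "(\<lambda>s. \<pi> (\<psi>1 s)) constant_on UNIV" by (rule Liouville_theorem[OF lfun_holomorphic[OF l e1]])
        then show ?thesis unfolding constant_on_def by auto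
      qed
      have "\<psi>1 0 = \<psi>1 1" using const[OF lfun_fst] const[OF lfun_snd] by (simp add: prod_eq_iff)
      then show False using inj1 by (metis injD zero_neq_one)
    qed
  qed
  then have "\<sigma> holomorphic_on UNIV" unfolding holomorphic_on_def using diff by (auto simp: Z_def)
  then show ?thesis using \<sigma> by blast
qed

subsection \<open>A limit curve through a point of a leaf stays in the leaf\<close>

text \<open>A limit of curves, each of which has the same image as \<open>\<psi>0\<close> or a disjoint one, that passes through
  \<open>\<psi>0 0\<close> stays in a plaque of \<open>\<psi>0\<close>.\<close>

lemma limit_curve_in_plaque:
  assumes i0: "injective_immersion \<psi>0" and ih: "\<And>n. injective_immersion (h n)" and lim: "lul h \<phi>"
    and dis: "\<And>n. range (h n) \<inter> range \<psi>0 = {} \<or> range (h n) = range \<psi>0" and at0: "\<phi> 0 = \<psi>0 0"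
  shows "\<exists>e>0. \<exists>\<tau>. \<tau> holomorphic_on ball 0 e \<and> \<tau> 0 = 0 \<and> (\<forall>z\<in>ball 0 e. \<phi> z = \<psi>0 (\<tau> z))"
proof -
  note e0 = injective_immersionD(1)[OF i0] and eh = injective_immersionD(1)[OF ih]
  have e\<phi>: "entire_curve \<phi>" by (rule lul_entire_curve[OF lim eh])
  obtain \<pi> \<kappa> r \<theta> where c: "coordpair \<pi> \<kappa>" "r > 0" "open ((\<lambda>s. \<pi> (\<psi>0 s)) ` ball 0 r)"
    "\<theta> holomorphic_on (\<lambda>s. \<pi> (\<psi>0 s)) ` ball 0 r" "\<forall>s\<in>ball 0 r. \<theta> (\<pi> (\<psi>0 s)) = s"
    using immersion_chart[OF e0 injective_immersionD(3)[OF i0], of 0] by blast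
  define V where "V = (\<lambda>s. \<pi> (\<psi>0 s)) ` ball 0 r"
  have l: "lfun \<pi>" "lfun \<kappa>" using c(1) by (auto simp: coordpair_def)
  have V\<theta>: "\<theta> w \<in> ball 0 r" "\<pi> (\<psi>0 (\<theta> w)) = w" if "w \<in> V" for w using that c(5) unfolding V_def by auto
  define p where "p = \<pi> (\<psi>0 0)"
  have "p \<in> V" unfolding V_def p_def using c(2) by (intro image_eqI[of _ _ 0]) auto
  then obtain \<delta>0 where \<delta>0: "\<delta>0 > 0" "cball p \<delta>0 \<subseteq> V" using c(3) unfolding V_def open_contains_cball by blast
  define \<delta> where "\<delta> = \<delta>0 / 2"
  have \<delta>: "\<delta> > 0" "cball p (2 * \<delta>) \<subseteq> V" using \<delta>0 by (auto simp: \<delta>_def)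
  have "isCont (\<lambda>z. \<pi> (\<phi> z)) 0"
    using holomorphic_on_imp_continuous_on[OF lfun_holomorphic[OF l(1) e\<phi>, of UNIV]] by (simp add: continuous_on_eq_continuous_at)
  then obtain e1 where e1: "e1 > 0" "\<And>z. dist z 0 < e1 \<Longrightarrow> dist (\<pi> (\<phi> z)) p < \<delta>"
    using \<delta>(1) unfolding continuous_at_eps_delta at0 p_def by (metis dist_commute)
  define e where "e = e1 / 2"
  have e: "e > 0" "\<And>z. z \<in> cball 0 e \<Longrightarrow> dist (\<pi> (\<phi> z)) p < \<delta>" using e1 by (auto simp: e_def)
  have "\<forall>\<^sub>F n in sequentially. \<forall>z\<in>cball 0 e. dist (\<pi> (h n z)) (\<pi> (\<phi> z)) < \<delta>"
    using lul_lfun[OF lim l(1)] \<delta>(1) unfolding lul_def uniform_limit_iff by (meson compact_cball)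
  then obtain N where N: "\<And>n z. n \<ge> N \<Longrightarrow> z \<in> cball 0 e \<Longrightarrow> dist (\<pi> (h n z)) (\<pi> (\<phi> z)) < \<delta>"
    unfolding eventually_sequentially by blast
  have hB: "\<pi> (h n z) \<in> cball p (2 * \<delta>)" if "n \<ge> N" "z \<in> cball 0 e" for n z
    using N[OF that] e(2)[OF that(2)] dist_triangle[of "\<pi> (h n z)" p "\<pi> (\<phi> z)"] by (simp add: dist_commute)
  have \<phi>B: "\<pi> (\<phi> z) \<in> cball p (2 * \<delta>)" if "z \<in> cball 0 e" for z
    using e(2)[OF that] \<delta>(1) by (simp add: dist_commute)
  \<comment> \<open>The plaque is the graph of \<open>k\<close>, and \<open>D g\<close> measures the deviation of a curve \<open>g\<close> from it. On a fixed
    disc \<open>D\<close> vanishes identically or nowhere along each \<open>h n\<close>; by Hurwitz' theorem it vanishes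
    identically along \<open>\<phi>\<close>, where it vanishes at \<open>0\<close>.\<close>
  define k where "k = (\<lambda>w. \<kappa> (\<psi>0 (\<theta> w)))"
  have khol: "k holomorphic_on V"
    unfolding k_def using holomorphic_on_compose[OF c(4)[folded V_def] lfun_holomorphic[OF l(2) e0]] by (simp add: o_def)
  define D where "D = (\<lambda>g (z::complex). \<kappa> (g z) - k (\<pi> (g z)))"
  have Dhol: "D g holomorphic_on ball 0 e" if "entire_curve g" "\<And>z. z \<in> cball 0 e \<Longrightarrow> \<pi> (g z) \<in> cball p (2 * \<delta>)" for g
  proof -
    have "(\<lambda>z. k (\<pi> (g z))) holomorphic_on ball 0 e"
      using holomorphic_on_compose_gen[OF lfun_holomorphic[OF l(1) that(1)] khol, of "ball 0 e"] that(2) \<delta>(2)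
      by (force simp: o_def)
    then show ?thesis unfolding D_def by (intro holomorphic_intros lfun_holomorphic[OF l(2) that(1)])
  qed
  have Dzero: "g z = \<psi>0 (\<theta> (\<pi> (g z)))" if "D g z = 0" "\<pi> (g z) \<in> V" for g z
    using that V\<theta>(2)[OF that(2)] c(1) unfolding coordpair_def D_def k_def by simp
  have "D \<phi> z = 0" if "z \<in> ball 0 e" for z
  proof (rule ccontr)
    assume nz: "D \<phi> z \<noteq> 0"
    have D0: "D \<phi> 0 = 0" using c(2,5) by (simp add: D_def k_def at0)
    have nc: "\<not> D \<phi> constant_on ball 0 e"
      using nz D0 that e(1) unfolding constant_on_def by (metis centre_in_ball)
    have ul: "uniform_limit K (\<lambda>n. D (h (n + N))) (D \<phi>) sequentially" if K: "K \<subseteq> cball 0 e" for K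
    proof -
      have "strict_mono (\<lambda>n. n + N)" by (simp add: strict_mono_def)
      note lim' = lul_subseq[OF lim this]
      have "uniform_limit K (\<lambda>n z. \<pi> (h (n + N) z)) (\<lambda>z. \<pi> (\<phi> z)) sequentially"
        "uniform_limit K (\<lambda>n z. \<kappa> (h (n + N) z)) (\<lambda>z. \<kappa> (\<phi> z)) sequentially"
        using lul_lfun[OF lim' l(1)] lul_lfun[OF lim' l(2)] uniform_limit_on_subset[OF _ K] unfolding lul_def by (meson compact_cball)+
      note u = this
      have "uniformly_continuous_on (cball p (2 * \<delta>)) k"
        by (rule compact_uniformly_continuous[OF holomorphic_on_imp_continuous_on[OF holomorphic_on_subset[OF khol \<delta>(2)]] compact_cball])
      then have "uniform_limit K (\<lambda>n z. k (\<pi> (h (n + N) z))) (\<lambda>z. k (\<pi> (\<phi> z))) sequentially"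
        by (rule uniform_limit_compose_uniformly_continuous_on[OF u(1)]) (use hB K in \<open>auto intro!: always_eventually\<close>)
      then show ?thesis unfolding D_def using u(2) by (intro uniform_limit_intros)
    qed
    have dich: "(\<forall>z\<in>ball 0 e. D (h n) z = 0) \<or> (\<forall>z\<in>ball 0 e. D (h n) z \<noteq> 0)" if n: "n \<ge> N" for n
    proof (rule disjCI)
      assume "\<not> (\<forall>z\<in>ball 0 e. D (h n) z \<noteq> 0)"
      then obtain z' where z': "z' \<in> ball 0 e" "D (h n) z' = 0" by blast
      have piV: "\<pi> (h n z) \<in> V" if "z \<in> ball 0 e" for z using hB[OF n] that \<delta>(2) by auto
      have hz: "h n z' = \<psi>0 (\<theta> (\<pi> (h n z')))" by (rule Dzero[OF z'(2) piV[OF z'(1)]])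
      then have "range (h n) = range \<psi>0" using dis[of n] by (metis disjoint_iff rangeI)
      then obtain \<sigma> where \<sigma>: "\<sigma> holomorphic_on UNIV" "\<And>z. \<psi>0 (\<sigma> z) = h n z"
        using leaf_reparametrization[OF i0 ih, of n] by blast
      have "\<sigma> z' = \<theta> (\<pi> (h n z'))" using \<sigma>(2)[of z'] hz injective_immersionD(2)[OF i0] by (metis injD)
      then have "\<sigma> z' \<in> ball 0 r" using V\<theta>(1)[OF piV[OF z'(1)]] by simp
      moreover have "open (\<sigma> -` ball 0 r)" using holomorphic_on_imp_continuous_on[OF \<sigma>(1)] by (simp add: open_vimage)
      ultimately have op: "open (\<sigma> -` ball 0 r \<inter> ball 0 e)" "z' \<in> \<sigma> -` ball 0 r \<inter> ball 0 e" using z'(1) by auto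
      have zero: "D (h n) z = 0" if "z \<in> \<sigma> -` ball 0 r \<inter> ball 0 e" for z
      proof -
        have "\<theta> (\<pi> (\<psi>0 (\<sigma> z))) = \<sigma> z" using that c(5) by simp
        then show ?thesis by (simp add: D_def k_def \<sigma>(2))
      qed
      have "D (h n) z = 0" if z: "z \<in> ball 0 e" for z
        by (rule analytic_continuation_open[OF op(1) open_ball _ connected_ball _ Dhol[OF eh hB[OF n]] _ _ z, of "\<lambda>_. 0"])
           (use op zero in auto)
      then show "\<forall>z\<in>ball 0 e. D (h n) z = 0" by blast
    qed
    have pt: "(\<lambda>n. D (h (n + N)) z) \<longlonglongrightarrow> D \<phi> z"
      using ul[of "{z}"] that by auto
    then have "\<forall>\<^sub>F n in sequentially. D (h (n + N)) z \<noteq> 0" using nz by (rule tendsto_imp_eventually_ne)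
    then obtain N' where N': "\<And>n. n \<ge> N' \<Longrightarrow> D (h (n + N)) z \<noteq> 0" unfolding eventually_sequentially by blast
    have nv: "D (h (n + N' + N)) w \<noteq> 0" if "w \<in> ball 0 e" for n w
      using dich[of "n + N' + N"] N'[of "n + N'"] that \<open>z \<in> ball 0 e\<close> by auto
    have "D \<phi> 0 \<noteq> 0"
    proof (rule Hurwitz_no_zeros[of "ball 0 e" "\<lambda>n. D (h (n + N' + N))" "D \<phi>" 0])
      show "D (h (n + N' + N)) holomorphic_on ball 0 e" for n by (rule Dhol[OF eh hB]) auto
      show "D \<phi> holomorphic_on ball 0 e" by (rule Dhol[OF e\<phi> \<phi>B])
      fix K assume "compact K" "K \<subseteq> ball (0::complex) e"
      then have "K \<subseteq> cball 0 e" by auto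
      from ul[OF this] show "uniform_limit K (\<lambda>n. D (h (n + N' + N))) (D \<phi>) sequentially"
        unfolding uniform_limit_iff using eventually_sequentially_seg[of "\<lambda>n. \<forall>x\<in>K. dist (D (h (n + N)) x) (D \<phi> x) < _" N'] by blast
    qed (use nc nv e(1) in auto)
    then show False using D0 by simp
  qed
  note Dz = this
  define \<tau> where "\<tau> = (\<lambda>z. \<theta> (\<pi> (\<phi> z)))"
  have "\<tau> holomorphic_on ball 0 e"
    unfolding \<tau>_def using holomorphic_on_compose_gen[OF lfun_holomorphic[OF l(1) e\<phi>] c(4)[folded V_def], of "ball 0 e"] \<phi>B \<delta>(2)
    by (force simp: o_def)
  moreover have "\<tau> 0 = 0" using c(2,5) by (simp add: \<tau>_def at0)
  moreover have "\<phi> z = \<psi>0 (\<tau> z)" if "z \<in> ball 0 e" for z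
    unfolding \<tau>_def by (rule Dzero[OF Dz[OF that]]) (use \<phi>B[of z] that \<delta>(2) in auto)
  ultimately show ?thesis using e(1) by blast
qed

section \<open>Curves of higher order are not limits\<close>

subsection \<open>Expansion in powers of a function with a single zero\<close>

text \<open>Near \<open>0\<close>, let \<open>f\<close> and \<open>h\<close> be functions of \<open>\<tau>\<close>, with \<open>h\<close> a function \<open>G\<close> of \<open>\<tau>\<close> that is invertible at
  \<open>0\<close>; then \<open>f\<close> is a power series in \<open>h\<close>. If \<open>0\<close> is the only zero of \<open>h\<close> in the disc of radius \<open>\<rho>\<close> and
  \<open>\<bar>h\<bar> \<ge> \<delta>\<close> on its boundary, then the radius of convergence is at least \<open>\<delta> / 2\<close>, no matter how small the
  disc is on which \<open>\<tau>\<close> is defined: the successive quotients \<open>(f\<^sub>n - c\<^sub>n) / h\<close> extend holomorphically to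
  \<open>0\<close>, since there they are functions of \<open>\<tau>\<close>, and are estimated by the maximum principle.\<close>

lemma expansion_in_powers:
  fixes f h F G \<tau> :: "complex \<Rightarrow> complex"
  assumes hol: "f holomorphic_on UNIV" "h holomorphic_on UNIV" "F holomorphic_on UNIV" "G holomorphic_on UNIV"
    and \<rho>: "\<rho> > 0" and h0: "h 0 = 0" and hnz: "\<And>z. z \<noteq> 0 \<Longrightarrow> norm z \<le> \<rho> \<Longrightarrow> h z \<noteq> 0"
    and \<delta>: "\<delta> > 0" "\<And>z. norm z = \<rho> \<Longrightarrow> norm (h z) \<ge> \<delta>"
    and G: "G 0 = 0" "deriv G 0 \<noteq> 0"
    and e: "e > 0" "\<tau> holomorphic_on ball 0 e" "\<tau> 0 = 0" "\<And>z. z \<in> ball 0 e \<Longrightarrow> h z = G (\<tau> z) \<and> f z = F (\<tau> z)"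
  shows "\<exists>c M. (\<forall>n. norm (c n) \<le> M * (2 / \<delta>) ^ n) \<and> (\<forall>z. norm z \<le> \<rho> \<longrightarrow> norm (h z) < \<delta> / 2 \<longrightarrow> (\<lambda>n. c n * h z ^ n) sums f z)"
proof -
  define g where "g = dq G"
  have ghol: "g holomorphic_on X" for X unfolding g_def using dq_holomorphic[OF hol(4)] holomorphic_on_subset by blast
  have Gg: "G s = s * g s" for s using dq_eq[of G s] G(1) by (simp add: g_def)
  have g0: "g 0 \<noteq> 0" using G(2) by (simp add: g_def dq_def)
  have "isCont g 0" using holomorphic_on_imp_continuous_on[OF ghol[of UNIV]] by (simp add: continuous_on_eq_continuous_at)
  then obtain r where r: "r > 0" "\<And>s. dist 0 s < r \<Longrightarrow> g s \<noteq> 0" using continuous_at_avoid[of 0 g 0] g0 by blast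
  \<comment> \<open>The successive quotients as functions of \<open>\<tau>\<close>, for \<open>\<tau>\<close> near \<open>0\<close>.\<close>
  define Fn where "Fn = rec_nat F (\<lambda>_ Fi s. dq Fi s / g s)"
  have Fn: "Fn 0 = F" "Fn (Suc n) = (\<lambda>s. dq (Fn n) s / g s)" for n by (auto simp: Fn_def)
  have Fhol: "Fn n holomorphic_on ball 0 r" for n
  proof (induction n)
    case 0 then show ?case using hol(3) by (auto simp: Fn intro: holomorphic_on_subset)
  next
    case (Suc n)
    have "dq (Fn n) holomorphic_on ball 0 r"
      using pole_lemma[OF Suc, of 0] r(1) by (simp add: dq_def[abs_def] cong: if_cong)
    then show ?case unfolding Fn using r(2) by (intro holomorphic_intros ghol) auto
  qed
  define c where "c = (\<lambda>n. Fn n 0)"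
  define fn where "fn = rec_nat f (\<lambda>n fi z. if z = 0 then c (Suc n) else (fi z - c n) / h z)"
  have fn: "fn 0 = f" "fn (Suc n) = (\<lambda>z. if z = 0 then c (Suc n) else (fn n z - c n) / h z)" for n by (auto simp: fn_def)
  \<comment> \<open>A smaller disc on which \<open>\<tau>\<close> stays in the disc of radius \<open>r\<close>.\<close>
  have "isCont \<tau> 0" using holomorphic_on_imp_continuous_on[OF e(2)] e(1) by (simp add: continuous_on_eq_continuous_at)
  then obtain e1 where e1: "e1 > 0" "\<And>z. dist z 0 < e1 \<Longrightarrow> dist (\<tau> z) 0 < r"
    using r(1) e(3) unfolding continuous_at_eps_delta by (metis dist_commute)
  define e' where "e' = min (min e e1) \<rho>"
  have e': "e' > 0" "ball 0 e' \<subseteq> ball 0 e" using e(1) e1(1) \<rho> by (auto simp: e'_def)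
  have \<tau>r: "\<tau> z \<in> ball 0 r" if "z \<in> ball 0 e'" for z using e1(2)[of z] that by (auto simp: e'_def dist_commute)
  have loc: "fn n z = Fn n (\<tau> z)" if "z \<in> ball 0 e'" for n z
  proof (induction n)
    case 0
    have "z \<in> ball 0 e" using that e'(2) by blast
    then show ?case using e(4) by (simp only: fn Fn)
  next
    case (Suc n)
    show ?case
    proof (cases "z = 0")
      case True
      then show ?thesis by (simp add: fn e(3) c_def)
    next
      case False
      have hz: "h z \<noteq> 0" using hnz[OF False] that by (simp add: e'_def)
      have hG: "h z = G (\<tau> z)" using e(4) e'(2) that by blast
      then have "\<tau> z \<noteq> 0" using hz G(1) by auto
      then show ?thesis using False hG by (simp add: fn Fn Suc dq_def Gg c_def)
    qed
  qed
  define D where "D = {z. h z \<noteq> 0} \<union> ball 0 e'"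
  have opnz: "open {z. h z \<noteq> 0}"
  proof -
    have "open (h -` (- {0}))" using holomorphic_on_imp_continuous_on[OF hol(2)] by (intro open_vimage) auto
    moreover have "h -` (- {0}) = {z. h z \<noteq> 0}" by auto
    ultimately show ?thesis by simp
  qed
  have D: "open D" unfolding D_def by (rule open_Un[OF opnz open_ball])
  have Dsub: "cball 0 \<rho> \<subseteq> D"
  proof
    fix z :: complex assume "z \<in> cball 0 \<rho>"
    then show "z \<in> D" using hnz[of z] e'(1) by (cases "z = 0") (auto simp: D_def)
  qed
  have fhol: "fn n holomorphic_on D" for n
  proof (induction n)
    case 0 then show ?case using hol(1) by (auto simp: fn intro: holomorphic_on_subset)
  next
    case (Suc n)
    have "fn (Suc n) field_differentiable at z" if z: "z \<in> D" for z
    proof (cases "z \<in> ball 0 e'")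
      case True
      have "(\<lambda>z. Fn (Suc n) (\<tau> z)) holomorphic_on ball 0 e'"
        using holomorphic_on_compose_gen[OF holomorphic_on_subset[OF e(2) e'(2)] Fhol] \<tau>r by (force simp: o_def)
      then have "fn (Suc n) holomorphic_on ball 0 e'" by (rule holomorphic_transform) (rule loc[symmetric])
      then show ?thesis by (rule holomorphic_on_imp_differentiable_at[OF _ open_ball True])
    next
      case False
      then have hz: "h z \<noteq> 0" using z by (auto simp: D_def)
      have "(\<lambda>z. (fn n z - c n) / h z) holomorphic_on {z. h z \<noteq> 0}"
        by (intro holomorphic_intros holomorphic_on_subset[OF Suc] holomorphic_on_subset[OF hol(2)]) (auto simp: D_def)
      moreover have eq: "(fn n z - c n) / h z = fn (Suc n) z" if "z \<in> {z. h z \<noteq> 0}" for z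
        using that h0 by (auto simp: fn)
      ultimately have "fn (Suc n) holomorphic_on {z. h z \<noteq> 0}" by (rule holomorphic_transform)
      then show ?thesis using holomorphic_on_imp_differentiable_at[OF _ opnz] hz by simp
    qed
    then show ?case unfolding holomorphic_on_def using field_differentiable_at_within by blast
  qed
  have f0: "fn n 0 = c n" for n using loc[of 0 n] e'(1) by (simp add: e(3) c_def)
  have "compact (f ` sphere 0 \<rho>)"
    by (intro compact_continuous_image continuous_on_subset[OF holomorphic_on_imp_continuous_on[OF hol(1)]]) auto
  then obtain M where M0: "\<And>w. w \<in> f ` sphere 0 \<rho> \<Longrightarrow> norm w \<le> M"
    using compact_imp_bounded[of "f ` sphere 0 \<rho>"] unfolding bounded_iff by blast
  have M: "norm (f z) \<le> M" if "norm z = \<rho>" for z by (rule M0) (use that in auto)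
  have mm: "norm (fn n z) \<le> B" if b: "\<And>z. norm z = \<rho> \<Longrightarrow> norm (fn n z) \<le> B" and z: "norm z \<le> \<rho>" for n z B
  proof (rule maximum_modulus_frontier[of "fn n" "cball 0 \<rho>"])
    show "fn n holomorphic_on interior (cball 0 \<rho>)" 
      by (rule holomorphic_on_subset[OF fhol order_trans[OF interior_subset Dsub]])
    show "continuous_on (closure (cball 0 \<rho>)) (fn n)"
      using continuous_on_subset[OF holomorphic_on_imp_continuous_on[OF fhol] Dsub] by (simp add: closure_closed)
    show "norm (fn n z) \<le> B" if "z \<in> frontier (cball 0 \<rho>)" for z using that b by (simp add: frontier_cball)
  qed (use z in auto)
  have bd: "norm (fn n z) \<le> M * (2 / \<delta>) ^ n" if "norm z = \<rho>" for n z
    using that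
  proof (induction n arbitrary: z)
    case 0 then show ?case using M by (simp add: fn)
  next
    case (Suc n)
    have "norm (c n) \<le> M * (2 / \<delta>) ^ n" using mm[of n "M * (2 / \<delta>) ^ n" 0] Suc.IH \<rho> f0[of n] by simp
    then have le: "norm (fn n z - c n) \<le> 2 * (M * (2 / \<delta>) ^ n)"
      using norm_triangle_ineq4[of "fn n z" "c n"] Suc.IH[OF Suc.prems] by linarith
    moreover have "0 \<le> 2 * (M * (2 / \<delta>) ^ n)" by (rule order_trans[OF norm_ge_zero le])
    moreover have "z \<noteq> 0" using Suc.prems \<rho> by auto
    ultimately have "norm (fn (Suc n) z) \<le> 2 * (M * (2 / \<delta>) ^ n) / \<delta>"
      using \<delta>(1) \<delta>(2)[OF Suc.prems] by (simp add: fn norm_divide frac_le)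
    then show ?case by (simp add: field_simps)
  qed
  have bdc: "norm (fn n z) \<le> M * (2 / \<delta>) ^ n" if "norm z \<le> \<rho>" for n z by (rule mm[OF bd that])
  have cb: "norm (c n) \<le> M * (2 / \<delta>) ^ n" for n using bdc[of 0 n] \<rho> by (simp add: f0)
  have part: "f z = (\<Sum>m<n. c m * h z ^ m) + h z ^ n * fn n z" if "norm z \<le> \<rho>" for n z
  proof (induction n)
    case 0 then show ?case by (simp add: fn)
  next
    case (Suc n)
    have "fn n z = c n + h z * fn (Suc n) z"
      using hnz[of z] that f0[of n] h0 by (cases "z = 0") (auto simp: fn)
    then show ?case using Suc by (simp add: algebra_simps)
  qed
  have "(\<lambda>n. c n * h z ^ n) sums f z" if z: "norm z \<le> \<rho>" "norm (h z) < \<delta> / 2" for z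
  proof -
    have "(\<lambda>n. h z ^ n * fn n z) \<longlonglongrightarrow> 0"
    proof (rule Lim_null_comparison)
      show "\<forall>\<^sub>F n in sequentially. norm (h z ^ n * fn n z) \<le> M * (norm (h z) * 2 / \<delta>) ^ n"
      proof (intro always_eventually allI)
        fix n
        have "norm (h z ^ n * fn n z) \<le> norm (h z) ^ n * (M * (2 / \<delta>) ^ n)"
          unfolding norm_mult norm_power by (intro mult_left_mono bdc z) auto
        then show "norm (h z ^ n * fn n z) \<le> M * (norm (h z) * 2 / \<delta>) ^ n"
          by (simp add: power_mult_distrib power_divide mult_ac)
      qed
      have "(\<lambda>n. M * (norm (h z) * 2 / \<delta>) ^ n) \<longlonglongrightarrow> M * 0"
        using z(2) \<delta>(1) by (intro tendsto_mult tendsto_const LIMSEQ_power_zero) (simp add: field_simps)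
      then show "(\<lambda>n. M * (norm (h z) * 2 / \<delta>) ^ n) \<longlonglongrightarrow> 0" by simp
    qed
    then have "(\<lambda>n. f z - h z ^ n * fn n z) \<longlonglongrightarrow> f z - 0" by (intro tendsto_intros)
    moreover have "(\<lambda>n. f z - h z ^ n * fn n z) = (\<lambda>n. \<Sum>m<n. c m * h z ^ m)"
    proof
      fix n show "f z - h z ^ n * fn n z = (\<Sum>m<n. c m * h z ^ m)" using part[OF z(1), of n] by simp
    qed
    ultimately show ?thesis unfolding sums_def by simp
  qed
  then show ?thesis using cb by blast
qed

lemma order_factor_curve:
  assumes l: "lfun \<pi>" and ec: "entire_curve g" and d: "\<And>i. 1 \<le> i \<Longrightarrow> i < k \<Longrightarrow> curve_deriv i g 0 = 0" and k: "k \<ge> 1"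
  defines "f \<equiv> \<lambda>z. \<pi> (g z)"
  shows "f z = f 0 + z ^ k * (dq ^^ k) f z" "(dq ^^ k) f 0 = \<pi> (curve_deriv k g 0) / fact k"
proof -
  have hol: "f holomorphic_on UNIV" unfolding f_def by (rule lfun_holomorphic[OF l ec])
  have hd: "(deriv ^^ i) f 0 = \<pi> (curve_deriv i g 0)" for i unfolding f_def by (rule lfun_higher_deriv[OF l ec])
  have \<pi>0: "\<pi> 0 = 0" using l unfolding lfun_def by auto
  have val: "(dq ^^ i) f 0 = \<pi> (curve_deriv i g 0) / fact i" for i
    using dq_iterate_0[OF hol, of i] hd[of i] by simp
  then show "(dq ^^ k) f 0 = \<pi> (curve_deriv k g 0) / fact k" .
  obtain m where m: "k = Suc m" using k by (cases k) auto
  have "(dq ^^ i) (dq f) 0 = 0" if "i < m" for i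
    using val[of "Suc i"] d[of "Suc i"] that m \<pi>0 by (simp add: funpow_swap1)
  then have "dq f z = z ^ m * (dq ^^ m) (dq f) z" by (rule dq_iterate_factor)
  then show "f z = f 0 + z ^ k * (dq ^^ k) f z" using dq_eq[of f z] by (simp add: m funpow_swap1)
qed

lemma lul_eventually:
  assumes "lul f g" "compact K" "e > 0" shows "\<forall>\<^sub>F n in sequentially. \<forall>z\<in>K. dist (f n z) (g z) < e"
  using assms unfolding lul_def uniform_limit_iff by blast

text \<open>The heart of the matter: immersed curves \<open>\<psi>\<^sub>j\<close> and curves \<open>\<phi>\<^sub>j\<close> of order \<open>k \<ge> 2\<close> in their images
  cannot both converge to curves of order exactly \<open>k\<close>. For a generic linear function \<open>\<pi>\<close> the power
  series that expresses the other coordinate through \<open>\<pi>\<close> along \<open>\<phi>\<^sub>j\<close> has a radius of convergence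
  bounded below. So it is valid along \<open>\<psi>\<^sub>j\<close> on a fixed disc, where \<open>\<pi> \<circ> \<psi>\<^sub>j\<close> is not injective because
  its limit is branched at \<open>0\<close>.\<close>

lemma no_branched_limits:
  assumes \<psi>: "\<And>j. injective_immersion (\<psi> j)" and \<phi>: "\<And>j. entire_curve (\<phi> j)"
    and lim\<psi>: "lul \<psi> g" and lim\<phi>: "lul \<phi> \<phi>'" and at0: "\<And>j. \<phi> j 0 = \<psi> j 0"
    and plaque: "\<And>j. \<exists>e>0. \<exists>\<tau>. \<tau> holomorphic_on ball 0 e \<and> \<tau> 0 = 0 \<and> (\<forall>z\<in>ball 0 e. \<phi> j z = \<psi> j (\<tau> z))"
    and k: "k \<ge> 2"
    and ord\<phi>: "\<And>i j. 1 \<le> i \<Longrightarrow> i < k \<Longrightarrow> curve_deriv i (\<phi> j) 0 = 0"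
    and ordg: "\<And>i. 1 \<le> i \<Longrightarrow> i < k \<Longrightarrow> curve_deriv i g 0 = 0" "curve_deriv k g 0 \<noteq> 0"
    and ord\<phi>': "curve_deriv k \<phi>' 0 \<noteq> 0"
  shows False
proof -
  note e\<psi> = injective_immersionD(1)[OF \<psi>]
  have eg: "entire_curve g" by (rule lul_entire_curve[OF lim\<psi> e\<psi>])
  have e\<phi>': "entire_curve \<phi>'" by (rule lul_entire_curve[OF lim\<phi> \<phi>])
  have k1: "k \<ge> 1" using k by simp
  obtain \<pi> \<kappa> where c: "coordpair \<pi> \<kappa>" "\<pi> (curve_deriv k g 0) \<noteq> 0" "\<pi> (curve_deriv k \<phi>' 0) \<noteq> 0"
    using coordpair_generic[OF ordg(2) ord\<phi>'] by blast
  have l: "lfun \<pi>" "lfun \<kappa>" using c(1) by (auto simp: coordpair_def)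
  define p where "p = (\<lambda>j z. \<pi> (\<phi> j z))"
  define q where "q = (\<lambda>j z. \<pi> (\<psi> j z))"
  define G where "G = (\<lambda>z. \<pi> (g z))"
  have hol: "p j holomorphic_on UNIV" "q j holomorphic_on UNIV" "G holomorphic_on UNIV" for j
    unfolding p_def q_def G_def by (intro lfun_holomorphic[OF l(1)] \<phi> e\<psi> eg)+
  have lp: "lul p (\<lambda>z. \<pi> (\<phi>' z))" and lq: "lul q G"
    unfolding p_def q_def G_def by (intro lul_lfun lim\<psi> lim\<phi> l)+
  \<comment> \<open>On the side of \<open>\<phi>\<close>, a disc on which \<open>\<pi> \<circ> \<phi>\<^sub>j\<close> takes its value at \<open>0\<close> only there.\<close>
  define E where "E = (\<lambda>j. (dq ^^ k) (p j))"
  define E' where "E' = (dq ^^ k) (\<lambda>z. \<pi> (\<phi>' z))"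
  have pE: "p j z = p j 0 + z ^ k * E j z" for j z
    using order_factor_curve(1)[OF l(1) \<phi> ord\<phi> k1, of j z] by (simp add: p_def E_def)
  have Ehol: "E j holomorphic_on UNIV" for j unfolding E_def by (rule dq_iterate_holomorphic[OF hol(1)])
  have lE: "lul E E'" unfolding E_def E'_def by (rule lul_dq_iterate[OF lp hol(1)])
  have E'hol: "E' holomorphic_on UNIV" by (rule lul_holomorphic[OF lE Ehol])
  have E'0: "E' 0 \<noteq> 0"
    using dq_iterate_0[OF lfun_holomorphic[OF l(1) e\<phi>'], of k] lfun_higher_deriv[OF l(1) e\<phi>', of k 0] c(3) by (auto simp: E'_def)
  define a where "a = norm (E' 0)"
  have a0: "a > 0" using E'0 by (simp add: a_def)
  have "isCont E' 0" using holomorphic_on_imp_continuous_on[OF E'hol] by (simp add: continuous_on_eq_continuous_at)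
  then obtain \<rho>0 where \<rho>0: "\<rho>0 > 0" "\<And>z. dist z 0 < \<rho>0 \<Longrightarrow> dist (E' z) (E' 0) < a / 4"
    using a0 unfolding continuous_at_eps_delta by (metis dist_commute divide_pos_pos zero_less_numeral)
  define \<rho> where "\<rho> = \<rho>0 / 2"
  have \<rho>: "\<rho> > 0" "\<And>z. norm z \<le> \<rho> \<Longrightarrow> dist (E' z) (E' 0) < a / 4" using \<rho>0 by (auto simp: \<rho>_def)
  define \<delta> where "\<delta> = \<rho> ^ k * (a / 2)"
  have \<delta>0: "\<delta> > 0" using \<rho>(1) a0 by (simp add: \<delta>_def)
  have "\<forall>\<^sub>F j in sequentially. \<forall>z\<in>cball 0 \<rho>. dist (E j z) (E' z) < a / 4"
    by (rule lul_eventually[OF lE compact_cball]) (use a0 in simp)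
  then have evE: "\<forall>\<^sub>F j in sequentially. \<forall>z. norm z \<le> \<rho> \<longrightarrow> norm (E j z) \<ge> a / 2"
  proof eventually_elim
    case (elim j)
    show ?case
    proof (intro allI impI)
      fix z :: complex assume z: "norm z \<le> \<rho>"
      have "dist (E j z) (E' 0) < a / 4 + a / 4"
        using elim z \<rho>(2)[OF z] dist_triangle[of "E j z" "E' 0" "E' z"] by force
      then show "norm (E j z) \<ge> a / 2"
        using norm_triangle_ineq3[of "E' 0" "E j z"] by (simp add: a_def dist_norm norm_minus_commute)
    qed
  qed
  \<comment> \<open>On the side of \<open>\<psi>\<close>, a disc on which, for infinitely many \<open>j\<close>, the difference quotient \<open>u j\<close> of
    \<open>\<pi> \<circ> \<psi>\<^sub>j\<close> has a zero. This disc is so small that the power series will converge on it.\<close>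
  define u where "u = (\<lambda>j. dq (q j))"
  have uhol: "u j holomorphic_on X" for j X unfolding u_def using dq_holomorphic[OF hol(2)] holomorphic_on_subset by blast
  have lu: "lul u (dq G)" unfolding u_def by (rule lul_dq[OF lq hol(2)])
  have dGhol: "dq G holomorphic_on UNIV" by (rule dq_holomorphic[OF hol(3)])
  have "isCont G 0" using holomorphic_on_imp_continuous_on[OF hol(3)] by (simp add: continuous_on_eq_continuous_at)
  then obtain \<rho>1 where \<rho>1: "\<rho>1 > 0" "\<And>z. dist z 0 < \<rho>1 \<Longrightarrow> dist (G z) (G 0) < \<delta> / 8"
    using \<delta>0 unfolding continuous_at_eps_delta by (metis dist_commute divide_pos_pos zero_less_numeral)
  define \<rho>' where "\<rho>' = \<rho>1 / 2"
  have \<rho>': "\<rho>' > 0" "\<And>z. norm z \<le> \<rho>' \<Longrightarrow> dist (G z) (G 0) < \<delta> / 8" using \<rho>1 by (auto simp: \<rho>'_def)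
  have "\<forall>\<^sub>F j in sequentially. \<forall>z\<in>cball 0 \<rho>'. dist (q j z) (G z) < \<delta> / 8"
    by (rule lul_eventually[OF lq compact_cball]) (use \<delta>0 in simp)
  then have evq: "\<forall>\<^sub>F j in sequentially. \<forall>z. norm z \<le> \<rho>' \<longrightarrow> norm (q j z - q j 0) < \<delta> / 2"
  proof eventually_elim
    case (elim j)
    show ?case
    proof (intro allI impI)
      fix z :: complex assume z: "norm z \<le> \<rho>'"
      have 1: "dist (q j z) (G z) < \<delta> / 8" "dist (q j 0) (G 0) < \<delta> / 8" using elim z \<rho>'(1) by auto
      have "dist (q j z) (q j 0) \<le> dist (q j z) (G z) + dist (G z) (G 0) + dist (G 0) (q j 0)"
        using dist_triangle[of "q j z" "q j 0" "G z"] dist_triangle[of "G z" "q j 0" "G 0"] by linarith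
      also have "\<dots> < \<delta> / 8 + \<delta> / 8 + \<delta> / 8" using 1 \<rho>'(2)[OF z] by (intro add_strict_mono) (auto simp: dist_commute)
      also have "\<dots> < \<delta> / 2" using \<delta>0 by simp
      finally show "norm (q j z - q j 0) < \<delta> / 2" by (simp add: dist_norm)
    qed
  qed
  have frz: "\<exists>\<^sub>F j in sequentially. \<exists>z\<in>ball 0 \<rho>'. u j z = 0"
  proof (rule ccontr)
    assume "\<not> ?thesis"
    then have "\<forall>\<^sub>F j in sequentially. \<forall>z\<in>ball 0 \<rho>'. u j z \<noteq> 0" by (simp add: frequently_def)
    then obtain N where N: "\<And>j z. j \<ge> N \<Longrightarrow> z \<in> ball 0 \<rho>' \<Longrightarrow> u j z \<noteq> 0" unfolding eventually_sequentially by blast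
    have "strict_mono (\<lambda>n. n + N)" by (simp add: strict_mono_def)
    note lu' = lul_subseq[OF lu this]
    obtain m where m: "k = Suc (Suc m)" using k by (metis add_2_eq_Suc le_iff_add)
    have dG0: "dq G 0 = 0"
      using dq_iterate_0[OF hol(3), of 1] lfun_higher_deriv[OF l(1) eg, of 1 0] ordg(1)[of 1] k l(1)
      by (auto simp: G_def lfun_def)
    have nc: "\<not> dq G constant_on ball 0 \<rho>'"
    proof
      assume "dq G constant_on ball 0 \<rho>'"
      then have z: "dq G z = 0" if "z \<in> ball 0 \<rho>'" for z using that dG0 \<rho>'(1) unfolding constant_on_def by (metis centre_in_ball)
      have G0: "G z = G 0" if "z \<in> ball 0 \<rho>'" for z using dq_eq[of G z] z[OF that] by simp
      have "(deriv ^^ k) G 0 = (deriv ^^ k) (\<lambda>z. G 0) 0"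
        by (rule higher_deriv_transform_within_open[of _ "ball 0 \<rho>'"]) (use hol(3) \<rho>'(1) in \<open>auto intro: holomorphic_on_subset G0\<close>)
      then have "(deriv ^^ k) G 0 = 0" using k by simp
      then show False using lfun_higher_deriv[OF l(1) eg, of k 0] c(2) by (simp add: G_def)
    qed
    have "dq G 0 \<noteq> 0"
      by (rule Hurwitz_no_zeros[of "ball 0 \<rho>'" "\<lambda>n. u (n + N)" "dq G" 0])
         (use lu' uhol dGhol nc N \<rho>'(1) in \<open>auto simp: lul_def intro: holomorphic_on_subset\<close>)
    then show False using dG0 by simp
  qed
  obtain j where j: "\<exists>z\<in>ball 0 \<rho>'. u j z = 0" "\<forall>z. norm z \<le> \<rho> \<longrightarrow> norm (E j z) \<ge> a / 2" "\<forall>z. norm z \<le> \<rho>' \<longrightarrow> norm (q j z - q j 0) < \<delta> / 2"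
    using frequently_ex[OF frequently_eventually_conj[OF frz eventually_conj[OF evE evq]]] by blast
  obtain e \<tau> where \<tau>: "e > 0" "\<tau> holomorphic_on ball 0 e" "\<tau> 0 = 0" "\<And>z. z \<in> ball 0 e \<Longrightarrow> \<phi> j z = \<psi> j (\<tau> z)" using plaque[of j] by blast
  define h where "h = (\<lambda>z. p j z - p j 0)"
  define Gj where "Gj = (\<lambda>s. q j s - q j 0)"
  have hz: "h z = z ^ k * E j z" for z using pE[of j z] by (simp add: h_def)
  have q0p0: "q j 0 = p j 0" by (simp add: q_def p_def at0)
  have Gjh: "h z = Gj (\<tau> z)" if "z \<in> ball 0 e" for z using \<tau>(4)[OF that] by (simp add: h_def Gj_def q0p0) (simp add: p_def q_def)
  have Ej0: "E j z \<noteq> 0" if "norm z \<le> \<rho>" for z using j(2) that a0 by fastforce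
  have u0: "u j 0 = deriv Gj 0"
  proof -
    have "(q j has_field_derivative deriv (q j) 0) (at 0)" using holomorphic_derivI[OF hol(2) open_UNIV] by simp
    then have "(Gj has_field_derivative deriv (q j) 0 - 0) (at 0)" unfolding Gj_def by (intro derivative_intros)
    then show ?thesis using DERIV_imp_deriv by (fastforce simp: u_def dq_def)
  qed
  \<comment> \<open>The order of \<open>\<tau>\<close> at \<open>0\<close> is at least \<open>k\<close>, and that of \<open>\<pi> \<circ> \<phi>\<^sub>j = \<pi> \<circ> \<psi>\<^sub>j \<circ> \<tau>\<close> is \<open>k\<close>, so \<open>\<pi> \<circ> \<psi>\<^sub>j\<close> is
    unramified at \<open>0\<close>.\<close>
  have dG: "deriv Gj 0 \<noteq> 0"
  proof
    assume d0: "deriv Gj 0 = 0"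
    obtain \<pi>' \<kappa>' where c': "coordpair \<pi>' \<kappa>'" "deriv (\<lambda>s. \<pi>' (\<psi> j s)) 0 \<noteq> 0"
      using immersion_chart[OF e\<psi> injective_immersionD(3)[OF \<psi>], of j 0] by blast
    have l': "lfun \<pi>'" using c'(1) by (simp add: coordpair_def)
    define v where "v = dq (\<lambda>s. \<pi>' (\<psi> j s))"
    define w where "w = dq (dq (q j))"
    define E2 where "E2 = (dq ^^ k) (\<lambda>z. \<pi>' (\<phi> j z))"
    have vh: "v holomorphic_on UNIV" and wh: "w holomorphic_on UNIV" and E2h: "E2 holomorphic_on UNIV"
      unfolding v_def w_def E2_def by (intro dq_holomorphic dq_iterate_holomorphic hol lfun_holomorphic[OF l'] e\<psi> \<phi>)+
    have v0: "v 0 \<noteq> 0" using c'(2) by (simp add: v_def dq_def)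
    have qw: "Gj s = s ^ 2 * w s" for s
    proof -
      have "dq (q j) 0 = 0" using u0 d0 by (simp add: u_def)
      then have "dq (q j) s = s * w s" using dq_eq[of "dq (q j)" s] by (simp add: w_def)
      then show ?thesis using dq_eq[of "q j" s] by (simp add: Gj_def power2_eq_square)
    qed
    have \<tau>v: "\<tau> z * v (\<tau> z) = z ^ k * E2 z" if "z \<in> ball 0 e" for z
    proof -
      have "\<pi>' (\<psi> j (\<tau> z)) = \<pi>' (\<psi> j 0) + \<tau> z * v (\<tau> z)" unfolding v_def by (rule dq_eq)
      moreover have "\<pi>' (\<phi> j z) = \<pi>' (\<phi> j 0) + z ^ k * E2 z"
        unfolding E2_def by (rule order_factor_curve(1)[OF l' \<phi> ord\<phi> k1])
      ultimately show ?thesis using \<tau>(4)[OF that] at0[of j] by simp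
    qed
    have c\<tau>: "(\<tau> \<longlongrightarrow> 0) (at 0)"
    proof -
      have "isCont \<tau> 0" using holomorphic_on_imp_continuous_on[OF \<tau>(2)] \<tau>(1) by (simp add: continuous_on_eq_continuous_at)
      then show ?thesis by (simp add: isCont_def \<tau>(3))
    qed
    have tl: "((\<lambda>z. f (\<tau> z)) \<longlongrightarrow> f 0) (at 0)" if "f holomorphic_on UNIV" for f
      using holomorphic_on_imp_continuous_on[OF that] isCont_tendsto_compose[OF _ c\<tau>] by (auto simp: continuous_on_eq_continuous_at)
    have tl': "(f \<longlongrightarrow> f 0) (at 0)" if "f holomorphic_on UNIV" for f :: "complex \<Rightarrow> complex"
      using holomorphic_on_imp_continuous_on[OF that] by (auto simp: continuous_on_eq_continuous_at isCont_def)
    have "((\<lambda>z. z ^ k * (E2 z / v (\<tau> z)) ^ 2 * w (\<tau> z)) \<longlongrightarrow> 0 ^ k * (E2 0 / v 0) ^ 2 * w 0) (at 0)"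
      by (intro tendsto_intros tl tl' vh wh E2h v0)
    then have L: "((\<lambda>z. z ^ k * (E2 z / v (\<tau> z)) ^ 2 * w (\<tau> z)) \<longlongrightarrow> 0) (at 0)" using k1 by (simp add: power_0_left)
    have "\<forall>\<^sub>F z in at 0. z ^ k * (E2 z / v (\<tau> z)) ^ 2 * w (\<tau> z) = E j z"
    proof -
      have "\<forall>\<^sub>F z in at 0. v (\<tau> z) \<noteq> 0" by (rule tendsto_imp_eventually_ne[OF tl[OF vh] v0])
      moreover have "\<forall>\<^sub>F z in at 0. z \<in> ball 0 e \<and> z \<noteq> 0" using \<tau>(1) unfolding eventually_at by (intro exI[of _ e]) (auto simp: dist_commute)
      ultimately show ?thesis
      proof eventually_elim
        case (elim z)
        have "\<tau> z = z ^ k * (E2 z / v (\<tau> z))" using \<tau>v[of z] elim by (simp add: field_simps)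
        then have "Gj (\<tau> z) = (z ^ k * (E2 z / v (\<tau> z))) ^ 2 * w (\<tau> z)" using qw[of "\<tau> z"] by simp
        then have "z ^ k * E j z = z ^ k * (z ^ k * (E2 z / v (\<tau> z)) ^ 2 * w (\<tau> z))"
          using Gjh[of z] elim hz[of z] by (simp add: power_mult_distrib power2_eq_square mult_ac)
        then show ?case using elim by simp
      qed
    qed
    with L have "(E j \<longlongrightarrow> 0) (at 0)" by (rule Lim_transform_eventually)
    then have "E j 0 = 0" using tl'[OF Ehol[of j]] tendsto_unique[OF trivial_limit_at] by blast
    then show False using Ej0[of 0] \<rho>(1) by simp
  qed
  define F where "F = (\<lambda>s. \<kappa> (\<psi> j s))"
  define f where "f = (\<lambda>z. \<kappa> (\<phi> j z))"
  have Fhol: "F holomorphic_on UNIV" "f holomorphic_on UNIV" unfolding F_def f_def by (intro lfun_holomorphic[OF l(2)] e\<psi> \<phi>)+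
  have hh: "h holomorphic_on UNIV" "Gj holomorphic_on UNIV" unfolding h_def Gj_def by (intro holomorphic_intros hol)+
  have hnz: "h z \<noteq> 0" if "z \<noteq> 0" "norm z \<le> \<rho>" for z using Ej0[OF that(2)] that(1) by (simp add: hz)
  have hs: "norm (h z) \<ge> \<delta>" if "norm z = \<rho>" for z
  proof -
    have "\<rho> ^ k * (a / 2) \<le> \<rho> ^ k * norm (E j z)" using j(2) that \<rho>(1) by (intro mult_left_mono) auto
    then show ?thesis using that by (simp add: hz norm_mult norm_power \<delta>_def)
  qed
  have h0: "h 0 = 0" and Gj0: "Gj 0 = 0" by (auto simp: h_def Gj_def)
  have fF: "h z = Gj (\<tau> z) \<and> f z = F (\<tau> z)" if "z \<in> ball 0 e" for z using Gjh[OF that] \<tau>(4)[OF that] by (simp add: f_def F_def)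
  obtain cc M where cc: "\<And>n. norm (cc n) \<le> M * (2 / \<delta>) ^ n"
    "\<And>z. norm z \<le> \<rho> \<Longrightarrow> norm (h z) < \<delta> / 2 \<Longrightarrow> (\<lambda>n. cc n * h z ^ n) sums f z"
    using expansion_in_powers[OF Fhol(2) hh(1) Fhol(1) hh(2) \<rho>(1) h0 hnz \<delta>0 hs Gj0 dG \<tau>(1-3) fF] by blast
  define \<gamma> where "\<gamma> = (\<lambda>w. \<Sum>n. cc n * w ^ n)"
  have summ: "summable (\<lambda>n. cc n * w ^ n)" if "norm w < \<delta> / 2" for w
  proof (rule summable_comparison_test'[of "\<lambda>n. M * (norm w * 2 / \<delta>) ^ n" 0])
    show "summable (\<lambda>n. M * (norm w * 2 / \<delta>) ^ n)" using that \<delta>0 by (intro summable_mult summable_geometric) (simp add: field_simps)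
    fix n
    have "norm (cc n * w ^ n) \<le> (M * (2 / \<delta>) ^ n) * norm w ^ n" unfolding norm_mult norm_power by (intro mult_right_mono cc) auto
    then show "norm (cc n * w ^ n) \<le> M * (norm w * 2 / \<delta>) ^ n" by (simp add: power_mult_distrib power_divide mult_ac)
  qed
  have \<gamma>hol: "\<gamma> holomorphic_on ball 0 (\<delta> / 2)"
  proof (rule power_series_holomorphic)
    fix w :: complex assume "w \<in> ball 0 (\<delta> / 2)"
    then show "(\<lambda>n. cc n * (w - 0) ^ n) sums \<gamma> w" using summ[of w] by (simp add: \<gamma>_def summable_sums)
  qed
  \<comment> \<open>The difference \<open>d\<close> vanishes at the points \<open>\<tau> z\<close> near \<open>0\<close>, hence on the whole disc.\<close>
  define d where "d = (\<lambda>s. F s - \<gamma> (Gj s))"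
  have dhol: "d holomorphic_on ball 0 \<rho>'"
  proof -
    have "(\<lambda>s. \<gamma> (Gj s)) holomorphic_on ball 0 \<rho>'"
      using holomorphic_on_compose_gen[OF holomorphic_on_subset[OF hh(2)] \<gamma>hol, of "ball 0 \<rho>'"] j(3) by (force simp: o_def Gj_def)
    then show ?thesis unfolding d_def by (intro holomorphic_intros holomorphic_on_subset[OF Fhol(1)]) auto
  qed
  define A where "A = {z. z \<noteq> 0 \<and> norm z \<le> \<rho> \<and> z \<in> ball 0 e \<and> norm (h z) < \<delta> / 2}"
  have dA: "d (\<tau> z) = 0" if "z \<in> A" for z
  proof -
    have 1: "f z = \<gamma> (h z)" using cc(2)[of z] that unfolding A_def \<gamma>_def by (auto dest: sums_unique)
    have zb: "z \<in> ball 0 e" using that by (auto simp: A_def)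
    have "F (\<tau> z) = \<gamma> (Gj (\<tau> z))" using 1 unfolding conjunct1[OF fF[OF zb]] conjunct2[OF fF[OF zb]] .
    then show ?thesis unfolding d_def by simp
  qed
  have lp0: "0 islimpt (\<tau> ` A \<inter> ball 0 \<rho>')"
    unfolding islimpt_approachable
  proof (intro allI impI)
    fix \<epsilon> :: real assume \<epsilon>: "\<epsilon> > 0"
    have c0: "isCont \<tau> 0" "isCont h 0"
      using holomorphic_on_imp_continuous_on[OF \<tau>(2)] \<tau>(1) holomorphic_on_imp_continuous_on[OF hh(1)]
      by (auto simp: continuous_on_eq_continuous_at)
    have m0: "min \<epsilon> \<rho>' > 0" "\<delta> / 2 > 0" using \<epsilon> \<rho>' \<delta>0 by auto
    obtain d1 where d1: "d1 > 0" "\<And>z. dist z 0 < d1 \<Longrightarrow> dist (\<tau> z) 0 < min \<epsilon> \<rho>'"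
      using c0(1) m0(1) \<tau>(3) unfolding continuous_at_eps_delta by metis
    obtain d2 where d2: "d2 > 0" "\<And>z. dist z 0 < d2 \<Longrightarrow> dist (h z) 0 < \<delta> / 2"
      using c0(2) m0(2) h0 unfolding continuous_at_eps_delta by metis
    define z where "z = (of_real (min (min d1 d2) (min \<rho> e) / 2) :: complex)"
    have m: "min (min d1 d2) (min \<rho> e) > 0" using d1 d2 \<rho> \<tau> by auto
    then have nz: "norm z = min (min d1 d2) (min \<rho> e) / 2" by (simp add: z_def)
    then have z: "z \<noteq> 0" "norm z < d1" "norm z < d2" "norm z \<le> \<rho>" "norm z < e" using m by auto
    then have zA: "z \<in> A" using d2(2)[of z] by (auto simp: A_def)
    have "h z \<noteq> 0" by (rule hnz[OF z(1,4)])
    then have "\<tau> z \<noteq> 0" using Gjh[of z] z(5) Gj0 by auto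
    moreover have "dist (\<tau> z) 0 < min \<epsilon> \<rho>'" using d1(2)[of z] z(2) by simp
    ultimately show "\<exists>x'\<in>\<tau> ` A \<inter> ball 0 \<rho>'. x' \<noteq> 0 \<and> dist x' 0 < \<epsilon>"
      using zA by (intro bexI[of _ "\<tau> z"]) auto
  qed
  have dz: "d s = 0" if "s \<in> ball 0 \<rho>'" for s
    by (rule analytic_continuation[OF dhol open_ball connected_ball _ _ lp0 _ that]) (use dA \<rho>'(1) in auto)
  \<comment> \<open>At the zero \<open>z1\<close> of the difference quotient both coordinates of \<open>\<psi>\<^sub>j\<close> agree with those at \<open>0\<close>.\<close>
  obtain z1 where z1: "z1 \<in> ball 0 \<rho>'" "u j z1 = 0" using j(1) by blast
  have z10: "z1 \<noteq> 0" using z1(2) u0 dG by auto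
  have qz: "q j z1 = q j 0" using dq_eq[of "q j" z1] z1(2) by (simp add: u_def)
  then have "\<kappa> (\<psi> j z1) = \<kappa> (\<psi> j 0)" using dz[OF z1(1)] dz[of 0] \<rho>'(1) by (simp add: d_def F_def Gj_def)
  then have "\<psi> j z1 = \<psi> j 0" using qz c(1) unfolding coordpair_def q_def by blast
  then show False using z10 injective_immersionD(2)[OF \<psi>] by (metis injD)
qed

section \<open>Openness and density for limit curves\<close>

lemma limit_curvesD:
  assumes "g \<in> limit_curves S \<psi> x"
  shows "entire_curve g" "\<exists>y. range y \<subseteq> S \<and> y \<longlonglongrightarrow> x \<and> lul (\<lambda>j. \<psi> (y j)) g"
  using assms by (auto simp: limit_curves_def locally_uniform_limit_iff_lul)

lemma limit_curve_at_0:
  assumes "g \<in> limit_curves S \<psi> x" "\<And>y. y \<in> S \<Longrightarrow> \<psi> y 0 = y" shows "g 0 = x"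
proof -
  obtain y where y: "range y \<subseteq> S" "y \<longlonglongrightarrow> x" "lul (\<lambda>j. \<psi> (y j)) g" using limit_curvesD(2)[OF assms(1)] by blast
  have "(\<lambda>j. \<psi> (y j) 0) \<longlonglongrightarrow> g 0" by (rule lul_tendsto[OF y(3)])
  moreover have "(\<lambda>j. \<psi> (y j) 0) = y" by (rule ext, rule assms(2)) (use y(1) in blast)
  ultimately show ?thesis using y(2) LIMSEQ_unique by metis
qed

lemma lul_transfer:
  fixes f :: "nat \<Rightarrow> complex \<Rightarrow> complex \<times> complex"
  assumes f: "lul f g" and d: "\<And>n z. norm z \<le> real n \<Longrightarrow> dist (f n z) (h n z) \<le> inverse (real (Suc n))"
  shows "lul h g"
  unfolding lul_def
proof (intro allI impI uniform_limitI)
  fix K :: "complex set" and e :: real assume K: "compact K" and e: "e > 0"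
  obtain R where R: "\<And>z. z \<in> K \<Longrightarrow> norm z \<le> R" using K compact_imp_bounded bounded_iff by metis
  have "\<forall>\<^sub>F n in sequentially. \<forall>z\<in>K. dist (f n z) (g z) < e / 2" by (rule lul_eventually[OF f K]) (use e in simp)
  moreover have "\<forall>\<^sub>F n in sequentially. inverse (real (Suc n)) < e / 2"
    using order_tendstoD(2)[OF LIMSEQ_inverse_real_of_nat, of "e / 2"] e by simp
  moreover have "\<forall>\<^sub>F n in sequentially. R \<le> real n" using filterlim_real_sequentially unfolding filterlim_at_top by blast
  ultimately show "\<forall>\<^sub>F n in sequentially. \<forall>x\<in>K. dist (h n x) (g x) < e"
  proof eventually_elim
    case (elim n)
    show ?case
    proof
      fix x assume x: "x \<in> K"
      have "norm x \<le> real n" using R[OF x] elim(3) by simp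
      then show "dist (h n x) (g x) < e"
        using d[of x n] elim(1,2) x dist_triangle[of "h n x" "g x" "f n x"] by (force simp: dist_commute)
    qed
  qed
qed

text \<open>Limits of limit curves are limit curves, by a diagonal choice.\<close>

lemma limit_curves_diagonal:
  assumes qe: "quasi_expanding S \<psi>" and ec: "\<And>y. y \<in> S \<Longrightarrow> entire_curve (\<psi> y)"
    and x: "xs \<longlonglongrightarrow> x" and g: "\<And>n. gs n \<in> limit_curves S \<psi> (xs n)"
  shows "\<exists>r g. strict_mono r \<and> g \<in> limit_curves S \<psi> x \<and> lul (\<lambda>n. gs (r n)) g"
proof -
  have "\<exists>y. y \<in> S \<and> dist y (xs n) < inverse (real (Suc n)) \<and> (\<forall>z. norm z \<le> real n \<longrightarrow> dist (\<psi> y z) (gs n z) < inverse (real (Suc n)))" for n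
  proof -
    obtain y where y: "range y \<subseteq> S" "y \<longlonglongrightarrow> xs n" "lul (\<lambda>j. \<psi> (y j)) (gs n)" using limit_curvesD(2)[OF g[of n]] by blast
    have "\<forall>\<^sub>F j in sequentially. dist (y j) (xs n) < inverse (real (Suc n))"
      by (rule tendstoD[OF y(2)]) simp
    moreover have "\<forall>\<^sub>F j in sequentially. \<forall>z\<in>cball 0 (real n). dist (\<psi> (y j) z) (gs n z) < inverse (real (Suc n))"
      by (rule lul_eventually[OF y(3) compact_cball]) simp
    ultimately have "\<forall>\<^sub>F j in sequentially. dist (y j) (xs n) < inverse (real (Suc n)) \<and> (\<forall>z\<in>cball 0 (real n). dist (\<psi> (y j) z) (gs n z) < inverse (real (Suc n)))"
      by (rule eventually_conj)
    then obtain j where "dist (y j) (xs n) < inverse (real (Suc n))" "\<forall>z\<in>cball 0 (real n). dist (\<psi> (y j) z) (gs n z) < inverse (real (Suc n))"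
      using eventually_happens'[OF sequentially_bot] by blast
    then show ?thesis using y(1) by (intro exI[of _ "y j"]) auto
  qed
  then obtain y where y: "\<And>n. y n \<in> S" "\<And>n. dist (y n) (xs n) < inverse (real (Suc n))"
    "\<And>n z. norm z \<le> real n \<Longrightarrow> dist (\<psi> (y n) z) (gs n z) < inverse (real (Suc n))" by metis
  have "range (\<lambda>n. \<psi> (y n)) \<subseteq> \<psi> ` S" using y(1) by blast
  then obtain g r where r: "strict_mono r" "lul (\<lambda>n. \<psi> (y (r n))) g"
    using qe unfolding quasi_expanding_def normal_family_def locally_uniform_limit_iff_lul by (force simp: o_def)
  have ry: "inverse (real (Suc (r n))) \<le> inverse (real (Suc n))" for n using seq_suble[OF r(1), of n] by simp
  have ylim: "(\<lambda>n. y (r n)) \<longlonglongrightarrow> x"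
  proof -
    have "(\<lambda>n. dist (y n) (xs n)) \<longlonglongrightarrow> 0"
      by (rule tendsto_sandwich[OF _ _ tendsto_const LIMSEQ_inverse_real_of_nat]) (use y(2) in \<open>auto intro!: always_eventually less_imp_le\<close>)
    then have "y \<longlonglongrightarrow> x"
    proof -
      have "(\<lambda>n. y n - xs n) \<longlonglongrightarrow> 0"
        using \<open>(\<lambda>n. dist (y n) (xs n)) \<longlonglongrightarrow> 0\<close> by (simp add: dist_norm tendsto_norm_zero_iff)
      from tendsto_add[OF this x] show ?thesis by simp
    qed
    then show ?thesis using LIMSEQ_subseq_LIMSEQ[OF _ r(1)] by (simp add: o_def)
  qed
  have eg: "entire_curve g" by (rule lul_entire_curve[OF r(2)]) (use ec y(1) in blast)
  have "g \<in> limit_curves S \<psi> x"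
    unfolding limit_curves_def locally_uniform_limit_iff_lul using eg ylim r(2) y(1)
    by (auto intro!: exI[of _ "\<lambda>n. y (r n)"])
  moreover have "lul (\<lambda>n. gs (r n)) g"
  proof (rule lul_transfer[OF r(2)])
    fix n z assume "norm (z::complex) \<le> real n"
    then have "norm z \<le> real (r n)" using seq_suble[OF r(1), of n] by (meson of_nat_le_iff order_trans)
    then show "dist (\<psi> (y (r n)) z) (gs (r n) z) \<le> inverse (real (Suc n))" using y(3)[of z "r n"] ry[of n] by linarith
  qed
  ultimately show ?thesis using r(1) by blast
qed

lemma self_limit_curve:
  assumes "y \<in> S" "entire_curve (\<psi> y)" shows "\<psi> y \<in> limit_curves S \<psi> y"
  unfolding limit_curves_def locally_uniform_limit_def using assms
  by (auto intro!: exI[of _ "\<lambda>_. y"] uniform_limit_const)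

lemma limit_curves_nonempty:
  assumes "quasi_expanding S \<psi>" "\<And>y. y \<in> S \<Longrightarrow> entire_curve (\<psi> y)" "x \<in> closure S"
  shows "limit_curves S \<psi> x \<noteq> {}"
proof -
  obtain y where y: "\<And>n. y n \<in> S" "y \<longlonglongrightarrow> x" using assms(3) unfolding closure_sequential by blast
  show ?thesis using limit_curves_diagonal[OF assms(1,2) y(2), where gs = "\<lambda>n. \<psi> (y n)"] self_limit_curve[of "y _" S \<psi>] y(1) assms(2) by blast
qed

text \<open>Some limit curve at \<open>x\<close> has order at least \<open>k\<close>.\<close>

definition high_order :: "(complex \<times> complex) set \<Rightarrow> (complex \<times> complex \<Rightarrow> complex \<Rightarrow> complex \<times> complex) \<Rightarrow> nat \<Rightarrow> complex \<times> complex \<Rightarrow> bool" where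
  "high_order S \<psi> k x \<longleftrightarrow> (\<exists>g\<in>limit_curves S \<psi> x. \<forall>i. 1 \<le> i \<longrightarrow> i < k \<longrightarrow> curve_deriv i g 0 = 0)"

text \<open>Upper semicontinuity of the maximal order.\<close>

lemma high_order_closed:
  assumes qe: "quasi_expanding S \<psi>" and ec: "\<And>y. y \<in> S \<Longrightarrow> entire_curve (\<psi> y)"
    and x: "xs \<longlonglongrightarrow> x" and h: "\<And>n. high_order S \<psi> k (xs n)"
  shows "high_order S \<psi> k x"
proof -
  have "\<forall>n. \<exists>g. g \<in> limit_curves S \<psi> (xs n) \<and> (\<forall>i. 1 \<le> i \<longrightarrow> i < k \<longrightarrow> curve_deriv i g 0 = 0)"
    using h unfolding high_order_def by blast
  from choice[OF this] obtain gs where "\<forall>n. gs n \<in> limit_curves S \<psi> (xs n) \<and> (\<forall>i. 1 \<le> i \<longrightarrow> i < k \<longrightarrow> curve_deriv i (gs n) 0 = 0)" ..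
  then have gs: "gs n \<in> limit_curves S \<psi> (xs n)" "\<And>i. 1 \<le> i \<Longrightarrow> i < k \<Longrightarrow> curve_deriv i (gs n) 0 = 0" for n by auto
  obtain r g where r: "strict_mono r" "g \<in> limit_curves S \<psi> x" "lul (\<lambda>n. gs (r n)) g"
    using limit_curves_diagonal[OF qe ec x gs(1)] by blast
  have "curve_deriv i g 0 = 0" if "1 \<le> i" "i < k" for i
    using lul_curve_deriv[OF r(3) limit_curvesD(1)[OF gs(1)], of i 0] gs(2)[OF that] by (simp add: LIMSEQ_const_iff)
  then show ?thesis using r(2) unfolding high_order_def by blast
qed

lemma entire_curve_const:
  assumes "entire_curve g" "\<And>i. i \<ge> 1 \<Longrightarrow> curve_deriv i g 0 = 0" shows "g z = g 0"
proof -
  have *: "f z = f 0" if f: "f holomorphic_on UNIV" "\<And>i. i \<ge> 1 \<Longrightarrow> (deriv ^^ i) f 0 = 0" for f :: "complex \<Rightarrow> complex"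
    by (rule holomorphic_fun_eq_const_on_connected[OF f(1) open_UNIV connected_UNIV]) (use f(2) in auto)
  have "(deriv ^^ i) (\<lambda>z. fst (g z)) 0 = 0" "(deriv ^^ i) (\<lambda>z. snd (g z)) 0 = 0" if "i \<ge> 1" for i
    using assms(2)[OF that] by (simp_all add: curve_deriv_def zero_prod_def)
  then show ?thesis using assms(1) *[of "\<lambda>z. fst (g z)"] *[of "\<lambda>z. snd (g z)"] by (auto simp: entire_curve_def prod_eq_iff)
qed

lemma high_order_bounded:
  assumes qe: "quasi_expanding S \<psi>" and ec: "\<And>y. y \<in> S \<Longrightarrow> entire_curve (\<psi> y)"
    and nc: "\<And>g. g \<in> limit_curves S \<psi> x \<Longrightarrow> \<exists>z. g z \<noteq> g 0"
  shows "\<exists>k. \<not> high_order S \<psi> k x"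
proof (rule ccontr)
  assume "\<not> ?thesis"
  then have "\<forall>k. \<exists>g. g \<in> limit_curves S \<psi> x \<and> (\<forall>i. 1 \<le> i \<longrightarrow> i < k \<longrightarrow> curve_deriv i g 0 = 0)"
    unfolding high_order_def by blast
  from choice[OF this] obtain gs where "\<forall>k. gs k \<in> limit_curves S \<psi> x \<and> (\<forall>i. 1 \<le> i \<longrightarrow> i < k \<longrightarrow> curve_deriv i (gs k) 0 = 0)" ..
  then have gs: "gs k \<in> limit_curves S \<psi> x" "\<And>i. 1 \<le> i \<Longrightarrow> i < k \<Longrightarrow> curve_deriv i (gs k) 0 = 0" for k by auto
  obtain r g where r: "strict_mono r" "g \<in> limit_curves S \<psi> x" "lul (\<lambda>n. gs (r n)) g"
    using limit_curves_diagonal[OF qe ec tendsto_const[of x], where gs = gs] gs(1) by blast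
  have "curve_deriv i g 0 = 0" if i: "i \<ge> 1" for i
  proof -
    have "\<forall>\<^sub>F n in sequentially. curve_deriv i (gs (r n)) 0 = 0"
      using eventually_gt_at_top[of i]
    proof eventually_elim
      case (elim n)
      then have "i < r n" using seq_suble[OF r(1), of n] by simp
      then show ?case using gs(2)[OF i] by blast
    qed
    then have "(\<lambda>n. curve_deriv i (gs (r n)) 0) \<longlonglongrightarrow> 0" by (rule tendsto_eventually)
    then show ?thesis using lul_curve_deriv[OF r(3) limit_curvesD(1)[OF gs(1)], of i 0] LIMSEQ_unique by blast
  qed
  then show False using nc[OF r(2)] entire_curve_const[OF limit_curvesD(1)[OF r(2)]] by blast
qed

lemma tau_1_iff:
  assumes ne: "limit_curves S \<psi> x \<noteq> {}"
  shows "tau S \<psi> x = enat 1 \<longleftrightarrow> \<not> high_order S \<psi> 2 x"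
proof
  assume t: "tau S \<psi> x = enat 1"
  show "\<not> high_order S \<psi> 2 x"
  proof
    assume "high_order S \<psi> 2 x"
    then obtain g where g: "g \<in> limit_curves S \<psi> x" "\<And>i. 1 \<le> i \<Longrightarrow> i < 2 \<Longrightarrow> curve_deriv i g 0 = 0" unfolding high_order_def by blast
    have "enat 2 \<le> curve_order g"
      unfolding curve_order_def
    proof (rule Inf_greatest)
      fix e assume "e \<in> {enat n | n. 1 \<le> n \<and> curve_deriv n g 0 \<noteq> 0}"
      then obtain n where "e = enat n" "1 \<le> n" "curve_deriv n g 0 \<noteq> 0" by blast
      then show "enat 2 \<le> e" using g(2)[of n] by (cases "n < 2") auto
    qed
    also have "\<dots> \<le> tau S \<psi> x" unfolding tau_def by (rule SUP_upper[OF g(1)])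
    finally show False using t by simp
  qed
next
  assume h: "\<not> high_order S \<psi> 2 x"
  have "curve_order g = enat 1" if g: "g \<in> limit_curves S \<psi> x" for g
  proof (rule antisym)
    have "curve_deriv 1 g 0 \<noteq> 0"
    proof
      assume 0: "curve_deriv 1 g 0 = 0"
      have "curve_deriv i g 0 = 0" if "1 \<le> i" "i < 2" for i
      proof -
        have "i = 1" using that by simp
        then show ?thesis using 0 by simp
      qed
      then show False using h g unfolding high_order_def by blast
    qed
    then show "curve_order g \<le> enat 1" unfolding curve_order_def by (intro Inf_lower) auto
    show "enat 1 \<le> curve_order g" unfolding curve_order_def by (rule Inf_greatest) auto
  qed
  then have "curve_order ` limit_curves S \<psi> x = {enat 1}" using ne by auto
  then show "tau S \<psi> x = enat 1" unfolding tau_def by simp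
qed

text \<open>The topological conclusion for a family of injective immersions with pairwise disjoint or
  equal images, none of whose limits is constant.\<close>

lemma order_one_open_dense:
  assumes qe: "quasi_expanding S \<psi>" and im: "\<And>y. y \<in> S \<Longrightarrow> injective_immersion (\<psi> y)" and at0: "\<And>y. y \<in> S \<Longrightarrow> \<psi> y 0 = y"
    and dis: "\<And>y y'. y \<in> S \<Longrightarrow> y' \<in> S \<Longrightarrow> range (\<psi> y) \<inter> range (\<psi> y') = {} \<or> range (\<psi> y) = range (\<psi> y')"
    and SJ: "S \<subseteq> J" "J \<subseteq> closure S"
    and nc: "\<And>x g. x \<in> J \<Longrightarrow> g \<in> limit_curves S \<psi> x \<Longrightarrow> \<exists>z. g z \<noteq> g 0"
  shows "openin (top_of_set J) {x \<in> J. tau S \<psi> x = enat 1} \<and> J \<subseteq> closure {x \<in> J. tau S \<psi> x = enat 1}"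
proof -
  have ec: "entire_curve (\<psi> y)" if "y \<in> S" for y using im[OF that] injective_immersionD(1) by blast
  have J1: "{x \<in> J. tau S \<psi> x = enat 1} = {x \<in> J. \<not> high_order S \<psi> 2 x}"
    using tau_1_iff limit_curves_nonempty[OF qe ec] SJ by blast
  have near: "\<exists>d>0. \<forall>x\<in>J. dist x x0 < d \<longrightarrow> \<not> high_order S \<psi> k x" if n: "\<not> high_order S \<psi> k x0" for k x0
  proof (rule ccontr)
    assume no: "\<not> ?thesis"
    have "\<exists>x. dist x x0 < inverse (real (Suc n)) \<and> high_order S \<psi> k x" for n
    proof -
      have "inverse (real (Suc n)) > 0" by simp
      then show ?thesis using no by blast
    qed
    then have "\<forall>n. \<exists>x. dist x x0 < inverse (real (Suc n)) \<and> high_order S \<psi> k x" by blast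
    from choice[OF this] obtain xs where xs: "\<And>n. dist (xs n) x0 < inverse (real (Suc n))" "\<And>n. high_order S \<psi> k (xs n)" by blast
    have "xs \<longlonglongrightarrow> x0"
      by (rule metric_tendsto_imp_tendsto[OF LIMSEQ_inverse_real_of_nat]) (use xs(1) in \<open>auto simp: less_imp_le dist_real_def\<close>)
    from high_order_closed[OF qe ec this xs(2)] show False using n by blast
  qed
  have op: "openin (top_of_set J) {x \<in> J. \<not> high_order S \<psi> 2 x}"
    unfolding openin_euclidean_subtopology_iff using near by (auto simp: dist_commute) 
  have "x0 \<in> closure {x \<in> J. \<not> high_order S \<psi> 2 x}" if x0: "x0 \<in> J" for x0
  proof (rule ccontr)
    assume "x0 \<notin> closure {x \<in> J. \<not> high_order S \<psi> 2 x}"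
    then obtain \<epsilon> where \<epsilon>: "\<epsilon> > 0" "\<And>x. x \<in> J \<Longrightarrow> dist x x0 < \<epsilon> \<Longrightarrow> high_order S \<psi> 2 x"
      unfolding closure_approachable by auto
    define U where "U = {x \<in> J. dist x x0 < \<epsilon>}"
    have x0U: "x0 \<in> U" using x0 \<epsilon>(1) by (simp add: U_def)
    \<comment> \<open>The least value \<open>k\<close> of the maximal order on \<open>U\<close>, attained at \<open>xm\<close>. Below, \<open>y j\<close> are centres in \<open>U\<close>
      tending to \<open>xm\<close>, and \<open>\<phi> j\<close> are limit curves of order at least \<open>k\<close> at these centres.\<close>
    obtain K where K: "\<not> high_order S \<psi> K x0" using high_order_bounded[OF qe ec nc[OF x0]] by blast
    define k where "k = (LEAST k. \<exists>x\<in>U. \<not> high_order S \<psi> (Suc k) x)"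
    have exk: "\<exists>k. \<exists>x\<in>U. \<not> high_order S \<psi> (Suc k) x"
    proof -
      have "\<not> high_order S \<psi> (Suc K) x0" using K unfolding high_order_def by (meson less_SucI)
      then show ?thesis using x0U by blast
    qed
    obtain xm where xm: "xm \<in> U" "\<not> high_order S \<psi> (Suc k) xm" using LeastI_ex[OF exk] unfolding k_def by blast
    have hi2: "high_order S \<psi> 2 x" if "x \<in> U" for x using that \<epsilon>(2) by (simp add: U_def)
    have k2: "k \<ge> 2"
    proof (rule ccontr)
      assume "\<not> ?thesis"
      then have "Suc k \<le> 2" by simp
      then have "high_order S \<psi> (Suc k) xm" using hi2[OF xm(1)] unfolding high_order_def by (meson less_le_trans)
      then show False using xm(2) by simp
    qed
    have hik: "high_order S \<psi> k x" if "x \<in> U" for x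
    proof -
      obtain k' where k': "k = Suc k'" using k2 by (cases k) auto
      then have "k' < k" by simp
      from not_less_Least[OF this[unfolded k_def]] show ?thesis using that k' by blast
    qed
    have xmJ: "xm \<in> J" using xm(1) by (simp add: U_def)
    have exact: "curve_deriv k g 0 \<noteq> 0" if "g \<in> limit_curves S \<psi> xm" "\<And>i. 1 \<le> i \<Longrightarrow> i < k \<Longrightarrow> curve_deriv i g 0 = 0" for g
    proof
      assume "curve_deriv k g 0 = 0"
      then have "curve_deriv i g 0 = 0" if "1 \<le> i" "i < Suc k" for i using that \<open>\<And>i. 1 \<le> i \<Longrightarrow> i < k \<Longrightarrow> curve_deriv i g 0 = 0\<close> by (cases "i = k") auto
      then show False using xm(2) that(1) unfolding high_order_def by blast
    qed
    obtain g where g: "g \<in> limit_curves S \<psi> xm" "\<And>i. 1 \<le> i \<Longrightarrow> i < k \<Longrightarrow> curve_deriv i g 0 = 0"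
      using hik[OF xm(1)] unfolding high_order_def by blast
    obtain y0 where y0: "range y0 \<subseteq> S" "y0 \<longlonglongrightarrow> xm" "lul (\<lambda>j. \<psi> (y0 j)) g" using limit_curvesD(2)[OF g(1)] by blast
    have "dist xm x0 < \<epsilon>" using xm(1) by (simp add: U_def)
    moreover have "(\<lambda>j. dist (y0 j) x0) \<longlonglongrightarrow> dist xm x0" by (intro tendsto_intros y0)
    ultimately have "\<forall>\<^sub>F j in sequentially. dist (y0 j) x0 < \<epsilon>" by (rule order_tendstoD(2)[rotated])
    then obtain n0 where n0: "\<And>j. j \<ge> n0 \<Longrightarrow> dist (y0 j) x0 < \<epsilon>" unfolding eventually_sequentially by blast
    define y where "y = (\<lambda>j. y0 (j + n0))"
    have sm: "strict_mono (\<lambda>j. j + n0)" by (simp add: strict_mono_def)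
    have yS: "y j \<in> S" and yU: "y j \<in> U" for j using y0(1) SJ n0[of "j + n0"] by (auto simp: y_def U_def)
    have ylim: "y \<longlonglongrightarrow> xm" using LIMSEQ_subseq_LIMSEQ[OF y0(2) sm] by (simp add: y_def o_def)
    have yg: "lul (\<lambda>j. \<psi> (y j)) g" using lul_subseq[OF y0(3) sm] by (simp add: y_def)
    have "\<exists>p. p \<in> limit_curves S \<psi> (y j) \<and> (\<forall>i. 1 \<le> i \<longrightarrow> i < k \<longrightarrow> curve_deriv i p 0 = 0)" for j
      using hik[OF yU[of j]] unfolding high_order_def by blast
    then have "\<forall>j. \<exists>p. p \<in> limit_curves S \<psi> (y j) \<and> (\<forall>i. 1 \<le> i \<longrightarrow> i < k \<longrightarrow> curve_deriv i p 0 = 0)" by blast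
    from choice[OF this] obtain \<phi> where "\<forall>j. \<phi> j \<in> limit_curves S \<psi> (y j) \<and> (\<forall>i. 1 \<le> i \<longrightarrow> i < k \<longrightarrow> curve_deriv i (\<phi> j) 0 = 0)" ..
    then have \<phi>: "\<phi> j \<in> limit_curves S \<psi> (y j)" "\<And>i. 1 \<le> i \<Longrightarrow> i < k \<Longrightarrow> curve_deriv i (\<phi> j) 0 = 0" for j by auto
    obtain r \<phi>' where r: "strict_mono r" "\<phi>' \<in> limit_curves S \<psi> xm" "lul (\<lambda>n. \<phi> (r n)) \<phi>'"
      using limit_curves_diagonal[OF qe ec ylim \<phi>(1)] by blast
    have ord\<phi>': "curve_deriv i \<phi>' 0 = 0" if "1 \<le> i" "i < k" for i
      using lul_curve_deriv[OF r(3) limit_curvesD(1)[OF \<phi>(1)], of i 0] \<phi>(2)[OF that] by (simp add: LIMSEQ_const_iff)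
    show False
    proof (rule no_branched_limits[of "\<lambda>n. \<psi> (y (r n))" "\<lambda>n. \<phi> (r n)" g \<phi>' k])
      show "injective_immersion (\<psi> (y (r j)))" for j by (rule im[OF yS])
      show "entire_curve (\<phi> (r j))" for j by (rule limit_curvesD(1)[OF \<phi>(1)])
      show "lul (\<lambda>n. \<psi> (y (r n))) g" by (rule lul_subseq[OF yg r(1)])
      show "\<phi> (r j) 0 = \<psi> (y (r j)) 0" for j
        using limit_curve_at_0[OF \<phi>(1) at0] at0[OF yS] by simp
      show "\<exists>e>0. \<exists>\<tau>. \<tau> holomorphic_on ball 0 e \<and> \<tau> 0 = 0 \<and> (\<forall>z\<in>ball 0 e. \<phi> (r j) z = \<psi> (y (r j)) (\<tau> z))" for j
      proof -
        obtain w where w: "range w \<subseteq> S" "lul (\<lambda>n. \<psi> (w n)) (\<phi> (r j))" using limit_curvesD(2)[OF \<phi>(1)] by blast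
        have wS: "w n \<in> S" for n using w(1) by blast
        show ?thesis
          by (rule limit_curve_in_plaque[OF im[OF yS] im[OF wS] w(2) dis[OF wS yS]])
             (use limit_curve_at_0[OF \<phi>(1) at0] at0[OF yS] in simp)
      qed
    qed (use k2 \<phi>(2) g(2) exact[OF g] exact[OF r(2) ord\<phi>'] r(3) in auto)
  qed
  then show ?thesis using op unfolding J1 by blast
qed

section \<open>Limit curves are not constant\<close>

lemma normal_family_bounded_centres:
  assumes qe: "quasi_expanding S \<psi>" and at0: "\<And>y. y \<in> S \<Longrightarrow> \<psi> y 0 = y"
  shows "bounded S"
proof (rule ccontr)
  assume nb: "\<not> bounded S"
  have "\<exists>y. y \<in> S \<and> norm y > real n" for n using nb unfolding bounded_iff by (meson not_le)
  then have "\<forall>n. \<exists>y. y \<in> S \<and> norm y > real n" by blast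
  from choice[OF this] obtain y where y: "\<forall>n. y n \<in> S \<and> norm (y n) > real n" ..
  have "range (\<lambda>n. \<psi> (y n)) \<subseteq> \<psi> ` S" using y by blast
  then obtain g r where r: "strict_mono r" "lul (\<lambda>n. \<psi> (y (r n))) g"
    using qe unfolding quasi_expanding_def normal_family_def locally_uniform_limit_iff_lul by (force simp: o_def)
  have "(\<lambda>n. \<psi> (y (r n)) 0) \<longlonglongrightarrow> g 0" by (rule lul_tendsto[OF r(2)])
  then have "(\<lambda>n. y (r n)) \<longlonglongrightarrow> g 0" using y at0 by simp
  then have "bounded (range (\<lambda>n. y (r n)))" by (rule convergent_imp_bounded)
  then obtain B where "\<forall>x\<in>range (\<lambda>n. y (r n)). norm x \<le> B" unfolding bounded_iff by blast
  then have B: "norm (y (r n)) \<le> B" for n by blast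
  obtain n where n: "real n > B" using reals_Archimedean2 by blast
  have "real n \<le> real (r n)" using seq_suble[OF r(1), of n] by simp
  also have "\<dots> < norm (y (r n))" using y by blast
  also have "\<dots> \<le> B" by (rule B)
  finally show False using n by simp
qed

lemma continuous_on_funpow:
  fixes f :: "'a::topological_space \<Rightarrow> 'a"
  assumes "continuous_on UNIV f" shows "continuous_on UNIV (f ^^ n)"
proof (induction n)
  case (Suc n)
  have "continuous_on UNIV (\<lambda>x. f ((f ^^ n) x))" by (rule continuous_on_compose2[OF assms Suc]) auto
  then show ?case by (simp add: o_def)
qed (simp add: id_def)

lemma image_funpow_eq: "f ` S = S \<Longrightarrow> (f ^^ n) ` S = S"
  by (induction n) (simp_all only: funpow.simps image_comp[symmetric] image_ident id_def)

text \<open>A point \<open>z\<close> whose \<open>m\<close>-th image lies in the ball of radius \<open>B\<close> satisfies \<open>G\<^sup>+(z) \<le> C / d ^ m\<close>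
  with \<open>C\<close> depending only on \<open>B\<close>. If the curves \<open>\<psi> y\<close> tended to the constant \<open>x\<close>, their points
  in the unit disc would have arbitrarily long orbits near the bounded invariant set \<open>S\<close>, which
  contradicts the normalization.\<close>

lemma limit_curves_nonconstant:
  assumes f: "poly_diffeo f" and d: "dynamical_degree f > 1" and qe: "quasi_expanding S \<psi>"
    and inv: "f ` S = S" and at0: "\<And>y. y \<in> S \<Longrightarrow> \<psi> y 0 = y"
    and G1: "\<And>y. y \<in> S \<Longrightarrow> \<exists>\<zeta>\<in>cball 0 1. G_plus f (\<psi> y \<zeta>) = 1"
    and g: "g \<in> limit_curves S \<psi> x"
  shows "\<exists>z. g z \<noteq> g 0"
proof (rule ccontr)
  assume "\<not> ?thesis"
  then have gc: "g z = x" for z using limit_curve_at_0[OF g at0] by auto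
  obtain y where y: "range y \<subseteq> S" "y \<longlonglongrightarrow> x" "lul (\<lambda>j. \<psi> (y j)) g" using limit_curvesD(2)[OF g] by blast
  have "\<forall>j. \<exists>\<zeta>. \<zeta> \<in> cball 0 1 \<and> G_plus f (\<psi> (y j) \<zeta>) = 1" using G1 y(1) by blast
  from choice[OF this] obtain \<zeta> where \<zeta>: "\<forall>j. \<zeta> j \<in> cball 0 1 \<and> G_plus f (\<psi> (y j) (\<zeta> j)) = 1" ..
  define z where "z j = \<psi> (y j) (\<zeta> j)" for j
  have Gz: "G_plus f (z j) = 1" for j using \<zeta> by (simp add: z_def)
  have zx: "z \<longlonglongrightarrow> x"
  proof (rule tendstoI)
    fix e :: real assume "e > 0"
    from lul_eventually[OF y(3) compact_cball this, of 0 1]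
    show "\<forall>\<^sub>F j in sequentially. dist (z j) x < e"
      by eventually_elim (use \<zeta> gc in \<open>auto simp: z_def\<close>)
  qed
  obtain N where N: "N \<ge> 2" "dynamical_degree f = real N"
    "\<forall>z. convergent (\<lambda>n. log_plus (norm ((f ^^ n) z)) / real N ^ n)"
    "\<forall>B. \<exists>C. \<forall>z n. norm z \<le> B \<longrightarrow> log_plus (norm ((f ^^ n) z)) \<le> C * real N ^ n"
    using green_facts[OF f d] by blast
  have "bounded (closure S)" using normal_family_bounded_centres[OF qe at0] by blast
  then obtain B where B: "\<And>p. p \<in> closure S \<Longrightarrow> norm p \<le> B" unfolding bounded_iff by blast
  obtain C where C: "\<And>z n. norm z \<le> B + 1 \<Longrightarrow> log_plus (norm ((f ^^ n) z)) \<le> C * real N ^ n" using N(4) by blast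
  obtain m where m: "C < real N ^ m" using real_arch_pow[of "real N" C] N(1) by auto
  have cf: "continuous_on UNIV (f ^^ m)"
    by (rule continuous_on_funpow, rule continuous_on_polymap) (use f in \<open>simp add: poly_diffeo_def\<close>)
  have "x \<in> closure S" unfolding closure_sequential using y(1,2) by blast
  then have "(f ^^ m) x \<in> closure S"
    using image_closure_subset[OF continuous_on_subset[OF cf] closed_closure, of S S] image_funpow_eq[OF inv, of m] closure_subset[of S] by blast
  then have bx: "norm ((f ^^ m) x) < B + 1" using B by fastforce
  have "(\<lambda>j. (f ^^ m) (z j)) \<longlonglongrightarrow> (f ^^ m) x"
    using cf zx by (simp add: continuous_on_eq_continuous_at isCont_tendsto_compose)
  then have "(\<lambda>j. norm ((f ^^ m) (z j))) \<longlonglongrightarrow> norm ((f ^^ m) x)" by (rule tendsto_norm)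
  then have "\<forall>\<^sub>F j in sequentially. norm ((f ^^ m) (z j)) < B + 1" using bx by (rule order_tendstoD(2))
  then obtain j where j: "norm ((f ^^ m) (z j)) < B + 1" using eventually_happens'[OF sequentially_bot] by blast
  have "(\<lambda>n. log_plus (norm ((f ^^ n) (z j))) / real N ^ n) \<longlonglongrightarrow> G_plus f (z j)"
    unfolding G_plus_def N(2) using N(3) by (simp add: convergent_LIMSEQ_iff)
  then have "(\<lambda>n. log_plus (norm ((f ^^ (n + m)) (z j))) / real N ^ (n + m)) \<longlonglongrightarrow> 1"
    unfolding Gz by (rule LIMSEQ_ignore_initial_segment)
  moreover have "log_plus (norm ((f ^^ (n + m)) (z j))) / real N ^ (n + m) \<le> C / real N ^ m" for n
  proof -
    have "log_plus (norm ((f ^^ n) ((f ^^ m) (z j)))) \<le> C * real N ^ n" using C j by simp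
    then have "log_plus (norm ((f ^^ (n + m)) (z j))) \<le> C * real N ^ n" by (simp only: funpow_add o_apply)
    then show ?thesis using N(1) by (simp add: power_add divide_simps mult_ac)
  qed
  ultimately have "1 \<le> C / real N ^ m" by (intro LIMSEQ_le_const2) auto
  then show False using m N(1) by (simp add: field_simps)
qed

section \<open>Generic order one\<close>

theorem theorem6p7:
  fixes f :: "complex \<times> complex \<Rightarrow> complex \<times> complex"
    and S :: "(complex \<times> complex) set"
    and \<psi> :: "complex \<times> complex \<Rightarrow> complex \<Rightarrow> complex \<times> complex"
  assumes "poly_diffeo f"
    and "dynamical_degree f > 1"
    and "normalized_invariant_family f S \<psi>"
    and "quasi_expanding S \<psi>"
  shows "openin (top_of_set (J_star f)) (J_stratum f S \<psi> 1) \<and>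
         J_star f \<subseteq> closure (J_stratum f S \<psi> 1)"
proof -
  note F = assms(3)[unfolded normalized_invariant_family_def]
  show ?thesis
    unfolding J_stratum_def
  proof (rule order_one_open_dense[OF assms(4)])
    show "\<exists>z. g z \<noteq> g 0" if "g \<in> limit_curves S \<psi> x" for x g
      by (rule limit_curves_nonconstant[OF assms(1,2,4) _ _ _ that]) (use F in blast)+
  qed (use F in blast)+
qed

end
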